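(* Let $(M,d,\mu)$ be a complete doubling metric measure space with the cone covering property and let $X$ be a complex UMD space. Given any $\varepsilon>0$, there is a constant $C_\varepsilon$ such that for every $\alpha\ge1$ and every $u\in L^2_c(M^+)\otimes X$, $$\|\mathscr A_\alpha u\|_{L^1(M)}\le C_\varepsilon\,\alpha^{n+\varepsilon}\,\|\mathscr A u\|_{L^1(M)}.$$
   Context: Doubling: there is $n>0$ such that $\mu(\alpha B)\lesssim \alpha^n\mu(B)$ for all balls $B\subset M$ and all $\alpha\ge 1$ ($\alpha B$ is the concentric dilate); $n$ is fixed to be the smallest such number. Write $V(y,t)=\mu(B(y,t))$. $M^+=M\times(0,\infty)$ carries the measure $d\nu(y,t)=\frac{d\mu(y)\,dt}{tV(y,t)}$; $L^2(M^+)=L^2(M^+,\nu)$; $L^2_c(M^+)$ is the space of compactly supported functions in $L^2(M^+)$; $\Gamma_\alpha(x)=\{(y,t)\in M^+:d(x,y)<\alpha t\}$ and $\Gamma=\Gamma_1$. A linear operator $u$ from (a dense subspace of) $L^2(M^+)$ to $X$ has norm $\|u\|_{\gamma(L^2(M^+),X)}=\sup(\mathbb E\|\sum_k\gamma_kuh_k\|^2)^{1/2}$, the supremum over finite orthonormal systems $\{h_k\}$ in the domain of $u$, with $\gamma_k$ independent standard Gaussians. An element $u=\sum_ku_k\otimes\xi_k\in L^2_c(M^+)\otimes X$ is identified with the operator $h\mapsto\sum_k\big(\iint_{M^+}u_kh\,d\nu\big)\xi_k$. $1_{\Gamma_\alpha(x)}$ also denotes the projection $h\mapsto1_{\Gamma_\alpha(x)}h$.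 Define $\mathscr A_\alpha u(x)=\|u1_{\Gamma_\alpha(x)}\|_{\gamma(L^2(M^+),X)}$ and $\mathscr A=\mathscr A_1$. Cone covering property: for open $E\subset M$ and $\sigma\in(0,1)$ let $E^\sigma=\{x\in M:\sup_{B\ni x}\mu(B\cap E)/\mu(B)>\sigma\}$ (supremum over balls) and $T(E)=\{(y,t)\in M^+:B(y,t)\subset E\}$. $M$ has the cone covering property if there is $\sigma\in(0,1)$ such that every bounded open set $E\subset M$ satisfies: for every $x\in E$ there are $x_1,\dots,x_N\in M\setminus E$, with $N$ depending only on $M$, such that $\Gamma(x)\setminus T(E^\sigma)\subset\bigcup_{m=1}^N\Gamma(x_m)$. *)

theory Defs
  imports "HOL-Probability.Probability"
begin

section \<open>Doubling metric measure spaces\<close>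

text \<open>
  The metric space \<open>M\<close> is the universe of a type of class \<^class>\<open>metric_space\<close>. A ball is given by
  its centre and its radius, so that its concentric dilates make sense.
\<close>

definition volume :: "'m::metric_space measure \<Rightarrow> 'm \<Rightarrow> real \<Rightarrow> real" where
  "volume \<mu> y t = measure \<mu> (ball y t)"

definition doubling_exponent :: "'m::metric_space measure \<Rightarrow> real \<Rightarrow> bool" where
  "doubling_exponent \<mu> n \<longleftrightarrow> n > 0 \<and>
     (\<exists>C. \<forall>x r \<alpha>. 0 < r \<longrightarrow> 1 \<le> \<alpha> \<longrightarrow> volume \<mu> x (\<alpha> * r) \<le> C * \<alpha> powr n * volume \<mu> x r)"

definition doubling_space :: "'m::metric_space measure \<Rightarrow> bool" where
  "doubling_space \<mu> \<longleftrightarrow> sets \<mu> = sets borel \<and>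
     (\<forall>x. \<forall>r>0. 0 < emeasure \<mu> (ball x r) \<and> emeasure \<mu> (ball x r) < \<infinity>) \<and>
     (\<exists>n. doubling_exponent \<mu> n)"

text \<open>
  The smallest doubling exponent need not be attained (on a bounded space every \<open>n > 0\<close> is
  admissible), hence the infimum; it is the minimum whenever a minimum exists.
\<close>

definition doubling_dimension :: "'m::metric_space measure \<Rightarrow> real" where
  "doubling_dimension \<mu> = Inf {n. doubling_exponent \<mu> n}"


section \<open>The upper half-space over \<open>M\<close>, cones and tents\<close>

definition upper_half :: "('m \<times> real) set" where
  "upper_half = UNIV \<times> {0<..}"

definition upper_measure :: "'m::metric_space measure \<Rightarrow> ('m \<times> real) measure" where
  "upper_measure \<mu> = density (\<mu> \<Otimes>\<^sub>M restrict_space lborel {0<..})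
     (\<lambda>(y, t). ennreal (1 / (t * volume \<mu> y t)))"

lemma space_upper_measure:
  "sets \<mu> = sets borel \<Longrightarrow> space (upper_measure \<mu>) = upper_half"
  by (auto simp: upper_measure_def upper_half_def space_pair_measure space_restrict_space
      dest: sets_eq_imp_space_eq)

definition cone :: "real \<Rightarrow> 'm::metric_space \<Rightarrow> ('m \<times> real) set" where
  "cone \<alpha> x = {(y, t). 0 < t \<and> dist x y < \<alpha> * t}"

definition tent :: "'m::metric_space set \<Rightarrow> ('m \<times> real) set" where
  "tent E = {(y, t). 0 < t \<and> ball y t \<subseteq> E}"

definition enlargement :: "'m::metric_space measure \<Rightarrow> real \<Rightarrow> 'm set \<Rightarrow> 'm set" where
  "enlargement \<mu> \<sigma> E =
     {x. (SUP (c, r) \<in> {(c, r). 0 < r \<and> x \<in> ball c r}.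
            measure \<mu> (ball c r \<inter> E) / measure \<mu> (ball c r)) > \<sigma>}"

text \<open>
  The points \<open>x\<^sub>1, \<dots>, x\<^sub>N\<close> are collected in a set with at most \<open>N\<close> elements. Points may be
  repeated, so this only differs from a family of exactly \<open>N\<close> points if \<open>E\<close> is the whole space;
  then the set to be covered is empty, and so is the covering family.
\<close>

definition cone_covering_property :: "'m::metric_space measure \<Rightarrow> bool" where
  "cone_covering_property \<mu> \<longleftrightarrow>
     (\<exists>\<sigma>. 0 < \<sigma> \<and> \<sigma> < 1 \<and> (\<exists>N::nat. \<forall>E. open E \<and> bounded E \<longrightarrow> (\<forall>x\<in>E.
        \<exists>F. finite F \<and> card F \<le> N \<and> F \<subseteq> - E \<and>
            cone 1 x - tent (enlargement \<mu> \<sigma> E) \<subseteq> (\<Union>z\<in>F. cone 1 z))))"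


section \<open>Complex Banach spaces\<close>

class complex_banach = banach +
  fixes scaleC :: "complex \<Rightarrow> 'a \<Rightarrow> 'a"
  assumes scaleC_add_right: "scaleC c (x + y) = scaleC c x + scaleC c y"
    and scaleC_add_left: "scaleC (b + c) x = scaleC b x + scaleC c x"
    and scaleC_scaleC: "scaleC b (scaleC c x) = scaleC (b * c) x"
    and scaleC_of_real: "scaleC (complex_of_real r) x = r *\<^sub>R x"
    and norm_scaleC: "norm (scaleC c x) = cmod c * norm x"

instantiation complex :: complex_banach
begin

definition scaleC_complex :: "complex \<Rightarrow> complex \<Rightarrow> complex" where
  "scaleC_complex c z = c * z"

instance
  by standard (simp_all add: scaleC_complex_def algebra_simps norm_mult scaleR_conv_of_real)

end


section \<open>UMD spaces\<close>

text \<open>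
  The library's Bochner integral is restricted to second countable Banach spaces. As \<open>X\<close> need not
  be separable, strong measurability and the Bochner integral are defined by approximation
  with simple functions.
\<close>

definition strongly_measurable :: "'w measure \<Rightarrow> ('w \<Rightarrow> 'x::topological_space) \<Rightarrow> bool" where
  "strongly_measurable P f \<longleftrightarrow>
     (\<exists>s. (\<forall>i::nat. simple_function P (s i)) \<and> (\<forall>\<omega>\<in>space P. (\<lambda>i. s i \<omega>) \<longlonglongrightarrow> f \<omega>))"

definition has_strong_integral :: "'w measure \<Rightarrow> ('w \<Rightarrow> 'x::banach) \<Rightarrow> 'x \<Rightarrow> bool" where
  "has_strong_integral P f v \<longleftrightarrow> strongly_measurable P f \<and>
     (\<exists>s. (\<forall>i::nat. Bochner_Integration.simple_bochner_integrable P (s i)) \<and>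
          (\<lambda>i. \<integral>\<^sup>+\<omega>. ennreal (norm (f \<omega> - s i \<omega>)) \<partial>P) \<longlonglongrightarrow> 0 \<and>
          (\<lambda>i. Bochner_Integration.simple_bochner_integral P (s i)) \<longlonglongrightarrow> v)"

definition Lp_martingale_differences ::
  "real \<Rightarrow> 'w measure \<Rightarrow> (nat \<Rightarrow> 'w measure) \<Rightarrow> nat \<Rightarrow> (nat \<Rightarrow> 'w \<Rightarrow> 'x::banach) \<Rightarrow> bool" where
  "Lp_martingale_differences p P F N d \<longleftrightarrow>
     filtration (space P) F \<and> (\<forall>k. subalgebra P (F k)) \<and>
     (\<forall>k<N. strongly_measurable (F (Suc k)) (d k) \<and>
            (\<integral>\<^sup>+\<omega>. ennreal (norm (d k \<omega>) powr p) \<partial>P) < \<infinity> \<and>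
            (\<forall>A\<in>sets (F k). has_strong_integral P (\<lambda>\<omega>. indicator A \<omega> *\<^sub>R d k \<omega>) 0))"

text \<open>
  The last condition says that the conditional expectation of \<open>d k\<close> given \<open>F k\<close> vanishes.

  Quantifying over all probability measures, with arbitrary sigma-algebras, on the type of
  sequences in \<open>X\<close> amounts to quantifying over all probability spaces: a martingale difference
  sequence on any probability space can be replaced by the coordinates under its joint law.
\<close>

definition umd_space :: "'x::banach itself \<Rightarrow> bool" where
  "umd_space _ \<longleftrightarrow>
     (\<forall>p>1. \<exists>\<beta>\<ge>0. \<forall>(P :: (nat \<Rightarrow> 'x) measure) F N (d :: nat \<Rightarrow> (nat \<Rightarrow> 'x) \<Rightarrow> 'x) (e :: nat \<Rightarrow> real).
        prob_space P \<and> Lp_martingale_differences p P F N d \<and> (\<forall>k<N. e k \<in> {-1, 1}) \<longrightarrow>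
        (\<integral>\<^sup>+\<omega>. ennreal (norm (\<Sum>k<N. e k *\<^sub>R d k \<omega>) powr p) \<partial>P)
          \<le> ennreal (\<beta> powr p) * (\<integral>\<^sup>+\<omega>. ennreal (norm (\<Sum>k<N. d k \<omega>) powr p) \<partial>P))"


section \<open>The gamma-norm\<close>

definition L2 :: "'a measure \<Rightarrow> ('a \<Rightarrow> complex) set" where
  "L2 N = {h \<in> borel_measurable N. integrable N (\<lambda>z. (cmod (h z))\<^sup>2)}"

definition orthonormal_system :: "'a measure \<Rightarrow> nat \<Rightarrow> (nat \<Rightarrow> 'a \<Rightarrow> complex) \<Rightarrow> bool" where
  "orthonormal_system N n h \<longleftrightarrow> (\<forall>k<n. h k \<in> L2 N) \<and>
     (\<forall>j<n. \<forall>k<n. (\<integral>z. h j z * cnj (h k z) \<partial>N) = (if j = k then 1 else 0))"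

text \<open>Under this measure the coordinates are \<open>n\<close> independent standard Gaussians.\<close>

definition gaussian_measure :: "nat \<Rightarrow> (nat \<Rightarrow> real) measure" where
  "gaussian_measure n = (\<Pi>\<^sub>M k\<in>{..<n}. density lborel (\<lambda>x. ennreal (std_normal_density x)))"

definition gamma_norm :: "'a measure \<Rightarrow> (('a \<Rightarrow> complex) \<Rightarrow> 'x::banach) \<Rightarrow> ennreal" where
  "gamma_norm N U =
     (SUP (n, h) \<in> {(n, h). orthonormal_system N n h}.
        ennreal (sqrt (\<integral>g. (norm (\<Sum>k<n. g k *\<^sub>R U (h k)))\<^sup>2 \<partial>gaussian_measure n)))"


section \<open>The area functional\<close>

definition L2_compact :: "'m::metric_space measure \<Rightarrow> ('m \<times> real \<Rightarrow> complex) set" where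
  "L2_compact \<mu> = {h \<in> L2 (upper_measure \<mu>).
     \<exists>K. compact K \<and> K \<subseteq> upper_half \<and> (AE z in upper_measure \<mu>. z \<notin> K \<longrightarrow> h z = 0)}"

text \<open>The algebraic tensor product of \<^term>\<open>L2_compact \<mu>\<close> and \<open>X\<close>, as a set of operators.\<close>

definition L2_compact_tensor ::
  "'m::metric_space measure \<Rightarrow> (('m \<times> real \<Rightarrow> complex) \<Rightarrow> 'x::complex_banach) set" where
  "L2_compact_tensor \<mu> =
     {U. \<exists>(n::nat) u \<xi>. (\<forall>k<n. u k \<in> L2_compact \<mu>) \<and>
         U = (\<lambda>h. \<Sum>k<n. scaleC (\<integral>z. u k z * h z \<partial>upper_measure \<mu>) (\<xi> k))}"

definition area_functional ::
  "'m::metric_space measure \<Rightarrow> real \<Rightarrow> (('m \<times> real \<Rightarrow> complex) \<Rightarrow> 'x::banach) \<Rightarrow> 'm \<Rightarrow> ennreal" where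
  "area_functional \<mu> \<alpha> U x =
     gamma_norm (upper_measure \<mu>) (\<lambda>h. U (\<lambda>z. indicator (cone \<alpha> x) z * h z))"

end

theory Submission
  imports Defs
begin

text \<open>
  Everything is reduced to finitely many vectors \<open>v\<^sub>j\<close> attached to points \<open>(y\<^sub>j, 2\<^sup>k\<^sup>j)\<close> of the upper half-space:
  up to a bounded change of aperture and a factor 2, the area functional at \<open>x\<close> is the Gaussian norm of the
  sum of those \<open>v\<^sub>j\<close> whose points lie in the cone over \<open>x\<close>. For \<open>1 < p \<le> 2\<close> the indicator of the ball
  \<open>B(y, \<alpha> t)\<close> is at most a constant times \<open>\<alpha>\<^sup>n\<close> times an average of the indicator of \<open>B(y, t)\<close> over a
  slightly larger set; these sets can be arranged in boundedly many laminar families, so that the averages are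
  conditional expectations and Stein's inequality in UMD spaces gives the bound \<open>\<alpha>\<^sup>n\<close> in \<open>L\<^sup>p\<close>. The comparison of
  Gaussian moments allows one to use \<open>p\<close>-th instead of second moments.

  For \<open>L\<^sup>1\<close>, cut the points by the tents over the enlarged level sets \<open>{\<A> u > 2\<^sup>k}\<close>. By the cone covering
  property the part of \<open>u\<close> outside the tent at the next level has area functional bounded by a constant times
  \<open>2\<^sup>k\<close>, with support of measure comparable to that of the level set, and the \<open>L\<^sup>p\<close> estimate of the pieces adds up to
  the bound \<open>\<alpha>\<^sup>n\<^sup>p\<close>. Finally \<open>p\<close> is taken close to 1.
\<close>

section \<open>Gaussian sums\<close>

text \<open>Two monotonicity properties carry every comparison of cones: no convex moment of a
  Gaussian sum grows when its coefficients are multiplied by factors in [0, 1], or when its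
  coefficient matrix is a Euclidean contraction. The first turns a pointwise inequality between
  indicators into one between area functionals. The second, together with Bessel's inequality,
  bounds the supremum over all orthonormal systems by a single finite sum.

  The martingale estimate behind Stein's inequality is available for p > 1 only, so the argument
  pays the exponent np with p > 1 and with an admissible doubling exponent n that may lie above the
  infimum; epsilon covers both losses. Averages over arbitrary sets are not conditional
  expectations, which is why balls have to be replaced by laminar sets before UMD can be applied.

  X may be nonseparable. All random vectors are therefore finite sums with real random coefficients,
  and UMD enters only through finite probability spaces.\<close>

abbreviation gauss :: "real measure" where
  "gauss \<equiv> density lborel (\<lambda>x. ennreal (std_normal_density x))"

lemma prob_space_gauss: "prob_space gauss"
  using prob_space_normal_density[of 1 0] by simp

interpretation gauss: prob_space gauss
  by (rule prob_space_gauss)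

interpretation gauss_prod: product_sigma_finite "\<lambda>_::nat. gauss" ..

section \<open>Rotation invariance of the planar Gaussian measure\<close>

lemma nn_integral_shear:
  fixes K :: "real \<Rightarrow> real \<Rightarrow> ennreal"
  assumes K: "case_prod K \<in> borel_measurable (borel \<Otimes>\<^sub>M borel)"
  shows "(\<integral>\<^sup>+s. \<integral>\<^sup>+t. K s (t + a * s) \<partial>lborel \<partial>lborel) = (\<integral>\<^sup>+s. \<integral>\<^sup>+t. K s t \<partial>lborel \<partial>lborel)"
proof (rule nn_integral_cong)
  fix s
  have [measurable]: "K s \<in> borel_measurable borel" using K by measurable
  show "(\<integral>\<^sup>+t. K s (t + a * s) \<partial>lborel) = (\<integral>\<^sup>+t. K s t \<partial>lborel)"
    using nn_integral_real_affine[of "K s" 1 "a * s"] by (simp add: add.commute)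
qed

lemma nn_integral_shear':
  fixes K :: "real \<Rightarrow> real \<Rightarrow> ennreal"
  assumes K[measurable]: "case_prod K \<in> borel_measurable (borel \<Otimes>\<^sub>M borel)"
  shows "(\<integral>\<^sup>+s. \<integral>\<^sup>+t. K (s + a * t) t \<partial>lborel \<partial>lborel) = (\<integral>\<^sup>+s. \<integral>\<^sup>+t. K s t \<partial>lborel \<partial>lborel)"
proof -
  have "(\<integral>\<^sup>+s. \<integral>\<^sup>+t. K (s + a * t) t \<partial>lborel \<partial>lborel) = (\<integral>\<^sup>+t. \<integral>\<^sup>+s. K (s + a * t) t \<partial>lborel \<partial>lborel)"
    by (rule lborel_pair.Fubini'[symmetric]) measurable
  also have "\<dots> = (\<integral>\<^sup>+t. \<integral>\<^sup>+s. K s t \<partial>lborel \<partial>lborel)"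
    by (rule nn_integral_shear[of "\<lambda>t s. K s t"]) measurable
  also have "\<dots> = (\<integral>\<^sup>+s. \<integral>\<^sup>+t. K s t \<partial>lborel \<partial>lborel)"
    by (rule lborel_pair.Fubini') measurable
  finally show ?thesis .
qed

text \<open>A rotation is a product of three shears, and each shear preserves Lebesgue measure by
  Tonelli and translation invariance. The outer shear parameter \<open>a\<close> is minus the
  tangent of half the angle, which is why the half turn \<open>c = -1\<close> is excluded.\<close>

lemma nn_integral_rotation:
  fixes K :: "real \<Rightarrow> real \<Rightarrow> ennreal"
  assumes K[measurable]: "case_prod K \<in> borel_measurable (borel \<Otimes>\<^sub>M borel)"
    and cd: "c\<^sup>2 + d\<^sup>2 = 1" "c \<noteq> -1"
  shows "(\<integral>\<^sup>+s. \<integral>\<^sup>+t. K (c * s - d * t) (d * s + c * t) \<partial>lborel \<partial>lborel)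
       = (\<integral>\<^sup>+s. \<integral>\<^sup>+t. K s t \<partial>lborel \<partial>lborel)"
proof -
  define a where "a = - d / (1 + c)"
  have nz: "1 + c \<noteq> 0" using cd(2) by linarith
  have ac: "a * (1 + c) = - d" using nz by (simp add: a_def)
  have "(1 + a * d) * (1 + c) = c * (1 + c)"
    using ac cd(1) by (algebra)
  then have ad: "1 + a * d = c" using nz by simp
  have e1: "(s + a * t) + a * (t + d * (s + a * t)) = c * s - d * t" for s t
  proof -
    have "(s + a * t) + a * (t + d * (s + a * t)) = (1 + a * d) * s + a * (1 + (1 + a * d)) * t" by algebra
    then show ?thesis using ad ac by (simp add: mult.commute)
  qed
  have e2: "t + d * (s + a * t) = d * s + c * t" for s t
  proof -
    have "t + d * (s + a * t) = d * s + (1 + a * d) * t" by algebra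
    then show ?thesis using ad by simp
  qed
  have "(\<integral>\<^sup>+s. \<integral>\<^sup>+t. K s t \<partial>lborel \<partial>lborel) = (\<integral>\<^sup>+s. \<integral>\<^sup>+t. K (s + a * t) t \<partial>lborel \<partial>lborel)"
    by (rule nn_integral_shear'[symmetric]) measurable
  also have "\<dots> = (\<integral>\<^sup>+s. \<integral>\<^sup>+t. K (s + a * (t + d * s)) (t + d * s) \<partial>lborel \<partial>lborel)"
    by (rule nn_integral_shear[symmetric, of "\<lambda>s t. K (s + a * t) t"]) measurable
  also have "\<dots> = (\<integral>\<^sup>+s. \<integral>\<^sup>+t. K ((s + a * t) + a * (t + d * (s + a * t))) (t + d * (s + a * t)) \<partial>lborel \<partial>lborel)"
    by (rule nn_integral_shear'[symmetric, of "\<lambda>s t. K (s + a * (t + d * s)) (t + d * s)"]) measurable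
  also have "\<dots> = (\<integral>\<^sup>+s. \<integral>\<^sup>+t. K (c * s - d * t) (d * s + c * t) \<partial>lborel \<partial>lborel)"
    unfolding e1 unfolding e2 ..
  finally show ?thesis ..
qed

text \<open>The product of two standard normal densities depends only on the sum of the squares of
  its arguments, which the rotation preserves.\<close>

lemma gauss_rotation:
  fixes H :: "real \<Rightarrow> real \<Rightarrow> ennreal"
  assumes H[measurable]: "case_prod H \<in> borel_measurable (borel \<Otimes>\<^sub>M borel)"
    and cd: "c\<^sup>2 + d\<^sup>2 = 1" "c \<noteq> -1"
  shows "(\<integral>\<^sup>+s. \<integral>\<^sup>+t. H (c * s - d * t) (d * s + c * t) \<partial>gauss \<partial>gauss)
       = (\<integral>\<^sup>+s. \<integral>\<^sup>+t. H s t \<partial>gauss \<partial>gauss)"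
proof -
  let ?f = "\<lambda>x. ennreal (std_normal_density x)"
  have dens: "(\<integral>\<^sup>+s. \<integral>\<^sup>+t. G s t \<partial>gauss \<partial>gauss) = (\<integral>\<^sup>+s. \<integral>\<^sup>+t. ?f s * ?f t * G s t \<partial>lborel \<partial>lborel)"
    if G[measurable]: "case_prod G \<in> borel_measurable (borel \<Otimes>\<^sub>M borel)" for G :: "real \<Rightarrow> real \<Rightarrow> ennreal"
    by (simp add: nn_integral_density nn_integral_cmult[symmetric] mult.assoc)
  have inv: "?f (c * s - d * t) * ?f (d * s + c * t) = ?f s * ?f t" for s t
  proof -
    have "(c * s - d * t)\<^sup>2 + (d * s + c * t)\<^sup>2 = (c\<^sup>2 + d\<^sup>2) * (s\<^sup>2 + t\<^sup>2)" by algebra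
    then have "std_normal_density (c * s - d * t) * std_normal_density (d * s + c * t)
      = std_normal_density s * std_normal_density t"
      using cd(1) by (simp add: normal_density_def exp_add[symmetric] add_divide_distrib[symmetric])
    then show ?thesis by (simp add: ennreal_mult[symmetric])
  qed
  have "(\<integral>\<^sup>+s. \<integral>\<^sup>+t. H (c * s - d * t) (d * s + c * t) \<partial>gauss \<partial>gauss)
     = (\<integral>\<^sup>+s. \<integral>\<^sup>+t. ?f (c * s - d * t) * ?f (d * s + c * t) * H (c * s - d * t) (d * s + c * t) \<partial>lborel \<partial>lborel)"
    by (subst dens) (simp_all add: inv)
  also have "\<dots> = (\<integral>\<^sup>+s. \<integral>\<^sup>+t. ?f s * ?f t * H s t \<partial>lborel \<partial>lborel)"
    by (rule nn_integral_rotation[OF _ cd, of "\<lambda>s t. ?f s * ?f t * H s t"]) measurable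
  also have "\<dots> = (\<integral>\<^sup>+s. \<integral>\<^sup>+t. H s t \<partial>gauss \<partial>gauss)"
    by (rule dens[symmetric, OF H])
  finally show ?thesis .
qed

lemma gauss_uminus:
  fixes H :: "real \<Rightarrow> ennreal"
  assumes [measurable]: "H \<in> borel_measurable borel"
  shows "(\<integral>\<^sup>+s. H (- s) \<partial>gauss) = (\<integral>\<^sup>+s. H s \<partial>gauss)"
proof -
  have "(\<integral>\<^sup>+s. H s \<partial>gauss) = (\<integral>\<^sup>+s. ennreal (std_normal_density s) * H s \<partial>lborel)"
    by (simp add: nn_integral_density)
  also have "\<dots> = (\<integral>\<^sup>+s. ennreal (std_normal_density (-s)) * H (-s) \<partial>lborel)"
    by (subst nn_integral_real_affine[where c="-1" and t=0]) simp_all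
  also have "\<dots> = (\<integral>\<^sup>+s. H (- s) \<partial>gauss)"
    by (simp add: nn_integral_density normal_density_def)
  finally show ?thesis by simp
qed

text \<open>In a nonseparable space a sum of Borel functions need not be Borel. Here the sum factors
  through the vector of its real coefficients, which is Borel as a map into the space of real
  sequences, followed by a continuous map.\<close>

lemma borel_measurable_sum_scaleR:
  fixes x :: "'i \<Rightarrow> 'y::real_normed_vector"
  assumes "finite I" and f: "\<And>k. k \<in> I \<Longrightarrow> f k \<in> borel_measurable M"
  shows "(\<lambda>\<omega>. \<Sum>k\<in>I. f k \<omega> *\<^sub>R x k) \<in> borel_measurable M"
proof -
  obtain h where h: "bij_betw h {..<card I} I"
    using ex_bij_betw_nat_finite[OF \<open>finite I\<close>] by (auto simp: atLeast0LessThan)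
  let ?\<phi> = "\<lambda>\<omega> m::nat. if m < card I then f (h m) \<omega> else 0"
  let ?\<Phi> = "\<lambda>c::nat \<Rightarrow> real. \<Sum>m<card I. c m *\<^sub>R x (h m)"
  have "?\<phi> \<in> borel_measurable M"
  proof (rule measurable_coordinatewise_then_product)
    fix i show "(\<lambda>\<omega>. ?\<phi> \<omega> i) \<in> borel_measurable M"
      using f[of "h i"] bij_betwE[OF h] by (cases "i < card I") auto
  qed
  moreover have "continuous_on UNIV ?\<Phi>"
    by (intro continuous_intros continuous_on_product_coordinates)
  then have "?\<Phi> \<in> borel_measurable borel"
    by (rule borel_measurable_continuous_onI)
  ultimately have "(\<lambda>\<omega>. ?\<Phi> (?\<phi> \<omega>)) \<in> borel_measurable M"
    by (rule measurable_compose)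
  moreover have "?\<Phi> (?\<phi> \<omega>) = (\<Sum>k\<in>I. f k \<omega> *\<^sub>R x k)" for \<omega>
    by (subst sum.reindex_bij_betw[OF h, symmetric]) simp
  ultimately show ?thesis by simp
qed

text \<open>The nonnegative integral asks for neither integrability nor separability of the vector
  values. General index sets are allowed because a cone selects a subset of the vectors.\<close>

definition gauss_expect :: "nat set \<Rightarrow> (nat \<Rightarrow> 'y::real_normed_vector) \<Rightarrow> ('y \<Rightarrow> ennreal) \<Rightarrow> ennreal" where
  "gauss_expect I x F = (\<integral>\<^sup>+g. F (\<Sum>k\<in>I. g k *\<^sub>R x k) \<partial>(\<Pi>\<^sub>M k\<in>I. gauss))"

lemma gauss_sum_measurable [measurable]:
  fixes x :: "'i \<Rightarrow> 'y::real_normed_vector"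
  assumes "finite I"
  shows "(\<lambda>g. \<Sum>k\<in>I. g k *\<^sub>R x k) \<in> borel_measurable (\<Pi>\<^sub>M k\<in>I. gauss)"
  by (rule borel_measurable_sum_scaleR[where f="\<lambda>k g. g k", OF assms]) measurable

lemma translate_borel:
  fixes F :: "'y::real_normed_vector \<Rightarrow> ennreal"
  assumes "F \<in> borel_measurable borel"
  shows "(\<lambda>z. F (w + z)) \<in> borel_measurable borel"
  using assms by (rule measurable_compose[rotated]) (intro borel_measurable_continuous_onI continuous_intros)

section \<open>Coordinatewise rules for Gaussian expectations\<close>

lemma gauss_expect_empty [simp]: "gauss_expect {} x F = F 0"
  unfolding gauss_expect_def by (subst nn_integral_cong[of _ _ "\<lambda>_. F 0"]) (simp_all add: PiM_empty)

lemma gauss_expect_cong: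
  "I = J \<Longrightarrow> (\<And>k. k \<in> J \<Longrightarrow> x k = y k) \<Longrightarrow> (\<And>z. F z = G z) \<Longrightarrow> gauss_expect I x F = gauss_expect J y G"
  unfolding gauss_expect_def by (auto intro!: nn_integral_cong)

lemma gauss_expect_mono:
  "(\<And>z. F z \<le> G z) \<Longrightarrow> gauss_expect I x F \<le> gauss_expect I x G"
  unfolding gauss_expect_def by (auto intro!: nn_integral_mono)

lemma gauss_expect_insert:
  assumes I: "finite I" "i \<notin> I" and F: "F \<in> borel_measurable borel"
  shows "gauss_expect (insert i I) x F = (\<integral>\<^sup>+t. gauss_expect I x (\<lambda>z. F (t *\<^sub>R x i + z)) \<partial>gauss)"
proof -
  have *: "(\<Sum>k\<in>I. (if k = i then t else g k) *\<^sub>R x k) = (\<Sum>k\<in>I. g k *\<^sub>R x k)" for g :: "nat \<Rightarrow> real" and t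
    using I by (intro sum.cong) auto
  have "(\<lambda>g. F (\<Sum>k\<in>insert i I. g k *\<^sub>R x k)) \<in> borel_measurable (\<Pi>\<^sub>M k\<in>insert i I. gauss)"
    using gauss_sum_measurable[of "insert i I" x] I(1) F by (auto intro: measurable_compose)
  then show ?thesis
    unfolding gauss_expect_def using I *
    by (subst gauss_prod.product_nn_integral_insert_rev) (auto intro!: nn_integral_cong simp: fun_upd_def)
qed

text \<open>The parameters \<open>f j\<close> and the Gaussian coordinates are merged into one sum
  over the disjoint union of the index sets. Joint measurability then comes from the scalar
  coefficients and not from adding vector-valued functions.\<close>

lemma gauss_expect_measurable:
  fixes x :: "nat \<Rightarrow> 'y::real_normed_vector" and F :: "'y \<Rightarrow> ennreal"
  assumes I: "finite I" and F: "F \<in> borel_measurable borel" and J: "finite J"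
    and f: "\<And>j. j \<in> J \<Longrightarrow> f j \<in> borel_measurable M"
  shows "(\<lambda>\<omega>. gauss_expect I x (\<lambda>z. F ((\<Sum>j\<in>J. f j \<omega> *\<^sub>R w j) + z))) \<in> borel_measurable M"
proof -
  interpret sigma_finite_measure "\<Pi>\<^sub>M k\<in>I. gauss" using I by (rule gauss_prod.sigma_finite)
  have "(\<lambda>p. \<Sum>k\<in>I <+> J. (case k of Inl k \<Rightarrow> snd p k | Inr j \<Rightarrow> f j (fst p)) *\<^sub>R (case k of Inl k \<Rightarrow> x k | Inr j \<Rightarrow> w j))
      \<in> borel_measurable (M \<Otimes>\<^sub>M (\<Pi>\<^sub>M k\<in>I. gauss))"
  proof (rule borel_measurable_sum_scaleR)
    show "finite (I <+> J)" using I J by simp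
    fix k assume k: "k \<in> I <+> J"
    show "(\<lambda>p. case k of Inl k \<Rightarrow> snd p k | Inr j \<Rightarrow> f j (fst p)) \<in> borel_measurable (M \<Otimes>\<^sub>M (\<Pi>\<^sub>M k\<in>I. gauss))"
    proof (cases k)
      case (Inl i)
      then have [measurable]: "(\<lambda>g. g i) \<in> borel_measurable (\<Pi>\<^sub>M k\<in>I. gauss)" using k by auto
      show ?thesis unfolding Inl by simp
    next
      case (Inr j)
      then have [measurable]: "f j \<in> borel_measurable M" using f k by auto
      show ?thesis unfolding Inr by simp
    qed
  qed
  moreover have "(\<Sum>k\<in>I <+> J. (case k of Inl k \<Rightarrow> snd p k | Inr j \<Rightarrow> f j (fst p)) *\<^sub>R (case k of Inl k \<Rightarrow> x k | Inr j \<Rightarrow> w j))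
     = (\<Sum>j\<in>J. f j (fst p) *\<^sub>R w j) + (\<Sum>k\<in>I. snd p k *\<^sub>R x k)" for p
    using I J by (simp add: sum.Plus add.commute)
  ultimately have m: "(\<lambda>p. (\<Sum>j\<in>J. f j (fst p) *\<^sub>R w j) + (\<Sum>k\<in>I. snd p k *\<^sub>R x k))
      \<in> borel_measurable (M \<Otimes>\<^sub>M (\<Pi>\<^sub>M k\<in>I. gauss))" by simp
  show ?thesis
    unfolding gauss_expect_def using measurable_compose[OF m F]
    by (intro borel_measurable_nn_integral) (simp add: case_prod_unfold)
qed

lemma gauss_expect_measurable1:
  fixes x :: "nat \<Rightarrow> 'y::real_normed_vector" and F :: "'y \<Rightarrow> ennreal"
  assumes I: "finite I" and F: "F \<in> borel_measurable borel"
  shows "(\<lambda>t. gauss_expect I x (\<lambda>z. F (t *\<^sub>R w + z))) \<in> borel_measurable borel"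
  using gauss_expect_measurable[OF I F, of "{()}" "\<lambda>_ t. t" borel x "\<lambda>_. w"] by simp

lemma gauss_expect_measurable2:
  fixes x :: "nat \<Rightarrow> 'y::real_normed_vector" and F :: "'y \<Rightarrow> ennreal"
  assumes I: "finite I" and F: "F \<in> borel_measurable borel"
  shows "(\<lambda>(s, t). gauss_expect I x (\<lambda>z. F (s *\<^sub>R w + (t *\<^sub>R v + z)))) \<in> borel_measurable (borel \<Otimes>\<^sub>M borel)"
proof -
  have "(\<lambda>p. gauss_expect I x (\<lambda>z. F ((\<Sum>j\<in>UNIV. (if j then fst p else snd p) *\<^sub>R (if j then w else v)) + z)))
     \<in> borel_measurable (borel \<Otimes>\<^sub>M borel)"
    by (rule gauss_expect_measurable[OF I F]) simp_all
  then show ?thesis by (simp add: UNIV_bool case_prod_unfold add_ac)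
qed

text \<open>A Gaussian sum pairs coordinates with vectors, so rotating two of the vectors amounts to
  rotating the two Gaussian coordinates by the transposed matrix.\<close>

lemma gauss_expect_rotate:
  fixes x :: "nat \<Rightarrow> 'y::real_normed_vector" and F :: "'y \<Rightarrow> ennreal"
  assumes I: "finite I" "i \<in> I" "j \<in> I" "i \<noteq> j" and F: "F \<in> borel_measurable borel"
    and cd: "c\<^sup>2 + d\<^sup>2 = 1" "c \<noteq> -1"
  shows "gauss_expect I (x(i := c *\<^sub>R x i + d *\<^sub>R x j, j := c *\<^sub>R x j - d *\<^sub>R x i)) F = gauss_expect I x F"
proof -
  define L where "L = I - {i, j}"
  have L: "finite L" "i \<notin> L" "j \<notin> L" "I = insert i (insert j L)" "i \<notin> insert j L"
    using I by (auto simp: L_def)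
  let ?H = "\<lambda>s t. gauss_expect L x (\<lambda>z. F (s *\<^sub>R x i + (t *\<^sub>R x j + z)))"
  have eq: "gauss_expect I y F = (\<integral>\<^sup>+s. \<integral>\<^sup>+t. gauss_expect L y (\<lambda>z. F (s *\<^sub>R y i + (t *\<^sub>R y j + z))) \<partial>gauss \<partial>gauss)"
    for y :: "nat \<Rightarrow> 'y"
    using L F by (simp add: gauss_expect_insert translate_borel)
  let ?y = "x(i := c *\<^sub>R x i + d *\<^sub>R x j, j := c *\<^sub>R x j - d *\<^sub>R x i)"
  have "gauss_expect L ?y (\<lambda>z. F (s *\<^sub>R ?y i + (t *\<^sub>R ?y j + z))) = ?H (c * s - d * t) (d * s + c * t)" for s t
    using L I(4) by (intro gauss_expect_cong) (auto intro!: arg_cong[of _ _ F] simp: algebra_simps)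
  then have "gauss_expect I ?y F = (\<integral>\<^sup>+s. \<integral>\<^sup>+t. ?H (c * s - d * t) (d * s + c * t) \<partial>gauss \<partial>gauss)"
    by (simp only: eq)
  also have "\<dots> = (\<integral>\<^sup>+s. \<integral>\<^sup>+t. ?H s t \<partial>gauss \<partial>gauss)"
    by (rule gauss_rotation[OF gauss_expect_measurable2[OF L(1) F] cd])
  finally show ?thesis by (simp only: eq)
qed

lemma gauss_expect_flip:
  fixes x :: "nat \<Rightarrow> 'y::real_normed_vector" and F :: "'y \<Rightarrow> ennreal"
  assumes I: "finite I" "i \<in> I" and F: "F \<in> borel_measurable borel"
  shows "gauss_expect I (x(i := - x i)) F = gauss_expect I x F"
proof -
  define L where "L = I - {i}"
  have L: "finite L" "i \<notin> L" "I = insert i L"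
    using I by (auto simp: L_def)
  have "gauss_expect I (x(i := - x i)) F = (\<integral>\<^sup>+s. gauss_expect L x (\<lambda>z. F ((- s) *\<^sub>R x i + z)) \<partial>gauss)"
    unfolding L(3) using L by (subst gauss_expect_insert[OF _ _ F]) (auto intro!: nn_integral_cong gauss_expect_cong)
  also have "\<dots> = (\<integral>\<^sup>+s. gauss_expect L x (\<lambda>z. F (s *\<^sub>R x i + z)) \<partial>gauss)"
    by (rule gauss_uminus[OF gauss_expect_measurable1[OF L(1) F]])
  also have "\<dots> = gauss_expect I x F"
    unfolding L(3) using L by (subst gauss_expect_insert[OF _ _ F]) auto
  finally show ?thesis .
qed

lemma gauss_expect_signs:
  fixes x :: "nat \<Rightarrow> 'y::real_normed_vector" and F :: "'y \<Rightarrow> ennreal"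
  assumes I: "finite I" and F: "F \<in> borel_measurable borel"
  shows "gauss_expect I (\<lambda>k. if k \<in> R then - x k else x k) F = gauss_expect I x F"
proof -
  have "gauss_expect I (\<lambda>k. if k \<in> T then - x k else x k) F = gauss_expect I x F" if "finite T" "T \<subseteq> I" for T
    using that
  proof (induction T)
    case (insert i T)
    then have eq: "(\<lambda>k. if k \<in> insert i T then - x k else x k)
        = (\<lambda>k. if k \<in> T then - x k else x k)(i := - (\<lambda>k. if k \<in> T then - x k else x k) i)"
      by (auto simp: fun_eq_iff)
    show ?case unfolding eq
      by (subst gauss_expect_flip[OF I _ F]) (use insert in auto)
  qed simp
  from this[of "R \<inter> I"] have "gauss_expect I (\<lambda>k. if k \<in> R \<inter> I then - x k else x k) F = gauss_expect I x F"
    using I by simp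
  also have "gauss_expect I (\<lambda>k. if k \<in> R \<inter> I then - x k else x k) F = gauss_expect I (\<lambda>k. if k \<in> R then - x k else x k) F"
    by (rule gauss_expect_cong) auto
  finally show ?thesis .
qed

text \<open>The class of test functionals. It is stable under translation, so that one Gaussian
  coordinate at a time can be frozen in an induction, and it contains all powers of the norm with
  exponent at least 1. Nonnegativity makes the passage to \<open>ennreal\<close> faithful.\<close>

definition cvx_cont :: "('y::real_normed_vector \<Rightarrow> real) \<Rightarrow> bool" where
  "cvx_cont \<phi> \<longleftrightarrow> continuous_on UNIV \<phi> \<and> convex_on UNIV \<phi> \<and> (\<forall>z. 0 \<le> \<phi> z)"

lemma cvx_cont_translate:
  assumes "cvx_cont \<phi>" shows "cvx_cont (\<lambda>z. \<phi> (w + z))"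
proof -
  have "continuous_on UNIV (\<lambda>z. \<phi> (w + z))"
    using assms unfolding cvx_cont_def
    by (intro continuous_on_compose2[of UNIV \<phi> UNIV "\<lambda>z. w + z"] continuous_on_add continuous_on_const continuous_on_id) auto
  moreover have "convex_on UNIV (\<lambda>z. \<phi> (w + z))"
  proof (rule convex_onI)
    fix t x y assume t: "0 < t" "t < (1::real)"
    have "\<phi> ((1 - t) *\<^sub>R (w + x) + t *\<^sub>R (w + y)) \<le> (1 - t) * \<phi> (w + x) + t * \<phi> (w + y)"
      using assms t unfolding cvx_cont_def by (intro convex_onD[of UNIV]) auto
    also have "(1 - t) *\<^sub>R (w + x) + t *\<^sub>R (w + y) = w + ((1 - t) *\<^sub>R x + t *\<^sub>R y)"
      by (simp add: algebra_simps)
    finally show "\<phi> (w + ((1 - t) *\<^sub>R x + t *\<^sub>R y)) \<le> (1 - t) * \<phi> (w + x) + t * \<phi> (w + y)" .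
  qed simp
  ultimately show ?thesis using assms by (simp add: cvx_cont_def)
qed

lemma cvx_cont_borel:
  assumes "cvx_cont \<phi>" shows "(\<lambda>z. ennreal (\<phi> z)) \<in> borel_measurable borel"
  using assms unfolding cvx_cont_def
  by (intro measurable_compose[OF borel_measurable_continuous_onI measurable_ennreal]) auto

text \<open>Convexity of the power is invoked for positive arguments; if one argument is zero the
  claim reduces to \<open>c powr p <= c\<close> for \<open>0 < c < 1\<close>.\<close>

lemma convex_powr_nonneg:
  fixes a b p t :: real
  assumes p: "1 \<le> p" and ab: "0 \<le> a" "0 \<le> b" and t: "0 < t" "t < 1"
  shows "((1 - t) * a + t * b) powr p \<le> (1 - t) * a powr p + t * b powr p"
proof -
  have *: "(c * z) powr p \<le> c * z powr p" if "0 \<le> z" "0 < c" "c < 1" for c z :: real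
    using powr_mono'[of 1 p c] p that by (simp add: powr_mult mult_right_mono)
  consider "a = 0" | "b = 0" | "a > 0" "b > 0" using ab by linarith
  then show ?thesis
  proof cases
    case 3
    then show ?thesis using convex_onD[OF powr_convex[OF p], of t a b] t by simp
  qed (use * ab t p in auto)
qed

lemma cvx_cont_norm_powr:
  assumes "1 \<le> p" shows "cvx_cont (\<lambda>z::'y::real_normed_vector. norm z powr p)"
proof -
  have "continuous_on UNIV (\<lambda>z::'y. norm z powr p)"
    using assms by (intro continuous_on_powr' continuous_intros) auto
  moreover have "convex_on UNIV (\<lambda>z::'y. norm z powr p)"
  proof (rule convex_onI)
    fix t :: real and x y :: 'y assume t: "0 < t" "t < 1"
    have "norm ((1 - t) *\<^sub>R x + t *\<^sub>R y) \<le> (1 - t) * norm x + t * norm y"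
      using t by (intro norm_triangle_le) simp
    then have "norm ((1 - t) *\<^sub>R x + t *\<^sub>R y) powr p \<le> ((1 - t) * norm x + t * norm y) powr p"
      using assms by (intro powr_mono2) auto
    also have "\<dots> \<le> (1 - t) * norm x powr p + t * norm y powr p"
      using assms t by (intro convex_powr_nonneg) auto
    finally show "norm ((1 - t) *\<^sub>R x + t *\<^sub>R y) powr p \<le> (1 - t) * norm x powr p + t * norm y powr p" .
  qed simp
  ultimately show ?thesis by (simp add: cvx_cont_def)
qed

lemma cvx_cont_norm_square: "cvx_cont (\<lambda>z::'y::real_normed_vector. (norm z)\<^sup>2)"
  using cvx_cont_norm_powr[of 2] by simp

lemma gauss_expect_add:
  assumes I: "finite I" and F: "F \<in> borel_measurable borel" and G: "G \<in> borel_measurable borel"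
  shows "gauss_expect I x (\<lambda>z. F z + G z) = gauss_expect I x F + gauss_expect I x G"
  unfolding gauss_expect_def
  using measurable_compose[OF gauss_sum_measurable[OF I] F] measurable_compose[OF gauss_sum_measurable[OF I] G]
  by (intro nn_integral_add) auto

lemma gauss_expect_cmult:
  assumes I: "finite I" and F: "F \<in> borel_measurable borel"
  shows "gauss_expect I x (\<lambda>z. c * F z) = c * gauss_expect I x F"
  unfolding gauss_expect_def
  using measurable_compose[OF gauss_sum_measurable[OF I] F]
  by (intro nn_integral_cmult) auto

lemma prob_space_gauss_prod: "prob_space (\<Pi>\<^sub>M k\<in>I. gauss)"
  by (rule prob_space_PiM) (rule prob_space_gauss)

lemma gauss_expect_const [simp]: "gauss_expect I x (\<lambda>_. c) = c"
  unfolding gauss_expect_def using prob_space.emeasure_space_1[OF prob_space_gauss_prod[of I]] by simp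

lemma gauss_expect_linear:
  assumes "linear L"
  shows "gauss_expect I (\<lambda>k. L (x k)) F = gauss_expect I x (\<lambda>z. F (L z))"
  unfolding gauss_expect_def
  by (simp add: linear_sum[OF assms] linear_scale[OF assms])

lemma gauss_expect_insert_zero:
  assumes "finite I" "i \<notin> I" "F \<in> borel_measurable borel" "x i = 0"
  shows "gauss_expect (insert i I) x F = gauss_expect I x F"
  using assms gauss.emeasure_space_1 by (simp add: gauss_expect_insert)

lemma gauss_expect_support:
  assumes I: "finite I" and J: "J \<subseteq> I" "\<And>k. k \<in> I - J \<Longrightarrow> x k = 0" and F: "F \<in> borel_measurable borel"
  shows "gauss_expect I x F = gauss_expect J x F"
proof -
  have "gauss_expect (J \<union> T) x F = gauss_expect J x F" if "finite T" "T \<subseteq> I - J" for T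
    using that
  proof (induction T)
    case (insert i T)
    have "gauss_expect (insert i (J \<union> T)) x F = gauss_expect (J \<union> T) x F"
      by (rule gauss_expect_insert_zero)
         (use insert I J F in \<open>auto intro: finite_subset\<close>)
    then show ?case using insert by simp
  qed simp
  from this[of "I - J"] show ?thesis using I J(1) by (simp add: Un_absorb1)
qed

text \<open>Contraction principle for scalars: \<open>t * m\<close> is the convex combination of
  \<open>t\<close> and \<open>- t\<close> with weights \<open>(1 + m) / 2\<close> and
  \<open>(1 - m) / 2\<close>, and both have the same Gaussian law. The coordinates are treated one
  after the other.\<close>

lemma gauss_expect_scale_le:
  assumes I: "finite I" and \<phi>: "cvx_cont \<phi>" and m: "\<And>k. k \<in> I \<Longrightarrow> 0 \<le> m k \<and> m k \<le> 1"
  shows "gauss_expect I (\<lambda>k. m k *\<^sub>R x k) (\<lambda>z. ennreal (\<phi> z)) \<le> gauss_expect I x (\<lambda>z. ennreal (\<phi> z))"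
  using I \<phi> m
proof (induction arbitrary: \<phi>)
  case (insert i I)
  define h where "h t = gauss_expect I x (\<lambda>z. ennreal (\<phi> (t *\<^sub>R x i + z)))" for t
  have [measurable]: "h \<in> borel_measurable borel"
    unfolding h_def by (rule gauss_expect_measurable1[OF insert(1) cvx_cont_borel[OF insert(4)]])
  have mi: "0 \<le> m i" "m i \<le> 1" using insert(5)[of i] by auto
  have h: "h (t * m i) \<le> ennreal ((1 + m i) / 2) * h t + ennreal ((1 - m i) / 2) * h (- t)" for t
  proof -
    have B: "(\<lambda>z. ennreal (\<phi> (w + z))) \<in> borel_measurable borel" for w
      by (intro cvx_cont_borel cvx_cont_translate insert)
    have B2: "(\<lambda>z. c * ennreal (\<phi> (w + z))) \<in> borel_measurable borel" for c w
      using B[of w] by measurable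
    have "h (t * m i) \<le> gauss_expect I x (\<lambda>z. ennreal ((1 + m i) / 2) * ennreal (\<phi> (t *\<^sub>R x i + z))
        + ennreal ((1 - m i) / 2) * ennreal (\<phi> ((-t) *\<^sub>R x i + z)))"
      unfolding h_def
    proof (rule gauss_expect_mono)
      fix z
      have "\<phi> ((1 - (1 - m i) / 2) *\<^sub>R (t *\<^sub>R x i + z) + ((1 - m i) / 2) *\<^sub>R ((-t) *\<^sub>R x i + z))
         \<le> (1 - (1 - m i) / 2) * \<phi> (t *\<^sub>R x i + z) + ((1 - m i) / 2) * \<phi> ((-t) *\<^sub>R x i + z)"
        using insert(4) mi unfolding cvx_cont_def by (intro convex_onD[of UNIV]) auto
      also have "1 - (1 - m i) / 2 = (1 + m i) / 2" by (simp add: field_simps)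
      also have "((1 + m i) / 2) *\<^sub>R (t *\<^sub>R x i + z) + ((1 - m i) / 2) *\<^sub>R ((-t) *\<^sub>R x i + z)
        = ((1 + m i) / 2 * t - (1 - m i) / 2 * t) *\<^sub>R x i + ((1 + m i) / 2 + (1 - m i) / 2) *\<^sub>R z"
        by (simp only: scaleR_add_right scaleR_add_left scaleR_diff_left scaleR_scaleR) simp
      also have "\<dots> = (t * m i) *\<^sub>R x i + z" by (simp add: field_simps)
      finally have "\<phi> ((t * m i) *\<^sub>R x i + z) \<le> (1 + m i) / 2 * \<phi> (t *\<^sub>R x i + z) + (1 - m i) / 2 * \<phi> ((-t) *\<^sub>R x i + z)" .
      then have "ennreal (\<phi> ((t * m i) *\<^sub>R x i + z)) \<le> ennreal ((1 + m i) / 2 * \<phi> (t *\<^sub>R x i + z) + (1 - m i) / 2 * \<phi> ((-t) *\<^sub>R x i + z))"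
        by (rule ennreal_leI)
      then show "ennreal (\<phi> ((t * m i) *\<^sub>R x i + z)) \<le> ennreal ((1 + m i) / 2) * ennreal (\<phi> (t *\<^sub>R x i + z))
        + ennreal ((1 - m i) / 2) * ennreal (\<phi> ((-t) *\<^sub>R x i + z))"
        using mi insert(4) unfolding cvx_cont_def
        by (subst (1 2) ennreal_mult[symmetric]) (simp_all add: ennreal_plus[symmetric] del: ennreal_plus)
    qed
    also have "\<dots> = ennreal ((1 + m i) / 2) * h t + ennreal ((1 - m i) / 2) * h (- t)"
      unfolding h_def
      by (simp only: gauss_expect_add[OF insert(1) B2 B2] gauss_expect_cmult[OF insert(1) B])
    finally show ?thesis .
  qed
  have "gauss_expect (insert i I) (\<lambda>k. m k *\<^sub>R x k) (\<lambda>z. ennreal (\<phi> z))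
     = (\<integral>\<^sup>+t. gauss_expect I (\<lambda>k. m k *\<^sub>R x k) (\<lambda>z. ennreal (\<phi> ((t * m i) *\<^sub>R x i + z))) \<partial>gauss)"
    using gauss_expect_insert[OF insert(1,2) cvx_cont_borel[OF insert(4)]] by simp
  also have "\<dots> \<le> (\<integral>\<^sup>+t. h (t * m i) \<partial>gauss)"
    unfolding h_def by (intro nn_integral_mono insert.IH cvx_cont_translate insert) auto
  also have "\<dots> \<le> (\<integral>\<^sup>+t. ennreal ((1 + m i) / 2) * h t + ennreal ((1 - m i) / 2) * h (- t) \<partial>gauss)"
    by (intro nn_integral_mono h)
  also have "\<dots> = ennreal ((1 + m i) / 2) * (\<integral>\<^sup>+t. h t \<partial>gauss) + ennreal ((1 - m i) / 2) * (\<integral>\<^sup>+t. h (- t) \<partial>gauss)"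
    by (subst nn_integral_add) (simp_all add: nn_integral_cmult)
  also have "(\<integral>\<^sup>+t. h (- t) \<partial>gauss) = (\<integral>\<^sup>+t. h t \<partial>gauss)"
    by (rule gauss_uminus) measurable
  also have "ennreal ((1 + m i) / 2) * (\<integral>\<^sup>+t. h t \<partial>gauss) + ennreal ((1 - m i) / 2) * (\<integral>\<^sup>+t. h t \<partial>gauss)
     = (\<integral>\<^sup>+t. h t \<partial>gauss)"
  proof -
    have "ennreal ((1 + m i) / 2) + ennreal ((1 - m i) / 2) = 1"
      using mi by (subst ennreal_plus[symmetric]) (auto simp: field_simps)
    then show ?thesis by (metis distrib_right mult_1)
  qed
  also have "\<dots> = gauss_expect (insert i I) x (\<lambda>z. ennreal (\<phi> z))"
    unfolding h_def by (rule gauss_expect_insert[OF insert(1,2) cvx_cont_borel[OF insert(4)], symmetric])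
  finally show ?case .
qed simp

lemma gauss_expect_subset_le:
  assumes I: "finite I" and J: "J \<subseteq> I" and \<phi>: "cvx_cont \<phi>"
  shows "gauss_expect J x (\<lambda>z. ennreal (\<phi> z)) \<le> gauss_expect I x (\<lambda>z. ennreal (\<phi> z))"
proof -
  let ?m = "\<lambda>k. if k \<in> J then 1 else 0 :: real"
  have "gauss_expect J x (\<lambda>z. ennreal (\<phi> z)) = gauss_expect J (\<lambda>k. ?m k *\<^sub>R x k) (\<lambda>z. ennreal (\<phi> z))"
    by (rule gauss_expect_cong) auto
  also have "\<dots> = gauss_expect I (\<lambda>k. ?m k *\<^sub>R x k) (\<lambda>z. ennreal (\<phi> z))"
    using I J cvx_cont_borel[OF \<phi>] by (intro gauss_expect_support[symmetric]) auto
  also have "\<dots> \<le> gauss_expect I x (\<lambda>z. ennreal (\<phi> z))"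
    by (rule gauss_expect_scale_le[OF I \<phi>]) auto
  finally show ?thesis .
qed

subsection \<open>Contractions\<close>

text \<open>Givens rotations act on pairs of rows of the coefficient matrix. Each one preserves the
  law of the Gaussian sum and the Gram matrix of the columns, and one rotation per row clears the
  entry in column \<open>j0\<close> at the expense of row \<open>i\<close>. The vectors are
  quantified after \<open>b\<close>, so a single matrix serves all of them.\<close>

lemma gauss_expect_givens:
  fixes a :: "nat \<Rightarrow> 'j \<Rightarrow> real"
  assumes I: "finite I" "i \<in> I"
  shows "\<exists>b. (\<forall>(v :: 'j \<Rightarrow> 'y::real_normed_vector) F. F \<in> borel_measurable borel \<longrightarrow>
        gauss_expect I (\<lambda>k. \<Sum>j\<in>J. b k j *\<^sub>R v j) F = gauss_expect I (\<lambda>k. \<Sum>j\<in>J. a k j *\<^sub>R v j) F) \<and>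
      (\<forall>j l. (\<Sum>k\<in>I. b k j * b k l) = (\<Sum>k\<in>I. a k j * a k l)) \<and> (\<forall>k\<in>I - {i}. b k j0 = 0)"
proof -
  have "\<exists>b. (\<forall>(v :: 'j \<Rightarrow> 'y::real_normed_vector) F. F \<in> borel_measurable borel \<longrightarrow>
        gauss_expect I (\<lambda>k. \<Sum>j\<in>J. b k j *\<^sub>R v j) F = gauss_expect I (\<lambda>k. \<Sum>j\<in>J. a k j *\<^sub>R v j) F) \<and>
      (\<forall>j l. (\<Sum>k\<in>I. b k j * b k l) = (\<Sum>k\<in>I. a k j * a k l)) \<and> (\<forall>k\<in>T. b k j0 = 0)"
    if "finite T" "T \<subseteq> I - {i}" for T
    using that
  proof (induction T)
    case empty
    show ?case by (rule exI[of _ a]) auto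
  next
    case (insert k T)
    then obtain b where b: "\<And>(v :: 'j \<Rightarrow> 'y) F. F \<in> borel_measurable borel \<Longrightarrow>
        gauss_expect I (\<lambda>k. \<Sum>j\<in>J. b k j *\<^sub>R v j) F = gauss_expect I (\<lambda>k. \<Sum>j\<in>J. a k j *\<^sub>R v j) F"
      "\<And>j l. (\<Sum>k\<in>I. b k j * b k l) = (\<Sum>k\<in>I. a k j * a k l)" "\<forall>k\<in>T. b k j0 = 0"
      by auto
    show ?case
    proof (cases "b k j0 = 0")
      case True
      then show ?thesis using b by (intro exI[of _ b]) auto
    next
      case False
      \<comment> \<open>The angle is chosen such that the new entry
        \<open>c * b k j0 - d * b i j0\<close> of row \<open>k\<close> vanishes.\<close>
      define h where "h = sqrt ((b i j0)\<^sup>2 + (b k j0)\<^sup>2)"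
      define c where "c = b i j0 / h"
      define d where "d = b k j0 / h"
      have k: "k \<in> I" "k \<noteq> i" "k \<notin> T" "i \<notin> T" using insert by auto
      have "(b i j0)\<^sup>2 + (b k j0)\<^sup>2 > 0" using False by (simp add: sum_power2_gt_zero_iff)
      then have h: "h > 0" "h\<^sup>2 = (b i j0)\<^sup>2 + (b k j0)\<^sup>2" by (auto simp: h_def)
      have cd: "c\<^sup>2 + d\<^sup>2 = 1"
        unfolding c_def d_def power_divide add_divide_distrib[symmetric] h(2)[symmetric] using h(1) by simp
      \<comment> \<open>A half turn would force \<open>d = 0\<close>, but \<open>b k j0\<close> is
        not zero.\<close>
      have "c \<noteq> -1" using cd False h(1) by (auto simp: d_def)
      define b' where "b' = b(i := (\<lambda>j. c * b i j + d * b k j), k := (\<lambda>j. c * b k j - d * b i j))"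
      have 1: "gauss_expect I (\<lambda>k. \<Sum>j\<in>J. b' k j *\<^sub>R v j) F = gauss_expect I (\<lambda>k. \<Sum>j\<in>J. a k j *\<^sub>R v j) F"
        if F: "F \<in> borel_measurable borel" for v :: "'j \<Rightarrow> 'y" and F
      proof -
        let ?x = "\<lambda>k. \<Sum>j\<in>J. b k j *\<^sub>R v j"
        have "(\<lambda>k. \<Sum>j\<in>J. b' k j *\<^sub>R v j) = ?x(i := c *\<^sub>R ?x i + d *\<^sub>R ?x k, k := c *\<^sub>R ?x k - d *\<^sub>R ?x i)"
          using k by (auto simp: fun_eq_iff b'_def scaleR_sum_right sum.distrib sum_subtractf algebra_simps)
        then have "gauss_expect I (\<lambda>k. \<Sum>j\<in>J. b' k j *\<^sub>R v j) F = gauss_expect I ?x F"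
          using gauss_expect_rotate[OF I(1) I(2) k(1) k(2)[symmetric] F cd \<open>c \<noteq> -1\<close>] by simp
        then show ?thesis using b(1)[OF F] by simp
      qed
      have 2: "(\<Sum>k\<in>I. b' k j * b' k l) = (\<Sum>k\<in>I. a k j * a k l)" for j l
      proof -
        have split: "(\<Sum>m\<in>I. f m) = f i + (f k + (\<Sum>m\<in>I - {i} - {k}. f m))" for f :: "nat \<Rightarrow> real"
          using I k by (subst sum.remove[of I i], simp, simp, subst sum.remove[of "I - {i}" k]) auto
        have rest: "(\<Sum>m\<in>I - {i} - {k}. b' m j * b' m l) = (\<Sum>m\<in>I - {i} - {k}. b m j * b m l)"
          by (rule sum.cong) (auto simp: b'_def)
        have "(c * b i j + d * b k j) * (c * b i l + d * b k l) + (c * b k j - d * b i j) * (c * b k l - d * b i l)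
           = (c\<^sup>2 + d\<^sup>2) * (b i j * b i l + b k j * b k l)" by algebra
        then have "b' i j * b' i l + b' k j * b' k l = b i j * b i l + b k j * b k l"
          using cd k by (simp add: b'_def)
        then have "(\<Sum>k\<in>I. b' k j * b' k l) = (\<Sum>k\<in>I. b k j * b k l)"
          by (simp add: split rest add.assoc[symmetric])
        then show ?thesis using b(2) by simp
      qed
      have 3: "\<forall>m\<in>insert k T. b' m j0 = 0"
        using b(3) k by (auto simp: b'_def c_def d_def)
      show ?thesis using 1 2 3 by blast
    qed
  qed
  from this[of "I - {i}"] I show ?thesis by auto
qed

text \<open>The rows enter this quadratic form only through the Gram matrix of the columns, so
  contractivity survives the rotations.\<close>

lemma sum_square_gram:
  fixes b :: "'k \<Rightarrow> 'j \<Rightarrow> real"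
  shows "(\<Sum>k\<in>I. (\<Sum>j\<in>J. b k j * y j)\<^sup>2) = (\<Sum>j\<in>J. \<Sum>l\<in>J. y j * y l * (\<Sum>k\<in>I. b k j * b k l))"
proof -
  have "(\<Sum>k\<in>I. (\<Sum>j\<in>J. b k j * y j)\<^sup>2) = (\<Sum>k\<in>I. \<Sum>j\<in>J. \<Sum>l\<in>J. y j * y l * (b k j * b k l))"
    by (simp add: power2_eq_square sum_product algebra_simps)
  also have "\<dots> = (\<Sum>j\<in>J. \<Sum>l\<in>J. \<Sum>k\<in>I. y j * y l * (b k j * b k l))"
    by (subst sum.swap, rule sum.cong, simp, rule sum.swap)
  finally show ?thesis by (simp add: sum_distrib_left)
qed

text \<open>
  The contraction is first completed by an extra row that makes the column \<open>j0\<close> a unit vector orthogonal to the other columns; by rotation invariance this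
  column may then be assumed to be concentrated in the extra row, and \<open>v j0\<close> splits off.
\<close>

lemma gauss_expect_contraction:
  fixes v :: "nat \<Rightarrow> 'y::real_normed_vector"
  assumes "finite J" "finite I" "cvx_cont \<phi>"
    and "\<And>y. (\<Sum>k\<in>I. (\<Sum>j\<in>J. a k j * y j)\<^sup>2) \<le> (\<Sum>j\<in>J. (y j)\<^sup>2)"
  shows "gauss_expect I (\<lambda>k. \<Sum>j\<in>J. a k j *\<^sub>R v j) (\<lambda>z. ennreal (\<phi> z)) \<le> gauss_expect J v (\<lambda>z. ennreal (\<phi> z))"
  using assms
proof (induction J arbitrary: I a \<phi>)
  case empty
  then show ?case by (subst gauss_expect_support[of I "{}"]) (auto intro: cvx_cont_borel)
next
  case (insert j0 J)
  note con = insert.prems(3)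
  have fin: "finite I" "finite J" "j0 \<notin> J" using insert by auto
  define \<beta> where "\<beta> = (\<Sum>k\<in>I. (a k j0)\<^sup>2)"
  define g where "g j = (\<Sum>k\<in>I. a k j0 * a k j)" for j
  \<comment> \<open>The hypothesis, evaluated at the vector with entry \<open>t\<close> at
    \<open>j0\<close> and entries of \<open>y\<close> elsewhere, and expanded in powers of
    \<open>t\<close>.\<close>
  have test: "2 * t * (\<Sum>j\<in>J. g j * y j) + (\<Sum>k\<in>I. (\<Sum>j\<in>J. a k j * y j)\<^sup>2) \<le> t\<^sup>2 * (1 - \<beta>) + (\<Sum>j\<in>J. (y j)\<^sup>2)" for t y
  proof -
    have e: "(\<Sum>j\<in>J. f j ((y(j0 := t)) j)) = (\<Sum>j\<in>J. f j (y j))" for f :: "nat \<Rightarrow> real \<Rightarrow> real"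
      using fin by (intro sum.cong) auto
    have "(\<Sum>k\<in>I. (\<Sum>j\<in>insert j0 J. a k j * (y(j0 := t)) j)\<^sup>2) = (\<Sum>k\<in>I. (a k j0 * t + (\<Sum>j\<in>J. a k j * y j))\<^sup>2)"
      using fin e[of "\<lambda>j z. a _ j * z"] by simp
    also have "\<dots> = (\<Sum>k\<in>I. t\<^sup>2 * (a k j0)\<^sup>2 + 2 * t * (\<Sum>j\<in>J. a k j0 * a k j * y j) + (\<Sum>j\<in>J. a k j * y j)\<^sup>2)"
      by (rule sum.cong) (auto simp: power2_eq_square sum_distrib_left algebra_simps)
    also have "\<dots> = t\<^sup>2 * \<beta> + 2 * t * (\<Sum>k\<in>I. \<Sum>j\<in>J. a k j0 * a k j * y j) + (\<Sum>k\<in>I. (\<Sum>j\<in>J. a k j * y j)\<^sup>2)"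
      by (simp add: sum.distrib sum_distrib_left \<beta>_def)
    also have "(\<Sum>k\<in>I. \<Sum>j\<in>J. a k j0 * a k j * y j) = (\<Sum>j\<in>J. g j * y j)"
      by (subst sum.swap) (simp add: g_def sum_distrib_right)
    finally have "t\<^sup>2 * \<beta> + 2 * t * (\<Sum>j\<in>J. g j * y j) + (\<Sum>k\<in>I. (\<Sum>j\<in>J. a k j * y j)\<^sup>2)
      \<le> t\<^sup>2 + (\<Sum>j\<in>J. (y j)\<^sup>2)" using con[of "y(j0 := t)"] fin e[of "\<lambda>j z. z\<^sup>2"] by simp
    then show ?thesis by (simp add: algebra_simps)
  qed
  have \<beta>: "\<beta> \<le> 1" using test[of 1 "\<lambda>_. 0"] by simp
  \<comment> \<open>The entry in the extra row that completes column \<open>j0\<close> to length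
    1.\<close>
  define s where "s = sqrt (1 - \<beta>)"
  have s: "s \<ge> 0" "s\<^sup>2 = 1 - \<beta>" using \<beta> by (auto simp: s_def)
  \<comment> \<open>If the column already has length 1, the quadratic term in \<open>t\<close> drops
    out of \<open>test\<close>, and a nonzero linear term would violate the inequality;
    \<open>1 / g j\<close> is large enough to show it.\<close>
  have g0: "g j = 0" if "s = 0" "j \<in> J" for j
  proof (rule ccontr)
    assume "g j \<noteq> 0"
    let ?y = "\<lambda>l. if l = j then 1 else 0 :: real"
    let ?t = "1 / g j"
    have eq: "(\<Sum>j\<in>J. f j * ?y j) = f j" for f :: "nat \<Rightarrow> real" using that fin by (simp add: sum.If_cases if_distrib cong: if_cong)
    have "(\<Sum>j\<in>J. (?y j)\<^sup>2) = 1" using eq[of ?y] by (simp add: power2_eq_square)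
    moreover have "(\<Sum>k\<in>I. (\<Sum>j\<in>J. a k j * ?y j)\<^sup>2) \<ge> 0" by (intro sum_nonneg) simp
    ultimately have "2 * ?t * g j \<le> ?t\<^sup>2 * (1 - \<beta>) + 1"
      using test[of ?t ?y] unfolding eq by linarith
    then show False using \<open>g j \<noteq> 0\<close> s that by simp
  qed
  obtain k0 where k0: "k0 \<notin> I" using ex_new_if_finite[OF infinite_UNIV_nat fin(1)] by auto
  \<comment> \<open>The entries \<open>- g j / s\<close> make the completed column orthogonal to all
    others. For \<open>s = 0\<close> the quotient is 0 by convention, in agreement with
    \<open>g0\<close>.\<close>
  define b where "b = a(k0 := (\<lambda>j. if j = j0 then s else - g j / s))"
  let ?I = "insert k0 I"
  have sumb: "(\<Sum>k\<in>?I. f (b k)) = f (\<lambda>j. if j = j0 then s else - g j / s) + (\<Sum>k\<in>I. f (a k))" for f :: "_ \<Rightarrow> real"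
  proof -
    have "(\<Sum>k\<in>I. f (b k)) = (\<Sum>k\<in>I. f (a k))" using k0 by (intro sum.cong) (auto simp: b_def)
    then show ?thesis using k0 fin by (simp add: b_def)
  qed
  obtain b' where b': "\<And>(v :: nat \<Rightarrow> 'y) F. F \<in> borel_measurable borel \<Longrightarrow>
        gauss_expect ?I (\<lambda>k. \<Sum>j\<in>insert j0 J. b' k j *\<^sub>R v j) F = gauss_expect ?I (\<lambda>k. \<Sum>j\<in>insert j0 J. b k j *\<^sub>R v j) F"
      "\<And>j l. (\<Sum>k\<in>?I. b' k j * b' k l) = (\<Sum>k\<in>?I. b k j * b k l)" "\<forall>k\<in>?I - {k0}. b' k j0 = 0"
    using gauss_expect_givens[of ?I k0 "insert j0 J" b j0] fin by auto
  have z: "b' k j0 = 0" if "k \<in> I" for k using b'(3) that k0 by auto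
  have "(\<Sum>k\<in>?I. b' k j0 * b' k j0) = 1"
    unfolding b'(2) sumb[of "\<lambda>r. r j0 * r j0"] using s by (simp add: \<beta>_def power2_eq_square)
  then have "(b' k0 j0)\<^sup>2 = 1" using fin k0 z by (simp add: power2_eq_square)
  then have e1: "b' k0 j0 = 1 \<or> b' k0 j0 = -1" by (simp add: power2_eq_1_iff)
  have zz: "b' k0 j = 0" if "j \<in> J" for j
  proof -
    have "(\<Sum>k\<in>?I. b' k j0 * b' k j) = 0"
      unfolding b'(2) sumb[of "\<lambda>r. r j0 * r j"] using g0[OF _ that] that fin s
      by (cases "s = 0") (auto simp: g_def)
    then show ?thesis using fin k0 z e1 by auto
  qed
  have conb: "(\<Sum>k\<in>I. (\<Sum>j\<in>J. b' k j * y j)\<^sup>2) \<le> (\<Sum>j\<in>J. (y j)\<^sup>2)" for y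
  proof -
    have "(\<Sum>k\<in>I. (\<Sum>j\<in>J. b' k j * y j)\<^sup>2) = (\<Sum>k\<in>?I. (\<Sum>j\<in>J. b' k j * y j)\<^sup>2)"
      using fin k0 zz by simp
    also have "\<dots> = (\<Sum>k\<in>?I. (\<Sum>j\<in>J. b k j * y j)\<^sup>2)"
      by (simp only: sum_square_gram b'(2))
    also have "\<dots> = (\<Sum>j\<in>J. (if j = j0 then s else - g j / s) * y j)\<^sup>2 + (\<Sum>k\<in>I. (\<Sum>j\<in>J. a k j * y j)\<^sup>2)"
      by (rule sumb[of "\<lambda>r. (\<Sum>j\<in>J. r j * y j)\<^sup>2"])
    also have "(\<Sum>j\<in>J. (if j = j0 then s else - g j / s) * y j) = - (\<Sum>j\<in>J. g j * y j) / s"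
    proof -
      have "(\<Sum>j\<in>J. (if j = j0 then s else - g j / s) * y j) = (\<Sum>j\<in>J. - (g j * y j / s))"
        using fin by (intro sum.cong) auto
      then show ?thesis by (simp add: sum_negf sum_divide_distrib)
    qed
    also have "(- (\<Sum>j\<in>J. g j * y j) / s)\<^sup>2 + (\<Sum>k\<in>I. (\<Sum>j\<in>J. a k j * y j)\<^sup>2) \<le> (\<Sum>j\<in>J. (y j)\<^sup>2)"
    proof (cases "s = 0")
      case True
      then show ?thesis using test[of 0 y] by simp
    next
      case False
      \<comment> \<open>The value of \<open>t\<close> inserted into \<open>test\<close> is the
        optimal one; it reproduces exactly the square contributed by the extra row.\<close>
      have "2 * ((\<Sum>j\<in>J. g j * y j) / s\<^sup>2) * (\<Sum>j\<in>J. g j * y j) = 2 * ((\<Sum>j\<in>J. g j * y j) / s)\<^sup>2"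
        by (simp add: power2_eq_square)
      moreover have "((\<Sum>j\<in>J. g j * y j) / s\<^sup>2)\<^sup>2 * (1 - \<beta>) = ((\<Sum>j\<in>J. g j * y j) / s)\<^sup>2"
        using False by (simp add: s(2)[symmetric] power2_eq_square)
      ultimately show ?thesis using test[of "(\<Sum>j\<in>J. g j * y j) / s\<^sup>2" y] by simp
    qed
    finally show ?thesis .
  qed
  note bm = cvx_cont_borel[OF insert.prems(2)]
  have tm: "(\<lambda>t. gauss_expect J v (\<lambda>z. ennreal (\<phi> (t *\<^sub>R v j0 + z)))) \<in> borel_measurable borel"
    by (rule gauss_expect_measurable1[OF fin(2) bm])
  have "gauss_expect I (\<lambda>k. \<Sum>j\<in>insert j0 J. a k j *\<^sub>R v j) (\<lambda>z. ennreal (\<phi> z))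
     = gauss_expect I (\<lambda>k. \<Sum>j\<in>insert j0 J. b k j *\<^sub>R v j) (\<lambda>z. ennreal (\<phi> z))"
    using k0 by (intro gauss_expect_cong) (auto simp: b_def)
  also have "\<dots> \<le> gauss_expect ?I (\<lambda>k. \<Sum>j\<in>insert j0 J. b k j *\<^sub>R v j) (\<lambda>z. ennreal (\<phi> z))"
    using fin insert.prems(2) by (intro gauss_expect_subset_le) auto
  also have "\<dots> = gauss_expect ?I (\<lambda>k. \<Sum>j\<in>insert j0 J. b' k j *\<^sub>R v j) (\<lambda>z. ennreal (\<phi> z))"
    by (rule b'(1)[OF bm, symmetric])
  also have "\<dots> = (\<integral>\<^sup>+t. gauss_expect I (\<lambda>k. \<Sum>j\<in>J. b' k j *\<^sub>R v j) (\<lambda>z. ennreal (\<phi> ((t * b' k0 j0) *\<^sub>R v j0 + z))) \<partial>gauss)"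
    using fin z zz by (subst gauss_expect_insert[OF fin(1) k0 bm]) (auto intro!: nn_integral_cong gauss_expect_cong)
  also have "\<dots> \<le> (\<integral>\<^sup>+t. gauss_expect J v (\<lambda>z. ennreal (\<phi> ((t * b' k0 j0) *\<^sub>R v j0 + z))) \<partial>gauss)"
    using fin conb insert.prems(2) by (intro nn_integral_mono insert.IH cvx_cont_translate) auto
  \<comment> \<open>The coefficient that splits off is 1 or -1, and its sign is invisible to the
    symmetric Gaussian law.\<close>
  also have "\<dots> = (\<integral>\<^sup>+t. gauss_expect J v (\<lambda>z. ennreal (\<phi> (t *\<^sub>R v j0 + z))) \<partial>gauss)"
    using e1
  proof
    assume "b' k0 j0 = -1" then show ?thesis using gauss_uminus[OF tm] by simp
  qed simp
  also have "\<dots> = gauss_expect (insert j0 J) v (\<lambda>z. ennreal (\<phi> z))"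
    by (rule gauss_expect_insert[OF fin(2,3) bm, symmetric])
  finally show ?case .
qed

subsection \<open>Comparison of moments\<close>

text \<open>Qualitative finiteness, required before a fraction of the second moment can be absorbed
  into the second moment itself.\<close>

lemma gauss_expect_norm_square_finite:
  fixes x :: "nat \<Rightarrow> 'y::real_normed_vector"
  assumes "finite I"
  shows "gauss_expect I x (\<lambda>z. ennreal ((norm z)\<^sup>2)) < \<infinity>"
  using assms
proof (induction I)
  case (insert i I)
  have m: "(\<lambda>z::'y. ennreal ((norm z)\<^sup>2)) \<in> borel_measurable borel"
    by (rule cvx_cont_borel[OF cvx_cont_norm_square])
  have sq: "(\<integral>\<^sup>+t. ennreal (t\<^sup>2) \<partial>gauss) < \<infinity>"
  proof -
    have "integrable lborel (\<lambda>t. std_normal_density t * t ^ (2 * 1))"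
      using integral_std_normal_moment_even(1)[of 1] std_normal_moment_even[of 1]
      by (auto simp: has_bochner_integral_iff)
    then have "(\<integral>\<^sup>+t. ennreal (std_normal_density t * t\<^sup>2) \<partial>lborel) < \<infinity>"
      by (subst nn_integral_eq_integral) auto
    then show ?thesis by (simp add: nn_integral_density ennreal_mult)
  qed
  have "gauss_expect (insert i I) x (\<lambda>z. ennreal ((norm z)\<^sup>2))
      = (\<integral>\<^sup>+t. gauss_expect I x (\<lambda>z. ennreal ((norm (t *\<^sub>R x i + z))\<^sup>2)) \<partial>gauss)"
    by (rule gauss_expect_insert[OF insert(1,2) m])
  also have "\<dots> \<le> (\<integral>\<^sup>+t. gauss_expect I x (\<lambda>z. ennreal (2 * t\<^sup>2 * (norm (x i))\<^sup>2) + 2 * ennreal ((norm z)\<^sup>2)) \<partial>gauss)"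
  proof (intro nn_integral_mono gauss_expect_mono)
    fix t z
    have "(norm (t *\<^sub>R x i + z))\<^sup>2 \<le> (norm (t *\<^sub>R x i) + norm z)\<^sup>2"
      by (intro power_mono norm_triangle_ineq) simp
    also have "\<dots> \<le> 2 * (norm (t *\<^sub>R x i))\<^sup>2 + 2 * (norm z)\<^sup>2"
      using zero_le_power2[of "norm (t *\<^sub>R x i) - norm z"] by (simp add: power2_eq_square algebra_simps)
    also have "\<dots> = 2 * t\<^sup>2 * (norm (x i))\<^sup>2 + 2 * (norm z)\<^sup>2" by (simp add: power_mult_distrib)
    finally have "ennreal ((norm (t *\<^sub>R x i + z))\<^sup>2) \<le> ennreal (2 * t\<^sup>2 * (norm (x i))\<^sup>2 + 2 * (norm z)\<^sup>2)"
      by (rule ennreal_leI)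
    then show "ennreal ((norm (t *\<^sub>R x i + z))\<^sup>2) \<le> ennreal (2 * t\<^sup>2 * (norm (x i))\<^sup>2) + 2 * ennreal ((norm z)\<^sup>2)"
      by (simp add: ennreal_plus ennreal_mult)
  qed
  also have "\<dots> = (\<integral>\<^sup>+t. ennreal (2 * (norm (x i))\<^sup>2) * ennreal (t\<^sup>2) + 2 * gauss_expect I x (\<lambda>z. ennreal ((norm z)\<^sup>2)) \<partial>gauss)"
    using insert(1) m by (simp add: gauss_expect_add gauss_expect_cmult ennreal_mult[symmetric] mult_ac)
  also have "\<dots> = ennreal (2 * (norm (x i))\<^sup>2) * (\<integral>\<^sup>+t. ennreal (t\<^sup>2) \<partial>gauss) + 2 * gauss_expect I x (\<lambda>z. ennreal ((norm z)\<^sup>2))"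
    using gauss.emeasure_space_1 by (subst nn_integral_add) (simp_all add: nn_integral_cmult)
  also have "\<dots> < \<infinity>"
    using sq insert.IH by (simp add: ennreal_mult_less_top)
  finally show ?case .
qed simp

lemma borel_measurable_pair_times:
  fixes G1 :: "'a::topological_space \<Rightarrow> ennreal" and G2 :: "'b::topological_space \<Rightarrow> ennreal"
  assumes G: "G1 \<in> borel_measurable borel" "G2 \<in> borel_measurable borel"
  shows "(\<lambda>z. G1 (fst z) * G2 (snd z)) \<in> borel_measurable borel"
proof -
  have "(\<lambda>z::'a \<times> 'b. G1 (fst z)) \<in> borel_measurable borel"
    by (rule measurable_compose[OF borel_measurable_continuous_onI[OF continuous_on_fst[OF continuous_on_id]] G(1)])
  moreover have "(\<lambda>z::'a \<times> 'b. G2 (snd z)) \<in> borel_measurable borel"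
    by (rule measurable_compose[OF borel_measurable_continuous_onI[OF continuous_on_snd[OF continuous_on_id]] G(2)])
  ultimately show ?thesis by measurable
qed

text \<open>Two independent copies are realised by interleaving: even indices carry the vectors in
  the first component of a product space, odd indices carry them in the second.\<close>

lemma gauss_expect_pair:
  fixes x :: "nat \<Rightarrow> 'y::real_normed_vector"
  assumes I: "finite I" and F: "F1 \<in> borel_measurable borel" "F2 \<in> borel_measurable borel"
  shows "gauss_expect ((\<lambda>k. 2 * k) ` I \<union> (\<lambda>k. 2 * k + 1) ` I) (\<lambda>n. if even n then (x (n div 2), 0) else (0, x (n div 2)))
           (\<lambda>z. F1 (fst z) * F2 (snd z)) = gauss_expect I x F1 * gauss_expect I x F2"
  (is "gauss_expect (?W I) ?w _ = _")
  using assms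
proof (induction arbitrary: F1 F2)
  case (insert i I)
  let ?h = "\<lambda>F t. gauss_expect I x (\<lambda>z. F (t *\<^sub>R x i + z))"
  note m = gauss_expect_measurable1[OF insert(1), of _ x "x i"]
  have W: "?W (insert i I) = insert (2 * i) (insert (2 * i + 1) (?W I))" by auto
  have ni: "2 * i \<notin> insert (2 * i + 1) (?W I)" "2 * i + 1 \<notin> ?W I"
    using insert(2) by (auto dest: arg_cong[of _ _ even])
  have mF: "F1 \<in> borel_measurable borel" "F2 \<in> borel_measurable borel" by fact+
  note mm = borel_measurable_pair_times[OF mF]
  have "gauss_expect (?W (insert i I)) ?w (\<lambda>z. F1 (fst z) * F2 (snd z))
     = (\<integral>\<^sup>+s. \<integral>\<^sup>+t. gauss_expect (?W I) ?w (\<lambda>z. F1 (s *\<^sub>R x i + fst z) * F2 (t *\<^sub>R x i + snd z)) \<partial>gauss \<partial>gauss)"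
    unfolding W
    by (simp only: gauss_expect_insert[OF _ ni(1) mm] gauss_expect_insert[OF _ ni(2) translate_borel[OF mm]]
        finite_insert finite_UnI finite_imageI insert(1)) simp
  also have "\<dots> = (\<integral>\<^sup>+s. \<integral>\<^sup>+t. ?h F1 s * ?h F2 t \<partial>gauss \<partial>gauss)"
    by (intro nn_integral_cong insert.IH translate_borel mF)
  also have "\<dots> = (\<integral>\<^sup>+s. ?h F1 s \<partial>gauss) * (\<integral>\<^sup>+t. ?h F2 t \<partial>gauss)"
    using m[OF mF(1)] m[OF mF(2)] by (simp add: nn_integral_cmult nn_integral_multc)
  also have "\<dots> = gauss_expect (insert i I) x F1 * gauss_expect (insert i I) x F2"
    by (simp add: gauss_expect_insert[OF insert(1,2)] mF)
  finally show ?case .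
qed simp

text \<open>A rotation by 45 degrees in each pair of coordinates \<open>2 * k\<close>,
  \<open>2 * k + 1\<close> replaces the two copies by their normalised difference and sum, with the
  same joint law.\<close>

lemma gauss_expect_pair_rotate:
  fixes x :: "nat \<Rightarrow> 'y::real_normed_vector" and F :: "'y \<times> 'y \<Rightarrow> ennreal"
  assumes I: "finite I" and F: "F \<in> borel_measurable borel" and c: "c = 1 / sqrt 2"
  shows "gauss_expect ((\<lambda>k. 2 * k) ` I \<union> (\<lambda>k. 2 * k + 1) ` I) (\<lambda>n. if even n then (x (n div 2), 0) else (0, x (n div 2))) F
       = gauss_expect ((\<lambda>k. 2 * k) ` I \<union> (\<lambda>k. 2 * k + 1) ` I) (\<lambda>n. if even n then (x (n div 2), 0) else (0, x (n div 2)))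
          (\<lambda>z. F (c *\<^sub>R (fst z - snd z), c *\<^sub>R (fst z + snd z)))"
  (is "gauss_expect ?W ?w F = _")
proof -
  let ?L = "\<lambda>z::'y\<times>'y. (c *\<^sub>R (fst z - snd z), c *\<^sub>R (fst z + snd z))"
  have cc: "c\<^sup>2 + c\<^sup>2 = 1" "c \<noteq> -1" using c by (auto simp: power_divide)
      (smt (verit) divide_nonneg_nonneg real_sqrt_ge_zero)
  have L: "linear ?L"
    by (rule linearI) (auto simp: algebra_simps)
  \<comment> \<open>The intermediate family in which only the pairs with index in \<open>T\<close>
    have been rotated.\<close>
  define W' where "W' T n = (if n div 2 \<in> T then ?L (?w n) else ?w n)" for T n
  have "gauss_expect ?W (W' T) F = gauss_expect ?W ?w F" if "finite T" "T \<subseteq> I" for T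
    using that
  proof (induction T)
    case empty
    then show ?case by (simp add: W'_def)
  next
    case (insert i T)
    let ?y = "W' T"
    have i: "2 * i \<in> ?W" "2 * i + 1 \<in> ?W" "i \<notin> T" using insert by auto
    have "W' (insert i T) = ?y(2 * i := c *\<^sub>R ?y (2 * i) + c *\<^sub>R ?y (2 * i + 1), 2 * i + 1 := c *\<^sub>R ?y (2 * i + 1) - c *\<^sub>R ?y (2 * i))"
    proof
      fix n
      have "n = 2 * i \<or> n = 2 * i + 1 \<or> n div 2 \<noteq> i" by presburger
      then consider "n = 2 * i" | "n = 2 * i + 1" | "n div 2 \<noteq> i" by blast
      then show "W' (insert i T) n = (?y(2 * i := c *\<^sub>R ?y (2 * i) + c *\<^sub>R ?y (2 * i + 1), 2 * i + 1 := c *\<^sub>R ?y (2 * i + 1) - c *\<^sub>R ?y (2 * i))) n"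
        by cases (use i(3) in \<open>auto simp: W'_def\<close>)
    qed
    then have "gauss_expect ?W (W' (insert i T)) F = gauss_expect ?W ?y F"
      using gauss_expect_rotate[OF _ i(1,2) _ F cc, of ?y] I by simp
    then show ?case using insert by simp
  qed
  from this[of I] have "gauss_expect ?W ?w F = gauss_expect ?W (W' I) F" using I by simp
  also have "\<dots> = gauss_expect ?W (\<lambda>n. ?L (?w n)) F"
    by (rule gauss_expect_cong) (auto simp: W'_def)
  also have "\<dots> = gauss_expect ?W ?w (\<lambda>z. F (?L z))" by (rule gauss_expect_linear[OF L])
  finally show ?thesis .
qed

text \<open>By the triangle inequality \<open>norm (z + z') - norm (z - z')\<close> is at most twice
  the norm of either vector, while the hypotheses and \<open>c <= 1\<close> put it above
  \<open>2 * s\<close>.\<close>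

lemma rotated_tail_bound:
  fixes z z' :: "'y::real_normed_vector"
  assumes s: "0 < s" and c: "c = 1 / sqrt 2"
    and h: "norm (c *\<^sub>R (z - z')) \<le> s" "norm (c *\<^sub>R (z + z')) > 3 * s"
  shows "norm z > s \<and> norm z' > s \<and> (norm (c *\<^sub>R (z + z')))\<^sup>2 \<le> (norm z)\<^sup>2 + (norm z')\<^sup>2"
proof -
  have c0: "c > 0" "c\<^sup>2 = 1 / 2" "c \<le> 1" using c by (auto simp: power_divide)
  have "norm (z + z') * c > 3 * s" "norm (z - z') * c \<le> s" using h c0 by (auto simp: mult.commute)
  then have d: "(norm (z + z') - norm (z - z')) * c > 2 * s" by (simp add: algebra_simps)
  have e: "2 *\<^sub>R z - (z - z') = z + z'" "2 *\<^sub>R z' + (z - z') = z + z'" by (simp_all add: scaleR_2)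
  have n1: "norm (z + z') - norm (z - z') \<le> 2 * norm z" and n2: "norm (z + z') - norm (z - z') \<le> 2 * norm z'"
    using norm_triangle_ineq4[of "2 *\<^sub>R z" "z - z'"] norm_triangle_ineq[of "2 *\<^sub>R z'" "z - z'"]
    unfolding e by (simp_all add: algebra_simps)
  have "(2 * s) * 1 < (norm (z + z') - norm (z - z')) * 1"
  proof -
    have "norm (z + z') - norm (z - z') \<ge> 0"
      using d s c0 by (smt (verit) mult_nonneg_nonneg zero_le_mult_iff)
    then have "(norm (z + z') - norm (z - z')) * c \<le> (norm (z + z') - norm (z - z')) * 1"
      using c0 by (intro mult_left_mono) auto
    then show ?thesis using d by simp
  qed
  then have "norm z > s" "norm z' > s" using n1 n2 by auto
  moreover have "(norm (c *\<^sub>R (z + z')))\<^sup>2 \<le> (norm z)\<^sup>2 + (norm z')\<^sup>2"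
  proof -
    have "(norm (c *\<^sub>R (z + z')))\<^sup>2 = (norm (z + z'))\<^sup>2 / 2" using c0 by (simp add: power_mult_distrib)
    also have "\<dots> \<le> (norm z + norm z')\<^sup>2 / 2" by (intro divide_right_mono power_mono norm_triangle_ineq) auto
    also have "\<dots> \<le> (norm z)\<^sup>2 + (norm z')\<^sup>2"
      using zero_le_power2[of "norm z - norm z'"] by (simp add: power2_eq_square algebra_simps)
    finally show ?thesis .
  qed
  ultimately show ?thesis by simp
qed

text \<open>
  Fernique's argument: if \<open>G, G'\<close> are independent copies then so are \<open>(G - G') / sqrt 2\<close> and
  \<open>(G + G') / sqrt 2\<close>, and the second one can only be large while the first one is small if both
  \<open>G\<close> and \<open>G'\<close> are large. The resulting bound for the tail of the second moment is absorbed.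
\<close>

lemma gauss_expect_square_le_level:
  fixes x :: "nat \<Rightarrow> 'y::real_normed_vector"
  assumes I: "finite I" and s: "0 < s" and s8: "8 * gauss_expect I x (\<lambda>z. ennreal (norm z)) \<le> ennreal s"
  shows "gauss_expect I x (\<lambda>z. ennreal ((norm z)\<^sup>2)) \<le> ennreal (13 * s\<^sup>2)"
proof -
  let ?E = "gauss_expect I x"
  define F1 where "F1 z = (if norm z \<le> s then 1 else 0 :: ennreal)" for z :: 'y
  define F1' where "F1' z = (if norm z > s then 1 else 0 :: ennreal)" for z :: 'y
  define F2 where "F2 z = (if norm z > 3 * s then ennreal ((norm z)\<^sup>2) else 0)" for z :: 'y
  define F2' where "F2' z = F1' z * ennreal ((norm z)\<^sup>2)" for z :: 'y
  have nb: "norm \<in> borel_measurable (borel :: 'y measure)"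
    by (intro borel_measurable_continuous_onI continuous_intros)
  note [measurable] = nb
  have m: "F1 \<in> borel_measurable borel" "F1' \<in> borel_measurable borel" "F2 \<in> borel_measurable borel" "F2' \<in> borel_measurable borel"
    unfolding F1_def F1'_def F2_def F2'_def by measurable
  have sqm: "(\<lambda>z::'y. ennreal ((norm z)\<^sup>2)) \<in> borel_measurable borel" by measurable
  let ?W = "(\<lambda>k. 2 * k) ` I \<union> (\<lambda>k. 2 * k + 1) ` I"
  let ?w = "\<lambda>n. if even n then (x (n div 2), 0) else (0, x (n div 2))"
  define c where "c = 1 / sqrt 2"
  note mp = borel_measurable_pair_times
  have "?E F1 * ?E F2 = gauss_expect ?W ?w (\<lambda>z. F1 (fst z) * F2 (snd z))"
    by (rule gauss_expect_pair[OF I m(1,3), symmetric])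
  also have "\<dots> = gauss_expect ?W ?w (\<lambda>z. F1 (c *\<^sub>R (fst z - snd z)) * F2 (c *\<^sub>R (fst z + snd z)))"
    using gauss_expect_pair_rotate[OF I mp[OF m(1,3)] c_def, of x] by simp
  also have "\<dots> \<le> gauss_expect ?W ?w (\<lambda>z. F2' (fst z) * F1' (snd z) + F1' (fst z) * F2' (snd z))"
  proof (rule gauss_expect_mono)
    fix z :: "'y \<times> 'y"
    show "F1 (c *\<^sub>R (fst z - snd z)) * F2 (c *\<^sub>R (fst z + snd z)) \<le> F2' (fst z) * F1' (snd z) + F1' (fst z) * F2' (snd z)"
    proof (cases "norm (c *\<^sub>R (fst z - snd z)) \<le> s \<and> norm (c *\<^sub>R (fst z + snd z)) > 3 * s")
      case True
      then have "norm (fst z) > s \<and> norm (snd z) > s \<and> (norm (c *\<^sub>R (fst z + snd z)))\<^sup>2 \<le> (norm (fst z))\<^sup>2 + (norm (snd z))\<^sup>2"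
        by (intro rotated_tail_bound[OF s c_def]) auto
      then show ?thesis using True
        by (simp add: F1_def F2_def F1'_def F2'_def ennreal_plus[symmetric] ennreal_leI del: ennreal_plus)
    qed (auto simp: F1_def F2_def)
  qed
  also have "\<dots> = ?E F2' * ?E F1' + ?E F1' * ?E F2'"
    by (simp only: gauss_expect_add[OF _ mp[OF m(4,2)] mp[OF m(2,4)]] finite_UnI finite_imageI I
        gauss_expect_pair[OF I m(4,2)] gauss_expect_pair[OF I m(2,4)])
  \<comment> \<open>By independence all products factor: the probability of staying below
    \<open>s\<close>, times the second moment beyond \<open>3 * s\<close>, is at most twice the
    probability of exceeding \<open>s\<close> times the second moment beyond
    \<open>s\<close>.\<close>
  finally have main: "?E F1 * ?E F2 \<le> 2 * (?E F1' * ?E F2')" by (simp add: mult_2 mult.commute)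
  have "?E (\<lambda>z. ennreal s * F1' z) \<le> ?E (\<lambda>z. ennreal (norm z))"
    by (rule gauss_expect_mono) (auto simp: F1'_def intro: ennreal_leI)
  then have "8 * ?E (\<lambda>z. ennreal s * F1' z) \<le> 8 * ?E (\<lambda>z. ennreal (norm z))"
    by (rule mult_left_mono) simp
  also note s8
  finally have "8 * (ennreal s * ?E F1') \<le> ennreal s"
    by (simp only: gauss_expect_cmult[OF I m(2)])
  then have "ennreal s * (8 * ?E F1') \<le> ennreal s * 1" by (simp add: mult_ac)
  \<comment> \<open>Markov's inequality: the norm exceeds \<open>s\<close> with probability at most
    1/8.\<close>
  then have p8: "8 * ?E F1' \<le> 1" using s by (subst (asm) ennreal_mult_le_mult_iff) auto
  have p1: "?E F1' + ?E F1 = 1"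
  proof -
    have "?E F1' + ?E F1 = ?E (\<lambda>z. F1' z + F1 z)" by (rule gauss_expect_add[OF I m(2,1), symmetric])
    also have "\<dots> = ?E (\<lambda>z. 1)" by (rule gauss_expect_cong) (auto simp: F1_def F1'_def)
    finally show ?thesis by simp
  qed
  have M2: "?E (\<lambda>z. ennreal ((norm z)\<^sup>2)) \<le> ennreal (9 * s\<^sup>2) + ?E F2"
  proof -
    have "?E (\<lambda>z. ennreal ((norm z)\<^sup>2)) \<le> ?E (\<lambda>z. ennreal (9 * s\<^sup>2) + F2 z)"
    proof (rule gauss_expect_mono)
      fix z :: 'y
      have "(norm z)\<^sup>2 \<le> 9 * s\<^sup>2" if "norm z \<le> 3 * s"
        using power_mono[OF that, of 2] by (simp add: power_mult_distrib)
      then show "ennreal ((norm z)\<^sup>2) \<le> ennreal (9 * s\<^sup>2) + F2 z"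
        by (auto simp: F2_def intro: ennreal_leI)
    qed
    also have "\<dots> = ennreal (9 * s\<^sup>2) + ?E F2" using I m by (subst gauss_expect_add) auto
    finally show ?thesis .
  qed
  have F2'_le: "?E F2' \<le> ?E (\<lambda>z. ennreal ((norm z)\<^sup>2))"
    by (rule gauss_expect_mono) (auto simp: F2'_def F1'_def)
  have F2_le: "?E F2 \<le> ?E (\<lambda>z. ennreal ((norm z)\<^sup>2))"
    by (rule gauss_expect_mono) (auto simp: F2_def)
  have fin: "?E (\<lambda>z. ennreal ((norm z)\<^sup>2)) < \<infinity>" by (rule gauss_expect_norm_square_finite[OF I])
  obtain q where q: "?E F1 = ennreal q" "q \<ge> 0" using p1 by (cases "?E F1") auto
  obtain p where p: "?E F1' = ennreal p" "p \<ge> 0" using p1 by (cases "?E F1'") auto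
  obtain M where M: "?E (\<lambda>z. ennreal ((norm z)\<^sup>2)) = ennreal M" "M \<ge> 0" using fin by (cases "?E (\<lambda>z. ennreal ((norm z)\<^sup>2))") auto
  obtain T where T: "?E F2 = ennreal T" "T \<ge> 0" using fin F2_le by (cases "?E F2") auto
  have "ennreal (8 * p) \<le> ennreal 1" using p8 p by (simp add: ennreal_mult)
  then have "8 * p \<le> 1" by (simp add: ennreal_le_iff)
  have "ennreal (p + q) = ennreal 1" using p1 p q by simp
  then have "p + q = 1" using p q by (subst (asm) ennreal_inj) auto
  have "ennreal (q * T) \<le> ennreal (2 * (p * M))"
    using order_trans[OF main mult_left_mono[OF mult_left_mono[OF F2'_le]]] p q M T
    by (simp add: ennreal_mult)
  then have "q * T \<le> 2 * (p * M)" using p M by (subst (asm) ennreal_le_iff) auto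
  have "M \<le> 9 * s\<^sup>2 + T"
    using M2 M T by (simp add: ennreal_plus[symmetric] del: ennreal_plus)
  \<comment> \<open>Since \<open>p <= 1/8\<close> and \<open>q >= 7/8\<close>, the tail satisfies
    \<open>7 * T <= 2 * M\<close>. With \<open>M <= 9 * s^2 + T\<close> this gives
    \<open>5 * M <= 63 * s^2\<close>, and 13 rounds up 63/5.\<close>
  have "7 / 8 * T \<le> q * T" using \<open>p + q = 1\<close> \<open>8 * p \<le> 1\<close> T by (intro mult_right_mono) auto
  moreover have "2 * (p * M) \<le> 2 * (1 / 8 * M)" using \<open>8 * p \<le> 1\<close> M by (intro mult_left_mono mult_right_mono) auto
  ultimately have "7 * T \<le> 2 * M" using \<open>q * T \<le> 2 * (p * M)\<close> by linarith
  then have "5 * M \<le> 63 * s\<^sup>2" using \<open>M \<le> 9 * s\<^sup>2 + T\<close> by linarith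
  then have "M \<le> 13 * s\<^sup>2" using zero_le_power2[of s] by linarith
  then show ?thesis using M by (auto intro: ennreal_leI)
qed

text \<open>For finite index sets the second moment is finite, so \<open>enn2real\<close> loses
  nothing. For \<open>{..<n}\<close> this is the quantity whose supremum is
  \<open>gamma_norm\<close>.\<close>

definition gauss_norm :: "nat set \<Rightarrow> (nat \<Rightarrow> 'y::real_normed_vector) \<Rightarrow> real" where
  "gauss_norm I x = sqrt (enn2real (gauss_expect I x (\<lambda>z. ennreal ((norm z)\<^sup>2))))"

lemma gauss_norm_nonneg [simp]: "0 \<le> gauss_norm I x"
  by (simp add: gauss_norm_def)

lemma gauss_norm_square:
  assumes "finite I"
  shows "ennreal ((gauss_norm I x)\<^sup>2) = gauss_expect I x (\<lambda>z. ennreal ((norm z)\<^sup>2))"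
  using gauss_expect_norm_square_finite[OF assms, of x] by (simp add: gauss_norm_def ennreal_enn2real)

lemma gauss_norm_le_iff:
  assumes "finite I" "finite J" "0 \<le> c"
  shows "gauss_norm I x \<le> c * gauss_norm J y \<longleftrightarrow>
    gauss_expect I x (\<lambda>z. ennreal ((norm z)\<^sup>2)) \<le> ennreal (c\<^sup>2) * gauss_expect J y (\<lambda>z. ennreal ((norm z)\<^sup>2))"
proof -
  have "gauss_norm I x \<le> c * gauss_norm J y \<longleftrightarrow> (gauss_norm I x)\<^sup>2 \<le> c\<^sup>2 * (gauss_norm J y)\<^sup>2"
    using assms(3) by (simp add: power_mult_distrib[symmetric])
  also have "\<dots> \<longleftrightarrow> ennreal ((gauss_norm I x)\<^sup>2) \<le> ennreal (c\<^sup>2 * (gauss_norm J y)\<^sup>2)"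
    by simp
  finally show ?thesis using assms by (simp add: ennreal_mult gauss_norm_square)
qed

text \<open>Truncation at height \<open>m\<close>. It serves twice: to compare Gaussian moments, and
  to return from p-th powers to first powers on a set of finite measure.\<close>

lemma powr_split_le:
  fixes a m p :: real
  assumes "0 \<le> a" "0 < m" "1 \<le> p"
  shows "a \<le> m + m powr (1 - p) * a powr p"
proof (cases "a \<le> m")
  case False
  then have "a = a powr (1 - p) * a powr p" using assms by (simp add: powr_add[symmetric])
  also have "\<dots> \<le> m powr (1 - p) * a powr p"
    using False assms by (intro mult_right_mono powr_mono2') auto
  finally show ?thesis using assms by simp
qed (use assms in \<open>simp add: add_increasing2\<close>)

text \<open>Kahane-Khintchine inequality. By Fernique's estimate the first moment cannot be small
  compared with the second, and truncation passes from the first moment to the p-th.\<close>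

lemma gauss_norm_powr_le:
  assumes I: "finite I" and p: "1 \<le> p"
  shows "ennreal (gauss_norm I x powr p) \<le> ennreal (240 powr p) * gauss_expect I x (\<lambda>z. ennreal (norm z powr p))"
proof -
  let ?S = "gauss_norm I x" and ?E = "gauss_expect I x"
  show ?thesis
  proof (cases "?S > 0")
    case True
    \<comment> \<open>A quarter of the norm makes \<open>13 * s^2\<close> smaller than the second
      moment, hence the first moment exceeds \<open>s / 8\<close>.\<close>
    define s where "s = ?S / 4"
    have s: "s > 0" using True by (simp add: s_def)
    have "13 * s\<^sup>2 < ?S\<^sup>2" using True by (simp add: s_def power_divide field_simps)
    then have "\<not> ennreal (?S\<^sup>2) \<le> ennreal (13 * s\<^sup>2)" by simp
    then have big: "ennreal s < 8 * ?E (\<lambda>z. ennreal (norm z))"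
      using gauss_expect_square_le_level[OF I s, of x] gauss_norm_square[OF I, of x] by fastforce
    \<comment> \<open>Half of the lower bound for the first moment, so that the truncated part
      cannot account for all of it. The norm is \<open>64 * m\<close>, which the constant 240
      generously exceeds.\<close>
    define m where "m = s / 16"
    have m: "m > 0" using s by (simp add: m_def)
    have pm: "(\<lambda>z::'a. ennreal (norm z powr p)) \<in> borel_measurable borel"
      by (rule cvx_cont_borel[OF cvx_cont_norm_powr[OF p]])
    have "?E (\<lambda>z. ennreal (norm z)) \<le> ?E (\<lambda>z. ennreal m + ennreal (m powr (1 - p)) * ennreal (norm z powr p))"
    proof (rule gauss_expect_mono)
      fix z :: 'a
      have "ennreal (norm z) \<le> ennreal (m + m powr (1 - p) * norm z powr p)"
        by (intro ennreal_leI powr_split_le m p) simp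
      then show "ennreal (norm z) \<le> ennreal m + ennreal (m powr (1 - p)) * ennreal (norm z powr p)"
        using m by (simp add: ennreal_mult)
    qed
    also have "\<dots> = ennreal m + ennreal (m powr (1 - p)) * ?E (\<lambda>z. ennreal (norm z powr p))"
    proof -
      have "(\<lambda>z::'a. ennreal (m powr (1 - p)) * ennreal (norm z powr p)) \<in> borel_measurable borel"
        using pm by measurable
      then show ?thesis using I pm by (simp add: gauss_expect_add gauss_expect_cmult)
    qed
    finally have 1: "8 * ?E (\<lambda>z. ennreal (norm z)) \<le> 8 * (ennreal m + ennreal (m powr (1 - p)) * ?E (\<lambda>z. ennreal (norm z powr p)))"
      by (rule mult_left_mono) simp
    show ?thesis
    proof (cases "?E (\<lambda>z. ennreal (norm z powr p))")
      case (real e)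
      have "ennreal s < ennreal (8 * (m + m powr (1 - p) * e))"
        using less_le_trans[OF big 1] real m by (simp add: ennreal_mult)
      then have "s < 8 * (m + m powr (1 - p) * e)" by (simp add: ennreal_less_iff s less_imp_le)
      then have "m < m powr (1 - p) * e" by (simp add: m_def)
      then have "m * m powr (p - 1) \<le> e"
        using m by (simp add: powr_diff field_simps)
      then have "m powr p \<le> e" using m by (simp add: powr_diff)
      moreover have "?S powr p = 64 powr p * m powr p" using True by (simp add: m_def s_def powr_mult[symmetric])
      ultimately have "?S powr p \<le> 64 powr p * e" by (simp add: mult_left_mono)
      also have "\<dots> \<le> 240 powr p * e" using p real by (intro mult_right_mono powr_mono2) auto
      finally show ?thesis using real by (simp add: ennreal_mult[symmetric] ennreal_leI)
    next
      case top
      then show ?thesis by (simp add: ennreal_mult_top)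
    qed
  next
    case False
    then have "?S = 0" using gauss_norm_nonneg[of I x] by linarith
    then show ?thesis by simp
  qed
qed

text \<open>Truncation at the Gaussian norm itself gives the factor 2. If this norm vanishes, the
  level of truncation is sent to zero instead.\<close>

lemma gauss_expect_powr_le:
  assumes I: "finite I" and p: "0 < p" "p \<le> 2"
  shows "gauss_expect I x (\<lambda>z. ennreal (norm z powr p)) \<le> ennreal (2 * gauss_norm I x powr p)"
proof -
  let ?S = "gauss_norm I x" and ?E = "gauss_expect I x"
  have sq: "?E (\<lambda>z. ennreal ((norm z)\<^sup>2)) = ennreal (?S\<^sup>2)" using gauss_norm_square[OF I, of x] by simp
  have sqm: "(\<lambda>z::'a. ennreal ((norm z)\<^sup>2)) \<in> borel_measurable borel"
    by (rule cvx_cont_borel[OF cvx_cont_norm_square])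
  have 1: "?E (\<lambda>z. ennreal (norm z powr p)) \<le> ennreal (m powr p + m powr (p - 2) * ?S\<^sup>2)" if m: "m > 0" for m
  proof -
    have "?E (\<lambda>z. ennreal (norm z powr p)) \<le> ?E (\<lambda>z. ennreal (m powr p) + ennreal (m powr (p - 2)) * ennreal ((norm z)\<^sup>2))"
    proof (rule gauss_expect_mono)
      fix z :: 'a
      have "norm z powr p \<le> m powr p + m powr (p - 2) * (norm z)\<^sup>2"
      proof (cases "norm z \<le> m")
        case True
        then have "norm z powr p \<le> m powr p" using p by (intro powr_mono2) auto
        then show ?thesis by (simp add: add_increasing2)
      next
        case False
        then have "norm z > 0" using m by linarith
        then have "norm z powr p = norm z powr (p - 2) * (norm z)\<^sup>2" by (simp add: powr_diff)
        also have "\<dots> \<le> m powr (p - 2) * (norm z)\<^sup>2"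
          using False m p by (intro mult_right_mono powr_mono2') auto
        finally show ?thesis by (simp add: add_increasing)
      qed
      then have "ennreal (norm z powr p) \<le> ennreal (m powr p + m powr (p - 2) * (norm z)\<^sup>2)" by (rule ennreal_leI)
      then show "ennreal (norm z powr p) \<le> ennreal (m powr p) + ennreal (m powr (p - 2)) * ennreal ((norm z)\<^sup>2)"
        by (simp add: ennreal_mult)
    qed
    also have "\<dots> = ennreal (m powr p) + ennreal (m powr (p - 2)) * ennreal (?S\<^sup>2)"
    proof -
      have "(\<lambda>z::'a. ennreal (m powr (p - 2)) * ennreal ((norm z)\<^sup>2)) \<in> borel_measurable borel"
        using sqm by measurable
      then show ?thesis using I sqm sq by (simp add: gauss_expect_add gauss_expect_cmult)
    qed
    finally show ?thesis by (simp add: ennreal_mult)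
  qed
  show ?thesis
  proof (cases "?S > 0")
    case True
    then have "?S powr p + ?S powr (p - 2) * ?S\<^sup>2 = 2 * ?S powr p" by (simp add: powr_diff)
    then show ?thesis using 1[OF True] by simp
  next
    case False
    then have S0: "?S = 0" using gauss_norm_nonneg[of I x] by linarith
    have "?E (\<lambda>z. ennreal (norm z powr p)) \<le> 0 + ennreal e" if e: "e > 0" for e
      using 1[of "e powr (1 / p)"] e p by (simp add: S0 powr_powr)
    then have "?E (\<lambda>z. ennreal (norm z powr p)) \<le> 0" by (rule ennreal_le_epsilon)
    then show ?thesis by simp
  qed
qed

section \<open>Stein's inequality\<close>

text \<open>On a finite weighted set a filtration is a refining sequence of labels, and a vanishing
  conditional expectation is a vanishing weighted sum over every label class. As soon as X has a
  nonzero vector, any finite set can be embedded into the sequences in X over which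
  \<open>umd_space\<close> quantifies; in the trivial space all norms are zero.\<close>

lemma umd_finite:
  assumes umd: "umd_space TYPE('x::banach)" and p: "1 < p"
  shows "\<exists>\<beta>\<ge>0. \<forall>(\<Omega>::'w set) w (l :: nat \<Rightarrow> 'w \<Rightarrow> 'l) N (d :: nat \<Rightarrow> 'w \<Rightarrow> 'x) (e :: nat \<Rightarrow> real).
    finite \<Omega> \<longrightarrow> (\<forall>\<omega>\<in>\<Omega>. 0 \<le> w \<omega>) \<longrightarrow> sum w \<Omega> = 1 \<longrightarrow>
    (\<forall>k. \<forall>\<omega>\<in>\<Omega>. \<forall>\<omega>'\<in>\<Omega>. l (Suc k) \<omega> = l (Suc k) \<omega>' \<longrightarrow> l k \<omega> = l k \<omega>') \<longrightarrow>
    (\<forall>k<N. \<forall>\<omega>\<in>\<Omega>. \<forall>\<omega>'\<in>\<Omega>. l (Suc k) \<omega> = l (Suc k) \<omega>' \<longrightarrow> d k \<omega> = d k \<omega>') \<longrightarrow>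
    (\<forall>k<N. \<forall>\<omega>\<in>\<Omega>. (\<Sum>\<omega>'\<in>{\<omega>'\<in>\<Omega>. l k \<omega>' = l k \<omega>}. w \<omega>' *\<^sub>R d k \<omega>') = 0) \<longrightarrow>
    (\<forall>k<N. e k \<in> {-1, 1}) \<longrightarrow>
    (\<Sum>\<omega>\<in>\<Omega>. w \<omega> * norm (\<Sum>k<N. e k *\<^sub>R d k \<omega>) powr p)
      \<le> \<beta> powr p * (\<Sum>\<omega>\<in>\<Omega>. w \<omega> * norm (\<Sum>k<N. d k \<omega>) powr p)"
proof -
  have "\<exists>\<beta>\<ge>0. \<forall>(P :: (nat \<Rightarrow> 'x) measure) F N (d :: nat \<Rightarrow> (nat \<Rightarrow> 'x) \<Rightarrow> 'x) (e :: nat \<Rightarrow> real).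
        prob_space P \<and> Lp_martingale_differences p P F N d \<and> (\<forall>k<N. e k \<in> {-1, 1}) \<longrightarrow>
        (\<integral>\<^sup>+\<omega>. ennreal (norm (\<Sum>k<N. e k *\<^sub>R d k \<omega>) powr p) \<partial>P)
          \<le> ennreal (\<beta> powr p) * (\<integral>\<^sup>+\<omega>. ennreal (norm (\<Sum>k<N. d k \<omega>) powr p) \<partial>P)"
    by (rule umd[unfolded umd_space_def, THEN spec, THEN mp, OF p])
  then obtain \<beta> where \<beta>: "\<beta> \<ge> 0" and U: "\<forall>(P :: (nat \<Rightarrow> 'x) measure) F N (d :: nat \<Rightarrow> (nat \<Rightarrow> 'x) \<Rightarrow> 'x) (e :: nat \<Rightarrow> real).
        prob_space P \<and> Lp_martingale_differences p P F N d \<and> (\<forall>k<N. e k \<in> {-1, 1}) \<longrightarrow>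
        (\<integral>\<^sup>+\<omega>. ennreal (norm (\<Sum>k<N. e k *\<^sub>R d k \<omega>) powr p) \<partial>P)
          \<le> ennreal (\<beta> powr p) * (\<integral>\<^sup>+\<omega>. ennreal (norm (\<Sum>k<N. d k \<omega>) powr p) \<partial>P)"
    by (elim exE conjE) (rule that)
  show ?thesis
  proof (intro exI[of _ \<beta>] conjI allI impI \<beta>)
    fix \<Omega> :: "'w set" and w and l :: "nat \<Rightarrow> 'w \<Rightarrow> 'l" and N and d :: "nat \<Rightarrow> 'w \<Rightarrow> 'x" and e :: "nat \<Rightarrow> real"
    assume fin: "finite \<Omega>" and w: "\<forall>\<omega>\<in>\<Omega>. 0 \<le> w \<omega>" "sum w \<Omega> = 1"
      and ref: "\<forall>k. \<forall>\<omega>\<in>\<Omega>. \<forall>\<omega>'\<in>\<Omega>. l (Suc k) \<omega> = l (Suc k) \<omega>' \<longrightarrow> l k \<omega> = l k \<omega>'"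
      and meas: "\<forall>k<N. \<forall>\<omega>\<in>\<Omega>. \<forall>\<omega>'\<in>\<Omega>. l (Suc k) \<omega> = l (Suc k) \<omega>' \<longrightarrow> d k \<omega> = d k \<omega>'"
      and mean: "\<forall>k<N. \<forall>\<omega>\<in>\<Omega>. (\<Sum>\<omega>'\<in>{\<omega>'\<in>\<Omega>. l k \<omega>' = l k \<omega>}. w \<omega>' *\<^sub>R d k \<omega>') = 0"
      and e: "\<forall>k<N. e k \<in> {-1, 1}"
    show "(\<Sum>\<omega>\<in>\<Omega>. w \<omega> * norm (\<Sum>k<N. e k *\<^sub>R d k \<omega>) powr p)
      \<le> \<beta> powr p * (\<Sum>\<omega>\<in>\<Omega>. w \<omega> * norm (\<Sum>k<N. d k \<omega>) powr p)"
    proof (cases "\<exists>x0::'x. x0 \<noteq> 0")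
      case False
      then have "z = 0" for z :: 'x by blast
      then have n0: "norm z = 0" for z :: 'x by simp
      show ?thesis unfolding n0 by simp
    next
      case True
      then obtain x0 :: 'x where x0: "x0 \<noteq> 0" by auto
      obtain f :: "'w \<Rightarrow> nat" where f: "inj_on f \<Omega>"
        using finite_imp_inj_to_nat_seg[OF fin] by blast
      \<comment> \<open>Distinct multiples of \<open>x0\<close> give distinct sequences.\<close>
      define \<iota> where "\<iota> \<omega> = (\<lambda>_::nat. real (f \<omega>) *\<^sub>R x0)" for \<omega>
      have \<iota>: "inj_on \<iota> \<Omega>"
        using f x0 by (auto simp: inj_on_def \<iota>_def fun_eq_iff)
      define \<kappa> where "\<kappa> = inv_into \<Omega> \<iota>"
      have \<kappa>: "\<kappa> (\<iota> \<omega>) = \<omega>" if "\<omega> \<in> \<Omega>" for \<omega> using inv_into_f_f[OF \<iota> that] by (simp add: \<kappa>_def)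
      define D where "D k \<psi> = (if \<psi> \<in> \<iota> ` \<Omega> then d k (\<kappa> \<psi>) else 0)" for k \<psi>
      \<comment> \<open>The sequences outside the image form one further class, labelled
        \<open>None\<close>, of measure zero.\<close>
      define L where "L k \<psi> = (if \<psi> \<in> \<iota> ` \<Omega> then Some (l k (\<kappa> \<psi>)) else None)" for k \<psi>
      have D\<iota>: "D k (\<iota> \<omega>) = d k \<omega>" if "\<omega> \<in> \<Omega>" for k \<omega> using that \<kappa> by (auto simp: D_def)
      have L\<iota>: "L k (\<iota> \<omega>) = Some (l k \<omega>)" if "\<omega> \<in> \<Omega>" for k \<omega> using that \<kappa> by (auto simp: L_def)
      have Lcases: "(\<exists>\<omega>\<in>\<Omega>. \<exists>\<omega>'\<in>\<Omega>. \<psi> = \<iota> \<omega> \<and> \<psi>' = \<iota> \<omega>' \<and> l k \<omega> = l k \<omega>') \<or> (\<psi> \<notin> \<iota> ` \<Omega> \<and> \<psi>' \<notin> \<iota> ` \<Omega>)"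
        if "L k \<psi> = L k \<psi>'" for k \<psi> \<psi>'
      proof (cases "\<psi> \<in> \<iota> ` \<Omega>")
        case True
        then have "\<psi>' \<in> \<iota> ` \<Omega>" using that by (simp add: L_def split: if_splits)
        then show ?thesis using True that L\<iota> by fastforce
      next
        case False
        then show ?thesis using that by (simp add: L_def split: if_splits)
      qed
      have Lref: "L k \<psi> = L k \<psi>'" if "L (Suc k) \<psi> = L (Suc k) \<psi>'" for k \<psi> \<psi>'
        using Lcases[OF that]
      proof
        assume "\<exists>\<omega>\<in>\<Omega>. \<exists>\<omega>'\<in>\<Omega>. \<psi> = \<iota> \<omega> \<and> \<psi>' = \<iota> \<omega>' \<and> l (Suc k) \<omega> = l (Suc k) \<omega>'"
        then obtain \<omega> \<omega>' where o: "\<omega> \<in> \<Omega>" "\<omega>' \<in> \<Omega>" "\<psi> = \<iota> \<omega>" "\<psi>' = \<iota> \<omega>'" "l (Suc k) \<omega> = l (Suc k) \<omega>'" by blast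
        have "l k \<omega> = l k \<omega>'" by (rule ref[rule_format, OF o(1,2,5)])
        then show ?thesis by (simp only: o(3,4) L\<iota>[OF o(1)] L\<iota>[OF o(2)])
      qed (simp add: L_def)
      have LD: "D k \<psi> = D k \<psi>'" if "L (Suc k) \<psi> = L (Suc k) \<psi>'" "k < N" for k \<psi> \<psi>'
        using Lcases[OF that(1)]
      proof
        assume "\<exists>\<omega>\<in>\<Omega>. \<exists>\<omega>'\<in>\<Omega>. \<psi> = \<iota> \<omega> \<and> \<psi>' = \<iota> \<omega>' \<and> l (Suc k) \<omega> = l (Suc k) \<omega>'"
        then obtain \<omega> \<omega>' where o: "\<omega> \<in> \<Omega>" "\<omega>' \<in> \<Omega>" "\<psi> = \<iota> \<omega>" "\<psi>' = \<iota> \<omega>'" "l (Suc k) \<omega> = l (Suc k) \<omega>'" by blast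
        have "d k \<omega> = d k \<omega>'" by (rule meas[rule_format, OF that(2) o(1,2,5)])
        then show ?thesis by (simp only: o(3,4) D\<iota>[OF o(1)] D\<iota>[OF o(2)])
      qed (simp add: D_def)
      \<comment> \<open>All subsets are measurable for \<open>P\<close>; only the filtration is
        coarse.\<close>
      define P where "P = distr (point_measure \<Omega> (\<lambda>\<omega>. ennreal (w \<omega>))) (count_space UNIV) \<iota>"
      have sP: "sets P = UNIV" "space P = UNIV" by (auto simp: P_def)
      have \<iota>m: "\<iota> \<in> measurable (point_measure \<Omega> (\<lambda>\<omega>. ennreal (w \<omega>))) (count_space UNIV)" by simp
      have int: "(\<integral>\<^sup>+\<psi>. ennreal (g \<psi>) \<partial>P) = ennreal (\<Sum>\<omega>\<in>\<Omega>. w \<omega> * g (\<iota> \<omega>))" if "\<And>\<psi>. 0 \<le> g \<psi>" for g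
      proof -
        have "(\<integral>\<^sup>+\<psi>. ennreal (g \<psi>) \<partial>P) = (\<Sum>\<omega>\<in>\<Omega>. ennreal (w \<omega>) * ennreal (g (\<iota> \<omega>)))"
          unfolding P_def using fin w(1) by (subst nn_integral_distr[OF \<iota>m]) (auto simp: nn_integral_point_measure_finite)
        also have "\<dots> = ennreal (\<Sum>\<omega>\<in>\<Omega>. w \<omega> * g (\<iota> \<omega>))"
          using w(1) that by (subst sum_ennreal[symmetric]) (auto simp: ennreal_mult intro!: sum.cong)
        finally show ?thesis .
      qed
      have emP: "emeasure P S = ennreal (\<Sum>\<omega>\<in>\<Omega>. w \<omega> * indicator S (\<iota> \<omega>))" for S
        using int[of "indicator S"] nn_integral_indicator[of S P] sP by (simp add: ennreal_indicator)
      have prob: "prob_space P"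
        by (rule prob_spaceI) (use emP[of UNIV] w sP in simp)
      have mP: "measure P S = (\<Sum>\<omega>\<in>\<Omega>. w \<omega> * indicator S (\<iota> \<omega>))" for S
        unfolding measure_def emP using w(1) by (intro enn2real_ennreal sum_nonneg) auto
      define F where "F k = vimage_algebra UNIV (L k) (count_space UNIV)" for k
      have sF: "sets (F k) = {L k -` A | A. True}" "space (F k) = UNIV" for k
        by (auto simp: F_def sets_vimage_algebra2)
      have FI: "S \<in> sets (F k)" if "\<And>\<psi> \<psi>'. L k \<psi> = L k \<psi>' \<Longrightarrow> \<psi> \<in> S \<Longrightarrow> \<psi>' \<in> S" for S k
      proof -
        have "S = L k -` (L k ` S)"
        proof (intro set_eqI iffI)
          fix \<psi> assume "\<psi> \<in> L k -` (L k ` S)"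
          then obtain \<psi>' where "L k \<psi> = L k \<psi>'" "\<psi>' \<in> S" by blast
          then show "\<psi> \<in> S" using that[of \<psi>' \<psi>] by simp
        qed blast
        then show ?thesis unfolding sF by blast
      qed
      have mono1: "sets (F k) \<subseteq> sets (F (Suc k))" for k
      proof
        fix S assume "S \<in> sets (F k)"
        then obtain A where A: "S = L k -` A" unfolding sF by auto
        show "S \<in> sets (F (Suc k))"
        proof (rule FI)
          fix \<psi> \<psi>' assume "L (Suc k) \<psi> = L (Suc k) \<psi>'" "\<psi> \<in> S"
          then show "\<psi>' \<in> S" using Lref[of k \<psi> \<psi>'] unfolding A by simp
        qed
      qed
      have filt: "filtration (space P) F"
        by (rule filtration.intro) (use mono1 lift_Suc_mono_le[of "\<lambda>k. sets (F k)"] in \<open>auto simp: sF(2) sP\<close>)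
      have finD: "finite (range (\<lambda>\<psi>. h \<psi> *\<^sub>R D k \<psi>))" if "finite (range h)" for h :: "_ \<Rightarrow> real" and k
      proof (rule finite_subset)
        show "range (\<lambda>\<psi>. h \<psi> *\<^sub>R D k \<psi>) \<subseteq> (\<lambda>(a, b). a *\<^sub>R b) ` (range h \<times> insert 0 (d k ` \<Omega>))"
        proof clarify
          fix \<psi>
          have "D k \<psi> \<in> insert 0 (d k ` \<Omega>)" using \<kappa> by (auto simp: D_def)
          then show "h \<psi> *\<^sub>R D k \<psi> \<in> (\<lambda>(a, b). a *\<^sub>R b) ` (range h \<times> insert 0 (d k ` \<Omega>))"
            by (intro image_eqI[of _ _ "(h \<psi>, D k \<psi>)"]) auto
        qed
        show "finite ((\<lambda>(a, b). a *\<^sub>R b) ` (range h \<times> insert 0 (d k ` \<Omega>)))"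
          using that fin by auto
      qed
      have md: "Lp_martingale_differences p P F N D"
        unfolding Lp_martingale_differences_def
      proof (intro conjI allI impI ballI filt)
        show "subalgebra P (F k)" for k by (simp add: subalgebra_def sP sF)
        fix k assume k: "k < N"
        have "simple_function (F (Suc k)) (D k)"
          unfolding simple_function_def
        proof (intro conjI ballI)
          show "finite (D k ` space (F (Suc k)))" using finD[of "\<lambda>_. 1" k] by (simp add: sF)
          show "D k -` {x} \<inter> space (F (Suc k)) \<in> sets (F (Suc k))" for x
          proof (rule FI)
            fix \<psi> \<psi>' assume "L (Suc k) \<psi> = L (Suc k) \<psi>'" "\<psi> \<in> D k -` {x} \<inter> space (F (Suc k))"
            then show "\<psi>' \<in> D k -` {x} \<inter> space (F (Suc k))" using LD[OF _ k, of \<psi> \<psi>'] by (simp add: sF(2))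
          qed
        qed
        then show "strongly_measurable (F (Suc k)) (D k)"
          unfolding strongly_measurable_def by (intro exI[of _ "\<lambda>_. D k"]) auto
        show "(\<integral>\<^sup>+\<omega>. ennreal (norm (D k \<omega>) powr p) \<partial>P) < \<infinity>"
          using int[of "\<lambda>\<psi>. norm (D k \<psi>) powr p"] by simp
        fix A assume "A \<in> sets (F k)"
        then obtain B where A: "A = L k -` B" unfolding sF by auto
        let ?f = "\<lambda>\<psi>. indicator A \<psi> *\<^sub>R D k \<psi>"
        have fr: "finite (range ?f)" by (rule finD) (auto intro: finite_subset[of _ "{0, 1}"] simp: indicator_def)
        have sf: "simple_function P ?f" using fr by (auto simp: simple_function_def sP)
        have sbi: "Bochner_Integration.simple_bochner_integrable P ?f"
        proof (rule Bochner_Integration.simple_bochner_integrable.intros[OF sf])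
          show "emeasure P {y \<in> space P. ?f y \<noteq> 0} \<noteq> \<infinity>" using emP by simp
        qed
        \<comment> \<open>The integral of a simple function is a sum over its values. Regrouping it
          by points, and then by label classes, reduces it to the hypothesis
          \<open>mean\<close>.\<close>
        have "Bochner_Integration.simple_bochner_integral P ?f = (\<Sum>y\<in>range ?f. \<Sum>\<omega>\<in>\<Omega>. (if ?f (\<iota> \<omega>) = y then w \<omega> *\<^sub>R ?f (\<iota> \<omega>) else 0))"
          unfolding Bochner_Integration.simple_bochner_integral_def sP mP
          by (intro sum.cong) (auto simp: scaleR_sum_left indicator_def intro!: sum.cong)
        also have "\<dots> = (\<Sum>\<omega>\<in>\<Omega>. \<Sum>y\<in>range ?f. (if y = ?f (\<iota> \<omega>) then w \<omega> *\<^sub>R ?f (\<iota> \<omega>) else 0))"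
          by (subst sum.swap) (intro sum.cong, auto)
        also have "\<dots> = (\<Sum>\<omega>\<in>\<Omega>. w \<omega> *\<^sub>R ?f (\<iota> \<omega>))"
          using fr by (intro sum.cong refl, subst sum.delta) auto
        also have "\<dots> = (\<Sum>\<omega>\<in>\<Omega>. (if Some (l k \<omega>) \<in> B then 1 else 0) *\<^sub>R (w \<omega> *\<^sub>R d k \<omega>))"
          by (intro sum.cong) (auto simp: A D\<iota> L\<iota> indicator_def)
        also have "\<dots> = (\<Sum>y\<in>l k ` \<Omega>. \<Sum>\<omega>\<in>{\<omega> \<in> \<Omega>. l k \<omega> = y}. (if Some (l k \<omega>) \<in> B then 1 else 0) *\<^sub>R (w \<omega> *\<^sub>R d k \<omega>))"
          by (rule sum.image_gen[OF fin])
        also have "\<dots> = (\<Sum>y\<in>l k ` \<Omega>. (if Some y \<in> B then 1 else 0) *\<^sub>R (\<Sum>\<omega>\<in>{\<omega> \<in> \<Omega>. l k \<omega> = y}. w \<omega> *\<^sub>R d k \<omega>))"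
          by (intro sum.cong) (auto simp: scaleR_sum_right intro!: sum.cong)
        also have "\<dots> = 0" using mean k by (intro sum.neutral) auto
        finally have I0: "Bochner_Integration.simple_bochner_integral P ?f = 0" .
        show "has_strong_integral P ?f 0"
          unfolding has_strong_integral_def strongly_measurable_def
          by (intro conjI exI[of _ "\<lambda>_. ?f"]) (use sf sbi I0 in auto)
      qed
      have "ennreal (\<Sum>\<omega>\<in>\<Omega>. w \<omega> * norm (\<Sum>k<N. e k *\<^sub>R D k (\<iota> \<omega>)) powr p)
         \<le> ennreal (\<beta> powr p) * ennreal (\<Sum>\<omega>\<in>\<Omega>. w \<omega> * norm (\<Sum>k<N. D k (\<iota> \<omega>)) powr p)"
        using U[THEN spec, THEN spec, THEN spec, THEN spec, THEN spec, THEN mp, OF conjI[OF prob conjI[OF md e]]]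
        by (simp add: int)
      then have "ennreal (\<Sum>\<omega>\<in>\<Omega>. w \<omega> * norm (\<Sum>k<N. e k *\<^sub>R d k \<omega>) powr p)
         \<le> ennreal (\<beta> powr p * (\<Sum>\<omega>\<in>\<Omega>. w \<omega> * norm (\<Sum>k<N. d k \<omega>) powr p))"
        by (simp add: D\<iota> ennreal_mult' cong: sum.cong)
      moreover have "0 \<le> \<beta> powr p * (\<Sum>\<omega>\<in>\<Omega>. w \<omega> * norm (\<Sum>k<N. d k \<omega>) powr p)"
        using w(1) by (intro mult_nonneg_nonneg sum_nonneg) auto
      ultimately show ?thesis by (simp add: ennreal_le_iff)
    qed
  qed
qed

text \<open>A sign pattern is encoded by the set of indices that carry the sign -1, so that averages
  over signs are sums over a power set.\<close>

abbreviation sgn_of :: "nat set \<Rightarrow> nat \<Rightarrow> real" where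
  "sgn_of R j \<equiv> (if j \<in> R then -1 else 1)"

text \<open>Toggling the membership of \<open>c\<close> is an involution of \<open>S\<close> that
  reverses the sign.\<close>

lemma sum_sgn_of_eq_0:
  assumes c: "c < N" and S: "S \<subseteq> Pow {..<N}" "\<And>R. R \<in> S \<Longrightarrow> insert c R \<in> S \<and> R - {c} \<in> S"
  shows "(\<Sum>R\<in>S. sgn_of R c) = 0"
proof -
  have "(\<Sum>R\<in>S. sgn_of R c) = (\<Sum>R\<in>S. - sgn_of R c)"
    by (rule sum.reindex_bij_witness[of _ "\<lambda>R. if c \<in> R then R - {c} else insert c R" "\<lambda>R. if c \<in> R then R - {c} else insert c R"])
       (use S(2) in auto)
  then show ?thesis by (simp add: sum_negf)
qed

text \<open>
  Bourgain's argument. On \<open>\<Omega> \<times> {-1, 1}\<^sup>N\<close> the functions \<open>r\<^sub>c E\<^sub>c f\<^sub>c\<close> are every other difference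
  of the martingale generated by \<open>\<Sum>\<^sub>c r\<^sub>c f\<^sub>c\<close>, if the atoms of \<open>\<Omega>\<close> and the signs are revealed alternately.
\<close>

lemma stein_finite:
  assumes umd: "umd_space TYPE('x::banach)" and p: "1 < p"
  shows "\<exists>K\<ge>0. \<forall>(\<Omega>::'w set) w N Q B (v :: nat \<Rightarrow> 'x).
    finite \<Omega> \<longrightarrow> (\<forall>\<omega>\<in>\<Omega>. 0 \<le> w \<omega>) \<longrightarrow> sum w \<Omega> = 1 \<longrightarrow>
    (\<forall>j<N. B j \<subseteq> Q j \<and> Q j \<subseteq> \<Omega>) \<longrightarrow> (\<forall>j<N. \<forall>i<j. Q i \<inter> Q j = {} \<or> Q j \<subseteq> Q i) \<longrightarrow>
    (\<Sum>\<omega>\<in>\<Omega>. w \<omega> * (\<Sum>R\<in>Pow {..<N}. norm (\<Sum>j<N. (sgn_of R j * (sum w (B j) / sum w (Q j) * indicator (Q j) \<omega>)) *\<^sub>R v j) powr p))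
      \<le> K * (\<Sum>\<omega>\<in>\<Omega>. w \<omega> * (\<Sum>R\<in>Pow {..<N}. norm (\<Sum>j<N. (sgn_of R j * indicator (B j) \<omega>) *\<^sub>R v j) powr p))"
proof -
  obtain \<beta> where \<beta>: "\<beta> \<ge> 0" and U: "\<forall>(\<Omega>::('w \<times> nat set) set) w (l :: nat \<Rightarrow> ('w \<times> nat set) \<Rightarrow> (('w + nat set) \<times> nat set)) N (d :: nat \<Rightarrow> ('w \<times> nat set) \<Rightarrow> 'x) (e :: nat \<Rightarrow> real).
    finite \<Omega> \<longrightarrow> (\<forall>\<omega>\<in>\<Omega>. 0 \<le> w \<omega>) \<longrightarrow> sum w \<Omega> = 1 \<longrightarrow>
    (\<forall>k. \<forall>\<omega>\<in>\<Omega>. \<forall>\<omega>'\<in>\<Omega>. l (Suc k) \<omega> = l (Suc k) \<omega>' \<longrightarrow> l k \<omega> = l k \<omega>') \<longrightarrow>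
    (\<forall>k<N. \<forall>\<omega>\<in>\<Omega>. \<forall>\<omega>'\<in>\<Omega>. l (Suc k) \<omega> = l (Suc k) \<omega>' \<longrightarrow> d k \<omega> = d k \<omega>') \<longrightarrow>
    (\<forall>k<N. \<forall>\<omega>\<in>\<Omega>. (\<Sum>\<omega>'\<in>{\<omega>'\<in>\<Omega>. l k \<omega>' = l k \<omega>}. w \<omega>' *\<^sub>R d k \<omega>') = 0) \<longrightarrow>
    (\<forall>k<N. e k \<in> {-1, 1}) \<longrightarrow>
    (\<Sum>\<omega>\<in>\<Omega>. w \<omega> * norm (\<Sum>k<N. e k *\<^sub>R d k \<omega>) powr p)
      \<le> \<beta> powr p * (\<Sum>\<omega>\<in>\<Omega>. w \<omega> * norm (\<Sum>k<N. d k \<omega>) powr p)"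
    using umd_finite[OF umd p, where 'w = "'w \<times> nat set" and 'l = "('w + nat set) \<times> nat set"]
    by (elim exE conjE) (rule that)
  show ?thesis
  proof (intro exI[of _ "(\<beta> powr p + 1) / 2"] conjI allI impI)
    show "0 \<le> (\<beta> powr p + 1) / 2" by simp
    fix \<Omega> :: "'w set" and w :: "'w \<Rightarrow> real" and N and Q B :: "nat \<Rightarrow> 'w set" and v :: "nat \<Rightarrow> 'x"
    assume fin: "finite \<Omega>" and w: "\<forall>\<omega>\<in>\<Omega>. 0 \<le> w \<omega>" "sum w \<Omega> = 1"
      and BQ: "\<forall>j<N. B j \<subseteq> Q j \<and> Q j \<subseteq> \<Omega>" and lam: "\<forall>j<N. \<forall>i<j. Q i \<inter> Q j = {} \<or> Q j \<subseteq> Q i"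
    \<comment> \<open>The label of a point at stage \<open>c\<close> is its membership in
      \<open>Q 0, ..., Q c\<close>. From stage \<open>N\<close> on the point itself is known, so
      that conditioning changes nothing.\<close>
    define ql where "ql c \<omega> = (if N \<le> c then Inl \<omega> else Inr {j. j \<le> c \<and> \<omega> \<in> Q j})" for c \<omega>
    \<comment> \<open>The conditional expectation of the indicator of \<open>B j\<close> at stage
      \<open>c\<close>; on an atom of weight zero the quotient is 0.\<close>
    define E where "E c j \<omega> = (\<Sum>\<omega>'\<in>{\<omega>'\<in>\<Omega>. ql c \<omega>' = ql c \<omega>}. w \<omega>' * indicator (B j) \<omega>') / (\<Sum>\<omega>'\<in>{\<omega>'\<in>\<Omega>. ql c \<omega>' = ql c \<omega>}. w \<omega>')" for c j \<omega>
    have ql_ref: "ql c \<omega> = ql c \<omega>'" if "ql (Suc c) \<omega> = ql (Suc c) \<omega>'" for c \<omega> \<omega>'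
    proof (cases "N \<le> Suc c")
      case True
      then show ?thesis using that by (simp add: ql_def)
    next
      case False
      then have "{j. j \<le> Suc c \<and> \<omega> \<in> Q j} = {j. j \<le> Suc c \<and> \<omega>' \<in> Q j}" using that by (simp add: ql_def)
      moreover have "{j. j \<le> c \<and> \<omega> \<in> Q j} = {j. j \<le> Suc c \<and> \<omega> \<in> Q j} \<inter> {..c}" for \<omega> by auto
      ultimately have "{j. j \<le> c \<and> \<omega> \<in> Q j} = {j. j \<le> c \<and> \<omega>' \<in> Q j}" by simp
      then show ?thesis using False by (simp add: ql_def)
    qed
    have ql_half: "ql (k div 2) \<omega> = ql (k div 2) \<omega>'" if "ql (Suc k div 2) \<omega> = ql (Suc k div 2) \<omega>'" for k \<omega> \<omega>'
    proof (cases "even k")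
      case True
      then have "Suc k div 2 = k div 2" by simp
      then show ?thesis using that by simp
    next
      case False
      then have "Suc k div 2 = Suc (k div 2)" by simp
      then have "ql (Suc (k div 2)) \<omega> = ql (Suc (k div 2)) \<omega>'" using that by (simp only:)
      then show ?thesis by (rule ql_ref)
    qed
    have E_cong: "E c j \<omega> = E c j \<omega>'" if "ql c \<omega> = ql c \<omega>'" for c j \<omega> \<omega>'
      using that by (simp add: E_def)
    have tower: "(\<Sum>\<omega>\<in>A. w \<omega> * E c j \<omega>) = (\<Sum>\<omega>\<in>A. w \<omega> * indicator (B j) \<omega>)"
      if A: "A \<subseteq> \<Omega>" "\<And>\<omega> \<omega>'. \<omega> \<in> A \<Longrightarrow> \<omega>' \<in> \<Omega> \<Longrightarrow> ql c \<omega>' = ql c \<omega> \<Longrightarrow> \<omega>' \<in> A" for A c j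
    proof -
      have fA: "finite A" by (rule finite_subset[OF A(1) fin])
      have "(\<Sum>\<omega>\<in>{\<omega>\<in>A. ql c \<omega> = y}. w \<omega> * E c j \<omega>) = (\<Sum>\<omega>\<in>{\<omega>\<in>A. ql c \<omega> = y}. w \<omega> * indicator (B j) \<omega>)"
        if y: "y \<in> ql c ` A" for y
      proof -
        obtain \<omega>0 where \<omega>0: "\<omega>0 \<in> A" "y = ql c \<omega>0" using y by auto
        let ?C = "{\<omega>\<in>\<Omega>. ql c \<omega> = ql c \<omega>0}"
        have C: "{\<omega>\<in>A. ql c \<omega> = y} = ?C" using A \<omega>0 by auto
        have fC: "finite ?C" using fin by auto
        have "(\<Sum>\<omega>\<in>?C. w \<omega> * E c j \<omega>) = (\<Sum>\<omega>\<in>?C. w \<omega> * E c j \<omega>0)"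
          by (intro sum.cong refl arg_cong2[of _ _ _ _ "(*)"] E_cong) auto
        also have "\<dots> = sum w ?C * E c j \<omega>0" by (simp add: sum_distrib_right)
        also have "\<dots> = (\<Sum>\<omega>\<in>?C. w \<omega> * indicator (B j) \<omega>)"
        proof (cases "sum w ?C = 0")
          case True
          then have "\<forall>\<omega>\<in>?C. w \<omega> = 0" using w(1) fC by (subst (asm) sum_nonneg_eq_0_iff) auto
          then show ?thesis using True by simp
        qed (simp add: E_def)
        finally show ?thesis unfolding C .
      qed
      then show ?thesis
        unfolding sum.image_gen[OF fA, of "\<lambda>\<omega>. w \<omega> * E c j \<omega>" "ql c"]
          sum.image_gen[OF fA, of "\<lambda>\<omega>. w \<omega> * indicator (B j) \<omega>" "ql c"]
        by (rule sum.cong[OF refl])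
    qed
    let ?O = "\<Omega> \<times> Pow {..<N}"
    define W where "W z = w (fst z) / 2 ^ N" for z :: "'w \<times> nat set"
    \<comment> \<open>Sign \<open>c\<close> becomes known at time \<open>2 * c + 1\<close>, the
      atoms of stage \<open>c + 1\<close> at time \<open>2 * c + 2\<close>.\<close>
    define l where "l k z = (ql (k div 2) (fst z), {j \<in> snd z. 2 * j < k})" for k and z :: "'w \<times> nat set"
    \<comment> \<open>The even differences are the terms to be estimated; the odd ones update all
      terms introduced so far from stage \<open>c\<close> to stage \<open>c + 1\<close>.\<close>
    define d where "d k z = (if even k then (sgn_of (snd z) (k div 2) * E (k div 2) (k div 2) (fst z)) *\<^sub>R v (k div 2)
       else (\<Sum>j\<le>k div 2. (sgn_of (snd z) j * (E (Suc (k div 2)) j (fst z) - E (k div 2) j (fst z))) *\<^sub>R v j))"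
       for k and z :: "'w \<times> nat set"
    \<comment> \<open>With these signs the transform and the original martingale add up to twice the
      even part.\<close>
    define e where "e k = (if even k then 1 else -1 :: real)" for k :: nat
    have fO: "finite ?O" using fin by simp
    have W0: "\<forall>z\<in>?O. 0 \<le> W z" using w by (auto simp: W_def)
    have W1: "sum W ?O = 1"
      using w(2) fin by (simp add: sum.cartesian_product' W_def card_Pow sum_divide_distrib[symmetric] sum_distrib_left[symmetric])
    have ref: "\<forall>k. \<forall>z\<in>?O. \<forall>z'\<in>?O. l (Suc k) z = l (Suc k) z' \<longrightarrow> l k z = l k z'"
    proof (intro allI ballI impI)
      fix k z z' assume "l (Suc k) z = l (Suc k) z'"
      then have 1: "ql (Suc k div 2) (fst z) = ql (Suc k div 2) (fst z')"
        and 2: "{j \<in> snd z. 2 * j < Suc k} = {j \<in> snd z'. 2 * j < Suc k}" by (auto simp: l_def)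
      have "ql (k div 2) (fst z) = ql (k div 2) (fst z')" by (rule ql_half[OF 1])
      moreover have "{j \<in> snd z. 2 * j < k} = {j \<in> snd z. 2 * j < Suc k} \<inter> {j. 2 * j < k}" for z :: "'w \<times> nat set" by auto
      then have "{j \<in> snd z. 2 * j < k} = {j \<in> snd z'. 2 * j < k}" using 2 by simp
      ultimately show "l k z = l k z'" by (simp add: l_def)
    qed
    have meas: "\<forall>k<2 * N. \<forall>z\<in>?O. \<forall>z'\<in>?O. l (Suc k) z = l (Suc k) z' \<longrightarrow> d k z = d k z'"
    proof (intro allI ballI impI)
      fix k z z' assume "l (Suc k) z = l (Suc k) z'"
      then have 1: "ql (Suc k div 2) (fst z) = ql (Suc k div 2) (fst z')"
        and 2: "{j \<in> snd z. 2 * j < Suc k} = {j \<in> snd z'. 2 * j < Suc k}" by (auto simp: l_def)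
      have s: "sgn_of (snd z) j = sgn_of (snd z') j" if "2 * j < Suc k" for j
      proof -
        have "j \<in> snd z \<longleftrightarrow> j \<in> snd z'" using that 2 by blast
        then show ?thesis by simp
      qed
      note 3 = ql_half[OF 1]
      show "d k z = d k z'"
      proof (cases "even k")
        case True
        then show ?thesis using s[of "k div 2"] E_cong[OF 3] by (simp add: d_def)
      next
        case False
        then have 4: "ql (Suc (k div 2)) (fst z) = ql (Suc (k div 2)) (fst z')" using 1 by simp
        have "(\<Sum>j\<le>k div 2. (sgn_of (snd z) j * (E (Suc (k div 2)) j (fst z) - E (k div 2) j (fst z))) *\<^sub>R v j)
          = (\<Sum>j\<le>k div 2. (sgn_of (snd z') j * (E (Suc (k div 2)) j (fst z') - E (k div 2) j (fst z'))) *\<^sub>R v j)"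
        proof (rule sum.cong[OF refl])
          fix j assume "j \<in> {..k div 2}"
          then have "2 * j < Suc k" by auto
          then show "(sgn_of (snd z) j * (E (Suc (k div 2)) j (fst z) - E (k div 2) j (fst z))) *\<^sub>R v j
            = (sgn_of (snd z') j * (E (Suc (k div 2)) j (fst z') - E (k div 2) j (fst z'))) *\<^sub>R v j"
            by (simp only: s E_cong[OF 3] E_cong[OF 4])
        qed
        then show ?thesis using False by (simp only: d_def if_False)
      qed
    qed
    have mean: "\<forall>k<2 * N. \<forall>z\<in>?O. (\<Sum>z'\<in>{z'\<in>?O. l k z' = l k z}. W z' *\<^sub>R d k z') = 0"
    proof (intro allI ballI impI)
      fix k z assume k: "k < 2 * N" and z: "z \<in> ?O"
      let ?c = "k div 2"
      let ?A = "{\<omega>\<in>\<Omega>. ql ?c \<omega> = ql ?c (fst z)}"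
      let ?S = "{R \<in> Pow {..<N}. {j \<in> R. 2 * j < k} = {j \<in> snd z. 2 * j < k}}"
      have cl: "{z'\<in>?O. l k z' = l k z} = ?A \<times> ?S" by (auto simp: l_def)
      have c: "?c < N" using k by linarith
      show "(\<Sum>z'\<in>{z'\<in>?O. l k z' = l k z}. W z' *\<^sub>R d k z') = 0"
      proof (cases "even k")
        case True
        \<comment> \<open>At an even time the sign \<open>k div 2\<close> is still hidden, so it
          averages to zero over the atom.\<close>
        have "(\<Sum>R\<in>?S. sgn_of R ?c) = 0"
        proof (rule sum_sgn_of_eq_0[OF c])
          fix R assume R: "R \<in> ?S"
          have "\<not> 2 * ?c < k" using True by simp
          then have "{j \<in> insert ?c R. 2 * j < k} = {j \<in> R. 2 * j < k}" "{j \<in> R - {?c}. 2 * j < k} = {j \<in> R. 2 * j < k}"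
            by auto
          then show "insert ?c R \<in> ?S \<and> R - {?c} \<in> ?S" using R c by auto
        qed auto
        moreover have "(\<Sum>z'\<in>?A \<times> ?S. W z' *\<^sub>R d k z')
          = (\<Sum>\<omega>\<in>?A. ((w \<omega> / 2 ^ N) * E ?c ?c \<omega> * (\<Sum>R\<in>?S. sgn_of R ?c)) *\<^sub>R v ?c)"
          unfolding sum.cartesian_product' using True
          by (intro sum.cong refl) (simp add: W_def d_def sum_distrib_left scaleR_sum_left mult_ac)
        ultimately show ?thesis unfolding cl by simp
      next
        case False
        \<comment> \<open>Conditioning at stage \<open>c + 1\<close> preserves integrals over the
          atoms of stage \<open>c\<close>, because the later partition refines the earlier
          one.\<close>
        have t1: "(\<Sum>\<omega>\<in>?A. w \<omega> * E (Suc ?c) j \<omega>) = (\<Sum>\<omega>\<in>?A. w \<omega> * indicator (B j) \<omega>)" for j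
        proof (rule tower)
          fix \<omega> \<omega>' assume o: "\<omega> \<in> ?A" "\<omega>' \<in> \<Omega>" "ql (Suc ?c) \<omega>' = ql (Suc ?c) \<omega>"
          show "\<omega>' \<in> ?A" using o(1,2) ql_ref[OF o(3)] by simp
        qed auto
        have t2: "(\<Sum>\<omega>\<in>?A. w \<omega> * E ?c j \<omega>) = (\<Sum>\<omega>\<in>?A. w \<omega> * indicator (B j) \<omega>)" for j
          by (rule tower) (auto simp del: ex_simps)
        have t: "(\<Sum>\<omega>\<in>?A. w \<omega> * (E (Suc ?c) j \<omega> - E ?c j \<omega>)) = 0" for j
          using t1[of j] t2[of j] by (simp add: right_diff_distrib sum_subtractf)
        have "(\<Sum>z'\<in>?A \<times> ?S. W z' *\<^sub>R d k z')
          = (\<Sum>\<omega>\<in>?A. \<Sum>R\<in>?S. \<Sum>j\<le>?c. (sgn_of R j / 2 ^ N * (w \<omega> * (E (Suc ?c) j \<omega> - E ?c j \<omega>))) *\<^sub>R v j)"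
          unfolding sum.cartesian_product' using False
          by (intro sum.cong refl) (simp add: W_def d_def scaleR_sum_right mult_ac)
        also have "\<dots> = (\<Sum>R\<in>?S. \<Sum>j\<le>?c. \<Sum>\<omega>\<in>?A. (sgn_of R j / 2 ^ N * (w \<omega> * (E (Suc ?c) j \<omega> - E ?c j \<omega>))) *\<^sub>R v j)"
          by (subst sum.swap, rule sum.cong, simp, rule sum.swap)
        also have "\<dots> = (\<Sum>R\<in>?S. \<Sum>j\<le>?c. (sgn_of R j / 2 ^ N * (\<Sum>\<omega>\<in>?A. w \<omega> * (E (Suc ?c) j \<omega> - E ?c j \<omega>))) *\<^sub>R v j)"
          by (simp only: sum_distrib_left scaleR_sum_left)
        also have "\<dots> = 0" by (simp only: t) simp
        finally show ?thesis unfolding cl .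
      qed
    qed
    have main: "(\<Sum>z\<in>?O. W z * norm (\<Sum>k<2 * N. e k *\<^sub>R d k z) powr p)
      \<le> \<beta> powr p * (\<Sum>z\<in>?O. W z * norm (\<Sum>k<2 * N. d k z) powr p)"
      by (rule U[THEN spec, THEN spec, THEN spec, THEN spec, THEN spec, THEN spec, THEN mp, THEN mp, THEN mp,
          THEN mp, THEN mp, THEN mp, THEN mp, OF fO W0 W1 ref meas mean]) (auto simp: e_def)
    have split2: "(\<Sum>k<2 * n. h k) = (\<Sum>c<n. h (2 * c) + h (2 * c + 1))" for h :: "nat \<Rightarrow> 'x" and n
      by (induction n) (auto simp: algebra_simps)
    \<comment> \<open>After \<open>2 * n\<close> steps the martingale is the signed sum of the first
      \<open>n\<close> functions, all of them conditioned at stage \<open>n\<close>.\<close>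
    have tele: "(\<Sum>k<2 * n. d k z) = (\<Sum>j<n. (sgn_of (snd z) j * E n j (fst z)) *\<^sub>R v j)" for n z
      unfolding split2
    proof (induction n)
      case (Suc n)
      have "d (2 * n + 1) z = (\<Sum>j\<le>n. (sgn_of (snd z) j * E (Suc n) j (fst z)) *\<^sub>R v j) - (\<Sum>j\<le>n. (sgn_of (snd z) j * E n j (fst z)) *\<^sub>R v j)"
        by (simp add: d_def sum_subtractf[symmetric] right_diff_distrib scaleR_diff_left)
      moreover have "d (2 * n) z = (sgn_of (snd z) n * E n n (fst z)) *\<^sub>R v n" by (simp add: d_def)
      ultimately show ?case using Suc.IH by (simp add: lessThan_Suc_atMost[symmetric])
    qed simp
    have EN: "w \<omega> * norm (\<Sum>j<N. (sgn_of R j * E N j \<omega>) *\<^sub>R v j) powr p = w \<omega> * norm (\<Sum>j<N. (sgn_of R j * indicator (B j) \<omega>) *\<^sub>R v j) powr p"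
      if "\<omega> \<in> \<Omega>" for \<omega> R
    proof (cases "w \<omega> = 0")
      case False
      have "{\<omega>'\<in>\<Omega>. ql N \<omega>' = ql N \<omega>} = {\<omega>}" using that by (auto simp: ql_def)
      then have "E N j \<omega> = indicator (B j) \<omega>" for j using False by (cases "\<omega> \<in> B j") (simp_all add: E_def)
      then show ?thesis by simp
    qed simp
    \<comment> \<open>Each earlier set contains \<open>Q c\<close> or misses it, so the atom of
      stage \<open>c\<close> of a point in \<open>Q c\<close> is \<open>Q c\<close> itself. Off
      \<open>Q c\<close> both sides vanish, since \<open>B c\<close> lies in
      \<open>Q c\<close>.\<close>
    have Ecc: "E c c \<omega> = sum w (B c) / sum w (Q c) * indicator (Q c) \<omega>" if "c < N" "\<omega> \<in> \<Omega>" for c \<omega>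
    proof (cases "\<omega> \<in> Q c")
      case True
      have "{\<omega>'\<in>\<Omega>. ql c \<omega>' = ql c \<omega>} = Q c"
      proof (intro set_eqI iffI)
        fix \<omega>' assume "\<omega>' \<in> {\<omega>'\<in>\<Omega>. ql c \<omega>' = ql c \<omega>}"
        then have "{j. j \<le> c \<and> \<omega>' \<in> Q j} = {j. j \<le> c \<and> \<omega> \<in> Q j}" using that by (simp add: ql_def)
        then show "\<omega>' \<in> Q c" using True by auto
      next
        fix \<omega>' assume \<omega>': "\<omega>' \<in> Q c"
        have "(\<omega>' \<in> Q j) = (\<omega> \<in> Q j)" if "j \<le> c" for j
        proof (cases "j = c")
          case False
          then have "Q j \<inter> Q c = {} \<or> Q c \<subseteq> Q j" using lam \<open>c < N\<close> that by simp
          then show ?thesis using \<omega>' True by blast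
        qed (use \<omega>' True in simp)
        then show "\<omega>' \<in> {\<omega>'\<in>\<Omega>. ql c \<omega>' = ql c \<omega>}" using \<omega>' BQ that by (auto simp: ql_def)
      qed
      moreover have "(\<Sum>\<omega>'\<in>Q c. w \<omega>' * indicator (B c) \<omega>') = sum w (B c)"
        using BQ that fin finite_subset[of "Q c" \<Omega>] by (intro sum.mono_neutral_cong_right) auto
      ultimately show ?thesis using True by (simp add: E_def)
    next
      case False
      have "\<omega>' \<notin> Q c" if "ql c \<omega>' = ql c \<omega>" for \<omega>'
        using that False \<open>c < N\<close> by (auto simp: ql_def set_eq_iff)
      then have "(\<Sum>\<omega>'\<in>{\<omega>'\<in>\<Omega>. ql c \<omega>' = ql c \<omega>}. w \<omega>' * indicator (B c) \<omega>') = 0"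
        using BQ that by (intro sum.neutral) (auto simp: indicator_def)
      then show ?thesis using False by (simp add: E_def)
    qed
    let ?X = "\<lambda>z. \<Sum>k<2 * N. e k *\<^sub>R d k z" and ?Y = "\<lambda>z. \<Sum>k<2 * N. d k z"
    \<comment> \<open>The even part is the mean of the martingale and its transform. Convexity of
      the power then yields the constant \<open>(\<beta> powr p + 1) / 2\<close>.\<close>
    have half: "norm (\<Sum>j<N. (sgn_of (snd z) j * (sum w (B j) / sum w (Q j) * indicator (Q j) (fst z))) *\<^sub>R v j) powr p
       \<le> (norm (?X z) powr p + norm (?Y z) powr p) / 2" if "z \<in> ?O" for z
    proof -
      have "?X z + ?Y z = 2 *\<^sub>R (\<Sum>c<N. d (2 * c) z)"
        unfolding split2 by (simp add: e_def sum.distrib sum_negf scaleR_2 sum_subtractf algebra_simps)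
      also have "(\<Sum>c<N. d (2 * c) z) = (\<Sum>j<N. (sgn_of (snd z) j * (sum w (B j) / sum w (Q j) * indicator (Q j) (fst z))) *\<^sub>R v j)"
        using that by (intro sum.cong) (auto simp: d_def Ecc)
      finally have "(\<Sum>j<N. (sgn_of (snd z) j * (sum w (B j) / sum w (Q j) * indicator (Q j) (fst z))) *\<^sub>R v j) = (1/2) *\<^sub>R (?X z + ?Y z)"
        (is "?Z = _") by simp
      then have "norm ?Z \<le> (1 - 1/2) * norm (?X z) + 1/2 * norm (?Y z)"
        using norm_triangle_ineq[of "?X z" "?Y z"] by simp
      then have "norm ?Z powr p \<le> ((1 - 1/2) * norm (?X z) + 1/2 * norm (?Y z)) powr p"
        using p by (intro powr_mono2) auto
      also have "\<dots> \<le> (1 - 1/2) * norm (?X z) powr p + 1/2 * norm (?Y z) powr p"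
        using p by (intro convex_powr_nonneg) auto
      finally show ?thesis by simp
    qed
    let ?L = "\<Sum>\<omega>\<in>\<Omega>. w \<omega> * (\<Sum>R\<in>Pow {..<N}. norm (\<Sum>j<N. (sgn_of R j * (sum w (B j) / sum w (Q j) * indicator (Q j) \<omega>)) *\<^sub>R v j) powr p)"
    let ?R = "\<Sum>\<omega>\<in>\<Omega>. w \<omega> * (\<Sum>R\<in>Pow {..<N}. norm (\<Sum>j<N. (sgn_of R j * indicator (B j) \<omega>) *\<^sub>R v j) powr p)"
    have Y: "(\<Sum>z\<in>?O. W z * norm (?Y z) powr p) = ?R / 2 ^ N"
      unfolding sum.cartesian_product' tele using EN
      by (auto simp: W_def sum_divide_distrib sum_distrib_left intro!: sum.cong)
    have "?L / 2 ^ N = (\<Sum>z\<in>?O. W z * norm (\<Sum>j<N. (sgn_of (snd z) j * (sum w (B j) / sum w (Q j) * indicator (Q j) (fst z))) *\<^sub>R v j) powr p)"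
      unfolding sum.cartesian_product'
      by (auto simp: W_def sum_divide_distrib sum_distrib_left intro!: sum.cong)
    also have "\<dots> \<le> (\<Sum>z\<in>?O. W z * ((norm (?X z) powr p + norm (?Y z) powr p) / 2))"
      using W0 half by (intro sum_mono mult_left_mono) auto
    also have "\<dots> = ((\<Sum>z\<in>?O. W z * norm (?X z) powr p) + (\<Sum>z\<in>?O. W z * norm (?Y z) powr p)) / 2"
      by (simp add: sum_divide_distrib sum.distrib[symmetric] algebra_simps add_divide_distrib)
    also have "\<dots> \<le> (\<beta> powr p * (?R / 2 ^ N) + ?R / 2 ^ N) / 2"
      using main unfolding Y by (intro divide_right_mono add_right_mono) simp_all
    also have "\<dots> = ((\<beta> powr p + 1) / 2 * ?R) / 2 ^ N" by (simp add: field_simps)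
    finally show "?L \<le> (\<beta> powr p + 1) / 2 * ?R"
      by (auto simp only: divide_le_cancel zero_less_power zero_less_numeral)
  qed
qed

text \<open>Both integrands depend on a point only through the pattern \<open>\<tau>\<close> of the
  sets that contain it. The finitely many patterns, weighted by the measures of their level sets and
  normalised, form the finite probability space to which the discrete inequality applies.\<close>

lemma stein_signs:
  assumes umd: "umd_space TYPE('x::banach)" and p: "1 < p"
  shows "\<exists>K\<ge>0. \<forall>(\<mu> :: 'm measure) N Q B (v :: nat \<Rightarrow> 'x).
    (\<forall>j<N. Q j \<in> sets \<mu> \<and> B j \<in> sets \<mu> \<and> B j \<subseteq> Q j \<and> emeasure \<mu> (Q j) < \<infinity>) \<longrightarrow>
    (\<forall>j<N. \<forall>i<j. Q i \<inter> Q j = {} \<or> Q j \<subseteq> Q i) \<longrightarrow>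
    (\<integral>\<^sup>+x. ennreal (\<Sum>R\<in>Pow {..<N}. norm (\<Sum>j<N. (sgn_of R j * (measure \<mu> (B j) / measure \<mu> (Q j) * indicator (Q j) x)) *\<^sub>R v j) powr p) \<partial>\<mu>)
      \<le> ennreal K * (\<integral>\<^sup>+x. ennreal (\<Sum>R\<in>Pow {..<N}. norm (\<Sum>j<N. (sgn_of R j * indicator (B j) x) *\<^sub>R v j) powr p) \<partial>\<mu>)"
proof -
  obtain K where K: "K \<ge> 0" and U: "\<forall>(\<Omega>::(nat set \<times> nat set) set) w N Q B (v :: nat \<Rightarrow> 'x).
    finite \<Omega> \<longrightarrow> (\<forall>\<omega>\<in>\<Omega>. 0 \<le> w \<omega>) \<longrightarrow> sum w \<Omega> = 1 \<longrightarrow>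
    (\<forall>j<N. B j \<subseteq> Q j \<and> Q j \<subseteq> \<Omega>) \<longrightarrow> (\<forall>j<N. \<forall>i<j. Q i \<inter> Q j = {} \<or> Q j \<subseteq> Q i) \<longrightarrow>
    (\<Sum>\<omega>\<in>\<Omega>. w \<omega> * (\<Sum>R\<in>Pow {..<N}. norm (\<Sum>j<N. (sgn_of R j * (sum w (B j) / sum w (Q j) * indicator (Q j) \<omega>)) *\<^sub>R v j) powr p))
      \<le> K * (\<Sum>\<omega>\<in>\<Omega>. w \<omega> * (\<Sum>R\<in>Pow {..<N}. norm (\<Sum>j<N. (sgn_of R j * indicator (B j) \<omega>) *\<^sub>R v j) powr p))"
    using stein_finite[OF umd p, where 'w = "nat set \<times> nat set"] by (elim exE conjE) (rule that)
  show ?thesis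
  proof (intro exI[of _ K] conjI allI impI K)
    fix \<mu> :: "'m measure" and N and Q B :: "nat \<Rightarrow> 'm set" and v :: "nat \<Rightarrow> 'x"
    assume QB: "\<forall>j<N. Q j \<in> sets \<mu> \<and> B j \<in> sets \<mu> \<and> B j \<subseteq> Q j \<and> emeasure \<mu> (Q j) < \<infinity>"
      and lam: "\<forall>j<N. \<forall>i<j. Q i \<inter> Q j = {} \<or> Q j \<subseteq> Q i"
    define U0 where "U0 = (\<Union>j<N. Q j)"
    define \<tau> where "\<tau> x = ({j\<in>{..<N}. x \<in> Q j}, {j\<in>{..<N}. x \<in> B j})" for x
    define \<Omega> where "\<Omega> = \<tau> ` U0"
    define At where "At t = {x\<in>U0. \<tau> x = t}" for t
    define m where "m = measure \<mu> U0"
    have U0s: "U0 \<in> sets \<mu>" using QB by (auto simp: U0_def)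
    have U0f: "emeasure \<mu> U0 < \<infinity>"
    proof -
      have "emeasure \<mu> U0 \<le> (\<Sum>j<N. emeasure \<mu> (Q j))"
        unfolding U0_def using QB by (intro emeasure_subadditive_finite) auto
      also have "\<dots> < \<infinity>" using QB by simp
      finally show ?thesis .
    qed
    have fin: "finite \<Omega>"
      by (rule finite_subset[of _ "Pow {..<N} \<times> Pow {..<N}"]) (auto simp: \<Omega>_def \<tau>_def)
    have Ats: "At t \<in> sets \<mu>" for t
    proof -
      \<comment> \<open>Intersecting with \<open>U0\<close> takes care of intersections over empty
        index sets.\<close>
      have "At t = (if t \<in> Pow {..<N} \<times> Pow {..<N} then
          (U0 \<inter> ((\<Inter>j\<in>fst t. U0 \<inter> Q j) \<inter> (\<Inter>j\<in>snd t. U0 \<inter> B j)) - ((\<Union>j\<in>{..<N} - fst t. Q j) \<union> (\<Union>j\<in>{..<N} - snd t. B j))) else {})"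
        by (cases t) (auto simp: At_def \<tau>_def)
      moreover have "(U0 \<inter> ((\<Inter>j\<in>fst t. U0 \<inter> Q j) \<inter> (\<Inter>j\<in>snd t. U0 \<inter> B j))) \<in> sets \<mu>" if t: "t \<in> Pow {..<N} \<times> Pow {..<N}"
      proof -
        have f: "finite (fst t)" "finite (snd t)" using t by (auto intro: finite_subset[of _ "{..<N}"])
        have "U0 \<inter> (\<Inter>j\<in>fst t. U0 \<inter> Q j) \<in> sets \<mu>"
          using f t QB U0s by (cases "fst t = {}") (auto intro!: sets.Int sets.finite_INT)
        moreover have "U0 \<inter> (\<Inter>j\<in>snd t. U0 \<inter> B j) \<in> sets \<mu>"
          using f t QB U0s by (cases "snd t = {}") (auto intro!: sets.Int sets.finite_INT)
        ultimately have "(U0 \<inter> (\<Inter>j\<in>fst t. U0 \<inter> Q j)) \<inter> (U0 \<inter> (\<Inter>j\<in>snd t. U0 \<inter> B j)) \<in> sets \<mu>" by (rule sets.Int)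
        then show ?thesis by (simp add: Int_ac)
      qed
      moreover have "(\<Union>j\<in>{..<N} - fst t. Q j) \<union> (\<Union>j\<in>{..<N} - snd t. B j) \<in> sets \<mu>"
        using QB by (intro sets.Un sets.finite_UN) auto
      ultimately show ?thesis by (auto simp: sets.Diff)
    qed
    have Atf: "emeasure \<mu> (At t) < \<infinity>" for t
      using emeasure_mono[of "At t" U0 \<mu>] U0s U0f by (auto simp: At_def)
    have int: "(\<integral>\<^sup>+x. ennreal (\<Phi> (\<tau> x)) \<partial>\<mu>) = ennreal (\<Sum>t\<in>\<Omega>. measure \<mu> (At t) * \<Phi> t)"
      if \<Phi>: "\<And>t. 0 \<le> \<Phi> t" "\<And>x. x \<notin> U0 \<Longrightarrow> \<Phi> (\<tau> x) = 0" for \<Phi>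
    proof -
      have "(\<integral>\<^sup>+x. ennreal (\<Phi> (\<tau> x)) \<partial>\<mu>) = (\<integral>\<^sup>+x. (\<Sum>t\<in>\<Omega>. ennreal (\<Phi> t) * indicator (At t) x) \<partial>\<mu>)"
      proof (rule nn_integral_cong)
        fix x
        show "ennreal (\<Phi> (\<tau> x)) = (\<Sum>t\<in>\<Omega>. ennreal (\<Phi> t) * indicator (At t) x)"
        proof (cases "x \<in> U0")
          case True
          have "(\<Sum>t\<in>\<Omega>. ennreal (\<Phi> t) * indicator (At t) x) = (\<Sum>t\<in>\<Omega>. if t = \<tau> x then ennreal (\<Phi> t) else 0)"
            using True by (intro sum.cong) (auto simp: At_def indicator_def)
          then show ?thesis using True fin by (simp add: \<Omega>_def)
        qed (use \<Phi>(2) in \<open>simp add: At_def\<close>)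
      qed
      also have "\<dots> = (\<Sum>t\<in>\<Omega>. ennreal (\<Phi> t) * emeasure \<mu> (At t))"
        using Ats by (subst nn_integral_sum) (auto simp: nn_integral_cmult_indicator)
      also have "\<dots> = ennreal (\<Sum>t\<in>\<Omega>. measure \<mu> (At t) * \<Phi> t)"
        using \<Phi>(1) Atf by (subst sum_ennreal[symmetric])
          (auto simp: emeasure_eq_ennreal_measure ennreal_mult mult.commute less_top intro!: sum.cong)
      finally show ?thesis .
    qed
    have mU: "measure \<mu> A = (\<Sum>t\<in>{t\<in>\<Omega>. S t}. measure \<mu> (At t))"
      if A: "A = {x\<in>U0. S (\<tau> x)}" for A S
    proof -
      have "A = (\<Union>t\<in>{t\<in>\<Omega>. S t}. At t)" using A by (auto simp: At_def \<Omega>_def)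
      then have "measure \<mu> A = measure \<mu> (\<Union>t\<in>{t\<in>\<Omega>. S t}. At t)" by simp
      also have "\<dots> = (\<Sum>t\<in>{t\<in>\<Omega>. S t}. measure \<mu> (At t))"
        using fin Ats Atf by (intro measure_finite_Union) (auto simp: disjoint_family_on_def At_def less_top)
      finally show ?thesis .
    qed
    let ?L = "\<lambda>x. \<Sum>R\<in>Pow {..<N}. norm (\<Sum>j<N. (sgn_of R j * (measure \<mu> (B j) / measure \<mu> (Q j) * indicator (Q j) x)) *\<^sub>R v j) powr p"
    let ?R = "\<lambda>x. \<Sum>R\<in>Pow {..<N}. norm (\<Sum>j<N. (sgn_of R j * indicator (B j) x) *\<^sub>R v j) powr p"
    define Q' where "Q' j = {t\<in>\<Omega>. j \<in> fst t}" for j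
    define B' where "B' j = {t\<in>\<Omega>. j \<in> snd t}" for j
    define \<Phi>L where "\<Phi>L t = (\<Sum>R\<in>Pow {..<N}. norm (\<Sum>j<N. (sgn_of R j * (measure \<mu> (B j) / measure \<mu> (Q j) * indicator (fst t) j)) *\<^sub>R v j) powr p)" for t :: "nat set \<times> nat set"
    define \<Phi>R where "\<Phi>R t = (\<Sum>R\<in>Pow {..<N}. norm (\<Sum>j<N. (sgn_of R j * indicator (snd t) j) *\<^sub>R v j) powr p)" for t :: "nat set \<times> nat set"
    have L\<tau>: "?L x = \<Phi>L (\<tau> x)" for x
      unfolding \<Phi>L_def by (intro sum.cong refl arg_cong[of _ _ "\<lambda>z. norm z powr p"]) (auto simp: \<tau>_def indicator_def)
    have R\<tau>: "?R x = \<Phi>R (\<tau> x)" for x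
      unfolding \<Phi>R_def by (intro sum.cong refl arg_cong[of _ _ "\<lambda>z. norm z powr p"]) (auto simp: \<tau>_def indicator_def)
    have out: "\<Phi>L (\<tau> x) = 0 \<and> \<Phi>R (\<tau> x) = 0" if "x \<notin> U0" for x
    proof -
      have "x \<notin> Q j" "x \<notin> B j" if "j < N" for j using QB that \<open>x \<notin> U0\<close> by (auto simp: U0_def)
      then have "\<tau> x = ({}, {})" by (auto simp: \<tau>_def)
      then show ?thesis by (simp add: \<Phi>L_def \<Phi>R_def)
    qed
    have iL: "(\<integral>\<^sup>+x. ennreal (?L x) \<partial>\<mu>) = ennreal (\<Sum>t\<in>\<Omega>. measure \<mu> (At t) * \<Phi>L t)"
      unfolding L\<tau> using out by (intro int) (auto simp: \<Phi>L_def intro!: sum_nonneg)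
    have iR: "(\<integral>\<^sup>+x. ennreal (?R x) \<partial>\<mu>) = ennreal (\<Sum>t\<in>\<Omega>. measure \<mu> (At t) * \<Phi>R t)"
      unfolding R\<tau> using out by (intro int) (auto simp: \<Phi>R_def intro!: sum_nonneg)
    have m: "m = (\<Sum>t\<in>\<Omega>. measure \<mu> (At t))" using mU[of U0 "\<lambda>_. True"] by (simp add: m_def)
    have "(\<Sum>t\<in>\<Omega>. measure \<mu> (At t) * \<Phi>L t) \<le> K * (\<Sum>t\<in>\<Omega>. measure \<mu> (At t) * \<Phi>R t)"
    proof (cases "m = 0")
      case True
      then have "measure \<mu> (At t) = 0" if "t \<in> \<Omega>" for t
        using m fin that by (auto simp: sum_nonneg_eq_0_iff)
      then show ?thesis by simp
    next
      case False
      then have m0: "m > 0" by (simp add: m_def zero_less_measure_iff)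
      define w where "w t = measure \<mu> (At t) / m" for t
      have w: "\<forall>t\<in>\<Omega>. 0 \<le> w t" "sum w \<Omega> = 1"
        using m0 by (auto simp: w_def sum_divide_distrib[symmetric] m[symmetric])
      have sw: "sum w (Q' j) = measure \<mu> (Q j) / m" "sum w (B' j) = measure \<mu> (B j) / m" if "j < N" for j
      proof -
        have "measure \<mu> (Q j) = (\<Sum>t\<in>Q' j. measure \<mu> (At t))"
          unfolding Q'_def using that QB by (intro mU) (auto simp: \<tau>_def U0_def)
        then show "sum w (Q' j) = measure \<mu> (Q j) / m" by (simp add: w_def sum_divide_distrib)
        have "measure \<mu> (B j) = (\<Sum>t\<in>B' j. measure \<mu> (At t))"
          unfolding B'_def using that QB by (intro mU) (auto simp: \<tau>_def U0_def)
        then show "sum w (B' j) = measure \<mu> (B j) / m" by (simp add: w_def sum_divide_distrib)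
      qed
      have ratio: "sum w (B' j) / sum w (Q' j) = measure \<mu> (B j) / measure \<mu> (Q j)" if "j < N" for j
        using sw[OF that] m0 by simp
      have indQ: "indicator (Q' j) t = (indicator (fst t) j :: real)" if "t \<in> \<Omega>" for t j
        using that by (simp add: Q'_def indicator_def)
      have sub: "\<forall>j<N. B' j \<subseteq> Q' j \<and> Q' j \<subseteq> \<Omega>"
        using QB by (fastforce simp: B'_def Q'_def \<Omega>_def \<tau>_def)
      have lam': "\<forall>j<N. \<forall>i<j. Q' i \<inter> Q' j = {} \<or> Q' j \<subseteq> Q' i"
      proof (intro allI impI)
        fix i j assume ij: "j < N" "i < j"
        show "Q' i \<inter> Q' j = {} \<or> Q' j \<subseteq> Q' i"
        proof (cases "Q i \<inter> Q j = {}")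
          case True
          then show ?thesis by (auto simp: Q'_def \<Omega>_def \<tau>_def)
        next
          case False
          then have "Q j \<subseteq> Q i" using lam ij by blast
          then show ?thesis using ij by (auto simp: Q'_def \<Omega>_def \<tau>_def)
        qed
      qed
      have "(\<Sum>t\<in>\<Omega>. w t * \<Phi>L t) = (\<Sum>t\<in>\<Omega>. w t * (\<Sum>R\<in>Pow {..<N}. norm (\<Sum>j<N. (sgn_of R j * (sum w (B' j) / sum w (Q' j) * indicator (Q' j) t)) *\<^sub>R v j) powr p))"
        unfolding \<Phi>L_def
        by (intro sum.cong refl arg_cong2[of _ _ _ _ "(*)"] arg_cong[of _ _ "\<lambda>z. norm z powr p"])
           (simp add: ratio indQ)
      also have "\<dots> \<le> K * (\<Sum>t\<in>\<Omega>. w t * (\<Sum>R\<in>Pow {..<N}. norm (\<Sum>j<N. (sgn_of R j * indicator (B' j) t) *\<^sub>R v j) powr p))"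
        by (rule U[THEN spec, THEN spec, THEN spec, THEN spec, THEN spec, THEN spec, THEN mp, THEN mp, THEN mp, THEN mp, THEN mp, OF fin w sub lam'])
      also have "(\<Sum>t\<in>\<Omega>. w t * (\<Sum>R\<in>Pow {..<N}. norm (\<Sum>j<N. (sgn_of R j * indicator (B' j) t) *\<^sub>R v j) powr p)) = (\<Sum>t\<in>\<Omega>. w t * \<Phi>R t)"
        unfolding \<Phi>R_def
        by (intro sum.cong refl arg_cong2[of _ _ _ _ "(*)"] arg_cong[of _ _ "\<lambda>z. norm z powr p"])
           (auto simp: B'_def indicator_def)
      also have "(\<Sum>t\<in>\<Omega>. w t * \<Phi>R t) = (\<Sum>t\<in>\<Omega>. measure \<mu> (At t) * \<Phi>R t) / m"
        by (simp add: w_def sum_divide_distrib)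
      also have "(\<Sum>t\<in>\<Omega>. w t * \<Phi>L t) = (\<Sum>t\<in>\<Omega>. measure \<mu> (At t) * \<Phi>L t) / m"
        by (simp add: w_def sum_divide_distrib)
      finally have "(\<Sum>t\<in>\<Omega>. measure \<mu> (At t) * \<Phi>L t) / m \<le> (K * (\<Sum>t\<in>\<Omega>. measure \<mu> (At t) * \<Phi>R t)) / m"
        by (simp only: times_divide_eq_right)
      then show ?thesis using m0 by (auto simp only: divide_le_cancel)
    qed
    then show "(\<integral>\<^sup>+x. ennreal (?L x) \<partial>\<mu>) \<le> ennreal K * (\<integral>\<^sup>+x. ennreal (?R x) \<partial>\<mu>)"
      unfolding iL iR using K by (subst ennreal_mult'[symmetric]) (auto intro: ennreal_leI)
  qed
qed

lemma gauss_expect_reindex: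
  assumes "finite I" "inj_on h I" "F \<in> borel_measurable borel"
  shows "gauss_expect (h ` I) x F = gauss_expect I (\<lambda>k. x (h k)) F"
  using assms
proof (induction I arbitrary: F)
  case (insert i I)
  have "gauss_expect (h ` insert i I) x F = (\<integral>\<^sup>+t. gauss_expect (h ` I) x (\<lambda>z. F (t *\<^sub>R x (h i) + z)) \<partial>gauss)"
    using insert by (simp add: gauss_expect_insert)
  also have "\<dots> = (\<integral>\<^sup>+t. gauss_expect I (\<lambda>k. x (h k)) (\<lambda>z. F (t *\<^sub>R x (h i) + z)) \<partial>gauss)"
    using insert by (intro nn_integral_cong insert.IH translate_borel) auto
  also have "\<dots> = gauss_expect (insert i I) (\<lambda>k. x (h k)) F"
    using insert by (simp add: gauss_expect_insert)
  finally show ?case .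
qed simp

text \<open>For fixed Gaussian values the sign version is applied to the vectors multiplied by these
  values. After integration every sign pattern contributes equally, by symmetry of the Gaussians,
  and the number \<open>2 ^ N\<close> of patterns cancels.\<close>

lemma stein_gauss:
  assumes umd: "umd_space TYPE('x::banach)" and p: "1 < p"
  shows "\<exists>K\<ge>0. \<forall>(\<mu> :: 'm measure) N Q B (v :: nat \<Rightarrow> 'x).
    sigma_finite_measure \<mu> \<longrightarrow>
    (\<forall>j<N. Q j \<in> sets \<mu> \<and> B j \<in> sets \<mu> \<and> B j \<subseteq> Q j \<and> emeasure \<mu> (Q j) < \<infinity>) \<longrightarrow>
    (\<forall>j<N. \<forall>i<j. Q i \<inter> Q j = {} \<or> Q j \<subseteq> Q i) \<longrightarrow>
    (\<integral>\<^sup>+x. gauss_expect {..<N} (\<lambda>j. (measure \<mu> (B j) / measure \<mu> (Q j) * indicator (Q j) x) *\<^sub>R v j) (\<lambda>z. ennreal (norm z powr p)) \<partial>\<mu>)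
      \<le> ennreal K * (\<integral>\<^sup>+x. gauss_expect {..<N} (\<lambda>j. indicator (B j) x *\<^sub>R v j) (\<lambda>z. ennreal (norm z powr p)) \<partial>\<mu>)"
proof -
  obtain K where K: "K \<ge> 0" and U: "\<forall>(\<mu> :: 'm measure) N Q B (v :: nat \<Rightarrow> 'x).
    (\<forall>j<N. Q j \<in> sets \<mu> \<and> B j \<in> sets \<mu> \<and> B j \<subseteq> Q j \<and> emeasure \<mu> (Q j) < \<infinity>) \<longrightarrow>
    (\<forall>j<N. \<forall>i<j. Q i \<inter> Q j = {} \<or> Q j \<subseteq> Q i) \<longrightarrow>
    (\<integral>\<^sup>+x. ennreal (\<Sum>R\<in>Pow {..<N}. norm (\<Sum>j<N. (sgn_of R j * (measure \<mu> (B j) / measure \<mu> (Q j) * indicator (Q j) x)) *\<^sub>R v j) powr p) \<partial>\<mu>)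
      \<le> ennreal K * (\<integral>\<^sup>+x. ennreal (\<Sum>R\<in>Pow {..<N}. norm (\<Sum>j<N. (sgn_of R j * indicator (B j) x) *\<^sub>R v j) powr p) \<partial>\<mu>)"
    using stein_signs[OF umd p] by (elim exE conjE) (rule that)
  show ?thesis
  proof (intro exI[of _ K] conjI allI impI K)
    fix \<mu> :: "'m measure" and N and Q B :: "nat \<Rightarrow> 'm set" and v :: "nat \<Rightarrow> 'x"
    assume sf: "sigma_finite_measure \<mu>"
      and QB: "\<forall>j<N. Q j \<in> sets \<mu> \<and> B j \<in> sets \<mu> \<and> B j \<subseteq> Q j \<and> emeasure \<mu> (Q j) < \<infinity>"
      and lam: "\<forall>j<N. \<forall>i<j. Q i \<inter> Q j = {} \<or> Q j \<subseteq> Q i"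
    let ?G = "\<Pi>\<^sub>M k\<in>{..<N}. gauss"
    interpret \<mu>: sigma_finite_measure \<mu> by (rule sf)
    interpret G: sigma_finite_measure ?G by (rule gauss_prod.sigma_finite) simp
    interpret pair_sigma_finite ?G \<mu> ..
    have pm: "(\<lambda>z::'x. ennreal (norm z powr p)) \<in> borel_measurable borel"
      using p by (intro cvx_cont_borel cvx_cont_norm_powr) simp
    let ?H = "\<lambda>c x g. ennreal (\<Sum>R\<in>Pow {..<N}. norm (\<Sum>j<N. (sgn_of R j * c j x) *\<^sub>R (g j *\<^sub>R v j)) powr p)"
    \<comment> \<open>Exchanging the two integrals is where sigma-finiteness of the base measure
      enters.\<close>
    have avg: "2 ^ N * (\<integral>\<^sup>+x. gauss_expect {..<N} (\<lambda>j. c j x *\<^sub>R v j) (\<lambda>z. ennreal (norm z powr p)) \<partial>\<mu>)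
       = (\<integral>\<^sup>+g. \<integral>\<^sup>+x. ?H c x g \<partial>\<mu> \<partial>?G)" (is "_ * ?I = ?J")
      and avg_meas: "(\<lambda>g. \<integral>\<^sup>+x. ?H c x g \<partial>\<mu>) \<in> borel_measurable ?G"
      if c: "\<And>j. j < N \<Longrightarrow> c j \<in> borel_measurable \<mu>" for c
    proof -
      have tmeas: "(\<lambda>y. ennreal (norm (\<Sum>j<N. (sgn_of R j * c j (snd y)) *\<^sub>R (fst y j *\<^sub>R v j)) powr p)) \<in> borel_measurable (?G \<Otimes>\<^sub>M \<mu>)" for R
      proof -
        have "(\<lambda>y. \<Sum>j<N. (sgn_of R j * c j (snd y) * fst y j) *\<^sub>R v j) \<in> borel_measurable (?G \<Otimes>\<^sub>M \<mu>)"
        proof (rule borel_measurable_sum_scaleR)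
          fix j assume j: "j \<in> {..<N}"
          have [measurable]: "c j \<in> borel_measurable \<mu>" using c j by simp
          have [measurable]: "(\<lambda>g. g j) \<in> borel_measurable ?G" using j by measurable
          show "(\<lambda>y. sgn_of R j * c j (snd y) * fst y j) \<in> borel_measurable (?G \<Otimes>\<^sub>M \<mu>)" by measurable
        qed simp
        from measurable_compose[OF this pm] show ?thesis by simp
      qed
      have hsum: "?H c x g = (\<Sum>R\<in>Pow {..<N}. ennreal (norm (\<Sum>j<N. (sgn_of R j * c j x) *\<^sub>R (g j *\<^sub>R v j)) powr p))" for x g
        by (simp add: sum_ennreal)
      have Hm: "(\<lambda>(g, x). ?H c x g) \<in> borel_measurable (?G \<Otimes>\<^sub>M \<mu>)"
        unfolding hsum case_prod_unfold by (intro borel_measurable_sum tmeas)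
      have "(\<integral>\<^sup>+g. ?H c x g \<partial>?G) = 2 ^ N * gauss_expect {..<N} (\<lambda>j. c j x *\<^sub>R v j) (\<lambda>z. ennreal (norm z powr p))" for x
      proof -
        have "(\<integral>\<^sup>+g. ?H c x g \<partial>?G) = (\<Sum>R\<in>Pow {..<N}. \<integral>\<^sup>+g. ennreal (norm (\<Sum>j<N. (sgn_of R j * c j x) *\<^sub>R (g j *\<^sub>R v j)) powr p) \<partial>?G)"
        proof -
          have "(\<lambda>g. ennreal (norm (\<Sum>j<N. (sgn_of R j * c j x) *\<^sub>R (g j *\<^sub>R v j)) powr p)) \<in> borel_measurable ?G" for R
            using measurable_compose[OF gauss_sum_measurable[of "{..<N}" "\<lambda>j. (sgn_of R j * c j x) *\<^sub>R v j"] pm]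
            by (simp add: mult.commute)
          then show ?thesis unfolding hsum by (intro nn_integral_sum)
        qed
        also have "\<dots> = (\<Sum>R\<in>Pow {..<N}. gauss_expect {..<N} (\<lambda>k. if k \<in> R then - (c k x *\<^sub>R v k) else c k x *\<^sub>R v k) (\<lambda>z. ennreal (norm z powr p)))"
          unfolding gauss_expect_def
          by (intro sum.cong nn_integral_cong refl arg_cong[of _ _ "\<lambda>z. ennreal (norm z powr p)"]) (auto simp: mult.commute)
        also have "\<dots> = (\<Sum>R\<in>Pow {..<N}. gauss_expect {..<N} (\<lambda>k. c k x *\<^sub>R v k) (\<lambda>z. ennreal (norm z powr p)))"
          by (intro sum.cong refl gauss_expect_signs pm) simp
        also have "\<dots> = 2 ^ N * gauss_expect {..<N} (\<lambda>j. c j x *\<^sub>R v j) (\<lambda>z. ennreal (norm z powr p))"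
          by (simp add: card_Pow)
        finally show ?thesis .
      qed
      moreover have "(\<lambda>x. gauss_expect {..<N} (\<lambda>j. c j x *\<^sub>R v j) (\<lambda>z. ennreal (norm z powr p))) \<in> borel_measurable \<mu>"
      proof -
        have "(\<lambda>y. ennreal (norm (\<Sum>j<N. c j (fst y) *\<^sub>R (snd y j *\<^sub>R v j)) powr p)) \<in> borel_measurable (\<mu> \<Otimes>\<^sub>M ?G)"
        proof -
          have "(\<lambda>y. \<Sum>j<N. (c j (fst y) * snd y j) *\<^sub>R v j) \<in> borel_measurable (\<mu> \<Otimes>\<^sub>M ?G)"
          proof (rule borel_measurable_sum_scaleR)
            fix j assume j: "j \<in> {..<N}"
            have [measurable]: "c j \<in> borel_measurable \<mu>" using c j by simp
            have [measurable]: "(\<lambda>g. g j) \<in> borel_measurable ?G" using j by measurable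
            show "(\<lambda>y. c j (fst y) * snd y j) \<in> borel_measurable (\<mu> \<Otimes>\<^sub>M ?G)" by measurable
          qed simp
          from measurable_compose[OF this pm] show ?thesis by simp
        qed
        then show ?thesis unfolding gauss_expect_def
          by (intro G.borel_measurable_nn_integral) (simp add: case_prod_unfold mult.commute)
      qed
      ultimately have "2 ^ N * ?I = (\<integral>\<^sup>+x. \<integral>\<^sup>+g. ?H c x g \<partial>?G \<partial>\<mu>)" by (simp add: nn_integral_cmult)
      also have "\<dots> = (\<integral>\<^sup>+g. \<integral>\<^sup>+x. ?H c x g \<partial>\<mu> \<partial>?G)" by (rule Fubini'[OF Hm])
      finally show "2 ^ N * ?I = ?J" .
      show "(\<lambda>g. \<integral>\<^sup>+x. ?H c x g \<partial>\<mu>) \<in> borel_measurable ?G"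
        by (rule \<mu>.borel_measurable_nn_integral[OF Hm])
    qed
    let ?a = "\<lambda>j x. measure \<mu> (B j) / measure \<mu> (Q j) * indicator (Q j) x"
    have a: "?a j \<in> borel_measurable \<mu>" "indicat_real (B j) \<in> borel_measurable \<mu>" if "j < N" for j
      using QB that by auto
    have "2 ^ N * (\<integral>\<^sup>+x. gauss_expect {..<N} (\<lambda>j. ?a j x *\<^sub>R v j) (\<lambda>z. ennreal (norm z powr p)) \<partial>\<mu>)
      = (\<integral>\<^sup>+g. \<integral>\<^sup>+x. ?H ?a x g \<partial>\<mu> \<partial>?G)"
      by (rule avg[OF a(1)])
    also have "\<dots> \<le> (\<integral>\<^sup>+g. ennreal K * (\<integral>\<^sup>+x. ?H (\<lambda>j. indicator (B j)) x g \<partial>\<mu>) \<partial>?G)"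
      by (intro nn_integral_mono U[THEN spec, THEN spec, THEN spec, THEN spec, THEN spec, THEN mp, THEN mp, OF QB lam])
    also have "\<dots> = ennreal K * (\<integral>\<^sup>+g. (\<integral>\<^sup>+x. ?H (\<lambda>j. indicator (B j)) x g \<partial>\<mu>) \<partial>?G)"
      by (rule nn_integral_cmult[OF avg_meas[OF a(2)]])
    also have "(\<integral>\<^sup>+g. (\<integral>\<^sup>+x. ?H (\<lambda>j. indicator (B j)) x g \<partial>\<mu>) \<partial>?G)
       = 2 ^ N * (\<integral>\<^sup>+x. gauss_expect {..<N} (\<lambda>j. indicator (B j) x *\<^sub>R v j) (\<lambda>z. ennreal (norm z powr p)) \<partial>\<mu>)"
      by (rule avg[OF a(2), symmetric])
    finally have "2 ^ N * (\<integral>\<^sup>+x. gauss_expect {..<N} (\<lambda>j. ?a j x *\<^sub>R v j) (\<lambda>z. ennreal (norm z powr p)) \<partial>\<mu>)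
      \<le> 2 ^ N * (ennreal K * (\<integral>\<^sup>+x. gauss_expect {..<N} (\<lambda>j. indicator (B j) x *\<^sub>R v j) (\<lambda>z. ennreal (norm z powr p)) \<partial>\<mu>))"
      by (simp add: mult_ac)
    then show "(\<integral>\<^sup>+x. gauss_expect {..<N} (\<lambda>j. ?a j x *\<^sub>R v j) (\<lambda>z. ennreal (norm z powr p)) \<partial>\<mu>)
      \<le> ennreal K * (\<integral>\<^sup>+x. gauss_expect {..<N} (\<lambda>j. indicator (B j) x *\<^sub>R v j) (\<lambda>z. ennreal (norm z powr p)) \<partial>\<mu>)"
      by (subst (asm) ennreal_mult_le_mult_iff) (auto simp: power_eq_top_ennreal)
  qed
qed

section \<open>Geometry of doubling spaces\<close>

text \<open>\<open>n\<close> stands for an admissible exponent with its constant \<open>C\<close>,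
  and not for the infimum of the exponents, which need not be attained.\<close>

locale doubling =
  fixes \<mu> :: "'m::metric_space measure" and n C :: real
  assumes sets_eq: "sets \<mu> = sets borel"
    and ball_pos: "0 < r \<Longrightarrow> 0 < emeasure \<mu> (ball x r)"
    and ball_fin: "emeasure \<mu> (ball x r) < \<infinity>"
    and n_pos: "0 < n" and C_ge: "1 \<le> C"
    and doubling: "0 < r \<Longrightarrow> 1 \<le> a \<Longrightarrow> measure \<mu> (ball x (a * r)) \<le> C * a powr n * measure \<mu> (ball x r)"
begin

lemma open_sets [intro]: "open S \<Longrightarrow> S \<in> sets \<mu>"
  by (simp add: sets_eq)

lemma space_UNIV [simp]: "space \<mu> = UNIV"
  using sets_eq_imp_space_eq[OF sets_eq] by simp

lemma emeasure_ball: "emeasure \<mu> (ball x r) = ennreal (measure \<mu> (ball x r))"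
  using ball_fin by (simp add: emeasure_eq_ennreal_measure less_top)

lemma measure_ball_pos: "0 < r \<Longrightarrow> 0 < measure \<mu> (ball x r)"
  using ball_pos[of r x] emeasure_ball[of x r] by simp

lemma fmeasurable_bounded_open: "open S \<Longrightarrow> S \<subseteq> ball x r \<Longrightarrow> S \<in> fmeasurable \<mu>"
  using emeasure_mono[of S "ball x r" \<mu>] ball_fin[of x r] by (auto intro!: fmeasurableI simp: open_sets)

lemma measure_ball_mono:
  assumes "S \<subseteq> ball y r" "S \<in> sets \<mu>"
  shows "measure \<mu> S \<le> measure \<mu> (ball y r)"
proof (rule measure_mono_fmeasurable)
  show "ball y r \<in> fmeasurable \<mu>" by (rule fmeasurable_bounded_open) auto
qed (use assms in auto)

lemma measure_ball_le:
  assumes "0 < s" "1 \<le> a" "ball x r \<subseteq> ball y (a * s)"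
  shows "measure \<mu> (ball x r) \<le> C * a powr n * measure \<mu> (ball y s)"
  using order_trans[OF measure_ball_mono[OF assms(3) open_sets[OF open_ball]] doubling[OF assms(1,2)]] .

lemma sigma_finite: "sigma_finite_measure \<mu>"
proof
  have "z \<in> (\<Union>i::nat. ball x (real i))" for x z :: 'm
    using reals_Archimedean2[of "dist x z"] by auto
  then have "(\<Union>i::nat. ball x (real i)) = UNIV" for x :: 'm by blast
  then show "\<exists>A. countable A \<and> A \<subseteq> sets \<mu> \<and> \<Union>A = space \<mu> \<and> (\<forall>a\<in>A. emeasure \<mu> a \<noteq> \<infinity>)"
    using ball_fin by (intro exI[of _ "range (\<lambda>i::nat. ball undefined (real i))"]) (auto simp: less_top[symmetric])
qed

definition packing :: "real \<Rightarrow> nat" where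
  "packing R = nat \<lceil>C * (4 * R + 4) powr n\<rceil>"

text \<open>Volume comparison: the balls of radius \<open>\<rho> / 2\<close> about the points are
  disjoint and lie in the ball of radius \<open>(R + 1) * \<rho>\<close> about \<open>v\<close>,
  whose measure is at most \<open>C * (4 * R + 4) powr n\<close> times that of each small
  ball.\<close>

lemma card_separated_le:
  fixes Z :: "'m set"
  assumes Z: "finite Z" "\<And>w w'. w \<in> Z \<Longrightarrow> w' \<in> Z \<Longrightarrow> w \<noteq> w' \<Longrightarrow> \<rho> \<le> dist w w'" and \<rho>: "0 < \<rho>" and R: "1 \<le> R"
  shows "card {w \<in> Z. dist v w < R * \<rho>} \<le> packing R"
proof -
  let ?W = "{w \<in> Z. dist v w < R * \<rho>}"
  let ?M = "measure \<mu> (ball v ((R + 1) * \<rho>))"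
  have fW: "finite ?W" using Z by simp
  have disj: "disjoint_family_on (\<lambda>w. ball w (\<rho> / 2)) ?W"
    unfolding disjoint_family_on_def
  proof (intro ballI impI)
    fix w w' assume w: "w \<in> ?W" "w' \<in> ?W" "w \<noteq> w'"
    show "ball w (\<rho> / 2) \<inter> ball w' (\<rho> / 2) = {}"
    proof (rule equals0I)
      fix z assume "z \<in> ball w (\<rho> / 2) \<inter> ball w' (\<rho> / 2)"
      then have "dist w w' < \<rho>"
        using dist_triangle[of w w' z] by (simp add: dist_commute)
      then show False using Z(2)[of w w'] w by simp
    qed
  qed
  have "(\<Sum>w\<in>?W. ?M) \<le> (\<Sum>w\<in>?W. C * (4 * R + 4) powr n * measure \<mu> (ball w (\<rho> / 2)))"
  proof (rule sum_mono)
    fix w assume w: "w \<in> ?W"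
    show "?M \<le> C * (4 * R + 4) powr n * measure \<mu> (ball w (\<rho> / 2))"
    proof (rule measure_ball_le)
      show "ball v ((R + 1) * \<rho>) \<subseteq> ball w ((4 * R + 4) * (\<rho> / 2))"
      proof
        fix z assume "z \<in> ball v ((R + 1) * \<rho>)"
        then show "z \<in> ball w ((4 * R + 4) * (\<rho> / 2))" using w dist_triangle[of w z v] \<rho> by (simp add: dist_commute algebra_simps)
      qed
    qed (use \<rho> R in auto)
  qed
  also have "\<dots> = C * (4 * R + 4) powr n * measure \<mu> (\<Union>w\<in>?W. ball w (\<rho> / 2))"
    using fW disj ball_fin by (subst measure_finite_Union) (auto simp: sum_distrib_left less_top[symmetric])
  also have "\<dots> \<le> C * (4 * R + 4) powr n * ?M"
  proof -
    have "(\<Union>w\<in>?W. ball w (\<rho> / 2)) \<subseteq> ball v ((R + 1) * \<rho>)"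
    proof
      fix z assume "z \<in> (\<Union>w\<in>?W. ball w (\<rho> / 2))"
      then obtain w where "dist v w < R * \<rho>" "dist w z < \<rho> / 2" by auto
      then show "z \<in> ball v ((R + 1) * \<rho>)" using dist_triangle[of v z w] \<rho> by (simp add: algebra_simps)
    qed
    then show ?thesis using C_ge R by (intro mult_left_mono measure_ball_mono open_sets) auto
  qed
  finally have "real (card ?W) * ?M \<le> C * (4 * R + 4) powr n * ?M" by simp
  then have "real (card ?W) \<le> C * (4 * R + 4) powr n" using measure_ball_pos[of "(R + 1) * \<rho>" v] \<rho> R by simp
  then show ?thesis unfolding packing_def by linarith
qed

end

section \<open>Nets, colourings and laminar families\<close>

lemma finite_net:
  fixes Y :: "'a::metric_space set"
  assumes "finite Y" "0 < \<rho>"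
  shows "\<exists>Z\<subseteq>Y. (\<forall>w\<in>Z. \<forall>w'\<in>Z. w \<noteq> w' \<longrightarrow> \<rho> \<le> dist w w') \<and> (\<forall>y\<in>Y. \<exists>z\<in>Z. dist y z < \<rho>)"
  using assms(1)
proof (induction Y)
  case (insert y Y)
  then obtain Z where Z: "Z \<subseteq> Y" "\<forall>w\<in>Z. \<forall>w'\<in>Z. w \<noteq> w' \<longrightarrow> \<rho> \<le> dist w w'" "\<forall>y\<in>Y. \<exists>z\<in>Z. dist y z < \<rho>" by blast
  show ?case
  proof (cases "\<exists>z\<in>Z. dist y z < \<rho>")
    case True
    then show ?thesis using Z by (intro exI[of _ Z]) auto
  next
    case False
    then have "\<rho> \<le> dist y z" "\<rho> \<le> dist z y" if "z \<in> Z" for z using that by (force simp: dist_commute)+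
    then show ?thesis using Z assms(2) by (intro exI[of _ "insert y Z"]) auto
  qed
qed simp

text \<open>There are \<open>K + 1\<close> colours, and the neighbours of a new vertex occupy at
  most \<open>K\<close> of them.\<close>

lemma greedy_colouring:
  assumes "finite V" "\<And>v w. adj v w \<longleftrightarrow> adj w v" "\<And>v. v \<in> V \<Longrightarrow> card {w \<in> V. adj v w} \<le> K"
  shows "\<exists>col::'a \<Rightarrow> nat. (\<forall>v\<in>V. col v \<le> K) \<and> (\<forall>v\<in>V. \<forall>w\<in>V. v \<noteq> w \<and> adj v w \<longrightarrow> col v \<noteq> col w)"
  using assms(1,3)
proof (induction V)
  case (insert v V)
  have "card {w \<in> V. adj u w} \<le> K" if "u \<in> V" for u
    by (rule order_trans[OF card_mono insert.prems[of u]]) (use insert that in auto)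
  then have "\<exists>col::'a \<Rightarrow> nat. (\<forall>v\<in>V. col v \<le> K) \<and> (\<forall>v\<in>V. \<forall>w\<in>V. v \<noteq> w \<and> adj v w \<longrightarrow> col v \<noteq> col w)"
    by (rule insert.IH)
  then obtain col :: "'a \<Rightarrow> nat" where col: "\<forall>v\<in>V. col v \<le> K" "\<forall>v\<in>V. \<forall>w\<in>V. v \<noteq> w \<and> adj v w \<longrightarrow> col v \<noteq> col w"
    by (elim exE conjE) (rule that)
  have "card (col ` {w \<in> V. adj v w}) \<le> K"
  proof -
    have "card (col ` {w \<in> V. adj v w}) \<le> card {w \<in> V. adj v w}" using insert by (intro card_image_le) auto
    also have "\<dots> \<le> card {w \<in> insert v V. adj v w}" using insert by (intro card_mono) auto
    also have "\<dots> \<le> K" by (rule insert.prems) simp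
    finally show ?thesis .
  qed
  then have "\<not> {..K} \<subseteq> col ` {w \<in> V. adj v w}"
    using card_mono[of "col ` {w \<in> V. adj v w}" "{..K}"] insert by fastforce
  then obtain c where c: "c \<le> K" "c \<notin> col ` {w \<in> V. adj v w}" by auto
  show ?case
  proof (intro exI[of _ "col(v := c)"] conjI ballI impI)
    fix u w assume uw: "u \<in> insert v V" "w \<in> insert v V" "u \<noteq> w \<and> adj u w"
    then show "(col(v := c)) u \<noteq> (col(v := c)) w"
      using c col assms(2)[of v u] assms(2)[of v w] insert.hyps by (cases "u = v"; cases "w = v") auto
  qed (use c col in auto)
qed simp

text \<open>
  A substitute for dyadic cubes: every ball of the family is enlarged by the smaller sets that it meets.
\<close>

lemma laminar_family:
  fixes \<B> :: "('a::metric_space \<times> real) set"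
  assumes "finite \<B>" "\<And>b. b \<in> \<B> \<Longrightarrow> 0 < snd b"
    and "\<And>b b'. b \<in> \<B> \<Longrightarrow> b' \<in> \<B> \<Longrightarrow> b \<noteq> b' \<Longrightarrow>
      snd b = snd b' \<and> 6 * snd b \<le> dist (fst b) (fst b') \<or> 8 * snd b \<le> snd b' \<or> 8 * snd b' \<le> snd b"
  shows "\<exists>Q. (\<forall>b\<in>\<B>. open (Q b) \<and> ball (fst b) (2 * snd b) \<subseteq> Q b \<and> Q b \<subseteq> ball (fst b) (3 * snd b)) \<and>
    (\<forall>b\<in>\<B>. \<forall>b'\<in>\<B>. snd b' \<le> snd b \<longrightarrow> Q b' \<inter> Q b = {} \<or> Q b' \<subseteq> Q b)"
  using assms
proof (induction \<B> rule: finite_ranking_induct[where f = snd])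
  case (insert b \<B>)
  have "\<exists>Q. (\<forall>b\<in>\<B>. open (Q b) \<and> ball (fst b) (2 * snd b) \<subseteq> Q b \<and> Q b \<subseteq> ball (fst b) (3 * snd b)) \<and>
      (\<forall>b\<in>\<B>. \<forall>b'\<in>\<B>. snd b' \<le> snd b \<longrightarrow> Q b' \<inter> Q b = {} \<or> Q b' \<subseteq> Q b)"
    by (rule insert.IH) (use insert.prems in \<open>simp_all\<close>)
  then obtain Q where Q0: "\<forall>b\<in>\<B>. open (Q b) \<and> ball (fst b) (2 * snd b) \<subseteq> Q b \<and> Q b \<subseteq> ball (fst b) (3 * snd b)"
      "\<forall>b\<in>\<B>. \<forall>b'\<in>\<B>. snd b' \<le> snd b \<longrightarrow> Q b' \<inter> Q b = {} \<or> Q b' \<subseteq> Q b"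
    by (elim exE conjE) (rule that)
  have Q: "open (Q b)" "ball (fst b) (2 * snd b) \<subseteq> Q b" "Q b \<subseteq> ball (fst b) (3 * snd b)" if "b \<in> \<B>" for b
    using Q0(1) that by simp_all
  have Q4: "Q b' \<inter> Q b = {} \<or> Q b' \<subseteq> Q b" if "b \<in> \<B>" "b' \<in> \<B>" "snd b' \<le> snd b" for b b'
    using Q0(2) that by blast
  show ?case
  proof (cases "b \<in> \<B>")
    case True
    then show ?thesis using Q0 by (intro exI[of _ Q]) (simp add: insert_absorb)
  next
    case False
    let ?B = "ball (fst b) (2 * snd b)"
    \<comment> \<open>The induction adds balls in order of increasing radius, so the smaller sets
      absorbed here are already final.\<close>
    let ?M = "{b' \<in> \<B>. snd b' < snd b \<and> Q b' \<inter> ?B \<noteq> {}}"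
    define Q' where "Q' = Q(b := ?B \<union> (\<Union>b'\<in>?M. Q b'))"
    have Q'b: "Q' b = ?B \<union> (\<Union>b'\<in>?M. Q b')" by (simp add: Q'_def)
    have Q'o: "Q' b' = Q b'" if "b' \<in> \<B>" for b' using that False by (auto simp: Q'_def)
    have bpos: "snd b > 0" using insert.prems(1) by simp
    have sub: "Q' b \<subseteq> ball (fst b) (3 * snd b)"
    proof
      fix x assume "x \<in> Q' b"
      then consider "x \<in> ?B" | b' where "b' \<in> ?M" "x \<in> Q b'" unfolding Q'b by blast
      then show "x \<in> ball (fst b) (3 * snd b)"
      proof cases
        case 1
        then show ?thesis using bpos by simp
      next
        case 2
        then obtain w where w: "w \<in> Q b'" "w \<in> ?B" by auto
        have "8 * snd b' \<le> snd b" using insert.prems(2)[of b b'] 2 False bpos by auto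
        moreover have "dist (fst b') x < 3 * snd b'" "dist (fst b') w < 3 * snd b'"
          using Q(3)[of b'] w 2 by auto
        moreover have "dist (fst b) w < 2 * snd b" using w by simp
        ultimately show ?thesis
          using dist_triangle[of "fst b" x w] dist_triangle[of w x "fst b'"] bpos by (simp add: dist_commute)
      qed
    qed
    have lam: "Q b' \<inter> Q' b = {} \<or> Q b' \<subseteq> Q' b" if b': "b' \<in> \<B>" for b'
    proof (cases "snd b' < snd b")
      case True
      show ?thesis
      proof (cases "Q b' \<inter> ?B = {}")
        case False
        then show ?thesis using b' True unfolding Q'b by auto
      next
        case disj: True
        show ?thesis
        proof (cases "Q b' \<inter> Q' b = {}")
          case False
          then obtain b'' where b'': "b'' \<in> ?M" "Q b' \<inter> Q b'' \<noteq> {}" using disj unfolding Q'b by blast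
          \<comment> \<open>A set that misses the doubled ball but meets an absorbed set must lie
            inside it: the opposite inclusion would make it meet the ball.\<close>
          have "Q b' \<subseteq> Q b''"
          proof (cases "snd b' \<le> snd b''")
            case True
            then show ?thesis using Q4[of b'' b'] b' b'' by auto
          next
            case False
            then have "Q b'' \<subseteq> Q b'" using Q4[of b' b''] b' b'' by auto
            then show ?thesis using disj b'' by auto
          qed
          then show ?thesis using b'' unfolding Q'b by blast
        qed simp
      qed
    next
      case False
      then have "snd b' = snd b" using insert.hyps(2)[OF b'] by simp
      \<comment> \<open>For equal radii the sets lie in balls of radius \<open>3 * snd b\<close>
        whose centres are at least \<open>6 * snd b\<close> apart.\<close>
      then have d: "6 * snd b \<le> dist (fst b) (fst b')"
        using insert.prems(2)[of b b'] b' \<open>b \<notin> \<B>\<close> bpos by auto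
      have "Q b' \<inter> Q' b = {}"
      proof (rule equals0I)
        fix x assume x: "x \<in> Q b' \<inter> Q' b"
        then have "dist (fst b') x < 3 * snd b" "dist (fst b) x < 3 * snd b"
          using Q(3)[OF b'] sub \<open>snd b' = snd b\<close> by auto
        then show False using d dist_triangle[of "fst b" "fst b'" x] by (simp add: dist_commute)
      qed
      then show ?thesis ..
    qed
    have lam2: "Q' b \<inter> Q b' = {} \<or> Q' b \<subseteq> Q b'" if b': "b' \<in> \<B>" "snd b \<le> snd b'" for b'
    proof -
      have "snd b' = snd b" using insert.hyps(2)[OF b'(1)] b' by simp
      then have d: "6 * snd b \<le> dist (fst b) (fst b')"
        using insert.prems(2)[of b b'] b' \<open>b \<notin> \<B>\<close> bpos by auto
      have "Q' b \<inter> Q b' = {}"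
      proof (rule equals0I)
        fix x assume x: "x \<in> Q' b \<inter> Q b'"
        then have "dist (fst b') x < 3 * snd b" "dist (fst b) x < 3 * snd b"
          using Q(3)[OF b'(1)] sub \<open>snd b' = snd b\<close> by auto
        then show False using d dist_triangle[of "fst b" "fst b'" x] by (simp add: dist_commute)
      qed
      then show ?thesis ..
    qed
    show ?thesis
    proof (intro exI[of _ Q'] conjI ballI impI)
      fix c assume c: "c \<in> insert b \<B>"
      show "open (Q' c)"
      proof (cases "c = b")
        case True
        show ?thesis unfolding True Q'b by (intro open_Un open_UN open_ball ballI Q(1)) simp
      qed (use c Q in \<open>simp add: Q'o\<close>)
      show "ball (fst c) (2 * snd c) \<subseteq> Q' c" using c Q(2) by (cases "c = b") (auto simp: Q'b Q'o)
      show "Q' c \<subseteq> ball (fst c) (3 * snd c)" using c Q(3) sub by (cases "c = b") (auto simp: Q'o)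
      fix c' assume c': "c' \<in> insert b \<B>" "snd c' \<le> snd c"
      show "Q' c' \<inter> Q' c = {} \<or> Q' c' \<subseteq> Q' c"
      proof (cases "c = b")
        case True
        then show ?thesis using c' lam by (cases "c' = b") (auto simp: Q'o)
      next
        case c_neq: False
        then have cB: "c \<in> \<B>" using c by simp
        show ?thesis
        proof (cases "c' = b")
          case True
          then show ?thesis using lam2[OF cB] c' Q'o[OF cB] by simp
        next
          case False
          then have "c' \<in> \<B>" using c' by simp
          then show ?thesis using Q4[OF cB] Q'o[OF cB] Q'o c' by simp
        qed
      qed
    qed
  qed
qed simp

context doubling
begin

text \<open>The number of classes depends only on \<open>C\<close> and \<open>n\<close>. Centres are
  moved to a net at their own scale; net points closer than six radii receive different colours, and
  scales are sorted modulo 3 to reach the ratio 8 that a laminar family requires.\<close>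

lemma laminar_classes:
  fixes y :: "nat \<Rightarrow> 'm" and k :: "nat \<Rightarrow> int"
  assumes J: "finite J" and a: "0 < a"
  defines "\<rho> \<equiv> \<lambda>j. a * 2 powi k j"
  shows "\<exists>cls Q. (\<forall>j\<in>J. cls j \<in> {..packing 6} \<times> {..<3::nat} \<and> open (Q j) \<and> ball (y j) (\<rho> j) \<subseteq> Q j \<and> Q j \<subseteq> ball (y j) (4 * \<rho> j)) \<and>
    (\<forall>i\<in>J. \<forall>j\<in>J. cls i = cls j \<and> \<rho> j \<le> \<rho> i \<longrightarrow> Q j \<inter> Q i = {} \<or> Q j \<subseteq> Q i)"
proof -
  have \<rho>0: "0 < \<rho> j" for j using a by (simp add: \<rho>_def)
  have ap: "0 < a * 2 powi l" for l :: int using a by simp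
  let ?Y = "\<lambda>l. y ` {j \<in> J. k j = l}"
  have "\<forall>l. \<exists>Z\<subseteq>?Y l. (\<forall>w\<in>Z. \<forall>w'\<in>Z. w \<noteq> w' \<longrightarrow> a * 2 powi l \<le> dist w w') \<and> (\<forall>y\<in>?Y l. \<exists>z\<in>Z. dist y z < a * 2 powi l)"
    using J ap by (intro allI finite_net) auto
  from choice[OF this] obtain Z where Z0: "\<forall>l. Z l \<subseteq> ?Y l \<and> (\<forall>w\<in>Z l. \<forall>w'\<in>Z l. w \<noteq> w' \<longrightarrow> a * 2 powi l \<le> dist w w') \<and> (\<forall>y\<in>?Y l. \<exists>z\<in>Z l. dist y z < a * 2 powi l)"
    by (elim exE) (rule that)
  have Z: "Z l \<subseteq> ?Y l" "w \<in> Z l \<Longrightarrow> w' \<in> Z l \<Longrightarrow> w \<noteq> w' \<Longrightarrow> a * 2 powi l \<le> dist w w'"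
     "y \<in> ?Y l \<Longrightarrow> \<exists>z\<in>Z l. dist y z < a * 2 powi l" for l w w' y
    using Z0[THEN spec, of l] by (blast, blast, blast)
  have finZ: "finite (Z l)" for l using Z(1)[of l] J by (auto intro: finite_subset)
  have "\<forall>l. \<exists>col::'m \<Rightarrow> nat. (\<forall>v\<in>Z l. col v \<le> packing 6) \<and> (\<forall>v\<in>Z l. \<forall>w\<in>Z l. v \<noteq> w \<and> dist v w < 6 * (a * 2 powi l) \<longrightarrow> col v \<noteq> col w)"
    using finZ Z(2) ap by (intro allI greedy_colouring card_separated_le) (auto simp: dist_commute)
  from choice[OF this] obtain col :: "int \<Rightarrow> 'm \<Rightarrow> nat" where col0: "\<forall>l. (\<forall>v\<in>Z l. col l v \<le> packing 6) \<and> (\<forall>v\<in>Z l. \<forall>w\<in>Z l. v \<noteq> w \<and> dist v w < 6 * (a * 2 powi l) \<longrightarrow> col l v \<noteq> col l w)"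
    by (elim exE) (rule that)
  have col: "v \<in> Z l \<Longrightarrow> col l v \<le> packing 6"
     "v \<in> Z l \<Longrightarrow> w \<in> Z l \<Longrightarrow> v \<noteq> w \<Longrightarrow> dist v w < 6 * (a * 2 powi l) \<Longrightarrow> col l v \<noteq> col l w" for l v w
    using col0[THEN spec, of l] by (blast, blast)
  have "\<forall>j\<in>J. \<exists>z. z \<in> Z (k j) \<and> dist (y j) z < \<rho> j"
    using Z(3) unfolding \<rho>_def by blast
  from bchoice[OF this] obtain z where z0: "\<forall>j\<in>J. z j \<in> Z (k j) \<and> dist (y j) (z j) < \<rho> j"
    by (elim exE) (rule that)
  have z: "j \<in> J \<Longrightarrow> z j \<in> Z (k j)" "j \<in> J \<Longrightarrow> dist (y j) (z j) < \<rho> j" for j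
    using z0 by auto
  define cls where "cls j = (col (k j) (z j), nat (k j mod 3))" for j
  \<comment> \<open>Indices with the same net point and the same scale share one set, so only
    distinct pairs have to be separated.\<close>
  let ?\<B> = "\<lambda>c. (\<lambda>j. (z j, \<rho> j)) ` {j \<in> J. cls j = c}"
  have "\<forall>c. \<exists>Q. (\<forall>b\<in>?\<B> c. open (Q b) \<and> ball (fst b) (2 * snd b) \<subseteq> Q b \<and> Q b \<subseteq> ball (fst b) (3 * snd b)) \<and>
    (\<forall>b\<in>?\<B> c. \<forall>b'\<in>?\<B> c. snd b' \<le> snd b \<longrightarrow> Q b' \<inter> Q b = {} \<or> Q b' \<subseteq> Q b)"
  proof (rule allI, rule laminar_family)
    fix c
    show "finite (?\<B> c)" using J by simp
    show "0 < snd b" if "b \<in> ?\<B> c" for b using that \<rho>0 by auto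
    fix b b' assume "b \<in> ?\<B> c" "b' \<in> ?\<B> c" and ne: "b \<noteq> b'"
    then obtain i j where ij: "i \<in> J" "j \<in> J" "cls i = c" "cls j = c" "b = (z i, \<rho> i)" "b' = (z j, \<rho> j)" by auto
    have big: "8 * \<rho> i' \<le> \<rho> j'" if "k i' < k j'" "cls i' = cls j'" for i' j'
    proof -
      have "k i' mod 3 = k j' mod 3" using that(2) by (simp add: cls_def eq_nat_nat_iff)
      \<comment> \<open>Different scales in one residue class modulo 3 differ by at least 3, and the
        radii by a factor of at least 8.\<close>
      then have "k i' + 3 \<le> k j'" using that(1) by presburger
      then have "(2::real) powi (k i' + 3) \<le> 2 powi k j'" by (intro power_int_increasing) auto
      then show ?thesis using a by (simp add: \<rho>_def power_int_add)
    qed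
    consider "k i < k j" | "k j < k i" | "k i = k j" by linarith
    then show "snd b = snd b' \<and> 6 * snd b \<le> dist (fst b) (fst b') \<or> 8 * snd b \<le> snd b' \<or> 8 * snd b' \<le> snd b"
    proof cases
      case 3
      then have "z i \<noteq> z j" using ne ij by (auto simp: \<rho>_def)
      moreover have "cls i = cls j" using ij by simp
      then have "col (k i) (z i) = col (k i) (z j)" using 3 by (simp add: cls_def)
      ultimately have "\<not> dist (z i) (z j) < 6 * \<rho> i"
        using col(2)[of "z i" "k i" "z j"] z(1)[OF ij(1)] z(1)[OF ij(2)] 3 by (auto simp: \<rho>_def)
      then show ?thesis using ij 3 by (simp add: \<rho>_def)
    qed (use ij big in auto)
  qed
  from choice[OF this] obtain Q where Q0: "\<forall>c. (\<forall>b\<in>?\<B> c. open (Q c b) \<and> ball (fst b) (2 * snd b) \<subseteq> Q c b \<and> Q c b \<subseteq> ball (fst b) (3 * snd b)) \<and>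
    (\<forall>b\<in>?\<B> c. \<forall>b'\<in>?\<B> c. snd b' \<le> snd b \<longrightarrow> Q c b' \<inter> Q c b = {} \<or> Q c b' \<subseteq> Q c b)"
    by (elim exE) (rule that)
  have Q: "b \<in> ?\<B> c \<Longrightarrow> open (Q c b) \<and> ball (fst b) (2 * snd b) \<subseteq> Q c b \<and> Q c b \<subseteq> ball (fst b) (3 * snd b)"
     "b \<in> ?\<B> c \<Longrightarrow> b' \<in> ?\<B> c \<Longrightarrow> snd b' \<le> snd b \<Longrightarrow> Q c b' \<inter> Q c b = {} \<or> Q c b' \<subseteq> Q c b" for c b b'
    using Q0[THEN spec, of c] by (blast, blast)
  show ?thesis
  proof (intro exI[of _ cls] exI[of _ "\<lambda>j. Q (cls j) (z j, \<rho> j)"] conjI ballI impI)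
    fix j assume j: "j \<in> J"
    then have b: "(z j, \<rho> j) \<in> ?\<B> (cls j)" by auto
    show "cls j \<in> {..packing 6} \<times> {..<3}" using col(1)[OF z(1)[OF j]] by (simp add: cls_def nat_less_iff)
    show "open (Q (cls j) (z j, \<rho> j))" using Q(1)[OF b] by simp
    show "ball (y j) (\<rho> j) \<subseteq> Q (cls j) (z j, \<rho> j)"
    proof
      fix x assume "x \<in> ball (y j) (\<rho> j)"
      \<comment> \<open>Moving the centre to the net costs one radius on either side: radii 2 and 3
        about \<open>z j\<close> become radii 1 and 4 about \<open>y j\<close>.\<close>
      then have "dist (z j) x < 2 * \<rho> j" using z(2)[OF j] dist_triangle[of "z j" x "y j"] by (simp add: dist_commute)
      then show "x \<in> Q (cls j) (z j, \<rho> j)" using Q(1)[OF b] by auto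
    qed
    show "Q (cls j) (z j, \<rho> j) \<subseteq> ball (y j) (4 * \<rho> j)"
    proof
      fix x assume "x \<in> Q (cls j) (z j, \<rho> j)"
      then have "dist (z j) x < 3 * \<rho> j" using Q(1)[OF b] by auto
      then show "x \<in> ball (y j) (4 * \<rho> j)" using z(2)[OF j] dist_triangle[of "y j" x "z j"] by simp
    qed
  next
    fix i j assume ij: "i \<in> J" "j \<in> J" "cls i = cls j \<and> \<rho> j \<le> \<rho> i"
    then have "(z i, \<rho> i) \<in> ?\<B> (cls i)" "(z j, \<rho> j) \<in> ?\<B> (cls i)" by auto
    from Q(2)[OF this] ij show "Q (cls j) (z j, \<rho> j) \<inter> Q (cls i) (z i, \<rho> i) = {} \<or> Q (cls j) (z j, \<rho> j) \<subseteq> Q (cls i) (z i, \<rho> i)"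
      by simp
  qed
qed

end

section \<open>The estimate for p greater than 1\<close>

text \<open>Nonincreasing order, because Stein's inequality expects every later set to lie inside an
  earlier one or to miss it.\<close>

lemma finite_sorted_enum:
  fixes f :: "'a \<Rightarrow> real"
  assumes "finite S"
  shows "\<exists>h. bij_betw h {..<card S} S \<and> (\<forall>j<card S. \<forall>i<j. f (h j) \<le> f (h i))"
  using assms
proof (induction S rule: finite_ranking_induct[where f = "\<lambda>x. - f x"])
  case empty
  then show ?case by (auto simp: bij_betw_def)
next
  case (insert x S)
  show ?case
  proof (cases "x \<in> S")
    case True
    then show ?thesis using insert by (simp add: insert_absorb)
  next
    case False
    obtain h where h: "bij_betw h {..<card S} S" "\<forall>j<card S. \<forall>i<j. f (h j) \<le> f (h i)" using insert.IH by blast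
    let ?h = "h(card S := x)"
    have c: "card (insert x S) = Suc (card S)" using insert False by simp
    have "bij_betw ?h ({..<card S} \<union> {card S}) (S \<union> {x})"
    proof (rule bij_betw_combine)
      show "bij_betw ?h {..<card S} S"
        using h(1) by (subst bij_betw_cong[of _ _ h]) auto
      show "bij_betw ?h {card S} {x}" by (auto simp: bij_betw_def)
    qed (use False in auto)
    moreover have "{..<card S} \<union> {card S} = {..<Suc (card S)}" by auto
    moreover have "f (?h j) \<le> f (?h i)" if "j < Suc (card S)" "i < j" for i j
    proof (cases "j = card S")
      case True
      have "h i \<in> S" using that True h(1) by (auto simp: bij_betw_def)
      then show ?thesis using insert.hyps(2)[of "h i"] that True by simp
    qed (use h(2) that in auto)
    ultimately have "bij_betw ?h {..<card (insert x S)} (insert x S) \<and> (\<forall>j<card (insert x S). \<forall>i<j. f (?h j) \<le> f (?h i))"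
      unfolding c by (simp only: Un_insert_right Un_empty_right) blast
    then show ?thesis by - (rule exI[of _ ?h])
  qed
qed

lemma powr_sum_le:
  fixes a :: "'c \<Rightarrow> real"
  assumes "finite P" "\<And>c. c \<in> P \<Longrightarrow> 0 \<le> a c" "0 < p"
  shows "(\<Sum>c\<in>P. a c) powr p \<le> real (card P) powr p * (\<Sum>c\<in>P. a c powr p)"
proof (cases "P = {}")
  case False
  define m where "m = Max (a ` P)"
  have m: "m \<in> a ` P" "\<And>c. c \<in> P \<Longrightarrow> a c \<le> m" using assms(1) False by (auto simp: m_def)
  then obtain c0 where c0: "c0 \<in> P" "m = a c0" by auto
  have "(\<Sum>c\<in>P. a c) \<le> real (card P) * m" using sum_bounded_above[of P a m] m by simp
  then have "(\<Sum>c\<in>P. a c) powr p \<le> (real (card P) * m) powr p"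
    using assms by (intro powr_mono2) (auto intro: sum_nonneg)
  also have "\<dots> = real (card P) powr p * a c0 powr p" using c0 assms(2) by (simp add: powr_mult)
  also have "\<dots> \<le> real (card P) powr p * (\<Sum>c\<in>P. a c powr p)"
    using c0 assms(1) by (intro mult_left_mono member_le_sum) auto
  finally show ?thesis .
qed simp

text \<open>The triangle inequality over the classes. The power of their number is harmless as long
  as that number depends on the space only.\<close>

lemma gauss_expect_split:
  fixes v :: "nat \<Rightarrow> 'x::real_normed_vector"
  assumes A: "finite A" and P: "finite P" "cls ` A \<subseteq> P" and p: "1 \<le> p"
  shows "gauss_expect A v (\<lambda>z. ennreal (norm z powr p)) \<le>
    ennreal (real (card P) powr p) * (\<Sum>c\<in>P. gauss_expect {j\<in>A. cls j = c} v (\<lambda>z. ennreal (norm z powr p)))"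
proof -
  let ?v = "\<lambda>c j. if cls j = c then v j else 0"
  have pm: "(\<lambda>z::'x. ennreal (norm z powr p)) \<in> borel_measurable borel"
    by (rule cvx_cont_borel[OF cvx_cont_norm_powr[OF p]])
  have m: "(\<lambda>g. ennreal (norm (\<Sum>k\<in>A. g k *\<^sub>R ?v c k) powr p)) \<in> borel_measurable (\<Pi>\<^sub>M k\<in>A. gauss)" for c
    using measurable_compose[OF gauss_sum_measurable[OF A] pm] .
  have "gauss_expect A v (\<lambda>z. ennreal (norm z powr p))
     \<le> (\<integral>\<^sup>+g. ennreal (real (card P) powr p) * (\<Sum>c\<in>P. ennreal (norm (\<Sum>k\<in>A. g k *\<^sub>R ?v c k) powr p)) \<partial>(\<Pi>\<^sub>M k\<in>A. gauss))"
    unfolding gauss_expect_def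
  proof (rule nn_integral_mono)
    fix g :: "nat \<Rightarrow> real"
    have "(\<Sum>c\<in>P. \<Sum>k\<in>A. g k *\<^sub>R ?v c k) = (\<Sum>k\<in>A. \<Sum>c\<in>P. g k *\<^sub>R ?v c k)" by (rule sum.swap)
    also have "\<dots> = (\<Sum>k\<in>A. g k *\<^sub>R v k)"
    proof (rule sum.cong[OF refl])
      fix k assume k: "k \<in> A"
      have "(\<Sum>c\<in>P. g k *\<^sub>R ?v c k) = (\<Sum>c\<in>P. if c = cls k then g k *\<^sub>R v k else 0)"
        by (rule sum.cong) auto
      then show "(\<Sum>c\<in>P. g k *\<^sub>R ?v c k) = g k *\<^sub>R v k" using k P by (auto simp: sum.delta)
    qed
    finally have "norm (\<Sum>k\<in>A. g k *\<^sub>R v k) \<le> (\<Sum>c\<in>P. norm (\<Sum>k\<in>A. g k *\<^sub>R ?v c k))"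
      using norm_sum[of "\<lambda>c. \<Sum>k\<in>A. g k *\<^sub>R ?v c k" P] by simp
    then have "norm (\<Sum>k\<in>A. g k *\<^sub>R v k) powr p \<le> (\<Sum>c\<in>P. norm (\<Sum>k\<in>A. g k *\<^sub>R ?v c k)) powr p"
      using p by (intro powr_mono2) auto
    also have "\<dots> \<le> real (card P) powr p * (\<Sum>c\<in>P. norm (\<Sum>k\<in>A. g k *\<^sub>R ?v c k) powr p)"
      using P p by (intro powr_sum_le) auto
    finally have "ennreal (norm (\<Sum>k\<in>A. g k *\<^sub>R v k) powr p) \<le> ennreal (real (card P) powr p * (\<Sum>c\<in>P. norm (\<Sum>k\<in>A. g k *\<^sub>R ?v c k) powr p))"
      by (rule ennreal_leI)
    then show "ennreal (norm (\<Sum>k\<in>A. g k *\<^sub>R v k) powr p) \<le> ennreal (real (card P) powr p) * (\<Sum>c\<in>P. ennreal (norm (\<Sum>k\<in>A. g k *\<^sub>R ?v c k) powr p))"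
      by (simp add: ennreal_mult sum_nonneg sum_ennreal)
  qed
  also have "\<dots> = ennreal (real (card P) powr p) * (\<Sum>c\<in>P. gauss_expect A (?v c) (\<lambda>z. ennreal (norm z powr p)))"
    unfolding gauss_expect_def by (simp only: nn_integral_cmult nn_integral_sum m borel_measurable_sum)
  also have "(\<Sum>c\<in>P. gauss_expect A (?v c) (\<lambda>z. ennreal (norm z powr p))) = (\<Sum>c\<in>P. gauss_expect {j\<in>A. cls j = c} v (\<lambda>z. ennreal (norm z powr p)))"
  proof (rule sum.cong[OF refl])
    fix c
    have "gauss_expect A (?v c) (\<lambda>z. ennreal (norm z powr p)) = gauss_expect {j\<in>A. cls j = c} (?v c) (\<lambda>z. ennreal (norm z powr p))"
      using A pm by (intro gauss_expect_support) auto
    also have "\<dots> = gauss_expect {j\<in>A. cls j = c} v (\<lambda>z. ennreal (norm z powr p))"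
      by (rule gauss_expect_cong) auto
    finally show "gauss_expect A (?v c) (\<lambda>z. ennreal (norm z powr p)) = gauss_expect {j\<in>A. cls j = c} v (\<lambda>z. ennreal (norm z powr p))" .
  qed
  finally show ?thesis .
qed

lemma gauss_expect_indicator:
  fixes v :: "nat \<Rightarrow> 'x::real_normed_vector"
  assumes h: "bij_betw h {..<N} J" and F: "F \<in> borel_measurable borel"
  shows "gauss_expect {..<N} (\<lambda>i. indicator (S i) x *\<^sub>R v (h i)) F = gauss_expect {j\<in>J. x \<in> S (the_inv_into {..<N} h j)} v F"
proof -
  let ?I = "{i\<in>{..<N}. x \<in> S i}"
  have inj: "inj_on h {..<N}" and J: "J = h ` {..<N}" using h by (auto simp: bij_betw_def)
  have eq: "h ` ?I = {j\<in>J. x \<in> S (the_inv_into {..<N} h j)}"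
    using the_inv_into_f_f[OF inj] unfolding J by auto
  have "gauss_expect {..<N} (\<lambda>i. indicator (S i) x *\<^sub>R v (h i)) F = gauss_expect ?I (\<lambda>i. indicator (S i) x *\<^sub>R v (h i)) F"
    using F by (intro gauss_expect_support) auto
  also have "\<dots> = gauss_expect ?I (\<lambda>i. v (h i)) F" by (rule gauss_expect_cong) auto
  also have "\<dots> = gauss_expect (h ` ?I) v F"
    using inj F by (intro gauss_expect_reindex[symmetric]) (auto intro: inj_on_subset)
  finally show ?thesis unfolding eq .
qed

context doubling
begin

text \<open>Only finitely many patterns occur, and each is attained on a difference of two open
  sets; hence every function of the pattern is measurable.\<close>

lemma ball_pattern_measurable:
  fixes \<Phi> :: "nat set \<Rightarrow> ennreal"
  assumes J: "finite J"
  shows "(\<lambda>x. \<Phi> {j\<in>J. dist x (y j) < r j}) \<in> borel_measurable \<mu>"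
proof -
  have ms: "{x. {j\<in>J. dist x (y j) < r j} = A} \<in> sets \<mu>" if A: "A \<subseteq> J" for A
  proof -
    have "{x. {j\<in>J. dist x (y j) < r j} = A} = (\<Inter>j\<in>A. ball (y j) (r j)) - (\<Union>j\<in>J - A. ball (y j) (r j))"
      using A by (auto simp: dist_commute)
    moreover have "open (\<Inter>j\<in>A. ball (y j) (r j))" using J A by (intro open_INT) (auto intro: finite_subset)
    moreover have "open (\<Union>j\<in>J - A. ball (y j) (r j))" by auto
    ultimately show ?thesis using sets.Diff[OF open_sets open_sets] by simp
  qed
  have "\<Phi> {j\<in>J. dist x (y j) < r j} = (\<Sum>A\<in>Pow J. \<Phi> A * indicator {x. {j\<in>J. dist x (y j) < r j} = A} x)" for x
  proof -
    have "(\<Sum>A\<in>Pow J. \<Phi> A * indicator {x. {j\<in>J. dist x (y j) < r j} = A} x)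
       = (\<Sum>A\<in>Pow J. if A = {j\<in>J. dist x (y j) < r j} then \<Phi> A else 0)"
      by (rule sum.cong) auto
    then show ?thesis using J by (subst (asm) sum.delta) auto
  qed
  then show ?thesis
    using ms by (simp only:) (intro borel_measurable_sum borel_measurable_times_ennreal borel_measurable_const borel_measurable_indicator, simp)
qed

text \<open>By doubling, the indicator of the ball of radius \<open>\<alpha> * r j\<close> is at
  most \<open>C * (4 * \<alpha>) powr n\<close> times the average over \<open>Q j\<close> of the
  indicator of the ball of radius \<open>r j\<close>. The contraction principle carries this over to
  Gaussian moments, and Stein's inequality bounds the averages.\<close>

lemma Lp_class_estimate:
  fixes v :: "nat \<Rightarrow> 'x::banach" and y :: "nat \<Rightarrow> 'm"
  assumes p: "1 < p" and K: "0 \<le> K"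
    and stein: "\<forall>N Q B (v :: nat \<Rightarrow> 'x).
    (\<forall>j<N. Q j \<in> sets \<mu> \<and> B j \<in> sets \<mu> \<and> B j \<subseteq> Q j \<and> emeasure \<mu> (Q j) < \<infinity>) \<longrightarrow>
    (\<forall>j<N. \<forall>i<j. Q i \<inter> Q j = {} \<or> Q j \<subseteq> Q i) \<longrightarrow>
    (\<integral>\<^sup>+x. gauss_expect {..<N} (\<lambda>j. (measure \<mu> (B j) / measure \<mu> (Q j) * indicator (Q j) x) *\<^sub>R v j) (\<lambda>z. ennreal (norm z powr p)) \<partial>\<mu>)
      \<le> ennreal K * (\<integral>\<^sup>+x. gauss_expect {..<N} (\<lambda>j. indicator (B j) x *\<^sub>R v j) (\<lambda>z. ennreal (norm z powr p)) \<partial>\<mu>)"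
    and J: "finite J" and a: "1 \<le> \<alpha>" and r: "\<And>j. j \<in> J \<Longrightarrow> 0 < r j"
    and Q: "\<And>j. j \<in> J \<Longrightarrow> open (Q j) \<and> ball (y j) (\<alpha> * r j) \<subseteq> Q j \<and> Q j \<subseteq> ball (y j) (4 * (\<alpha> * r j))"
    and lam: "\<And>i j. i \<in> J \<Longrightarrow> j \<in> J \<Longrightarrow> \<alpha> * r j \<le> \<alpha> * r i \<Longrightarrow> Q j \<inter> Q i = {} \<or> Q j \<subseteq> Q i"
  shows "(\<integral>\<^sup>+x. gauss_expect {j\<in>J. dist x (y j) < \<alpha> * r j} v (\<lambda>z. ennreal (norm z powr p)) \<partial>\<mu>)
    \<le> ennreal (K * (C * (4 * \<alpha>) powr n) powr p) * (\<integral>\<^sup>+x. gauss_expect {j\<in>J. dist x (y j) < r j} v (\<lambda>z. ennreal (norm z powr p)) \<partial>\<mu>)"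
proof -
  let ?F = "\<lambda>z::'x. ennreal (norm z powr p)"
  have cv: "cvx_cont (\<lambda>z::'x. norm z powr p)" using p by (intro cvx_cont_norm_powr) simp
  note pm = cvx_cont_borel[OF cv]
  define D where "D = C * (4 * \<alpha>) powr n"
  have D: "D > 0" using C_ge a by (simp add: D_def)
  obtain h where h: "bij_betw h {..<card J} J" "\<forall>j<card J. \<forall>i<j. r (h j) \<le> r (h i)"
    using finite_sorted_enum[OF J, of r] by blast
  let ?N = "card J"
  have hJ: "h i \<in> J" if "i < ?N" for i using h(1) that by (auto simp: bij_betw_def)
  have inv: "the_inv_into {..<?N} h (h i) = i" if "i < ?N" for i
    using h(1) that by (intro the_inv_into_f_f) (auto simp: bij_betw_def)
  have inv': "h (the_inv_into {..<?N} h j) = j" if "j \<in> J" for j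
    using h(1) that by (intro f_the_inv_into_f) (auto simp: bij_betw_def)
  let ?B = "\<lambda>i. ball (y (h i)) (r (h i))" and ?A = "\<lambda>i. ball (y (h i)) (\<alpha> * r (h i))" and ?Q = "\<lambda>i. Q (h i)"
  let ?a = "\<lambda>i. measure \<mu> (?B i) / measure \<mu> (?Q i)"
  have BA: "?B i \<subseteq> ?A i" if "i < ?N" for i
    using a r[OF hJ[OF that]] by (intro subset_ball) simp
  have sub: "\<forall>i<?N. ?Q i \<in> sets \<mu> \<and> ?B i \<in> sets \<mu> \<and> ?B i \<subseteq> ?Q i \<and> emeasure \<mu> (?Q i) < \<infinity>"
  proof (intro allI impI conjI)
    fix i assume i: "i < ?N"
    show "?Q i \<in> sets \<mu>" using Q[OF hJ[OF i]] by auto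
    show "?B i \<in> sets \<mu>" by auto
    show "?B i \<subseteq> ?Q i" using Q[OF hJ[OF i]] BA[OF i] by blast
    show "emeasure \<mu> (?Q i) < \<infinity>"
      using fmeasurable_bounded_open[of "?Q i"] Q[OF hJ[OF i]] by (auto simp: fmeasurable_def)
  qed
  have lam': "\<forall>j<?N. \<forall>i<j. ?Q i \<inter> ?Q j = {} \<or> ?Q j \<subseteq> ?Q i"
  proof (intro allI impI)
    fix i j assume ij: "j < ?N" "i < j"
    then have "r (h j) \<le> r (h i)" using h(2) by blast
    then have "\<alpha> * r (h j) \<le> \<alpha> * r (h i)" using a by simp
    then show "?Q i \<inter> ?Q j = {} \<or> ?Q j \<subseteq> ?Q i" using lam[of "h i" "h j"] hJ ij by (auto simp: Int_commute)
  qed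
  have ratio: "0 < ?a i \<and> 1 \<le> D * ?a i" if i: "i < ?N" for i
  proof -
    have B0: "0 < measure \<mu> (?B i)" by (rule measure_ball_pos[OF r[OF hJ[OF i]]])
    have "measure \<mu> (?B i) \<le> measure \<mu> (?Q i)"
    proof (rule measure_mono_fmeasurable)
      show "?Q i \<in> fmeasurable \<mu>" using Q[OF hJ[OF i]] by (intro fmeasurable_bounded_open) auto
    qed (use sub i in auto)
    then have Q0: "0 < measure \<mu> (?Q i)" using B0 by linarith
    have "measure \<mu> (?Q i) \<le> measure \<mu> (ball (y (h i)) (4 * (\<alpha> * r (h i))))"
      using Q[OF hJ[OF i]] by (intro measure_ball_mono open_sets) auto
    also have "\<dots> \<le> D * measure \<mu> (?B i)"
      unfolding D_def using a r[OF hJ[OF i]] by (intro measure_ball_le) (auto simp: mult.assoc)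
    finally show ?thesis using Q0 B0 by (simp add: field_simps)
  qed
  have pt: "gauss_expect {j\<in>J. dist x (y j) < \<alpha> * r j} v ?F \<le> ennreal (D powr p) * gauss_expect {..<?N} (\<lambda>i. (?a i * indicator (?Q i) x) *\<^sub>R v (h i)) ?F" for x
  proof -
    have s: "{j\<in>J. x \<in> ?A (the_inv_into {..<?N} h j)} = {j\<in>J. dist x (y j) < \<alpha> * r j}"
      using inv' by (auto simp: dist_commute)
    \<comment> \<open>The quotient of the two sides of the dominating inequality; it lies in [0, 1]
      because \<open>D * ?a i\<close> is at least 1.\<close>
    define m where "m i = indicator (?A i) x / (D * ?a i)" for i
    have m01: "0 \<le> m i \<and> m i \<le> 1" if "i \<in> {..<?N}" for i
    proof -
      have i: "i < ?N" using that by simp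
      have q: "0 < D * ?a i" by (rule less_le_trans[OF zero_less_one]) (use ratio[OF i] in blast)
      have "indicator (?A i) x \<le> (1::real)" by (simp add: indicator_def)
      then have "indicator (?A i) x \<le> D * ?a i" by (rule order_trans) (use ratio[OF i] in blast)
      then show ?thesis unfolding m_def using q by (simp only: divide_le_eq_1_pos) (intro conjI divide_nonneg_pos; simp)
    qed
    have meq: "indicator (?A i) x *\<^sub>R v (h i) = m i *\<^sub>R (D *\<^sub>R ((?a i * indicator (?Q i) x) *\<^sub>R v (h i)))" if "i < ?N" for i
    proof (cases "x \<in> ?A i")
      case True
      then have "x \<in> ?Q i" using Q[OF hJ[OF that]] by blast
      then have ind: "indicator (?A i) x = (1::real)" "indicator (?Q i) x = (1::real)" using True by auto
      have nz: "D * ?a i \<noteq> 0" using ratio[OF that] by linarith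
      have one: "1 / c * c = 1" if "c \<noteq> 0" for c :: real using that by simp
      have "m i * (D * ?a i) = 1" unfolding m_def ind by (rule one[OF nz])
      then show ?thesis unfolding ind by (simp only: scaleR_scaleR mult_1_right scaleR_one)
    qed (simp add: m_def)
    have "gauss_expect {j\<in>J. dist x (y j) < \<alpha> * r j} v ?F = gauss_expect {..<?N} (\<lambda>i. indicator (?A i) x *\<^sub>R v (h i)) ?F"
      unfolding s[symmetric] by (rule gauss_expect_indicator[OF h(1) pm, symmetric])
    also have "\<dots> = gauss_expect {..<?N} (\<lambda>i. m i *\<^sub>R (D *\<^sub>R ((?a i * indicator (?Q i) x) *\<^sub>R v (h i)))) ?F"
      by (rule gauss_expect_cong) (simp_all only: meq lessThan_iff)
    also have "\<dots> \<le> gauss_expect {..<?N} (\<lambda>i. D *\<^sub>R ((?a i * indicator (?Q i) x) *\<^sub>R v (h i))) ?F"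
      by (rule gauss_expect_scale_le[OF _ cv m01]) simp
    also have "\<dots> = gauss_expect {..<?N} (\<lambda>i. (?a i * indicator (?Q i) x) *\<^sub>R v (h i)) (\<lambda>z. ?F (D *\<^sub>R z))"
      by (rule gauss_expect_linear) (rule linear_scaleR)
    \<comment> \<open>The dominating constant leaves as \<open>D powr p\<close>, which is the source
      of the exponent \<open>n * p\<close>.\<close>
    also have "(\<lambda>z. ?F (D *\<^sub>R z)) = (\<lambda>z. ennreal (D powr p) * ?F z)"
      using D by (auto simp: powr_mult ennreal_mult)
    also have "gauss_expect {..<?N} (\<lambda>i. (?a i * indicator (?Q i) x) *\<^sub>R v (h i)) (\<lambda>z. ennreal (D powr p) * ?F z)
       = ennreal (D powr p) * gauss_expect {..<?N} (\<lambda>i. (?a i * indicator (?Q i) x) *\<^sub>R v (h i)) ?F"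
      by (rule gauss_expect_cmult[OF _ pm]) simp
    finally show ?thesis .
  qed
  have mB: "gauss_expect {..<?N} (\<lambda>i. indicator (?B i) x *\<^sub>R v (h i)) ?F = gauss_expect {j\<in>J. dist x (y j) < r j} v ?F" for x
  proof -
    have s: "{j\<in>J. x \<in> ?B (the_inv_into {..<?N} h j)} = {j\<in>J. dist x (y j) < r j}"
      using inv' by (auto simp: dist_commute)
    show ?thesis unfolding s[symmetric] by (rule gauss_expect_indicator[OF h(1) pm])
  qed
  have "(\<integral>\<^sup>+x. gauss_expect {j\<in>J. dist x (y j) < \<alpha> * r j} v ?F \<partial>\<mu>)
    \<le> (\<integral>\<^sup>+x. ennreal (D powr p) * gauss_expect {..<?N} (\<lambda>i. (?a i * indicator (?Q i) x) *\<^sub>R v (h i)) ?F \<partial>\<mu>)"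
    by (intro nn_integral_mono pt)
  also have "\<dots> = ennreal (D powr p) * (\<integral>\<^sup>+x. gauss_expect {..<?N} (\<lambda>i. (?a i * indicator (?Q i) x) *\<^sub>R v (h i)) ?F \<partial>\<mu>)"
  proof (rule nn_integral_cmult)
    interpret G: sigma_finite_measure "\<Pi>\<^sub>M k\<in>{..<?N}. gauss" by (rule gauss_prod.sigma_finite) simp
    have "(\<lambda>y. \<Sum>j<?N. (?a j * indicator (?Q j) (fst y) * snd y j) *\<^sub>R v (h j)) \<in> borel_measurable (\<mu> \<Otimes>\<^sub>M (\<Pi>\<^sub>M k\<in>{..<?N}. gauss))"
    proof (rule borel_measurable_sum_scaleR)
      fix j assume j: "j \<in> {..<?N}"
      have [measurable]: "?Q j \<in> sets \<mu>" using sub j by simp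
      have [measurable]: "(\<lambda>g. g j) \<in> borel_measurable (\<Pi>\<^sub>M k\<in>{..<?N}. gauss)" using j by measurable
      show "(\<lambda>y. ?a j * indicator (?Q j) (fst y) * snd y j) \<in> borel_measurable (\<mu> \<Otimes>\<^sub>M (\<Pi>\<^sub>M k\<in>{..<?N}. gauss))" by measurable
    qed simp
    from measurable_compose[OF this pm]
    have "(\<lambda>y. ?F (\<Sum>j<?N. snd y j *\<^sub>R (?a j * indicator (?Q j) (fst y)) *\<^sub>R v (h j))) \<in> borel_measurable (\<mu> \<Otimes>\<^sub>M (\<Pi>\<^sub>M k\<in>{..<?N}. gauss))"
      by (simp add: mult_ac)
    then show "(\<lambda>x. gauss_expect {..<?N} (\<lambda>i. (?a i * indicator (?Q i) x) *\<^sub>R v (h i)) ?F) \<in> borel_measurable \<mu>"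
      unfolding gauss_expect_def by (intro G.borel_measurable_nn_integral) (simp add: case_prod_unfold)
  qed
  also have "\<dots> \<le> ennreal (D powr p) * (ennreal K * (\<integral>\<^sup>+x. gauss_expect {..<?N} (\<lambda>i. indicator (?B i) x *\<^sub>R v (h i)) ?F \<partial>\<mu>))"
    by (intro mult_left_mono stein[THEN spec, THEN spec, THEN spec, THEN spec, THEN mp, THEN mp, OF sub lam']) simp
  also have "\<dots> = ennreal (K * D powr p) * (\<integral>\<^sup>+x. gauss_expect {j\<in>J. dist x (y j) < r j} v ?F \<partial>\<mu>)"
    unfolding mB using K by (simp add: ennreal_mult mult_ac)
  finally show ?thesis unfolding D_def .
qed

text \<open>The laminar classes are estimated one by one and recombined. Their number is independent
  of \<open>\<alpha>\<close> and of the family, so it only affects the constant.\<close>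

lemma Lp_estimate:
  assumes umd: "umd_space TYPE('x::banach)" and p: "1 < p"
  shows "\<exists>K\<ge>0. \<forall>\<alpha>\<ge>1. \<forall>J y k (v :: nat \<Rightarrow> 'x). finite J \<longrightarrow>
     (\<integral>\<^sup>+x. gauss_expect {j\<in>J. dist x (y j) < \<alpha> * 2 powi k j} v (\<lambda>z. ennreal (norm z powr p)) \<partial>\<mu>)
    \<le> ennreal (K * \<alpha> powr (n * p)) * (\<integral>\<^sup>+x. gauss_expect {j\<in>J. dist x (y j) < 2 powi k j} v (\<lambda>z. ennreal (norm z powr p)) \<partial>\<mu>)"
proof -
  let ?F = "\<lambda>z::'x. ennreal (norm z powr p)"
  have cv: "cvx_cont (\<lambda>z::'x. norm z powr p)" using p by (intro cvx_cont_norm_powr) simp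
  note pm = cvx_cont_borel[OF cv]
  obtain K0 where K0: "K0 \<ge> 0" and stein0: "\<forall>(\<mu> :: 'm measure) N Q B (v :: nat \<Rightarrow> 'x).
    sigma_finite_measure \<mu> \<longrightarrow>
    (\<forall>j<N. Q j \<in> sets \<mu> \<and> B j \<in> sets \<mu> \<and> B j \<subseteq> Q j \<and> emeasure \<mu> (Q j) < \<infinity>) \<longrightarrow>
    (\<forall>j<N. \<forall>i<j. Q i \<inter> Q j = {} \<or> Q j \<subseteq> Q i) \<longrightarrow>
    (\<integral>\<^sup>+x. gauss_expect {..<N} (\<lambda>j. (measure \<mu> (B j) / measure \<mu> (Q j) * indicator (Q j) x) *\<^sub>R v j) (\<lambda>z. ennreal (norm z powr p)) \<partial>\<mu>)
      \<le> ennreal K0 * (\<integral>\<^sup>+x. gauss_expect {..<N} (\<lambda>j. indicator (B j) x *\<^sub>R v j) (\<lambda>z. ennreal (norm z powr p)) \<partial>\<mu>)"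
    using stein_gauss[OF umd p] by (elim exE conjE) (rule that)
  have stein: "\<forall>N Q B (v :: nat \<Rightarrow> 'x).
    (\<forall>j<N. Q j \<in> sets \<mu> \<and> B j \<in> sets \<mu> \<and> B j \<subseteq> Q j \<and> emeasure \<mu> (Q j) < \<infinity>) \<longrightarrow>
    (\<forall>j<N. \<forall>i<j. Q i \<inter> Q j = {} \<or> Q j \<subseteq> Q i) \<longrightarrow>
    (\<integral>\<^sup>+x. gauss_expect {..<N} (\<lambda>j. (measure \<mu> (B j) / measure \<mu> (Q j) * indicator (Q j) x) *\<^sub>R v j) (\<lambda>z. ennreal (norm z powr p)) \<partial>\<mu>)
      \<le> ennreal K0 * (\<integral>\<^sup>+x. gauss_expect {..<N} (\<lambda>j. indicator (B j) x *\<^sub>R v j) (\<lambda>z. ennreal (norm z powr p)) \<partial>\<mu>)"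
    by (intro allI) (rule stein0[THEN spec, THEN spec, THEN spec, THEN spec, THEN spec, THEN mp, OF sigma_finite])
  let ?P = "{..packing 6} \<times> {..<3::nat}"
  define M where "M = real (card ?P)"
  define K where "K = M powr p * (M * (K0 * (C * 4 powr n) powr p))"
  have Knn: "K \<ge> 0" using K0 by (simp add: K_def M_def)
  show ?thesis
  proof (intro exI[of _ K] conjI allI impI Knn)
    fix \<alpha> :: real and J :: "nat set" and y :: "nat \<Rightarrow> 'm" and k :: "nat \<Rightarrow> int" and v :: "nat \<Rightarrow> 'x"
    assume a: "1 \<le> \<alpha>" and J: "finite J"
    have a0: "0 < \<alpha>" using a by simp
    from laminar_classes[OF J a0, of y k] obtain cls Q where
      c0: "\<forall>j\<in>J. cls j \<in> ?P \<and> open (Q j) \<and> ball (y j) (\<alpha> * 2 powi k j) \<subseteq> Q j \<and> Q j \<subseteq> ball (y j) (4 * (\<alpha> * 2 powi k j))"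
      "\<forall>i\<in>J. \<forall>j\<in>J. cls i = cls j \<and> \<alpha> * 2 powi k j \<le> \<alpha> * 2 powi k i \<longrightarrow> Q j \<inter> Q i = {} \<or> Q j \<subseteq> Q i"
      by (elim exE conjE) (rule that)
    let ?J = "\<lambda>c. {j\<in>J. cls j = c}"
    let ?R = "\<integral>\<^sup>+x. gauss_expect {j\<in>J. dist x (y j) < 2 powi k j} v ?F \<partial>\<mu>"
    let ?D = "K0 * (C * (4 * \<alpha>) powr n) powr p"
    have cl: "(\<integral>\<^sup>+x. gauss_expect {j\<in>?J c. dist x (y j) < \<alpha> * 2 powi k j} v ?F \<partial>\<mu>) \<le> ennreal ?D * ?R" for c
    proof -
      have "(\<integral>\<^sup>+x. gauss_expect {j\<in>?J c. dist x (y j) < \<alpha> * 2 powi k j} v ?F \<partial>\<mu>)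
        \<le> ennreal ?D * (\<integral>\<^sup>+x. gauss_expect {j\<in>?J c. dist x (y j) < 2 powi k j} v ?F \<partial>\<mu>)"
      proof (rule Lp_class_estimate[OF p K0 stein, where Q = Q])
        show "finite (?J c)" using J by simp
        fix i j assume "i \<in> ?J c" "j \<in> ?J c" "\<alpha> * 2 powi k j \<le> \<alpha> * 2 powi k i"
        then show "Q j \<inter> Q i = {} \<or> Q j \<subseteq> Q i" using c0(2)[THEN bspec, of i, THEN bspec, of j] by simp
      qed (use a c0(1) in auto)
      also have "\<dots> \<le> ennreal ?D * ?R"
        using J by (intro mult_left_mono nn_integral_mono gauss_expect_subset_le cv) auto
      finally show ?thesis .
    qed
    have m: "(\<lambda>x. gauss_expect {j\<in>?J c. dist x (y j) < \<alpha> * 2 powi k j} v ?F) \<in> borel_measurable \<mu>" for c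
      using J by (intro ball_pattern_measurable) auto
    have "(\<integral>\<^sup>+x. gauss_expect {j\<in>J. dist x (y j) < \<alpha> * 2 powi k j} v ?F \<partial>\<mu>)
      \<le> (\<integral>\<^sup>+x. ennreal (M powr p) * (\<Sum>c\<in>?P. gauss_expect {j\<in>?J c. dist x (y j) < \<alpha> * 2 powi k j} v ?F) \<partial>\<mu>)"
    proof (rule nn_integral_mono)
      fix x
      have "{j \<in> {j\<in>J. dist x (y j) < \<alpha> * 2 powi k j}. cls j = c} = {j\<in>?J c. dist x (y j) < \<alpha> * 2 powi k j}" for c by auto
      then show "gauss_expect {j\<in>J. dist x (y j) < \<alpha> * 2 powi k j} v ?F
        \<le> ennreal (M powr p) * (\<Sum>c\<in>?P. gauss_expect {j\<in>?J c. dist x (y j) < \<alpha> * 2 powi k j} v ?F)"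
        using gauss_expect_split[of "{j\<in>J. dist x (y j) < \<alpha> * 2 powi k j}" ?P cls p v] J c0(1) p unfolding M_def by auto
    qed
    also have "\<dots> = ennreal (M powr p) * (\<Sum>c\<in>?P. \<integral>\<^sup>+x. gauss_expect {j\<in>?J c. dist x (y j) < \<alpha> * 2 powi k j} v ?F \<partial>\<mu>)"
      using m by (simp only: nn_integral_cmult nn_integral_sum borel_measurable_sum)
    also have "\<dots> \<le> ennreal (M powr p) * (\<Sum>c\<in>?P. ennreal ?D * ?R)"
      by (intro mult_left_mono sum_mono cl) simp
    also have "\<dots> = ennreal (M powr p) * (ennreal M * (ennreal ?D * ?R))"
      by (simp add: M_def ennreal_of_nat_eq_real_of_nat)
    also have "\<dots> = ennreal (M powr p * (M * ?D)) * ?R"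
      using K0 by (simp add: ennreal_mult M_def mult_ac)
    also have "M powr p * (M * ?D) = K * \<alpha> powr (n * p)"
      using C_ge a0 by (simp add: K_def powr_mult powr_powr mult_ac)
    finally show "(\<integral>\<^sup>+x. gauss_expect {j\<in>J. dist x (y j) < \<alpha> * 2 powi k j} v ?F \<partial>\<mu>)
      \<le> ennreal (K * \<alpha> powr (n * p)) * ?R" .
  qed
qed

end

section \<open>The endpoint estimate\<close>

lemma gauss_norm_mono:
  assumes "finite B" "A \<subseteq> B"
  shows "gauss_norm A v \<le> gauss_norm B v"
  using gauss_norm_le_iff[OF finite_subset[OF assms(2,1)] assms(1), of 1 v v] gauss_expect_subset_le[OF assms cvx_cont_norm_square, of v]
  by simp

lemma gauss_norm_empty [simp]: "gauss_norm {} v = 0"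
  by (simp add: gauss_norm_def)

text \<open>Minkowski's inequality in \<open>L^2\<close>, obtained from
  \<open>(x + y)^2 <= (1 + b / a) * x^2 + (1 + a / b) * y^2\<close>. With \<open>a\<close> and
  \<open>b\<close> near the two norms the right-hand side integrates to nearly the square of their
  sum; the added \<open>e / 2\<close> keeps both positive.\<close>

lemma gauss_norm_disjoint_Un:
  fixes v :: "nat \<Rightarrow> 'x::real_normed_vector"
  assumes fin: "finite A" "finite B" and disj: "A \<inter> B = {}"
  shows "gauss_norm (A \<union> B) v \<le> gauss_norm A v + gauss_norm B v"
proof (rule field_le_epsilon)
  fix e :: real assume e: "0 < e"
  define a b where "a = gauss_norm A v + e / 2" and "b = gauss_norm B v + e / 2"
  have ab: "0 < a" "0 < b" "gauss_norm A v \<le> a" "gauss_norm B v \<le> b" using e by (auto simp: a_def b_def add_nonneg_pos)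
  let ?G = "\<Pi>\<^sub>M k\<in>A \<union> B. gauss"
  let ?c = "1 + b / a" and ?d = "1 + a / b"
  note sqm = cvx_cont_borel[OF cvx_cont_norm_square]
  have part: "(\<integral>\<^sup>+g. ennreal ((norm (\<Sum>k\<in>D. g k *\<^sub>R v k))\<^sup>2) \<partial>?G) = ennreal ((gauss_norm D v)\<^sup>2)
      \<and> (\<lambda>g. ennreal ((norm (\<Sum>k\<in>D. g k *\<^sub>R v k))\<^sup>2)) \<in> borel_measurable ?G" if "D \<subseteq> A \<union> B" for D
  proof -
    let ?v = "\<lambda>k. if k \<in> D then v k else 0"
    have eq: "(\<Sum>k\<in>D. g k *\<^sub>R v k) = (\<Sum>k\<in>A \<union> B. g k *\<^sub>R ?v k)" for g :: "nat \<Rightarrow> real"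
      using fin that by (intro sum.mono_neutral_cong_left) auto
    have "gauss_expect (A \<union> B) ?v (\<lambda>z. ennreal ((norm z)\<^sup>2)) = gauss_expect D ?v (\<lambda>z. ennreal ((norm z)\<^sup>2))"
      using fin that by (intro gauss_expect_support sqm) auto
    also have "\<dots> = gauss_expect D v (\<lambda>z. ennreal ((norm z)\<^sup>2))" by (rule gauss_expect_cong) auto
    also have "\<dots> = ennreal ((gauss_norm D v)\<^sup>2)"
      using fin that finite_subset by (intro gauss_norm_square[symmetric]) auto
    finally show ?thesis unfolding eq gauss_expect_def
      using measurable_compose[OF gauss_sum_measurable[of "A \<union> B" ?v] sqm] fin by simp
  qed
  have "ennreal ((gauss_norm (A \<union> B) v)\<^sup>2) = (\<integral>\<^sup>+g. ennreal ((norm (\<Sum>k\<in>A \<union> B. g k *\<^sub>R v k))\<^sup>2) \<partial>?G)"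
    using part[of "A \<union> B"] by simp
  also have "\<dots> \<le> (\<integral>\<^sup>+g. ennreal ?c * ennreal ((norm (\<Sum>k\<in>A. g k *\<^sub>R v k))\<^sup>2) + ennreal ?d * ennreal ((norm (\<Sum>k\<in>B. g k *\<^sub>R v k))\<^sup>2) \<partial>?G)"
  proof (rule nn_integral_mono)
    fix g :: "nat \<Rightarrow> real"
    let ?x = "\<Sum>k\<in>A. g k *\<^sub>R v k" and ?y = "\<Sum>k\<in>B. g k *\<^sub>R v k"
    have "(\<Sum>k\<in>A \<union> B. g k *\<^sub>R v k) = ?x + ?y" using fin disj by (rule sum.union_disjoint)
    then have "(norm (\<Sum>k\<in>A \<union> B. g k *\<^sub>R v k))\<^sup>2 \<le> (norm ?x + norm ?y)\<^sup>2"
      by (intro power_mono) (auto intro: norm_triangle_ineq)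
    also have "\<dots> \<le> ?c * (norm ?x)\<^sup>2 + ?d * (norm ?y)\<^sup>2"
    proof -
      have "0 \<le> (b * norm ?x - a * norm ?y)\<^sup>2 / (a * b)" using ab by simp
      also have "\<dots> = b / a * (norm ?x)\<^sup>2 + a / b * (norm ?y)\<^sup>2 - 2 * norm ?x * norm ?y"
        using ab by (simp add: field_simps power2_eq_square)
      finally show ?thesis by (simp add: power2_eq_square algebra_simps)
    qed
    finally have "ennreal ((norm (\<Sum>k\<in>A \<union> B. g k *\<^sub>R v k))\<^sup>2) \<le> ennreal (?c * (norm ?x)\<^sup>2 + ?d * (norm ?y)\<^sup>2)"
      by (rule ennreal_leI)
    then show "ennreal ((norm (\<Sum>k\<in>A \<union> B. g k *\<^sub>R v k))\<^sup>2) \<le> ennreal ?c * ennreal ((norm ?x)\<^sup>2) + ennreal ?d * ennreal ((norm ?y)\<^sup>2)"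
      using ab by (subst (1 2) ennreal_mult[symmetric]) (auto simp: ennreal_plus[symmetric] simp del: ennreal_plus)
  qed
  also have "\<dots> = ennreal ?c * ennreal ((gauss_norm A v)\<^sup>2) + ennreal ?d * ennreal ((gauss_norm B v)\<^sup>2)"
  proof -
    have m: "(\<lambda>g. ennreal e * ennreal ((norm (\<Sum>k\<in>D. g k *\<^sub>R v k))\<^sup>2)) \<in> borel_measurable ?G" if "D \<subseteq> A \<union> B" for D e
      using part[OF that] by (intro borel_measurable_times_ennreal) auto
    show ?thesis
      using part[of A] part[of B] by (subst nn_integral_add[OF m m]) (simp_all only: nn_integral_cmult Un_upper1 Un_upper2)
  qed
  also have "\<dots> = ennreal (?c * (gauss_norm A v)\<^sup>2 + ?d * (gauss_norm B v)\<^sup>2)"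
    using ab by (subst (1 2) ennreal_mult[symmetric]) (auto simp: ennreal_plus[symmetric] simp del: ennreal_plus)
  finally have "(gauss_norm (A \<union> B) v)\<^sup>2 \<le> ?c * (gauss_norm A v)\<^sup>2 + ?d * (gauss_norm B v)\<^sup>2"
    using ab by (subst (asm) ennreal_le_iff) auto
  also have "\<dots> \<le> ?c * a\<^sup>2 + ?d * b\<^sup>2"
    using ab by (intro add_mono mult_left_mono power_mono) auto
  also have "\<dots> = (a + b)\<^sup>2" using ab by (simp add: field_simps power2_eq_square)
  finally have "gauss_norm (A \<union> B) v \<le> a + b" using ab by (simp add: power2_le_iff_abs_le abs_le_square_iff[symmetric])
  then show "gauss_norm (A \<union> B) v \<le> gauss_norm A v + gauss_norm B v + e" by (simp add: a_def b_def)
qed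

lemma gauss_norm_Un:
  assumes fin: "finite A" "finite B"
  shows "gauss_norm (A \<union> B) v \<le> gauss_norm A v + gauss_norm B v"
proof -
  have "gauss_norm (A \<union> B) v = gauss_norm (A \<union> (B - A)) v" by simp
  also have "\<dots> \<le> gauss_norm A v + gauss_norm (B - A) v" using fin by (intro gauss_norm_disjoint_Un) auto
  also have "\<dots> \<le> gauss_norm A v + gauss_norm B v" using fin by (intro add_left_mono gauss_norm_mono) auto
  finally show ?thesis .
qed

lemma gauss_norm_UN:
  assumes "finite I" "\<And>i. i \<in> I \<Longrightarrow> finite (A i)"
  shows "gauss_norm (\<Union>i\<in>I. A i) v \<le> (\<Sum>i\<in>I. gauss_norm (A i) v)"
  using assms
proof (induction I)
  case (insert i I)
  have "gauss_norm (\<Union>i\<in>insert i I. A i) v \<le> gauss_norm (A i) v + gauss_norm (\<Union>i\<in>I. A i) v"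
    using insert by (simp add: gauss_norm_Un)
  then show ?case using insert by (simp add: order_trans add_left_mono)
qed simp

section \<open>Covering lemmas and the weak-type maximal estimate\<close>

lemma finite_vitali:
  fixes c :: "'i \<Rightarrow> 'a::metric_space"
  assumes "finite I" "\<And>i. i \<in> I \<Longrightarrow> 0 < r i"
  shows "\<exists>I'\<subseteq>I. pairwise (\<lambda>i j. disjnt (ball (c i) (r i)) (ball (c j) (r j))) I' \<and>
    (\<Union>i\<in>I. ball (c i) (r i)) \<subseteq> (\<Union>i\<in>I'. ball (c i) (3 * r i))"
  using assms
proof (induction I rule: finite_psubset_induct)
  case (psubset I)
  show ?case
  proof (cases "I = {}")
    case False
    define m where "m = Max (r ` I)"
    have m: "m \<in> r ` I" "\<And>i. i \<in> I \<Longrightarrow> r i \<le> m" using psubset.hyps False by (auto simp: m_def)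
    then obtain i0 where i0: "i0 \<in> I" "\<And>i. i \<in> I \<Longrightarrow> r i \<le> r i0" by auto
    let ?S = "{i \<in> I. disjnt (ball (c i) (r i)) (ball (c i0) (r i0))}"
    have "c i0 \<in> ball (c i0) (r i0)" using psubset.prems[OF i0(1)] by simp
    then have "i0 \<notin> ?S" unfolding disjnt_def by blast
    then have "?S \<subset> I" using i0(1) by blast
    from psubset.IH[OF this] psubset.prems obtain I' where I': "I' \<subseteq> ?S"
      "pairwise (\<lambda>i j. disjnt (ball (c i) (r i)) (ball (c j) (r j))) I'"
      "(\<Union>i\<in>?S. ball (c i) (r i)) \<subseteq> (\<Union>i\<in>I'. ball (c i) (3 * r i))" by auto
    show ?thesis
    proof (intro exI[of _ "insert i0 I'"] conjI)
      show "insert i0 I' \<subseteq> I" using i0 I' by auto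
      show "pairwise (\<lambda>i j. disjnt (ball (c i) (r i)) (ball (c j) (r j))) (insert i0 I')"
        using I'(1,2) by (auto simp: pairwise_insert disjnt_sym)
      show "(\<Union>i\<in>I. ball (c i) (r i)) \<subseteq> (\<Union>i\<in>insert i0 I'. ball (c i) (3 * r i))"
      proof
        fix x assume "x \<in> (\<Union>i\<in>I. ball (c i) (r i))"
        then obtain i where i: "i \<in> I" "x \<in> ball (c i) (r i)" by blast
        show "x \<in> (\<Union>i\<in>insert i0 I'. ball (c i) (3 * r i))"
        proof (cases "i \<in> ?S")
          case True
          then show ?thesis using I'(3) i by blast
        next
          case False
          then obtain w where "dist (c i) w < r i" "dist (c i0) w < r i0" using i(1) by (auto simp: disjnt_def)
          then have "dist (c i0) x < 3 * r i0"
            using i i0(2)[OF i(1)] dist_triangle[of "c i0" x w] dist_triangle[of w x "c i"] by (simp add: dist_commute)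
          then show ?thesis by simp
        qed
      qed
    qed
  qed auto
qed

locale doubling_complete = doubling \<mu> n C
  for \<mu> :: "'m::complete_space measure" and n C
begin

text \<open>By packing, separated subsets of the ball have bounded cardinality, and one with the
  most points is an \<open>e\<close>-net. The ball is thus totally bounded, and completeness of the
  space makes it compact.\<close>

lemma compact_cball: "compact (cball (x::'m) r)"
proof -
  have "\<exists>F. finite F \<and> cball x r \<subseteq> (\<Union>z\<in>F. ball z e)" if e: "0 < e" for e
  proof (cases "r < 0")
    case False
    let ?P = "\<lambda>Z. finite Z \<and> Z \<subseteq> cball x r \<and> (\<forall>w\<in>Z. \<forall>w'\<in>Z. w \<noteq> w' \<longrightarrow> e \<le> dist w w')"
    let ?R = "r / e + 2"
    have bound: "card Z < Suc (packing ?R)" if Z: "?P Z" for Z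
    proof -
      have "r < ?R * e" using e by (simp add: field_simps)
      then have "{w \<in> Z. dist x w < ?R * e} = Z" using Z by force
      moreover have "card {w \<in> Z. dist x w < ?R * e} \<le> packing ?R"
        using Z e False by (intro card_separated_le) auto
      ultimately show ?thesis by simp
    qed
    have "\<exists>Z. ?P Z \<and> (\<forall>Y. ?P Y \<longrightarrow> card Y \<le> card Z)"
    proof (rule ex_has_greatest_nat)
      show "?P {}" by simp
      show "\<forall>Z. ?P Z \<longrightarrow> card Z < Suc (packing ?R)" using bound by blast
    qed
    then obtain Z where Z: "?P Z" "\<forall>Y. ?P Y \<longrightarrow> card Y \<le> card Z"
      by (elim exE conjE[of "?P _"]) (rule that)
    have "y \<in> (\<Union>z\<in>Z. ball z e)" if y: "y \<in> cball x r" for y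
    proof (rule ccontr)
      assume n: "y \<notin> (\<Union>z\<in>Z. ball z e)"
      then have d: "e \<le> dist z y" "e \<le> dist y z" if "z \<in> Z" for z using that by (auto simp: dist_commute not_less)
      have "y \<notin> Z" using d(1)[of y] e by auto
      have "?P (insert y Z)" using Z(1) d y by auto
      then have "card (insert y Z) \<le> card Z" using Z(2) by blast
      then show False using Z(1) \<open>y \<notin> Z\<close> by simp
    qed
    then have "finite Z \<and> cball x r \<subseteq> (\<Union>z\<in>Z. ball z e)" using Z(1) by (intro conjI subsetI) (simp only:)
    then show ?thesis by (rule exI)
  qed auto
  then show ?thesis unfolding compact_eq_totally_bounded by (simp add: complete_eq_closed)
qed

text \<open>Vitali's lemma selects disjoint dilated balls, and in each of them the undilated ball
  has a share \<open>\<theta>\<close> of its mass in \<open>E\<close>. Density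
  \<open>\<sigma>\<close> without dilation gives the maximal inequality; density 1 with dilation
  bounds the shadow of a tent.\<close>

lemma measure_dilated_union_le:
  fixes c :: "'i \<Rightarrow> 'm"
  assumes I: "finite I" and R: "\<And>i. i \<in> I \<Longrightarrow> 0 < R i" and b: "1 \<le> b" and \<theta>: "0 < \<theta>"
    and E: "E \<in> fmeasurable \<mu>" and dens: "\<And>i. i \<in> I \<Longrightarrow> \<theta> * measure \<mu> (ball (c i) (R i)) \<le> measure \<mu> (E \<inter> ball (c i) (R i))"
  shows "measure \<mu> (\<Union>i\<in>I. ball (c i) (b * R i)) \<le> C * (3 * b) powr n / \<theta> * measure \<mu> E"
proof -
  have "0 < b * R i" if "i \<in> I" for i using R[OF that] b by simp
  from finite_vitali[where I = I and r = "\<lambda>i. b * R i" and c = c, OF I this] obtain I' where I': "I' \<subseteq> I" "pairwise (\<lambda>i j. disjnt (ball (c i) (b * R i)) (ball (c j) (b * R j))) I'"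
      "(\<Union>i\<in>I. ball (c i) (b * R i)) \<subseteq> (\<Union>i\<in>I'. ball (c i) (3 * (b * R i)))"
    by auto
  have fI': "finite I'" using I'(1) I finite_subset by auto
  have fm: "ball x r \<in> fmeasurable \<mu>" for x r by (rule fmeasurable_bounded_open) auto
  have Rb: "ball (c i) (R i) \<subseteq> ball (c i) (b * R i)" if "i \<in> I" for i
    using b R[OF that] by (intro subset_ball) simp
  have disj: "disjoint_family_on (\<lambda>i. E \<inter> ball (c i) (R i)) I'"
    unfolding disjoint_family_on_def
  proof (intro ballI impI)
    fix i j assume ij: "i \<in> I'" "j \<in> I'" "i \<noteq> j"
    then have "disjnt (ball (c i) (b * R i)) (ball (c j) (b * R j))" using I'(2) by (auto simp: pairwise_def)
    then show "E \<inter> ball (c i) (R i) \<inter> (E \<inter> ball (c j) (R j)) = {}"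
      using Rb[of i] Rb[of j] ij I'(1) unfolding disjnt_def by blast
  qed
  have Em: "E \<inter> ball (c i) (R i) \<in> sets \<mu>" for i using E fm by (auto simp: fmeasurable_def)
  have "measure \<mu> (\<Union>i\<in>I. ball (c i) (b * R i)) \<le> measure \<mu> (\<Union>i\<in>I'. ball (c i) (3 * (b * R i)))"
    using I'(3) fI' fm by (intro measure_mono_fmeasurable fmeasurable.finite_UN) auto
  also have "\<dots> \<le> (\<Sum>i\<in>I'. measure \<mu> (ball (c i) (3 * (b * R i))))"
    using fI' fm by (intro measure_UNION_le) auto
  also have "\<dots> \<le> (\<Sum>i\<in>I'. C * (3 * b) powr n / \<theta> * measure \<mu> (E \<inter> ball (c i) (R i)))"
  proof (rule sum_mono)
    fix i assume "i \<in> I'"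
    then have i: "i \<in> I" using I' by auto
    have "measure \<mu> (ball (c i) (3 * (b * R i))) \<le> C * (3 * b) powr n * measure \<mu> (ball (c i) (R i))"
      using R[OF i] b by (intro measure_ball_le) (auto simp: mult.assoc)
    also have "\<dots> \<le> C * (3 * b) powr n * (measure \<mu> (E \<inter> ball (c i) (R i)) / \<theta>)"
      using dens[OF i] \<theta> C_ge by (intro mult_left_mono) (auto simp: field_simps)
    finally show "measure \<mu> (ball (c i) (3 * (b * R i))) \<le> C * (3 * b) powr n / \<theta> * measure \<mu> (E \<inter> ball (c i) (R i))" by simp
  qed
  also have "\<dots> = C * (3 * b) powr n / \<theta> * measure \<mu> (\<Union>i\<in>I'. E \<inter> ball (c i) (R i))"
    using fI' disj Em E by (subst measure_finite_Union)
      (auto simp: sum_distrib_left intro!: fmeasurableD2[of _ \<mu>] fmeasurable_Int_fmeasurable)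
  also have "\<dots> \<le> C * (3 * b) powr n / \<theta> * measure \<mu> E"
    using C_ge \<theta> E Em fI' by (intro mult_left_mono measure_mono_fmeasurable) auto
  finally show ?thesis .
qed

lemma ratio_le_1: "measure \<mu> (ball c r \<inter> E) / measure \<mu> (ball c r) \<le> 1" if "E \<in> sets \<mu>" for c :: 'm and r E
proof -
  have "measure \<mu> (ball c r \<inter> E) \<le> measure \<mu> (ball c r)"
    using that by (intro measure_ball_mono) auto
  then show ?thesis by (cases "measure \<mu> (ball c r) = 0") (auto simp: divide_le_eq_1 zero_less_measure_iff)
qed

text \<open>The ratios are bounded by 1 and there is a ball about every point, so the real supremum
  is genuine and a value above \<open>\<sigma>\<close> is attained by some single ball.\<close>

lemma enlargement_iff:
  assumes "E \<in> sets \<mu>"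
  shows "x \<in> enlargement \<mu> \<sigma> E \<longleftrightarrow> (\<exists>c r. 0 < r \<and> x \<in> ball c r \<and> \<sigma> < measure \<mu> (ball c r \<inter> E) / measure \<mu> (ball c r))"
proof -
  let ?S = "{(c, r). 0 < r \<and> x \<in> ball c r}"
  have "(x, 1) \<in> ?S" by simp
  then have ne: "?S \<noteq> {}" by blast
  have bdd: "bdd_above ((\<lambda>(c, r). measure \<mu> (ball c r \<inter> E) / measure \<mu> (ball c r)) ` ?S)"
    using ratio_le_1[OF assms] by (intro bdd_aboveI[of _ 1]) auto
  show ?thesis unfolding enlargement_def using less_cSUP_iff[OF ne bdd, of \<sigma>] by auto
qed

lemma subset_enlargement:
  assumes "open E" "\<sigma> < 1"
  shows "E \<subseteq> enlargement \<mu> \<sigma> E"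
proof
  fix x assume "x \<in> E"
  then obtain r where r: "0 < r" "ball x r \<subseteq> E" using assms(1) openE by blast
  then have "ball x r \<inter> E = ball x r" by auto
  then have "\<sigma> < measure \<mu> (ball x r \<inter> E) / measure \<mu> (ball x r)" using measure_ball_pos[OF r(1), of x] assms by simp
  then show "x \<in> enlargement \<mu> \<sigma> E" using r(1) assms by (subst enlargement_iff) (auto intro!: exI[of _ x] exI[of _ r])
qed

text \<open>The weak-type inequality for the maximal function, tested on compact sets because
  finitely many of the balls with large density cover them.\<close>

lemma compact_in_enlargement:
  assumes F: "compact F" "F \<subseteq> enlargement \<mu> \<sigma> E" and E: "E \<in> fmeasurable \<mu>" and \<sigma>: "0 < \<sigma>"
  shows "measure \<mu> F \<le> C * 3 powr n / \<sigma> * measure \<mu> E"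
proof -
  have "\<forall>x\<in>F. \<exists>cr. 0 < snd cr \<and> x \<in> ball (fst cr) (snd cr) \<and> \<sigma> < measure \<mu> (ball (fst cr) (snd cr) \<inter> E) / measure \<mu> (ball (fst cr) (snd cr))"
    using F(2) E by (auto simp: enlargement_iff fmeasurableD)
  from bchoice[OF this] obtain f where f: "\<forall>x\<in>F. 0 < snd (f x) \<and> x \<in> ball (fst (f x)) (snd (f x)) \<and>
      \<sigma> < measure \<mu> (ball (fst (f x)) (snd (f x)) \<inter> E) / measure \<mu> (ball (fst (f x)) (snd (f x)))" by (elim exE) (rule that)
  have "F \<subseteq> (\<Union>x\<in>F. ball (fst (f x)) (snd (f x)))" using f by blast
  then obtain I where I: "I \<subseteq> F" "finite I" "F \<subseteq> (\<Union>x\<in>I. ball (fst (f x)) (snd (f x)))"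
    using compactE_image[OF F(1), of F "\<lambda>x. ball (fst (f x)) (snd (f x))"] by (metis open_ball)
  have "measure \<mu> F \<le> measure \<mu> (\<Union>x\<in>I. ball (fst (f x)) (1 * snd (f x)))"
  proof (rule measure_mono_fmeasurable)
    show "F \<in> sets \<mu>" using F(1) by (simp add: sets_eq borel_compact)
    show "(\<Union>x\<in>I. ball (fst (f x)) (1 * snd (f x))) \<in> fmeasurable \<mu>"
      using I(2) by (intro fmeasurable.finite_UN fmeasurable_bounded_open) auto
  qed (use I(3) in simp)
  also have "\<dots> \<le> C * (3 * 1) powr n / \<sigma> * measure \<mu> E"
  proof (rule measure_dilated_union_le[OF I(2) _ _ \<sigma> E])
    fix x assume "x \<in> I"
    then have x: "x \<in> F" using I(1) by auto
    have "0 < measure \<mu> (ball (fst (f x)) (snd (f x)))" using f x by (intro measure_ball_pos) auto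
    then show "\<sigma> * measure \<mu> (ball (fst (f x)) (snd (f x))) \<le> measure \<mu> (E \<inter> ball (fst (f x)) (snd (f x)))"
      using f x by (auto simp: field_simps Int_commute less_imp_le)
  qed (use f I(1) in auto)
  finally show ?thesis by simp
qed

text \<open>Closed balls of half the radius are compact and stay inside the enlargement, so their
  union is controlled by \<open>E\<close>. Dilating them by \<open>2 * \<alpha>\<close> recovers the
  balls of radius \<open>\<alpha> * r j\<close>.\<close>

lemma measure_tent_shadow_le:
  fixes y :: "nat \<Rightarrow> 'm"
  assumes J: "finite J" and r: "\<And>j. j \<in> J \<Longrightarrow> 0 < r j" and sub: "\<And>j. j \<in> J \<Longrightarrow> ball (y j) (r j) \<subseteq> enlargement \<mu> \<sigma> E"
    and E: "E \<in> fmeasurable \<mu>" and \<sigma>: "0 < \<sigma>" and a: "1 \<le> \<alpha>"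
  shows "measure \<mu> (\<Union>j\<in>J. ball (y j) (\<alpha> * r j)) \<le> C * (6 * \<alpha>) powr n * (C * 3 powr n / \<sigma>) * measure \<mu> E"
proof -
  let ?F = "\<Union>j\<in>J. cball (y j) (r j / 2)"
  have cF: "compact ?F" using J compact_cball by (intro compact_UN) auto
  have "?F \<subseteq> enlargement \<mu> \<sigma> E"
  proof
    fix x assume "x \<in> ?F"
    then obtain j where j: "j \<in> J" "dist (y j) x \<le> r j / 2" by auto
    then have "x \<in> ball (y j) (r j)" using r[OF j(1)] by simp
    then show "x \<in> enlargement \<mu> \<sigma> E" using sub[OF j(1)] by blast
  qed
  then have F: "measure \<mu> ?F \<le> C * 3 powr n / \<sigma> * measure \<mu> E" by (rule compact_in_enlargement[OF cF _ E \<sigma>])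
  have Fm: "?F \<in> fmeasurable \<mu>"
  proof -
    have "(\<Union>j\<in>J. ball (y j) (r j)) \<in> fmeasurable \<mu>" using J by (intro fmeasurable.finite_UN fmeasurable_bounded_open) auto
    moreover have "?F \<subseteq> (\<Union>j\<in>J. ball (y j) (r j))" using r by fastforce
    moreover have "?F \<in> sets \<mu>" unfolding sets_eq by (rule borel_compact[OF cF])
    ultimately show ?thesis by (rule fmeasurableI2)
  qed
  have "measure \<mu> (\<Union>j\<in>J. ball (y j) (2 * \<alpha> * (r j / 2))) \<le> C * (3 * (2 * \<alpha>)) powr n / 1 * measure \<mu> ?F"
  proof (rule measure_dilated_union_le[OF J _ _ _ Fm])
    fix j assume j: "j \<in> J"
    have "ball (y j) (r j / 2) \<subseteq> ?F" using j by (auto intro!: bexI[of _ j])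
    then have "?F \<inter> ball (y j) (r j / 2) = ball (y j) (r j / 2)" by blast
    then show "1 * measure \<mu> (ball (y j) (r j / 2)) \<le> measure \<mu> (?F \<inter> ball (y j) (r j / 2))" by simp
  qed (use r a in auto)
  also have "\<dots> \<le> C * (3 * (2 * \<alpha>)) powr n / 1 * (C * 3 powr n / \<sigma> * measure \<mu> E)"
    using F C_ge by (intro mult_left_mono) auto
  finally show ?thesis by (simp add: mult_ac)
qed

end

text \<open>The last active power of 2 is below \<open>s\<close>, and the powers before it add up to
  at most the same amount.\<close>

lemma dyadic_layer_sum_le:
  fixes s :: real and l :: int
  assumes "0 \<le> s"
  shows "(\<Sum>i<m. 2 powi (l + int i) * (if 2 powi (l + int i) < s then 1 else 0)) \<le> 2 * s"
proof (induction m)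
  case (Suc m)
  have *: "(\<Sum>i<m. (2::real) powi (l + int i) * (if 2 powi (l + int i) < s then 1 else 0)) \<le> 2 powi (l + int m)" for m
  proof (induction m)
    case (Suc m)
    have "2 powi (l + int (Suc m)) = 2 * (2::real) powi (l + int m)" by (simp add: power_int_add add.assoc[symmetric])
    moreover have "2 powi (l + int m) * (if 2 powi (l + int m) < s then 1 else 0) \<le> (2::real) powi (l + int m)" by simp
    ultimately show ?case using Suc.IH by (simp only: sum.lessThan_Suc)
  qed simp
  show ?case
  proof (cases "2 powi (l + int m) < s")
    case True
    then show ?thesis using *[of m] by simp
  next
    case False
    then show ?thesis using Suc by simp
  qed
qed (use assms in simp)

section \<open>Decomposition along the level sets of the area functional\<close>

context doubling_complete
begin

text \<open>For aperture 1 the functional of the piece is bounded by \<open>M * h\<close> and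
  supported on a set of measure comparable to that of \<open>E\<close>, which controls its p-th
  moment. For aperture \<open>\<alpha>\<close> the support has measure at most a constant times
  \<open>\<alpha> powr n * measure \<mu> E\<close>, so truncation at height \<open>h\<close> leads
  back from the p-th power to the first.\<close>

lemma piece_estimate:
  fixes v :: "nat \<Rightarrow> 'x::banach" and y :: "nat \<Rightarrow> 'm" and k :: "nat \<Rightarrow> int"
  assumes p: "1 < p" "p \<le> 2" and KE: "0 \<le> KE" and a: "1 \<le> \<alpha>" and P: "finite P"
    and Lp: "(\<integral>\<^sup>+x. gauss_expect {j\<in>P. dist x (y j) < \<alpha> * 2 powi k j} v (\<lambda>z. ennreal (norm z powr p)) \<partial>\<mu>)
      \<le> ennreal (KE * \<alpha> powr (n * p)) * (\<integral>\<^sup>+x. gauss_expect {j\<in>P. dist x (y j) < 2 powi k j} v (\<lambda>z. ennreal (norm z powr p)) \<partial>\<mu>)"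
    and \<sigma>: "0 < \<sigma>" and E: "E \<in> fmeasurable \<mu>" and sub: "\<And>j. j \<in> P \<Longrightarrow> ball (y j) (2 powi k j) \<subseteq> enlargement \<mu> \<sigma> E"
    and h: "0 < h" and M: "0 \<le> M" and bound: "\<And>x. gauss_norm {j\<in>P. dist x (y j) < 2 powi k j} v \<le> M * h"
  shows "(\<integral>\<^sup>+x. ennreal (gauss_norm {j\<in>P. dist x (y j) < \<alpha> * 2 powi k j} v) \<partial>\<mu>)
    \<le> ennreal (C * 6 powr n * (C * 3 powr n / \<sigma>) * (1 + 240 powr p * KE * 2 * M powr p) * \<alpha> powr (n * p) * h * measure \<mu> E)"
proof -
  let ?F = "\<lambda>z::'x. ennreal (norm z powr p)"
  let ?A = "\<lambda>\<beta> x. {j\<in>P. dist x (y j) < \<beta> * 2 powi k j}"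
  define U where "U \<beta> = (\<Union>j\<in>P. ball (y j) (\<beta> * 2 powi k j))" for \<beta> :: real
  define W where "W = C * 6 powr n * (C * 3 powr n / \<sigma>)"
  have W0: "0 \<le> W" using C_ge \<sigma> by (simp add: W_def)
  have Um: "U \<beta> \<in> fmeasurable \<mu>" for \<beta>
    unfolding U_def using P by (intro fmeasurable.finite_UN fmeasurable_bounded_open) auto
  have Us: "U \<beta> \<in> sets \<mu>" for \<beta> using Um by (rule fmeasurableD)
  have Ue: "emeasure \<mu> (U \<beta>) = ennreal (measure \<mu> (U \<beta>))" for \<beta>
    using Um by (intro emeasure_eq_measure2)
  have Ub: "measure \<mu> (U \<beta>) \<le> W * \<beta> powr n * measure \<mu> E" if "1 \<le> \<beta>" for \<beta>
    using measure_tent_shadow_le[OF P _ sub E \<sigma> that] unfolding U_def W_def using that by (simp add: powr_mult mult_ac)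
  have emp: "?A \<beta> x = {}" if "x \<notin> U \<beta>" for \<beta> x using that by (auto simp: U_def dist_commute)
  have fA: "finite (?A \<beta> x)" for \<beta> x using P by simp
  have p1: "1 \<le> p" using p by simp
  have mS: "(\<lambda>x. ennreal (gauss_norm (?A \<beta> x) v powr p)) \<in> borel_measurable \<mu>" for \<beta>
    by (rule ball_pattern_measurable[OF P])
  have mE: "(\<lambda>x. gauss_expect (?A \<beta> x) v ?F) \<in> borel_measurable \<mu>" for \<beta>
    by (rule ball_pattern_measurable[OF P])
  have "(\<integral>\<^sup>+x. gauss_expect (?A 1 x) v ?F \<partial>\<mu>) \<le> (\<integral>\<^sup>+x. ennreal (2 * (M * h) powr p) * indicator (U 1) x \<partial>\<mu>)"
  proof (rule nn_integral_mono)
    fix x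
    show "gauss_expect (?A 1 x) v ?F \<le> ennreal (2 * (M * h) powr p) * indicator (U 1) x"
    proof (cases "x \<in> U 1")
      case True
      have "gauss_expect (?A 1 x) v ?F \<le> ennreal (2 * gauss_norm (?A 1 x) v powr p)"
        using p by (intro gauss_expect_powr_le fA) auto
      also have "\<dots> \<le> ennreal (2 * (M * h) powr p)"
        using bound[of x] p by (intro ennreal_leI mult_left_mono powr_mono2) auto
      finally show ?thesis using True by simp
    next
      case False
      show ?thesis unfolding emp[OF False] by simp
    qed
  qed
  also have "\<dots> = ennreal (2 * (M * h) powr p * measure \<mu> (U 1))"
    using Us Ue[of 1] by (simp add: nn_integral_cmult_indicator ennreal_mult)
  also have "\<dots> \<le> ennreal (2 * (M * h) powr p * (W * measure \<mu> E))"
    using Ub[of 1] by (intro ennreal_leI mult_left_mono) auto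
  finally have I1: "(\<integral>\<^sup>+x. gauss_expect (?A 1 x) v ?F \<partial>\<mu>) \<le> ennreal (2 * (M * h) powr p * (W * measure \<mu> E))" .
  have "(\<integral>\<^sup>+x. ennreal (gauss_norm (?A \<alpha> x) v powr p) \<partial>\<mu>) \<le> (\<integral>\<^sup>+x. ennreal (240 powr p) * gauss_expect (?A \<alpha> x) v ?F \<partial>\<mu>)"
    by (intro nn_integral_mono gauss_norm_powr_le fA p1)
  also have "\<dots> = ennreal (240 powr p) * (\<integral>\<^sup>+x. gauss_expect (?A \<alpha> x) v ?F \<partial>\<mu>)"
    by (rule nn_integral_cmult[OF mE])
  also have "\<dots> \<le> ennreal (240 powr p) * (ennreal (KE * \<alpha> powr (n * p)) * ennreal (2 * (M * h) powr p * (W * measure \<mu> E)))"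
    using order_trans[OF Lp mult_left_mono[OF I1[simplified]]] by (intro mult_left_mono) auto
  also have "\<dots> = ennreal (240 powr p * (KE * \<alpha> powr (n * p) * (2 * (M * h) powr p * (W * measure \<mu> E))))"
    using KE W0 by (simp add: ennreal_mult)
  finally have Ia: "(\<integral>\<^sup>+x. ennreal (gauss_norm (?A \<alpha> x) v powr p) \<partial>\<mu>)
     \<le> ennreal (240 powr p * (KE * \<alpha> powr (n * p) * (2 * (M * h) powr p * (W * measure \<mu> E))))" .
  have "(\<integral>\<^sup>+x. ennreal (gauss_norm (?A \<alpha> x) v) \<partial>\<mu>)
    \<le> (\<integral>\<^sup>+x. ennreal h * indicator (U \<alpha>) x + ennreal (h powr (1 - p)) * ennreal (gauss_norm (?A \<alpha> x) v powr p) \<partial>\<mu>)"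
  proof (rule nn_integral_mono)
    fix x
    show "ennreal (gauss_norm (?A \<alpha> x) v) \<le> ennreal h * indicator (U \<alpha>) x + ennreal (h powr (1 - p)) * ennreal (gauss_norm (?A \<alpha> x) v powr p)"
    proof (cases "x \<in> U \<alpha>")
      case True
      have "ennreal (gauss_norm (?A \<alpha> x) v) \<le> ennreal (h + h powr (1 - p) * gauss_norm (?A \<alpha> x) v powr p)"
        using h p1 by (intro ennreal_leI powr_split_le) auto
      then show ?thesis using True h by (simp add: ennreal_mult)
    next
      case False
      show ?thesis unfolding emp[OF False] by simp
    qed
  qed
  also have "\<dots> = ennreal h * emeasure \<mu> (U \<alpha>) + ennreal (h powr (1 - p)) * (\<integral>\<^sup>+x. ennreal (gauss_norm (?A \<alpha> x) v powr p) \<partial>\<mu>)"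
  proof -
    have "(\<lambda>x. ennreal h * indicator (U \<alpha>) x) \<in> borel_measurable \<mu>" using Us by measurable
    moreover have "(\<lambda>x. ennreal (h powr (1 - p)) * ennreal (gauss_norm (?A \<alpha> x) v powr p)) \<in> borel_measurable \<mu>"
      by (intro borel_measurable_times_ennreal borel_measurable_const mS)
    ultimately show ?thesis
      by (subst nn_integral_add) (simp_all only: nn_integral_cmult[OF mS] nn_integral_cmult_indicator[OF Us])
  qed
  also have "\<dots> \<le> ennreal h * ennreal (W * \<alpha> powr n * measure \<mu> E)
      + ennreal (h powr (1 - p)) * ennreal (240 powr p * (KE * \<alpha> powr (n * p) * (2 * (M * h) powr p * (W * measure \<mu> E))))"
    unfolding Ue using Ub[OF a] Ia by (intro add_mono mult_left_mono ennreal_leI) auto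
  also have "\<dots> = ennreal (h * (W * \<alpha> powr n * measure \<mu> E) + h powr (1 - p) * (240 powr p * (KE * \<alpha> powr (n * p) * (2 * (M * h) powr p * (W * measure \<mu> E)))))"
    using h W0 KE by (simp add: ennreal_mult)
  also have "\<dots> \<le> ennreal (W * (1 + 240 powr p * KE * 2 * M powr p) * \<alpha> powr (n * p) * h * measure \<mu> E)"
  proof (rule ennreal_leI)
    \<comment> \<open>The truncated part costs only the measure of the support; its smaller power of
      \<open>\<alpha>\<close> is absorbed.\<close>
    have "\<alpha> powr n \<le> \<alpha> powr (n * p)" using a p n_pos by (intro powr_mono) auto
    then have "h * (W * \<alpha> powr n * measure \<mu> E) \<le> h * (W * \<alpha> powr (n * p) * measure \<mu> E)"
      using h W0 by (intro mult_left_mono mult_right_mono) auto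
    \<comment> \<open>The powers of \<open>h\<close> combine to \<open>h\<close> itself, so a piece
      costs its level times the measure of its level set.\<close>
    moreover have hp: "h powr (1 - p) * (M * h) powr p = M powr p * h"
      using h M by (simp add: powr_mult powr_diff)
    have "h powr (1 - p) * (240 powr p * (KE * \<alpha> powr (n * p) * (2 * (M * h) powr p * (W * measure \<mu> E))))
      = 240 powr p * (KE * \<alpha> powr (n * p) * (2 * (h powr (1 - p) * (M * h) powr p) * (W * measure \<mu> E)))"
      by (simp only: mult_ac)
    then have "h powr (1 - p) * (240 powr p * (KE * \<alpha> powr (n * p) * (2 * (M * h) powr p * (W * measure \<mu> E))))
      = 240 powr p * (KE * \<alpha> powr (n * p) * (2 * (M powr p * h) * (W * measure \<mu> E)))" by (simp only: hp)
    ultimately have "h * (W * \<alpha> powr n * measure \<mu> E) + h powr (1 - p) * (240 powr p * (KE * \<alpha> powr (n * p) * (2 * (M * h) powr p * (W * measure \<mu> E))))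
      \<le> h * (W * \<alpha> powr (n * p) * measure \<mu> E) + 240 powr p * (KE * \<alpha> powr (n * p) * (2 * (M powr p * h) * (W * measure \<mu> E)))"
      by (intro add_mono) (simp_all only: order_refl)
    also have "\<dots> = W * (1 + 240 powr p * KE * 2 * M powr p) * \<alpha> powr (n * p) * h * measure \<mu> E"
      by (simp add: algebra_simps)
    finally show "h * (W * \<alpha> powr n * measure \<mu> E) + h powr (1 - p) * (240 powr p * (KE * \<alpha> powr (n * p) * (2 * (M * h) powr p * (W * measure \<mu> E))))
      \<le> W * (1 + 240 powr p * KE * 2 * M powr p) * \<alpha> powr (n * p) * h * measure \<mu> E" .
  qed
  finally show ?thesis unfolding W_def .
qed

text \<open>Since no single vector has norm zero, there is a dyadic level below all of them. The
  level set there contains every base ball, so the decomposition can start at a finite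
  level.\<close>

lemma L1_estimate_nondegenerate:
  assumes umd: "umd_space TYPE('x::banach)" and p: "1 < p" "p \<le> 2" and cc: "cone_covering_property \<mu>"
  shows "\<exists>K\<ge>0. \<forall>\<alpha>\<ge>1. \<forall>J y k (v :: nat \<Rightarrow> 'x). finite J \<longrightarrow> (\<forall>j\<in>J. 0 < gauss_norm {j} v) \<longrightarrow>
     (\<integral>\<^sup>+x. ennreal (gauss_norm {j\<in>J. dist x (y j) < \<alpha> * 2 powi k j} v) \<partial>\<mu>)
    \<le> ennreal (K * \<alpha> powr (n * p)) * (\<integral>\<^sup>+x. ennreal (gauss_norm {j\<in>J. dist x (y j) < 2 powi k j} v) \<partial>\<mu>)"
proof -
  obtain KE where KE: "0 \<le> KE" and Lp0: "\<forall>\<alpha>\<ge>1. \<forall>J y k (v :: nat \<Rightarrow> 'x). finite J \<longrightarrow>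
     (\<integral>\<^sup>+x. gauss_expect {j\<in>J. dist x (y j) < \<alpha> * 2 powi k j} v (\<lambda>z. ennreal (norm z powr p)) \<partial>\<mu>)
    \<le> ennreal (KE * \<alpha> powr (n * p)) * (\<integral>\<^sup>+x. gauss_expect {j\<in>J. dist x (y j) < 2 powi k j} v (\<lambda>z. ennreal (norm z powr p)) \<partial>\<mu>)"
    using Lp_estimate[OF umd p(1)] by (elim exE conjE) (rule that)
  obtain \<sigma> N where \<sigma>: "0 < \<sigma>" "\<sigma> < 1" and cov0: "\<forall>E. open E \<and> bounded E \<longrightarrow> (\<forall>x\<in>E.
        \<exists>F. finite F \<and> card F \<le> N \<and> F \<subseteq> - E \<and>
            cone 1 x - tent (enlargement \<mu> \<sigma> E) \<subseteq> (\<Union>z\<in>F. cone 1 z))"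
    using cc unfolding cone_covering_property_def by (elim exE conjE) (rule that)
  \<comment> \<open>Each of the at most \<open>N\<close> covering cones contributes
    \<open>2 * h i\<close>. The additional 1 serves the points outside the next level set, also when
    \<open>N = 0\<close>.\<close>
  define M where "M = 2 * (real N + 1)"
  define K1 where "K1 = C * 6 powr n * (C * 3 powr n / \<sigma>) * (1 + 240 powr p * KE * 2 * M powr p)"
  have K1: "0 \<le> K1" using C_ge \<sigma> KE by (simp add: K1_def)
  have M0: "0 \<le> M" by (simp add: M_def)
  show ?thesis
  proof (intro exI[of _ "2 * K1"] conjI allI impI)
    show "0 \<le> 2 * K1" using K1 by simp
    fix \<alpha> :: real and J :: "nat set" and y :: "nat \<Rightarrow> 'm" and k :: "nat \<Rightarrow> int" and v :: "nat \<Rightarrow> 'x"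
    assume a: "1 \<le> \<alpha>" and J: "finite J" and pos: "\<forall>j\<in>J. 0 < gauss_norm {j} v"
    define A where "A \<beta> x = {j\<in>J. dist x (y j) < \<beta> * 2 powi k j}" for \<beta> :: real and x
    define S where "S \<beta> x = gauss_norm (A \<beta> x) v" for \<beta> x
    have fA: "finite (A \<beta> x)" for \<beta> x using J by (simp add: A_def)
    have S0: "0 \<le> S \<beta> x" for \<beta> x by (simp add: S_def)
    have SJ: "S \<beta> x \<le> gauss_norm J v" for \<beta> x
      unfolding S_def using J by (intro gauss_norm_mono) (auto simp: A_def)
    have r0: "0 < (2::real) powi k j" for j by simp
    obtain l :: int where l: "\<And>j. j \<in> J \<Longrightarrow> 2 powi l < gauss_norm {j} v"
    proof -
      have "\<exists>i::nat. \<forall>j\<in>J. (1/2) ^ i < gauss_norm {j} v"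
      proof (cases "J = {}")
        case False
        define c where "c = Min ((\<lambda>j. gauss_norm {j} v) ` J)"
        have c: "c \<in> (\<lambda>j. gauss_norm {j} v) ` J" "\<And>j. j \<in> J \<Longrightarrow> c \<le> gauss_norm {j} v" using J False by (auto simp: c_def)
        then have "0 < c" using pos by auto
        then obtain i where "(1/2) ^ i < c" using real_arch_pow_inv[of c "1/2"] by auto
        then show ?thesis using c(2) by (intro exI[of _ i]) (auto intro: less_le_trans)
      qed simp
      then obtain i :: nat where i: "\<forall>j\<in>J. (1/2) ^ i < gauss_norm {j} v" by blast
      have "(2::real) powi (- int i) = (1/2) ^ i" by (simp add: power_int_minus power_one_over inverse_eq_divide)
      then show thesis using that[of "- int i"] i by simp
    qed
    \<comment> \<open>Above the norm of the whole family all level sets are empty, so finitely many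
      levels suffice.\<close>
    obtain m :: nat where m: "gauss_norm J v \<le> 2 powi (l + int m)"
    proof -
      obtain m where "gauss_norm J v / 2 powi l < 2 ^ m" using real_arch_pow[of 2 "gauss_norm J v / 2 powi l"] by auto
      then have "gauss_norm J v \<le> 2 powi l * 2 ^ m" by (simp add: field_simps)
      also have "\<dots> = 2 powi (l + int m)" by (simp add: power_int_add)
      finally show thesis by (rule that)
    qed
    define h where "h i = (2::real) powi (l + int i)" for i
    have h0: "0 < h i" for i by (simp add: h_def)
    have hS: "h (Suc i) = 2 * h i" for i by (simp add: h_def power_int_add add.assoc[symmetric])
    define E where "E i = {x. h i < S 1 x}" for i
    have E_sub: "E i \<subseteq> (\<Union>j\<in>J. ball (y j) (2 powi k j))" for i
    proof
      fix x assume "x \<in> E i"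
      then have "A 1 x \<noteq> {}" using h0[of i] by (auto simp: E_def S_def)
      then show "x \<in> (\<Union>j\<in>J. ball (y j) (2 powi k j))" by (auto simp: A_def dist_commute)
    qed
    \<comment> \<open>A slightly moved point stays in all the open balls that contained it, so the
      functional is lower semicontinuous.\<close>
    have oE: "open (E i)" for i
    proof (rule openI)
      fix x assume x: "x \<in> E i"
      let ?O = "\<Inter>j\<in>A 1 x. ball (y j) (2 powi k j)"
      have "open ?O" using fA by (intro open_INT) auto
      moreover have "x \<in> ?O" by (auto simp: A_def dist_commute)
      ultimately obtain e where e: "0 < e" "ball x e \<subseteq> ?O" using openE by blast
      have "ball x e \<subseteq> E i"
      proof
        fix z assume "z \<in> ball x e"
        then have "z \<in> ?O" using e by blast
        then have "A 1 x \<subseteq> A 1 z" by (auto simp: A_def dist_commute)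
        then have "S 1 x \<le> S 1 z" unfolding S_def by (intro gauss_norm_mono fA)
        then show "z \<in> E i" using x by (auto simp: E_def)
      qed
      then show "\<exists>e>0. ball x e \<subseteq> E i" using e(1) by blast
    qed
    have bE: "bounded (E i)" for i
      by (rule bounded_subset[OF _ E_sub]) (use J in auto)
    have Em: "E i \<in> fmeasurable \<mu>" for i
    proof -
      have "(\<Union>j\<in>J. ball (y j) (2 powi k j)) \<in> fmeasurable \<mu>" using J by (intro fmeasurable.finite_UN fmeasurable_bounded_open) auto
      then show ?thesis using E_sub open_sets[OF oE] by (rule fmeasurableI2)
    qed
    define Jt where "Jt i = {j\<in>J. ball (y j) (2 powi k j) \<subseteq> enlargement \<mu> \<sigma> (E i)}" for i
    \<comment> \<open>By the choice of \<open>l\<close> every base ball lies in \<open>E 0\<close>,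
      which is contained in its enlargement.\<close>
    have Jt0: "Jt 0 = J"
    proof -
      have "ball (y j) (2 powi k j) \<subseteq> E 0" if j: "j \<in> J" for j
      proof
        fix x assume "x \<in> ball (y j) (2 powi k j)"
        then have "{j} \<subseteq> A 1 x" using j by (auto simp: A_def dist_commute)
        then have "gauss_norm {j} v \<le> S 1 x" unfolding S_def by (intro gauss_norm_mono fA)
        then show "x \<in> E 0" using l[OF j] by (simp add: E_def h_def)
      qed
      then show ?thesis using subset_enlargement[OF oE \<sigma>(2), of 0] by (auto simp: Jt_def)
    qed
    have Jtm: "Jt m = {}"
    proof -
      have "E m = {}" using order_trans[OF SJ m] by (auto simp: E_def h_def not_less)
      then have "enlargement \<mu> \<sigma> (E m) = {}"
        using \<sigma>(1) by (auto simp: enlargement_iff)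
      moreover have "y j \<in> ball (y j) (2 powi k j)" for j using r0 by simp
      ultimately show ?thesis unfolding Jt_def by blast
    qed
    \<comment> \<open>Membership in the tent at level \<open>i\<close> controls the support of the
      piece; absence from the tent at level \<open>i + 1\<close> controls its size.\<close>
    define P where "P i = Jt i - Jt (Suc i)" for i
    have PJ: "P i \<subseteq> J" for i by (auto simp: P_def Jt_def)
    have fP: "finite (P i)" for i using PJ J finite_subset by blast
    have JP: "J \<subseteq> (\<Union>i<m. P i)"
    proof
      fix j assume j: "j \<in> J"
      \<comment> \<open>All indices are in \<open>Jt 0\<close> and none in \<open>Jt m\<close>, so
        each one drops out at some level in between.\<close>
      have "j \<in> Jt i \<or> j \<in> (\<Union>i'<i. P i')" for i
      proof (induction i)
        case 0
        show ?case using j Jt0 by simp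
      next
        case (Suc i)
        show ?case
        proof (cases "j \<in> Jt (Suc i)")
          case False
          then have "j \<in> P i \<or> j \<in> (\<Union>i'<i. P i')" using Suc by (auto simp: P_def)
          then show ?thesis by (auto simp: lessThan_Suc)
        qed simp
      qed
      from this[of m] Jtm show "j \<in> (\<Union>i<m. P i)" by simp
    qed
    have bound: "gauss_norm {j\<in>P i. dist x (y j) < 2 powi k j} v \<le> M * h i" for i x
    proof (cases "x \<in> E (Suc i)")
      case False
      have "gauss_norm {j\<in>P i. dist x (y j) < 2 powi k j} v \<le> S 1 x"
        unfolding S_def using PJ by (intro gauss_norm_mono fA) (auto simp: A_def)
      also have "\<dots> \<le> 2 * h i" using False by (simp add: E_def hS)
      also have "\<dots> \<le> M * h i" using h0[of i] by (intro mult_right_mono) (auto simp: M_def)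
      finally show ?thesis .
    next
      case True
      \<comment> \<open>The points of the piece lie outside the next tent, hence in cones over at
        most \<open>N\<close> points outside the next level set. At those points the functional is
        at most \<open>h (Suc i) = 2 * h i\<close>.\<close>
      from cov0[THEN spec, THEN mp, OF conjI[OF oE bE], THEN bspec, OF this] obtain F where F: "finite F" "card F \<le> N" "F \<subseteq> - E (Suc i)"
          "cone 1 x - tent (enlargement \<mu> \<sigma> (E (Suc i))) \<subseteq> (\<Union>z\<in>F. cone 1 z)"
        by (elim exE conjE) (rule that)
      have sub: "{j\<in>P i. dist x (y j) < 2 powi k j} \<subseteq> (\<Union>z\<in>F. A 1 z)"
      proof
        fix j assume "j \<in> {j\<in>P i. dist x (y j) < 2 powi k j}"
        then have j: "j \<in> J" "j \<notin> Jt (Suc i)" "dist x (y j) < 2 powi k j" by (auto simp: P_def Jt_def)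
        then have "(y j, 2 powi k j) \<in> cone 1 x - tent (enlargement \<mu> \<sigma> (E (Suc i)))"
          using r0[of j] by (simp add: cone_def tent_def Jt_def)
        then obtain z where "z \<in> F" "(y j, 2 powi k j) \<in> cone 1 z" using F(4) by blast
        then show "j \<in> (\<Union>z\<in>F. A 1 z)" using j(1) by (auto simp: cone_def A_def)
      qed
      have "gauss_norm {j\<in>P i. dist x (y j) < 2 powi k j} v \<le> gauss_norm (\<Union>z\<in>F. A 1 z) v"
        using sub F(1) fA by (intro gauss_norm_mono) auto
      also have "\<dots> \<le> (\<Sum>z\<in>F. S 1 z)" unfolding S_def by (rule gauss_norm_UN[OF F(1) fA])
      also have "\<dots> \<le> (\<Sum>z\<in>F. 2 * h i)"
        using F(3) by (intro sum_mono) (auto simp: E_def hS not_less)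
      also have "\<dots> = real (card F) * (2 * h i)" by simp
      also have "\<dots> \<le> (real N + 1) * (2 * h i)" using F(2) h0[of i] by (intro mult_right_mono) auto
      finally show ?thesis by (simp add: M_def mult_ac)
    qed
    have piece: "(\<integral>\<^sup>+x. ennreal (gauss_norm {j\<in>P i. dist x (y j) < \<alpha> * 2 powi k j} v) \<partial>\<mu>)
      \<le> ennreal (K1 * \<alpha> powr (n * p) * h i * measure \<mu> (E i))" for i
      unfolding K1_def
    proof (rule piece_estimate[OF p KE a fP _ \<sigma>(1) Em _ h0 M0 bound])
      show "(\<integral>\<^sup>+x. gauss_expect {j\<in>P i. dist x (y j) < \<alpha> * 2 powi k j} v (\<lambda>z. ennreal (norm z powr p)) \<partial>\<mu>)
        \<le> ennreal (KE * \<alpha> powr (n * p)) * (\<integral>\<^sup>+x. gauss_expect {j\<in>P i. dist x (y j) < 2 powi k j} v (\<lambda>z. ennreal (norm z powr p)) \<partial>\<mu>)"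
        by (rule Lp0[THEN spec, THEN mp, OF a, THEN spec, THEN spec, THEN spec, THEN spec, THEN mp, OF fP])
      fix j assume "j \<in> P i"
      then show "ball (y j) (2 powi k j) \<subseteq> enlargement \<mu> \<sigma> (E i)" by (auto simp: P_def Jt_def)
    qed
    have mp: "(\<lambda>x. ennreal (gauss_norm {j\<in>P i. dist x (y j) < \<alpha> * 2 powi k j} v)) \<in> borel_measurable \<mu>" for i
      by (rule ball_pattern_measurable[OF fP])
    have "(\<integral>\<^sup>+x. ennreal (S \<alpha> x) \<partial>\<mu>) \<le> (\<integral>\<^sup>+x. (\<Sum>i<m. ennreal (gauss_norm {j\<in>P i. dist x (y j) < \<alpha> * 2 powi k j} v)) \<partial>\<mu>)"
    proof (rule nn_integral_mono)
      fix x
      have "S \<alpha> x \<le> gauss_norm (\<Union>i\<in>{..<m}. {j\<in>P i. dist x (y j) < \<alpha> * 2 powi k j}) v"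
        unfolding S_def using JP fP by (intro gauss_norm_mono) (auto simp: A_def)
      also have "\<dots> \<le> (\<Sum>i<m. gauss_norm {j\<in>P i. dist x (y j) < \<alpha> * 2 powi k j} v)"
        using fP by (intro gauss_norm_UN) auto
      finally show "ennreal (S \<alpha> x) \<le> (\<Sum>i<m. ennreal (gauss_norm {j\<in>P i. dist x (y j) < \<alpha> * 2 powi k j} v))"
        by (simp add: sum_ennreal ennreal_leI)
    qed
    also have "\<dots> = (\<Sum>i<m. \<integral>\<^sup>+x. ennreal (gauss_norm {j\<in>P i. dist x (y j) < \<alpha> * 2 powi k j} v) \<partial>\<mu>)"
      by (rule nn_integral_sum[OF mp])
    also have "\<dots> \<le> (\<Sum>i<m. ennreal (K1 * \<alpha> powr (n * p)) * (ennreal (h i) * emeasure \<mu> (E i)))"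
    proof (rule sum_mono)
      fix i
      have "emeasure \<mu> (E i) = ennreal (measure \<mu> (E i))" using Em by (intro emeasure_eq_measure2)
      then show "(\<integral>\<^sup>+x. ennreal (gauss_norm {j\<in>P i. dist x (y j) < \<alpha> * 2 powi k j} v) \<partial>\<mu>)
        \<le> ennreal (K1 * \<alpha> powr (n * p)) * (ennreal (h i) * emeasure \<mu> (E i))"
        using piece[of i] K1 h0[of i] by (simp add: ennreal_mult mult_ac)
    qed
    also have "\<dots> = ennreal (K1 * \<alpha> powr (n * p)) * (\<Sum>i<m. ennreal (h i) * emeasure \<mu> (E i))"
      by (rule sum_distrib_left[symmetric])
    also have "(\<Sum>i<m. ennreal (h i) * emeasure \<mu> (E i)) = (\<integral>\<^sup>+x. (\<Sum>i<m. ennreal (h i) * indicator (E i) x) \<partial>\<mu>)"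
      using open_sets[OF oE] by (subst nn_integral_sum) (auto simp: nn_integral_cmult_indicator)
    \<comment> \<open>Layer cake summation: the dyadic levels below \<open>S 1 x\<close> add up to
      at most \<open>2 * S 1 x\<close>, which explains the factor 2 in the constant.\<close>
    also have "\<dots> \<le> (\<integral>\<^sup>+x. 2 * ennreal (S 1 x) \<partial>\<mu>)"
    proof (rule nn_integral_mono)
      fix x
      have "(\<Sum>i<m. ennreal (h i) * indicator (E i) x) = ennreal (\<Sum>i<m. h i * (if h i < S 1 x then 1 else 0))"
      proof -
        have "(\<Sum>i<m. ennreal (h i) * indicator (E i) x) = (\<Sum>i<m. ennreal (h i * (if h i < S 1 x then 1 else 0)))"
          by (intro sum.cong refl) (simp add: E_def)
        also have "\<dots> = ennreal (\<Sum>i<m. h i * (if h i < S 1 x then 1 else 0))"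
          by (rule sum_ennreal) (use h0 in \<open>simp add: less_imp_le\<close>)
        finally show ?thesis .
      qed
      also have "\<dots> \<le> ennreal (2 * S 1 x)"
        unfolding h_def by (intro ennreal_leI dyadic_layer_sum_le S0)
      finally show "(\<Sum>i<m. ennreal (h i) * indicator (E i) x) \<le> 2 * ennreal (S 1 x)" using S0 by (simp add: ennreal_mult)
    qed
    also have "\<dots> = 2 * (\<integral>\<^sup>+x. ennreal (S 1 x) \<partial>\<mu>)"
      unfolding S_def A_def by (rule nn_integral_cmult[OF ball_pattern_measurable[OF J]])
    finally have "(\<integral>\<^sup>+x. ennreal (S \<alpha> x) \<partial>\<mu>) \<le> ennreal (K1 * \<alpha> powr (n * p)) * (2 * (\<integral>\<^sup>+x. ennreal (S 1 x) \<partial>\<mu>))"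
      by (simp add: mult_left_mono)
    also have "\<dots> = ennreal (2 * K1 * \<alpha> powr (n * p)) * (\<integral>\<^sup>+x. ennreal (S 1 x) \<partial>\<mu>)"
      using K1 by (simp add: ennreal_mult mult_ac)
    finally show "(\<integral>\<^sup>+x. ennreal (gauss_norm {j\<in>J. dist x (y j) < \<alpha> * 2 powi k j} v) \<partial>\<mu>)
    \<le> ennreal (2 * K1 * \<alpha> powr (n * p)) * (\<integral>\<^sup>+x. ennreal (gauss_norm {j\<in>J. dist x (y j) < 2 powi k j} v) \<partial>\<mu>)"
      by (simp add: S_def A_def)
  qed
qed

text \<open>Vectors of Gaussian norm zero are discarded by the triangle inequality on the left-hand
  side and restored by monotonicity on the right.\<close>

lemma L1_estimate:
  assumes umd: "umd_space TYPE('x::banach)" and p: "1 < p" "p \<le> 2" and cc: "cone_covering_property \<mu>"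
  shows "\<exists>K\<ge>0. \<forall>\<alpha>\<ge>1. \<forall>J y k (v :: nat \<Rightarrow> 'x). finite J \<longrightarrow>
     (\<integral>\<^sup>+x. ennreal (gauss_norm {j\<in>J. dist x (y j) < \<alpha> * 2 powi k j} v) \<partial>\<mu>)
    \<le> ennreal (K * \<alpha> powr (n * p)) * (\<integral>\<^sup>+x. ennreal (gauss_norm {j\<in>J. dist x (y j) < 2 powi k j} v) \<partial>\<mu>)"
proof -
  obtain K where K: "0 \<le> K" and est: "\<forall>\<alpha>\<ge>1. \<forall>J y k (v :: nat \<Rightarrow> 'x). finite J \<longrightarrow> (\<forall>j\<in>J. 0 < gauss_norm {j} v) \<longrightarrow>
     (\<integral>\<^sup>+x. ennreal (gauss_norm {j\<in>J. dist x (y j) < \<alpha> * 2 powi k j} v) \<partial>\<mu>)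
    \<le> ennreal (K * \<alpha> powr (n * p)) * (\<integral>\<^sup>+x. ennreal (gauss_norm {j\<in>J. dist x (y j) < 2 powi k j} v) \<partial>\<mu>)"
    using L1_estimate_nondegenerate[OF umd p cc] by (elim exE conjE) (rule that)
  show ?thesis
  proof (intro exI[of _ K] conjI allI impI K)
    fix \<alpha> :: real and J :: "nat set" and y :: "nat \<Rightarrow> 'm" and k :: "nat \<Rightarrow> int" and v :: "nat \<Rightarrow> 'x"
    assume a: "1 \<le> \<alpha>" and J: "finite J"
    let ?J = "{j\<in>J. 0 < gauss_norm {j} v}"
    have le: "gauss_norm A v \<le> gauss_norm {j\<in>A. 0 < gauss_norm {j} v} v" if A: "finite A" for A
    proof -
      have "gauss_norm A v = gauss_norm ({j\<in>A. 0 < gauss_norm {j} v} \<union> (\<Union>j\<in>{j\<in>A. \<not> 0 < gauss_norm {j} v}. {j})) v"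
        by (rule arg_cong[of _ _ "\<lambda>A. gauss_norm A v"]) auto
      also have "\<dots> \<le> gauss_norm {j\<in>A. 0 < gauss_norm {j} v} v + gauss_norm (\<Union>j\<in>{j\<in>A. \<not> 0 < gauss_norm {j} v}. {j}) v"
        using A by (intro gauss_norm_Un) auto
      also have "gauss_norm (\<Union>j\<in>{j\<in>A. \<not> 0 < gauss_norm {j} v}. {j}) v \<le> (\<Sum>j\<in>{j\<in>A. \<not> 0 < gauss_norm {j} v}. gauss_norm {j} v)"
        using A by (intro gauss_norm_UN) auto
      also have "\<dots> \<le> 0" by (intro sum_nonpos) auto
      finally show ?thesis by simp
    qed
    have "(\<integral>\<^sup>+x. ennreal (gauss_norm {j\<in>J. dist x (y j) < \<alpha> * 2 powi k j} v) \<partial>\<mu>)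
      \<le> (\<integral>\<^sup>+x. ennreal (gauss_norm {j\<in>?J. dist x (y j) < \<alpha> * 2 powi k j} v) \<partial>\<mu>)"
    proof (intro nn_integral_mono ennreal_leI)
      fix x
      have "{j \<in> {j\<in>J. dist x (y j) < \<alpha> * 2 powi k j}. 0 < gauss_norm {j} v} = {j\<in>?J. dist x (y j) < \<alpha> * 2 powi k j}" by auto
      then show "gauss_norm {j\<in>J. dist x (y j) < \<alpha> * 2 powi k j} v \<le> gauss_norm {j\<in>?J. dist x (y j) < \<alpha> * 2 powi k j} v"
        using le[of "{j\<in>J. dist x (y j) < \<alpha> * 2 powi k j}"] J by simp
    qed
    also have "\<dots> \<le> ennreal (K * \<alpha> powr (n * p)) * (\<integral>\<^sup>+x. ennreal (gauss_norm {j\<in>?J. dist x (y j) < 2 powi k j} v) \<partial>\<mu>)"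
      by (rule est[THEN spec, THEN mp, OF a, THEN spec, THEN spec, THEN spec, THEN spec, THEN mp, THEN mp]) (use J in auto)
    also have "\<dots> \<le> ennreal (K * \<alpha> powr (n * p)) * (\<integral>\<^sup>+x. ennreal (gauss_norm {j\<in>J. dist x (y j) < 2 powi k j} v) \<partial>\<mu>)"
      using J by (intro mult_left_mono nn_integral_mono ennreal_leI gauss_norm_mono) auto
    finally show "(\<integral>\<^sup>+x. ennreal (gauss_norm {j\<in>J. dist x (y j) < \<alpha> * 2 powi k j} v) \<partial>\<mu>)
    \<le> ennreal (K * \<alpha> powr (n * p)) * (\<integral>\<^sup>+x. ennreal (gauss_norm {j\<in>J. dist x (y j) < 2 powi k j} v) \<partial>\<mu>)" .
  qed
qed

end

section \<open>Orthonormal systems\<close>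

definition L2_inner :: "'a measure \<Rightarrow> ('a \<Rightarrow> complex) \<Rightarrow> ('a \<Rightarrow> complex) \<Rightarrow> complex" where
  "L2_inner N f g = (\<integral>z. f z * cnj (g z) \<partial>N)"

lemma L2_measurable [measurable_dest]: "f \<in> L2 N \<Longrightarrow> f \<in> borel_measurable N"
  by (simp add: L2_def)

lemma L2_norm_integrable: "f \<in> L2 N \<Longrightarrow> integrable N (\<lambda>z. (cmod (f z))\<^sup>2)"
  by (simp add: L2_def)

lemma L2_I:
  assumes [measurable]: "f \<in> borel_measurable N" and g: "integrable N g" and le: "\<And>z. (cmod (f z))\<^sup>2 \<le> g z"
  shows "f \<in> L2 N"
proof -
  have "integrable N (\<lambda>z. (cmod (f z))\<^sup>2)"
    by (rule Bochner_Integration.integrable_bound[OF g]) (use le in \<open>auto intro!: AE_I2 order_trans[OF _ abs_ge_self]\<close>)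
  then show ?thesis by (simp add: L2_def)
qed

lemma L2_mult_integrable:
  assumes f: "f \<in> L2 N" and g: "g \<in> L2 N"
  shows "integrable N (\<lambda>z. f z * g z)"
proof (rule Bochner_Integration.integrable_bound)
  show "integrable N (\<lambda>z. (cmod (f z))\<^sup>2 + (cmod (g z))\<^sup>2)" using L2_norm_integrable[OF f] L2_norm_integrable[OF g] by simp
  show "(\<lambda>z. f z * g z) \<in> borel_measurable N" using L2_measurable[OF f] L2_measurable[OF g] by measurable
  have "a * b \<le> a\<^sup>2 + b\<^sup>2" if "0 \<le> a" "0 \<le> b" for a b :: real
    using zero_le_power2[of "a - b"] mult_nonneg_nonneg[OF that] by (simp add: power2_eq_square algebra_simps)
  then show "AE z in N. norm (f z * g z) \<le> norm ((cmod (f z))\<^sup>2 + (cmod (g z))\<^sup>2)"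
    by (auto simp: norm_mult)
qed

lemma L2_cnj: "f \<in> L2 N \<Longrightarrow> (\<lambda>z. cnj (f z)) \<in> L2 N"
  by (auto simp: L2_def intro: measurable_compose[OF _ borel_measurable_continuous_onI[OF continuous_on_cnj[OF continuous_on_id]]])

lemma L2_inner_integrable:
  assumes "f \<in> L2 N" "g \<in> L2 N" shows "integrable N (\<lambda>z. f z * cnj (g z))"
  using L2_mult_integrable[OF assms(1) L2_cnj[OF assms(2)]] .

lemma L2_zero [simp]: "(\<lambda>z. 0) \<in> L2 N"
  by (simp add: L2_def)

lemma L2_add:
  assumes f: "f \<in> L2 N" and g: "g \<in> L2 N"
  shows "(\<lambda>z. f z + g z) \<in> L2 N"
proof (rule L2_I)
  show "integrable N (\<lambda>z. 2 * (cmod (f z))\<^sup>2 + 2 * (cmod (g z))\<^sup>2)" using L2_norm_integrable[OF f] L2_norm_integrable[OF g] by simp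
  show "(\<lambda>z. f z + g z) \<in> borel_measurable N" using L2_measurable[OF f] L2_measurable[OF g] by measurable
  fix z
  have "(cmod (f z + g z))\<^sup>2 \<le> (cmod (f z) + cmod (g z))\<^sup>2" by (intro power_mono norm_triangle_ineq) simp
  also have "\<dots> \<le> 2 * (cmod (f z))\<^sup>2 + 2 * (cmod (g z))\<^sup>2"
    using zero_le_power2[of "cmod (f z) - cmod (g z)"] by (simp add: power2_eq_square algebra_simps)
  finally show "(cmod (f z + g z))\<^sup>2 \<le> 2 * (cmod (f z))\<^sup>2 + 2 * (cmod (g z))\<^sup>2" .
qed

lemma L2_cmult: "f \<in> L2 N \<Longrightarrow> (\<lambda>z. c * f z) \<in> L2 N"
  by (auto simp: L2_def norm_mult power_mult_distrib)

lemma L2_sum: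
  "(\<And>i. i \<in> I \<Longrightarrow> f i \<in> L2 N) \<Longrightarrow> (\<lambda>z. \<Sum>i\<in>I. c i * f i z) \<in> L2 N"
  by (induction I rule: infinite_finite_induct) (auto intro!: L2_add L2_cmult)

lemma L2_diff: "f \<in> L2 N \<Longrightarrow> g \<in> L2 N \<Longrightarrow> (\<lambda>z. f z - g z) \<in> L2 N"
  using L2_add[of f N "\<lambda>z. - 1 * g z"] L2_cmult[of g N "-1"] by simp

lemma L2_indicator:
  assumes f: "f \<in> L2 N" and S: "{z \<in> space N. z \<in> S} \<in> sets N"
  shows "(\<lambda>z. indicator S z * f z) \<in> L2 N"
proof (rule L2_I[OF _ L2_norm_integrable[OF f]])
  have "indicator S \<in> borel_measurable N"
    using S by (auto intro!: borel_measurable_indicator' simp: Collect_conj_eq Int_commute)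
  then have [measurable]: "(\<lambda>z. indicator S z :: complex) \<in> borel_measurable N" .
  show "(\<lambda>z. indicator S z * f z) \<in> borel_measurable N" using L2_measurable[OF f] by measurable
qed (auto simp: indicator_def)

lemma L2_inner_sum_left:
  assumes "\<And>i. i \<in> I \<Longrightarrow> f i \<in> L2 N" "g \<in> L2 N"
  shows "L2_inner N (\<lambda>z. \<Sum>i\<in>I. c i * f i z) g = (\<Sum>i\<in>I. c i * L2_inner N (f i) g)"
proof -
  have "L2_inner N (\<lambda>z. \<Sum>i\<in>I. c i * f i z) g = (\<integral>z. (\<Sum>i\<in>I. c i * (f i z * cnj (g z))) \<partial>N)"
    unfolding L2_inner_def by (simp add: sum_distrib_right mult.assoc)
  also have "\<dots> = (\<Sum>i\<in>I. \<integral>z. c i * (f i z * cnj (g z)) \<partial>N)"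
    using assms by (intro Bochner_Integration.integral_sum integrable_mult_right L2_inner_integrable) auto
  finally show ?thesis by (simp add: L2_inner_def)
qed

lemma L2_inner_commute: "L2_inner N g f = cnj (L2_inner N f g)"
  unfolding L2_inner_def using Bochner_Integration.integral_cnj[of N "\<lambda>z. f z * cnj (g z)"] by (simp add: mult.commute)

lemma L2_inner_sum_right:
  assumes "\<And>i. i \<in> I \<Longrightarrow> f i \<in> L2 N" "g \<in> L2 N"
  shows "L2_inner N g (\<lambda>z. \<Sum>i\<in>I. c i * f i z) = (\<Sum>i\<in>I. cnj (c i) * L2_inner N g (f i))"
proof -
  have "L2_inner N g (\<lambda>z. \<Sum>i\<in>I. c i * f i z) = cnj (\<Sum>i\<in>I. c i * L2_inner N (f i) g)"
    by (subst L2_inner_commute) (simp only: L2_inner_sum_left[OF assms])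
  also have "\<dots> = (\<Sum>i\<in>I. cnj (c i) * cnj (L2_inner N (f i) g))" by simp
  finally show ?thesis by (simp only: L2_inner_commute[of N g, symmetric])
qed

lemma L2_inner_diff_left:
  assumes "f \<in> L2 N" "f' \<in> L2 N" "g \<in> L2 N"
  shows "L2_inner N (\<lambda>z. f z - f' z) g = L2_inner N f g - L2_inner N f' g"
  unfolding L2_inner_def left_diff_distrib
  by (rule Bochner_Integration.integral_diff[OF L2_inner_integrable[OF assms(1,3)] L2_inner_integrable[OF assms(2,3)]])

lemma L2_inner_self: "L2_inner N f f = complex_of_real (\<integral>z. (cmod (f z))\<^sup>2 \<partial>N)"
  unfolding L2_inner_def by (simp only: complex_norm_square[symmetric] integral_complex_of_real)

lemma L2_inner_cong_AE:
  assumes "f \<in> L2 N" "f' \<in> L2 N" "g \<in> L2 N" "AE z in N. f z = f' z"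
  shows "L2_inner N f g = L2_inner N f' g"
  unfolding L2_inner_def
proof (rule integral_cong_AE)
  show "(\<lambda>z. f z * cnj (g z)) \<in> borel_measurable N" "(\<lambda>z. f' z * cnj (g z)) \<in> borel_measurable N"
    using L2_inner_integrable[OF assms(1,3)] L2_inner_integrable[OF assms(2,3)] by (simp_all only: borel_measurable_integrable)
  show "AE z in N. f z * cnj (g z) = f' z * cnj (g z)" using assms(4) by eventually_elim simp
qed

lemma bessel_inequality:
  assumes e: "\<And>i. i \<in> I \<Longrightarrow> e i \<in> L2 N" and on: "\<And>i j. i \<in> I \<Longrightarrow> j \<in> I \<Longrightarrow> L2_inner N (e i) (e j) = (if i = j then 1 else 0)"
    and I: "finite I" and f: "f \<in> L2 N"
  shows "(\<Sum>i\<in>I. (cmod (L2_inner N f (e i)))\<^sup>2) \<le> (\<integral>z. (cmod (f z))\<^sup>2 \<partial>N)"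
proof -
  define c where "c i = L2_inner N f (e i)" for i
  let ?p = "\<lambda>z. \<Sum>i\<in>I. c i * e i z"
  have p: "?p \<in> L2 N" by (rule L2_sum[OF e])
  have pe: "L2_inner N ?p (e i) = c i" if "i \<in> I" for i
    using I that by (simp add: L2_inner_sum_left[OF e e[OF that]] on if_distrib sum.If_cases cong: if_cong)
  have fpe: "L2_inner N f ?p = (\<Sum>i\<in>I. cnj (c i) * c i)"
    using L2_inner_sum_right[of I e N f c, OF e f] by (simp only: c_def[symmetric])
  moreover have "L2_inner N ?p ?p = (\<Sum>i\<in>I. cnj (c i) * c i)"
    using L2_inner_sum_right[of I e N ?p c, OF e p] pe by (simp cong: sum.cong)
  ultimately have fp: "L2_inner N (\<lambda>z. f z - ?p z) ?p = 0"
    by (simp only: L2_inner_diff_left[OF f p p]) simp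
  have "L2_inner N (\<lambda>z. f z - ?p z) (\<lambda>z. f z - ?p z) = cnj (L2_inner N (\<lambda>z. f z - ?p z) f) - 0"
    by (subst L2_inner_diff_left[OF f p L2_diff[OF f p]]) (simp add: L2_inner_commute[of N f] L2_inner_commute[of N ?p] fp)
  also have "L2_inner N (\<lambda>z. f z - ?p z) f = L2_inner N f f - cnj (L2_inner N f ?p)"
    by (simp add: L2_inner_diff_left[OF f p f] L2_inner_commute[of N ?p])
  also have "L2_inner N f ?p = complex_of_real (\<Sum>i\<in>I. (cmod (c i))\<^sup>2)"
    unfolding fpe of_real_sum by (simp only: complex_norm_square mult.commute)
  finally have "complex_of_real (\<integral>z. (cmod (f z - ?p z))\<^sup>2 \<partial>N) = complex_of_real ((\<integral>z. (cmod (f z))\<^sup>2 \<partial>N) - (\<Sum>i\<in>I. (cmod (c i))\<^sup>2))"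
    by (simp add: L2_inner_self)
  then have "(\<integral>z. (cmod (f z - ?p z))\<^sup>2 \<partial>N) = (\<integral>z. (cmod (f z))\<^sup>2 \<partial>N) - (\<Sum>i\<in>I. (cmod (c i))\<^sup>2)"
    by (simp only: of_real_eq_iff)
  moreover have "0 \<le> (\<integral>z. (cmod (f z - ?p z))\<^sup>2 \<partial>N)" by (rule integral_nonneg_AE) auto
  ultimately show ?thesis by (simp add: c_def)
qed

text \<open>The orthonormal functions vanish pointwise wherever all given functions do, so that
  supports are inherited exactly. The expansion holds only almost everywhere, since a remainder of
  norm zero is dropped.\<close>

lemma gram_schmidt_L2:
  fixes w :: "nat \<Rightarrow> 'a \<Rightarrow> complex"
  assumes "\<And>k. k < n \<Longrightarrow> w k \<in> L2 N"
  shows "\<exists>m e b. (\<forall>i<m. e i \<in> L2 N) \<and> (\<forall>i<m. \<forall>j<m. L2_inner N (e i) (e j) = (if i = j then 1 else 0)) \<and>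
     (\<forall>i<m. \<forall>z. (\<forall>k<n. w k z = 0) \<longrightarrow> e i z = 0) \<and>
     (\<forall>k<n. AE z in N. w k z = (\<Sum>i<(m::nat). b k i * e i z))"
  using assms
proof (induction n)
  case 0
  show ?case by (rule exI[of _ 0]) auto
next
  case (Suc n)
  have "\<exists>m e b. (\<forall>i<m. e i \<in> L2 N) \<and> (\<forall>i<m. \<forall>j<m. L2_inner N (e i) (e j) = (if i = j then 1 else 0)) \<and>
     (\<forall>i<m. \<forall>z. (\<forall>k<n. w k z = 0) \<longrightarrow> e i z = 0) \<and>
     (\<forall>k<n. AE z in N. w k z = (\<Sum>i<(m::nat). b k i * e i z))"
    by (rule Suc.IH) (use Suc.prems in simp)
  then obtain m :: nat and e b where e: "\<forall>i<m. e i \<in> L2 N" and on: "\<forall>i<m. \<forall>j<m. L2_inner N (e i) (e j) = (if i = j then 1 else 0)"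
    and van: "\<forall>i<m. \<forall>z. (\<forall>k<n. w k z = 0) \<longrightarrow> e i z = 0"
    and span: "\<forall>k<n. AE z in N. w k z = (\<Sum>i<m. b k i * e i z)" by (elim exE conjE) (rule that)
  have wn: "w n \<in> L2 N" using Suc.prems by simp
  define c where "c i = L2_inner N (w n) (e i)" for i
  define r where "r z = w n z - (\<Sum>i<m. c i * e i z)" for z
  have pL: "(\<lambda>z. \<Sum>i<m. c i * e i z) \<in> L2 N" using e by (intro L2_sum) auto
  have rL: "r \<in> L2 N" unfolding r_def by (rule L2_diff[OF wn pL])
  have re: "L2_inner N r (e j) = 0" if j: "j < m" for j
  proof -
    have ej: "e j \<in> L2 N" using e j by simp
    have "L2_inner N (\<lambda>z. \<Sum>i<m. c i * e i z) (e j) = (\<Sum>i<m. c i * L2_inner N (e i) (e j))"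
      using e by (intro L2_inner_sum_left ej) auto
    also have "\<dots> = (\<Sum>i<m. if i = j then c i else 0)" using on j by (intro sum.cong) auto
    also have "\<dots> = c j" using j by simp
    finally show ?thesis unfolding r_def using L2_inner_diff_left[OF wn pL ej] by (simp add: c_def)
  qed
  define s where "s = (\<integral>z. (cmod (r z))\<^sup>2 \<partial>N)"
  have s0: "0 \<le> s" unfolding s_def by (rule integral_nonneg_AE) auto
  have rz: "r z = 0" if "\<forall>k<Suc n. w k z = 0" for z
  proof -
    have "\<forall>i<m. e i z = 0" using van that by simp
    then show ?thesis using that by (simp add: r_def)
  qed
  show ?case
  proof (cases "s = 0")
    case True
    \<comment> \<open>The new function is in the span of the system up to a null set, so no
      normalisation takes place and the system is kept.\<close>
    then have "AE z in N. (cmod (r z))\<^sup>2 = 0"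
      unfolding s_def using L2_norm_integrable[OF rL] by (subst (asm) integral_nonneg_eq_0_iff_AE) auto
    then have wn0: "AE z in N. w n z = (\<Sum>i<m. c i * e i z)" by (auto simp: r_def)
    show ?thesis
    proof (intro exI[of _ m] exI[of _ e] exI[of _ "b(n := c)"] conjI)
      show "\<forall>k<Suc n. AE z in N. w k z = (\<Sum>i<m. (b(n := c)) k i * e i z)"
        using span wn0 by (auto simp: less_Suc_eq)
      show "\<forall>i<m. \<forall>z. (\<forall>k<Suc n. w k z = 0) \<longrightarrow> e i z = 0" using van by simp
    qed (use e on in auto)
  next
    case False
    then have sp: "0 < sqrt s" using s0 by simp
    define q where "q = complex_of_real (1 / sqrt s)"
    have q: "q \<noteq> 0" "q * cnj q * complex_of_real s = 1"
    proof -
      show "q \<noteq> 0" using sp by (simp add: q_def)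
      have "(1 / sqrt s) * (1 / sqrt s) * s = 1" using sp s0 False by simp
      then have "complex_of_real ((1 / sqrt s) * (1 / sqrt s) * s) = 1" by simp
      then show "q * cnj q * complex_of_real s = 1" unfolding q_def of_real_mult complex_cnj_complex_of_real .
    qed
    define e' where "e' = e(m := (\<lambda>z. q * r z))"
    have qr: "(\<lambda>z. q * r z) \<in> L2 N" by (rule L2_cmult[OF rL])
    have in1: "L2_inner N (\<lambda>z. q * r z) f = q * L2_inner N r f" for f
      unfolding L2_inner_def by (simp add: mult.assoc)
    have in2: "L2_inner N f (\<lambda>z. q * r z) = cnj q * L2_inner N f r" for f
      by (subst (1 2) L2_inner_commute) (simp add: in1)
    have rr: "L2_inner N r r = complex_of_real s" by (simp add: L2_inner_self s_def)
    show ?thesis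
    proof (intro exI[of _ "Suc m"] exI[of _ e'] exI[of _ "\<lambda>k i. if k = n then (if i = m then 1 / q else c i) else (if i = m then 0 else b k i)"] conjI allI impI)
      fix i assume i: "i < Suc m"
      show "e' i \<in> L2 N" using i e qr by (auto simp: e'_def less_Suc_eq)
      { fix j assume j: "j < Suc m"
        show "L2_inner N (e' i) (e' j) = (if i = j then 1 else 0)"
        proof (cases "i = m"; cases "j = m")
          assume "i = m" "j = m"
          then show ?thesis using q by (simp add: e'_def in1 in2 rr mult.assoc)
        next
          assume "i = m" "j \<noteq> m"
          then show ?thesis using re[of j] j by (simp add: e'_def in1)
        next
          assume "i \<noteq> m" "j = m"
          then show ?thesis using re[of i] i by (simp add: e'_def in2 L2_inner_commute[of N "e i" r])
        next
          assume "i \<noteq> m" "j \<noteq> m"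
          then show ?thesis using on i j by (simp add: e'_def)
        qed }
      { fix z assume z: "\<forall>k<Suc n. w k z = 0"
        show "e' i z = 0" using rz[OF z] van z i by (auto simp: e'_def less_Suc_eq) }
    next
      fix k assume k: "k < Suc n"
      have sum_e': "(\<Sum>i<Suc m. f i * e' i z) = (\<Sum>i<m. f i * e i z) + f m * (q * r z)" for f z
        by (simp add: e'_def)
      show "AE z in N. w k z = (\<Sum>i<Suc m. (if k = n then if i = m then 1 / q else c i else if i = m then 0 else b k i) * e' i z)"
      proof (cases "k = n")
        case True
        have "w n z = (\<Sum>i<Suc m. (if i = m then 1 / q else c i) * e' i z)" for z
          unfolding sum_e' using q by (simp add: r_def)
        then show ?thesis using True by simp
      next
        case False
        then have "AE z in N. w k z = (\<Sum>i<m. b k i * e i z)" using span k by simp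
        then show ?thesis
        proof eventually_elim
          case (elim z)
          have "(\<Sum>i<Suc m. (if k = n then if i = m then 1 / q else c i else if i = m then 0 else b k i) * e' i z) = (\<Sum>i<m. b k i * e i z)"
            unfolding sum_e' using False by simp
          then show ?case using elim by simp
        qed
      qed
    qed
  qed
qed

section \<open>Discretisation of the area functional\<close>

lemma scaleC_sum_right: "scaleC c (\<Sum>i\<in>I. f i) = (\<Sum>i\<in>I. scaleC c (f i :: 'x::complex_banach))"
proof -
  have "scaleC c (0::'x) = 0" using scaleC_add_right[of c 0 "0::'x"] by simp
  then show ?thesis by (induction I rule: infinite_finite_induct) (auto simp: scaleC_add_right)
qed

lemma scaleC_zero_left: "scaleC 0 x = (0::'x::complex_banach)"
  using scaleC_of_real[of 0 x] by simp

lemma scaleC_sum_left: "scaleC (\<Sum>i\<in>I. f i) x = (\<Sum>i\<in>I. scaleC (f i) (x :: 'x::complex_banach))"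
  by (induction I rule: infinite_finite_induct) (auto simp: scaleC_add_left scaleC_zero_left)

lemma scaleC_scaleR: "scaleC c (r *\<^sub>R x) = r *\<^sub>R scaleC c (x :: 'x::complex_banach)"
  by (simp add: scaleC_of_real[symmetric] scaleC_scaleC mult.commute)

text \<open>The Gaussian coordinates and the contraction principle are real; complex coefficients
  are therefore split into two real families.\<close>

lemma scaleC_conv_Re_Im: "scaleC c x = Re c *\<^sub>R x + scaleC \<i> (Im c *\<^sub>R (x :: 'x::complex_banach))"
proof -
  have "scaleC c x = scaleC (complex_of_real (Re c) + \<i> * complex_of_real (Im c)) x" by (simp add: complex_eq[symmetric])
  then show ?thesis by (simp add: scaleC_add_left scaleC_of_real scaleC_scaleC[symmetric])
qed

lemma sets_upper_measure: "sets (upper_measure \<mu>) = sets (\<mu> \<Otimes>\<^sub>M restrict_space lborel {0<..})"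
  by (simp add: upper_measure_def)

lemma cone_sets:
  fixes \<mu> :: "'m::metric_space measure"
  assumes \<mu>: "sets \<mu> = sets borel"
  shows "{z \<in> space (upper_measure \<mu>). z \<in> cone \<alpha> x} \<in> sets (upper_measure \<mu>)"
proof -
  let ?N = "\<mu> \<Otimes>\<^sub>M restrict_space lborel {0::real<..}"
  have d: "(\<lambda>y. dist x y) \<in> borel_measurable \<mu>"
    unfolding measurable_cong_sets[OF \<mu> refl] by (intro borel_measurable_continuous_onI continuous_intros)
  have [measurable]: "(\<lambda>z. dist x (fst z)) \<in> borel_measurable ?N" by (rule measurable_compose[OF measurable_fst d])
  have i: "(\<lambda>t. t) \<in> borel_measurable (restrict_space lborel {0::real<..})"
    by (rule measurable_restrict_space1) simp
  have [measurable]: "snd \<in> borel_measurable ?N" by (rule measurable_compose[OF measurable_snd i])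
  have "{z \<in> space ?N. 0 < snd z \<and> dist x (fst z) < \<alpha> * snd z} \<in> sets ?N" by measurable
  moreover have "space (upper_measure \<mu>) = space ?N" by (simp add: upper_measure_def)
  ultimately show ?thesis unfolding sets_upper_measure by (simp add: cone_def case_prod_unfold)
qed

text \<open>
  The kernel of the operator is cut into finitely many pieces supported in boxes. The constants are such that
  a cone of aperture 1 contains every box whose base point \<open>(y, 2\<^sup>k)\<close> it contains, and that if a cone of
  aperture \<open>\<alpha> \<ge> 1\<close> meets a box then the cone of aperture \<open>6 \<alpha>\<close> contains the base point.
\<close>

definition box :: "'m::metric_space \<Rightarrow> int \<Rightarrow> ('m \<times> real) set" where
  "box y k = ball y (2 powi k) \<times> {2 * 2 powi k<..<5 * 2 powi k}"

lemma box_sets: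
  assumes "sets \<mu> = sets borel"
  shows "box y k \<in> sets (upper_measure \<mu>)"
  unfolding sets_upper_measure box_def
proof (rule pair_measureI)
  have "0 < (2::real) powi k" by simp
  then show "{2 * 2 powi k<..<5 * 2 powi k} \<in> sets (restrict_space lborel {0::real<..})"
    by (subst sets_restrict_space_iff) (auto intro: less_trans[rotated])
qed (simp add: assms)

text \<open>With the logarithm of the height rounded up to \<open>l\<close> and the scale taken as
  \<open>l - 2\<close>, the height lies between 2 and 4 times \<open>2 powi (l - 2)\<close>,
  excluding 2 and including 4. The upper end 5 of the box leaves room for the closed
  endpoint.\<close>

lemma ex_box:
  fixes z :: "'m::metric_space \<times> real"
  assumes "0 < snd z"
  shows "\<exists>k. z \<in> box (fst z) k"
proof -
  define l where "l = \<lceil>log 2 (snd z)\<rceil>"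
  have "2 powr log 2 (snd z) = snd z" using assms by simp
  have "of_int l - 1 < log 2 (snd z)" "log 2 (snd z) \<le> of_int l" unfolding l_def by linarith+
  then have "2 powr (of_int l - 1) < 2 powr log 2 (snd z)" "2 powr log 2 (snd z) \<le> 2 powr of_int l"
    by (auto intro: powr_less_mono powr_mono)
  moreover have "2 powr (of_int l - 1) = 2 * (2::real) powi (l - 2)"
    using powr_real_of_int'[of 2 "l - 1"] power_int_add[of "2::real" "l - 2" 1] by simp
  moreover have "2 powr of_int l = 4 * (2::real) powi (l - 2)"
    using powr_real_of_int'[of 2 l] power_int_add[of "2::real" "l - 2" 2] by simp
  ultimately have "2 * 2 powi (l - 2) < snd z" "snd z \<le> 4 * 2 powi (l - 2)" using assms by simp_all
  moreover have "0 < (2::real) powi (l - 2)" by simp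
  ultimately have "z \<in> box (fst z) (l - 2)" by (cases z) (auto simp: box_def)
  then show ?thesis ..
qed

text \<open>Openness of the boxes gives a finite subcover of the compact set. It is made disjoint so
  that functions on different pieces are orthogonal.\<close>

lemma box_cover:
  fixes K :: "('m::metric_space \<times> real) set"
  assumes \<mu>: "sets \<mu> = sets borel" and K: "compact K" "K \<subseteq> upper_half"
  shows "\<exists>(B::nat) y k D. (\<forall>c<B. D c \<in> sets (upper_measure \<mu>) \<and> D c \<subseteq> box (y c) (k c)) \<and>
    (\<forall>c<B. \<forall>c'<B. c \<noteq> c' \<longrightarrow> D c \<inter> D c' = {}) \<and> K \<subseteq> (\<Union>c<B. D c)"
proof -
  have "\<forall>z\<in>K. \<exists>k. z \<in> box (fst z) k"
    using K(2) by (intro ballI ex_box) (auto simp: upper_half_def)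
  from bchoice[OF this] obtain \<kappa> where \<kappa>: "\<forall>z\<in>K. z \<in> box (fst z) (\<kappa> z)" by (elim exE) (rule that)
  have cov: "K \<subseteq> (\<Union>z\<in>K. box (fst z) (\<kappa> z))" using \<kappa> by blast
  have op: "open (box (fst z) (\<kappa> z))" for z :: "'m \<times> real" unfolding box_def by (intro open_Times) auto
  obtain Z where Z: "Z \<subseteq> K" "finite Z" "K \<subseteq> (\<Union>z\<in>Z. box (fst z) (\<kappa> z))"
    by (rule compactE_image[OF K(1) op cov]) (rule that)
  obtain h where h: "bij_betw h {..<card Z} Z"
    using ex_bij_betw_nat_finite[OF Z(2)] by (auto simp: atLeast0LessThan)
  define b where "b c = box (fst (h c)) (\<kappa> (h c))" for c
  show ?thesis
  proof (intro exI[of _ "card Z"] exI[of _ "\<lambda>c. fst (h c)"] exI[of _ "\<lambda>c. \<kappa> (h c)"] exI[of _ "disjointed b"] conjI allI impI)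
    fix c
    show "disjointed b c \<in> sets (upper_measure \<mu>)"
      unfolding disjointed_def by (intro sets.Diff sets.finite_UN) (auto simp: b_def intro: box_sets[OF \<mu>])
    show "disjointed b c \<subseteq> box (fst (h c)) (\<kappa> (h c))" using disjointed_subset[of b c] by (simp add: b_def)
    fix c' assume "c \<noteq> c'"
    then show "disjointed b c \<inter> disjointed b c' = {}"
      using disjoint_family_disjointed[of b] by (auto simp: disjoint_family_on_def)
  next
    have "K \<subseteq> (\<Union>z\<in>h ` {..<card Z}. box (fst z) (\<kappa> z))" using Z(3) h by (simp add: bij_betw_def)
    also have "\<dots> = (\<Union>c\<in>{0..<card Z}. b c)" by (simp add: b_def atLeast0LessThan)
    also have "\<dots> = (\<Union>c\<in>{0..<card Z}. disjointed b c)" by (rule finite_UN_disjointed_eq[symmetric])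
    finally show "K \<subseteq> (\<Union>c<card Z. disjointed b c)" by (simp add: atLeast0LessThan)
  qed
qed

text \<open>Gram-Schmidt is performed in each piece of the support separately. The resulting
  functions are localised in boxes, and functions from different pieces are orthogonal because their
  supports are disjoint. Expanding the kernel in them identifies the vectors \<open>v j\<close> of
  the discrete model.\<close>

lemma discretise:
  fixes U :: "('m::metric_space \<times> real \<Rightarrow> complex) \<Rightarrow> 'x::complex_banach"
  assumes \<mu>: "sets \<mu> = sets borel" and U: "U \<in> L2_compact_tensor \<mu>"
  shows "\<exists>(J::nat set) e v y k. finite J \<and> (\<forall>j\<in>J. e j \<in> L2 (upper_measure \<mu>)) \<and>
    (\<forall>i\<in>J. \<forall>j\<in>J. L2_inner (upper_measure \<mu>) (e i) (e j) = (if i = j then 1 else 0)) \<and>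
    (\<forall>j\<in>J. \<forall>z. e j z \<noteq> 0 \<longrightarrow> z \<in> box (y j) (k j)) \<and>
    (\<forall>f\<in>L2 (upper_measure \<mu>). U f = (\<Sum>j\<in>J. scaleC (L2_inner (upper_measure \<mu>) f (e j)) (v j)))"
proof -
  let ?N = "upper_measure \<mu>"
  obtain n :: nat and u \<xi> where u: "\<forall>l<n. u l \<in> L2_compact \<mu>"
    and Ueq: "U = (\<lambda>h. \<Sum>l<n. scaleC (\<integral>z. u l z * h z \<partial>?N) (\<xi> l))"
    using U unfolding L2_compact_tensor_def by blast
  have uL: "u l \<in> L2 ?N" if "l < n" for l using u that by (simp add: L2_compact_def)
  have "\<forall>l\<in>{..<n}. \<exists>K. compact K \<and> K \<subseteq> upper_half \<and> (AE z in ?N. z \<notin> K \<longrightarrow> u l z = 0)"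
    using u by (simp add: L2_compact_def)
  from bchoice[OF this] obtain Kf where Kf: "\<forall>l\<in>{..<n}. compact (Kf l) \<and> Kf l \<subseteq> upper_half \<and> (AE z in ?N. z \<notin> Kf l \<longrightarrow> u l z = 0)"
    by (elim exE) (rule that)
  have "compact (\<Union>l<n. Kf l)" using Kf by (intro compact_UN) auto
  moreover have "(\<Union>l<n. Kf l) \<subseteq> upper_half" using Kf by blast
  ultimately obtain B :: nat and y k D where D: "\<forall>c<B. D c \<in> sets ?N \<and> D c \<subseteq> box (y c) (k c)"
      "\<forall>c<B. \<forall>c'<B. c \<noteq> c' \<longrightarrow> D c \<inter> D c' = {}" "(\<Union>l<n. Kf l) \<subseteq> (\<Union>c<B. D c)"
    using box_cover[OF \<mu>, of "\<Union>l<n. Kf l"] by (elim exE conjE meta_impE) (assumption | rule that)+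
  \<comment> \<open>The tensor acts by a pairing without conjugation, whereas the inner product
    conjugates its second argument; hence the conjugate of the kernel is expanded.\<close>
  define w where "w c l z = indicator (D c) z * cnj (u l z)" for c l z
  have wL: "w c l \<in> L2 ?N" if "c < B" "l < n" for c l
  proof -
    have "{z \<in> space ?N. z \<in> D c} = D c" using D(1) that sets.sets_into_space by blast
    then show ?thesis unfolding w_def using D(1) that by (intro L2_indicator L2_cnj uL) auto
  qed
  have "\<forall>c\<in>{..<B}. \<exists>t. (\<forall>i<fst t. fst (snd t) i \<in> L2 ?N) \<and>
     (\<forall>i<fst t. \<forall>j<fst t. L2_inner ?N (fst (snd t) i) (fst (snd t) j) = (if i = j then 1 else 0)) \<and>
     (\<forall>i<fst t. \<forall>z. (\<forall>l<n. w c l z = 0) \<longrightarrow> fst (snd t) i z = 0) \<and>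
     (\<forall>l<n. AE z in ?N. w c l z = (\<Sum>i<(fst t::nat). snd (snd t) l i * fst (snd t) i z))"
  proof
    fix c assume "c \<in> {..<B}"
    then have "\<exists>m e b. (\<forall>i<m. e i \<in> L2 ?N) \<and> (\<forall>i<m. \<forall>j<m. L2_inner ?N (e i) (e j) = (if i = j then 1 else 0)) \<and>
     (\<forall>i<m. \<forall>z. (\<forall>l<n. w c l z = 0) \<longrightarrow> e i z = 0) \<and>
     (\<forall>l<n. AE z in ?N. w c l z = (\<Sum>i<(m::nat). b l i * e i z))"
      by (intro gram_schmidt_L2 wL) auto
    then obtain m e b where "(\<forall>i<m. e i \<in> L2 ?N) \<and> (\<forall>i<m. \<forall>j<m. L2_inner ?N (e i) (e j) = (if i = j then 1 else 0)) \<and>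
     (\<forall>i<m. \<forall>z. (\<forall>l<n. w c l z = 0) \<longrightarrow> e i z = 0) \<and>
     (\<forall>l<n. AE z in ?N. w c l z = (\<Sum>i<(m::nat). b l i * e i z))" by (elim exE) (rule that)
    then show "\<exists>t. (\<forall>i<fst t. fst (snd t) i \<in> L2 ?N) \<and>
     (\<forall>i<fst t. \<forall>j<fst t. L2_inner ?N (fst (snd t) i) (fst (snd t) j) = (if i = j then 1 else 0)) \<and>
     (\<forall>i<fst t. \<forall>z. (\<forall>l<n. w c l z = 0) \<longrightarrow> fst (snd t) i z = 0) \<and>
     (\<forall>l<n. AE z in ?N. w c l z = (\<Sum>i<(fst t::nat). snd (snd t) l i * fst (snd t) i z))"
      by (intro exI[of _ "(m, e, b)"]) simp
  qed
  from bchoice[OF this] obtain T where T: "\<forall>c\<in>{..<B}. (\<forall>i<fst (T c). fst (snd (T c)) i \<in> L2 ?N) \<and>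
     (\<forall>i<fst (T c). \<forall>j<fst (T c). L2_inner ?N (fst (snd (T c)) i) (fst (snd (T c)) j) = (if i = j then 1 else 0)) \<and>
     (\<forall>i<fst (T c). \<forall>z. (\<forall>l<n. w c l z = 0) \<longrightarrow> fst (snd (T c)) i z = 0) \<and>
     (\<forall>l<n. AE z in ?N. w c l z = (\<Sum>i<(fst (T c)::nat). snd (snd (T c)) l i * fst (snd (T c)) i z))"
    by (elim exE) (rule that)
  define m where "m c = fst (T c)" for c
  define e where "e c = fst (snd (T c))" for c
  define b where "b c = snd (snd (T c))" for c
  have eL: "e c i \<in> L2 ?N" if "c < B" "i < m c" for c i using T that by (simp add: m_def e_def)
  have eon: "L2_inner ?N (e c i) (e c j) = (if i = j then 1 else 0)" if "c < B" "i < m c" "j < m c" for c i j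
    using T that by (simp add: m_def e_def)
  have eD: "z \<in> D c" if nz: "e c i z \<noteq> 0" and ci: "c < B" "i < m c" for c i z
  proof (rule ccontr)
    assume "z \<notin> D c"
    then have "\<forall>l<n. w c l z = 0" by (simp add: w_def)
    moreover have "c \<in> {..<B}" using ci(1) by simp
    then have "\<forall>i<fst (T c). \<forall>z. (\<forall>l<n. w c l z = 0) \<longrightarrow> fst (snd (T c)) i z = 0" using T by blast
    ultimately show False using ci(2) nz unfolding m_def e_def by blast
  qed
  have wspan: "AE z in ?N. w c l z = (\<Sum>i<m c. b c l i * e c i z)" if "c < B" "l < n" for c l
    using T that by (simp add: m_def e_def b_def)
  \<comment> \<open>A pair consists of a piece and an index within it. The pairs are then encoded as
    natural numbers, the index type of the Gaussian sums.\<close>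
  define \<Sigma> where "\<Sigma> = (SIGMA c:{..<B}. {..<m c})"
  have fS: "finite \<Sigma>" by (simp add: \<Sigma>_def)
  define J where "J = prod_encode ` \<Sigma>"
  define E where "E j = e (fst (prod_decode j)) (snd (prod_decode j))" for j
  define \<beta> where "\<beta> l j = b (fst (prod_decode j)) l (snd (prod_decode j))" for l j
  \<comment> \<open>The coefficients of the conjugated kernel, conjugated back, move to the vectors
    of the tensor.\<close>
  define v where "v j = (\<Sum>l<n. scaleC (cnj (\<beta> l j)) (\<xi> l))" for j
  have fJ: "finite J" using fS by (simp add: J_def)
  have Jd: "fst (prod_decode j) < B \<and> snd (prod_decode j) < m (fst (prod_decode j))" if "j \<in> J" for j
    using that by (auto simp: J_def \<Sigma>_def)
  have sumJ: "(\<Sum>j\<in>J. g (prod_decode j)) = (\<Sum>c<B. \<Sum>i<m c. g (c, i))" for g :: "nat \<times> nat \<Rightarrow> complex"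
  proof -
    have "(\<Sum>j\<in>J. g (prod_decode j)) = (\<Sum>p\<in>\<Sigma>. g p)"
      unfolding J_def by (subst sum.reindex) (auto simp: inj_on_def prod_encode_eq)
    also have "\<dots> = (\<Sum>c<B. \<Sum>i<m c. g (c, i))" unfolding \<Sigma>_def by (subst sum.Sigma) auto
    finally show ?thesis .
  qed
  have EL: "E j \<in> L2 ?N" if "j \<in> J" for j using Jd[OF that] by (simp add: E_def eL)
  have Eon: "L2_inner ?N (E i) (E j) = (if i = j then 1 else 0)" if ij: "i \<in> J" "j \<in> J" for i j
  proof (cases "fst (prod_decode i) = fst (prod_decode j)")
    case True
    have "i = j \<longleftrightarrow> snd (prod_decode i) = snd (prod_decode j)"
      using True by (metis prod_decode_inverse prod_eq_iff)
    moreover have "L2_inner ?N (e (fst (prod_decode j)) (snd (prod_decode i))) (e (fst (prod_decode j)) (snd (prod_decode j)))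
        = (if snd (prod_decode i) = snd (prod_decode j) then 1 else 0)"
      using Jd[OF ij(1)] Jd[OF ij(2)] True by (intro eon) auto
    ultimately show ?thesis unfolding E_def True by (simp only:)
  next
    case False
    have zero: "E i z * cnj (E j z) = 0" for z
    proof (rule ccontr)
      assume "E i z * cnj (E j z) \<noteq> 0"
      then have "E i z \<noteq> 0" "E j z \<noteq> 0" by auto
      then have "z \<in> D (fst (prod_decode i))" "z \<in> D (fst (prod_decode j))"
        using eD[of "fst (prod_decode i)" "snd (prod_decode i)" z] eD[of "fst (prod_decode j)" "snd (prod_decode j)" z]
          Jd[OF ij(1)] Jd[OF ij(2)] unfolding E_def by blast+
      then show False using D(2) Jd[OF ij(1)] Jd[OF ij(2)] False by blast
    qed
    have "i \<noteq> j" using False by auto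
    then show ?thesis unfolding L2_inner_def by (simp only: zero) simp
  qed
  have coef: "(\<integral>z. u l z * f z \<partial>?N) = (\<Sum>j\<in>J. cnj (\<beta> l j) * L2_inner ?N f (E j))" if l: "l < n" and f: "f \<in> L2 ?N" for l f
  proof -
    have "AE z in ?N. \<forall>c\<in>{..<B}. w c l z = (\<Sum>i<m c. b c l i * e c i z)"
      using wspan l by (intro AE_finite_allI) auto
    moreover have "AE z in ?N. z \<notin> Kf l \<longrightarrow> u l z = 0" using Kf l by blast
    \<comment> \<open>A point lies in at most one piece, and outside all pieces the kernel vanishes
      almost everywhere.\<close>
    ultimately have ae: "AE z in ?N. cnj (u l z) = (\<Sum>j\<in>J. \<beta> l j * E j z)"
    proof eventually_elim
      case (elim z)
      have "(\<Sum>j\<in>J. \<beta> l j * E j z) = (\<Sum>c<B. \<Sum>i<m c. b c l i * e c i z)"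
        using sumJ[of "\<lambda>p. b (fst p) l (snd p) * e (fst p) (snd p) z"] by (simp add: \<beta>_def E_def)
      also have "\<dots> = (\<Sum>c<B. w c l z)" using elim(1) by (intro sum.cong) auto
      also have "\<dots> = cnj (u l z)"
      proof (cases "\<exists>c<B. z \<in> D c")
        case True
        then obtain c where c: "c < B" "z \<in> D c" by blast
        have "(\<Sum>c'<B. w c' l z) = (\<Sum>c'<B. if c' = c then cnj (u l z) else 0)"
        proof (rule sum.cong[OF refl])
          fix c' assume "c' \<in> {..<B}"
          then show "w c' l z = (if c' = c then cnj (u l z) else 0)"
            using c D(2)[THEN spec, THEN mp, of c, THEN spec, THEN mp, of c'] by (auto simp: w_def indicator_def)
        qed
        then show ?thesis using c by simp
      next
        case False
        then have "z \<notin> Kf l" using D(3) l by blast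
        then show ?thesis using elim(2) False by (simp add: w_def)
      qed
      finally show ?case by simp
    qed
    have "(\<integral>z. u l z * f z \<partial>?N) = L2_inner ?N f (\<lambda>z. cnj (u l z))" by (simp add: L2_inner_def mult.commute)
    also have "\<dots> = cnj (L2_inner ?N (\<lambda>z. cnj (u l z)) f)" by (rule L2_inner_commute)
    also have "L2_inner ?N (\<lambda>z. cnj (u l z)) f = L2_inner ?N (\<lambda>z. \<Sum>j\<in>J. \<beta> l j * E j z) f"
      using EL by (intro L2_inner_cong_AE L2_cnj uL l L2_sum f ae)
    also have "\<dots> = (\<Sum>j\<in>J. \<beta> l j * L2_inner ?N (E j) f)" by (rule L2_inner_sum_left[OF EL f])
    also have "cnj \<dots> = (\<Sum>j\<in>J. cnj (\<beta> l j) * cnj (L2_inner ?N (E j) f))" by simp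
    finally show ?thesis by (simp only: L2_inner_commute[of ?N f, symmetric])
  qed
  show ?thesis
  proof (intro exI[of _ J] exI[of _ E] exI[of _ v] exI[of _ "\<lambda>j. y (fst (prod_decode j))"] exI[of _ "\<lambda>j. k (fst (prod_decode j))"] conjI ballI allI impI fJ)
    show "E j \<in> L2 ?N" if "j \<in> J" for j by (rule EL[OF that])
    show "L2_inner ?N (E i) (E j) = (if i = j then 1 else 0)" if "i \<in> J" "j \<in> J" for i j by (rule Eon[OF that])
    show "z \<in> box (y (fst (prod_decode j))) (k (fst (prod_decode j)))" if "j \<in> J" "E j z \<noteq> 0" for j z
      using eD[of "fst (prod_decode j)" "snd (prod_decode j)" z] Jd[OF that(1)] that(2) D(1) by (auto simp: E_def)
    fix f assume f: "f \<in> L2 ?N"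
    have "U f = (\<Sum>l<n. \<Sum>j\<in>J. scaleC (L2_inner ?N f (E j)) (scaleC (cnj (\<beta> l j)) (\<xi> l)))"
      unfolding Ueq using coef[OF _ f] by (intro sum.cong) (simp_all add: scaleC_sum_left scaleC_scaleC mult.commute)
    also have "\<dots> = (\<Sum>j\<in>J. \<Sum>l<n. scaleC (L2_inner ?N f (E j)) (scaleC (cnj (\<beta> l j)) (\<xi> l)))" by (rule sum.swap)
    also have "\<dots> = (\<Sum>j\<in>J. scaleC (L2_inner ?N f (E j)) (v j))" by (simp add: v_def scaleC_sum_right)
    finally show "U f = (\<Sum>j\<in>J. scaleC (L2_inner ?N f (E j)) (v j))" .
  qed
qed

section \<open>Two-sided comparison of the area functional with finite Gaussian sums\<close>

lemma sqrt_integral_gaussian_measure: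
  fixes x :: "nat \<Rightarrow> 'x::real_normed_vector"
  shows "sqrt (\<integral>g. (norm (\<Sum>k<n. g k *\<^sub>R x k))\<^sup>2 \<partial>gaussian_measure n) = gauss_norm {..<n} x"
proof -
  have "(\<lambda>g. (norm (\<Sum>k<n. g k *\<^sub>R x k))\<^sup>2) \<in> borel_measurable (\<Pi>\<^sub>M k\<in>{..<n}. gauss)"
    by (rule measurable_compose[OF gauss_sum_measurable borel_measurable_continuous_onI]) (auto intro!: continuous_intros)
  then show ?thesis
    unfolding gauss_norm_def gauss_expect_def gaussian_measure_def
    by (subst integral_eq_nn_integral) auto
qed

lemma gauss_norm_reindex:
  assumes "finite I" "inj_on h I"
  shows "gauss_norm I (\<lambda>k. v (h k)) = gauss_norm (h ` I) v"
  unfolding gauss_norm_def by (subst gauss_expect_reindex[OF assms cvx_cont_borel[OF cvx_cont_norm_square]]) simp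

text \<open>A box is contained in the cone of aperture 1 as soon as its base point is. The
  corresponding \<open>e j\<close> form an orthonormal system that the projection leaves unchanged,
  and testing the supremum on this system gives the bound.\<close>

lemma area_functional_ge:
  fixes U :: "('m::metric_space \<times> real \<Rightarrow> complex) \<Rightarrow> 'x::complex_banach"
  assumes J: "finite J" and e: "\<And>j. j \<in> J \<Longrightarrow> e j \<in> L2 (upper_measure \<mu>)"
    and on: "\<And>i j. i \<in> J \<Longrightarrow> j \<in> J \<Longrightarrow> L2_inner (upper_measure \<mu>) (e i) (e j) = (if i = j then 1 else 0)"
    and bx: "\<And>j z. j \<in> J \<Longrightarrow> e j z \<noteq> 0 \<Longrightarrow> z \<in> box (y j) (k j)"
    and U: "\<And>f. f \<in> L2 (upper_measure \<mu>) \<Longrightarrow> U f = (\<Sum>j\<in>J. scaleC (L2_inner (upper_measure \<mu>) f (e j)) (v j))"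
  shows "ennreal (gauss_norm {j\<in>J. dist x (y j) < 2 powi k j} v) \<le> area_functional \<mu> 1 U x"
proof -
  let ?A = "{j\<in>J. dist x (y j) < 2 powi k j}"
  obtain h where h: "bij_betw h {..<card ?A} ?A"
    using ex_bij_betw_nat_finite[of ?A] J by (auto simp: atLeast0LessThan)
  let ?n = "card ?A"
  have hA: "h i \<in> J" "dist x (y (h i)) < 2 powi k (h i)" if "i < ?n" for i
    using h that by (auto simp: bij_betw_def)
  have inj: "inj_on h {..<?n}" and im: "h ` {..<?n} = ?A" using h by (auto simp: bij_betw_def)
  have os: "orthonormal_system (upper_measure \<mu>) ?n (\<lambda>i. e (h i))"
    unfolding orthonormal_system_def
  proof (intro conjI allI impI)
    fix i j assume ij: "i < ?n" "j < ?n"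
    have "h i = h j \<longleftrightarrow> i = j" using inj ij by (auto simp: inj_on_def)
    then show "(\<integral>z. e (h i) z * cnj (e (h j) z) \<partial>upper_measure \<mu>) = (if i = j then 1 else 0)"
      using on[OF hA(1)[OF ij(1)] hA(1)[OF ij(2)]] by (simp add: L2_inner_def)
  qed (use e hA in auto)
  have val: "U (\<lambda>z. indicator (cone 1 x) z * e (h i) z) = v (h i)" if i: "i < ?n" for i
  proof -
    have ind: "indicator (cone 1 x) z * e (h i) z = e (h i) z" for z
    proof (cases "e (h i) z = 0")
      case False
      obtain p t where z: "z = (p, t)" by (cases z)
      \<comment> \<open>From \<open>x\<close> to the base point and from there to \<open>p\<close>
        the distances are both below \<open>2 powi k (h i)\<close>, and the height exceeds twice
        this number.\<close>
      have "dist (y (h i)) p < 2 powi k (h i)" "2 * 2 powi k (h i) < t"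
        using bx[OF hA(1)[OF i] False] by (auto simp: box_def z)
      moreover have "dist x p \<le> dist x (y (h i)) + dist (y (h i)) p" by (rule dist_triangle)
      moreover have "0 < t"
        by (rule less_trans[OF _ \<open>2 * 2 powi k (h i) < t\<close>]) simp
      ultimately have "z \<in> cone 1 x" using hA(2)[OF i] by (simp add: cone_def z)
      then show ?thesis by simp
    qed simp
    have "U (\<lambda>z. indicator (cone 1 x) z * e (h i) z) = U (e (h i))" by (simp only: ind)
    also have "\<dots> = (\<Sum>j\<in>J. scaleC (L2_inner (upper_measure \<mu>) (e (h i)) (e j)) (v j))"
      by (rule U[OF e[OF hA(1)[OF i]]])
    also have "\<dots> = (\<Sum>j\<in>J. if j = h i then v j else 0)"
      using on[OF hA(1)[OF i]] scaleC_of_real[of 1] by (intro sum.cong) (auto simp: scaleC_zero_left)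
    also have "\<dots> = v (h i)" using hA(1)[OF i] J by simp
    finally show ?thesis .
  qed
  have "ennreal (gauss_norm ?A v) = ennreal (gauss_norm {..<?n} (\<lambda>i. v (h i)))"
    using gauss_norm_reindex[OF _ inj, of v] im by simp
  also have "\<dots> = ennreal (sqrt (\<integral>g. (norm (\<Sum>i<?n. g i *\<^sub>R U (\<lambda>z. indicator (cone 1 x) z * e (h i) z)))\<^sup>2 \<partial>gaussian_measure ?n))"
  proof -
    have "(\<Sum>i<?n. g i *\<^sub>R U (\<lambda>z. indicator (cone 1 x) z * e (h i) z)) = (\<Sum>i<?n. g i *\<^sub>R v (h i))" for g :: "nat \<Rightarrow> real"
      by (intro sum.cong refl) (simp only: val lessThan_iff)
    then show ?thesis by (simp only: sqrt_integral_gaussian_measure)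
  qed
  also have "\<dots> \<le> area_functional \<mu> 1 U x"
    unfolding area_functional_def gamma_norm_def
    by (rule SUP_upper2[of "(?n, \<lambda>i. e (h i))"]) (use os in auto)
  finally show ?thesis .
qed

text \<open>The inner products of a cut-off orthonormal system with the functions \<open>e j\<close>
  form a contraction by Bessel's inequality. The Gaussian contraction principle thus bounds every
  competitor in the supremum by the same finite sum. Treating real and imaginary parts separately
  costs the factor 2.\<close>

lemma area_functional_le:
  fixes U :: "('m::metric_space \<times> real \<Rightarrow> complex) \<Rightarrow> 'x::complex_banach"
  assumes \<mu>: "sets \<mu> = sets borel" and a: "1 \<le> \<alpha>"
    and J: "finite J" and e: "\<And>j. j \<in> J \<Longrightarrow> e j \<in> L2 (upper_measure \<mu>)"
    and on: "\<And>i j. i \<in> J \<Longrightarrow> j \<in> J \<Longrightarrow> L2_inner (upper_measure \<mu>) (e i) (e j) = (if i = j then 1 else 0)"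
    and bx: "\<And>j z. j \<in> J \<Longrightarrow> e j z \<noteq> 0 \<Longrightarrow> z \<in> box (y j) (k j)"
    and U: "\<And>f. f \<in> L2 (upper_measure \<mu>) \<Longrightarrow> U f = (\<Sum>j\<in>J. scaleC (L2_inner (upper_measure \<mu>) f (e j)) (v j))"
  shows "area_functional \<mu> \<alpha> U x \<le> ennreal (2 * gauss_norm {j\<in>J. dist x (y j) < 6 * \<alpha> * 2 powi k j} v)"
  unfolding area_functional_def gamma_norm_def
proof (rule SUP_least)
  let ?N = "upper_measure \<mu>" and ?\<Gamma> = "cone \<alpha> x"
  let ?A = "{j\<in>J. dist x (y j) < 6 * \<alpha> * 2 powi k j}"
  fix q assume "q \<in> {(n, h). orthonormal_system ?N n h}"
  then obtain n h where q: "q = (n, h)" and h: "orthonormal_system ?N n h" by auto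
  have hL: "h l \<in> L2 ?N" if "l < n" for l using h that by (simp add: orthonormal_system_def)
  have hon: "L2_inner ?N (h l) (h l') = (if l = l' then 1 else 0)" if "l < n" "l' < n" for l l'
    using h that by (simp add: orthonormal_system_def L2_inner_def)
  let ?f = "\<lambda>l z. indicator ?\<Gamma> z * h l z"
  note cs = cone_sets[OF \<mu>, of \<alpha> x]
  have fL: "?f l \<in> L2 ?N" if "l < n" for l by (rule L2_indicator[OF hL[OF that] cs])
  define c where "c l j = L2_inner ?N (?f l) (e j)" for l j
  \<comment> \<open>A common point of cone and box would give a distance from \<open>x\<close> to
    \<open>y j\<close> below \<open>5 * \<alpha> * 2 powi k j + 2 powi k j\<close>, which is at most
    \<open>6 * \<alpha> * 2 powi k j\<close>; this is the origin of the factor 6.\<close>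
  have c0: "c l j = 0" if j: "j \<in> J - ?A" for l j
  proof -
    have zero: "?f l z * cnj (e j z) = 0" for z
    proof (cases "e j z = 0 \<or> z \<notin> ?\<Gamma>")
      case False
      obtain p t where z: "z = (p, t)" by (cases z)
      have "dist (y j) p < 2 powi k j" "t < 5 * 2 powi k j" "dist x p < \<alpha> * t"
        using bx[of j z] j False by (auto simp: box_def cone_def z)
      moreover have "\<alpha> * t \<le> \<alpha> * (5 * 2 powi k j)" using a \<open>t < 5 * 2 powi k j\<close> by (intro mult_left_mono) auto
      moreover have "1 * 2 powi k j \<le> \<alpha> * (2::real) powi k j" using a by (intro mult_right_mono) auto
      moreover have "dist x (y j) \<le> dist x p + dist (y j) p" by (rule dist_triangle2)
      ultimately have "dist x (y j) < 6 * \<alpha> * 2 powi k j" by linarith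
      then show ?thesis using j by simp
    qed auto
    show ?thesis unfolding c_def L2_inner_def by (simp only: zero) simp
  qed
  define Xr where "Xr l = (\<Sum>j\<in>?A. Re (c l j) *\<^sub>R v j)" for l
  define Xi where "Xi l = (\<Sum>j\<in>?A. Im (c l j) *\<^sub>R v j)" for l
  have UX: "U (?f l) = Xr l + scaleC \<i> (Xi l)" if "l < n" for l
  proof -
    have "U (?f l) = (\<Sum>j\<in>J. scaleC (c l j) (v j))" unfolding c_def by (rule U[OF fL[OF that]])
    also have "\<dots> = (\<Sum>j\<in>?A. scaleC (c l j) (v j))"
      using J c0 by (intro sum.mono_neutral_right) (auto simp: scaleC_zero_left)
    also have "\<dots> = (\<Sum>j\<in>?A. Re (c l j) *\<^sub>R v j + scaleC \<i> (Im (c l j) *\<^sub>R v j))"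
      by (intro sum.cong refl scaleC_conv_Re_Im)
    finally show ?thesis by (simp add: Xr_def Xi_def sum.distrib scaleC_sum_right)
  qed
  \<comment> \<open>Read the other way round, the sums over \<open>j\<close> are, up to conjugation,
    the coefficients in the system \<open>h\<close> of the function \<open>F\<close> cut off to the
    cone, so Bessel's inequality applies.\<close>
  have bess: "(\<Sum>l<n. (cmod (\<Sum>j\<in>?A. c l j * complex_of_real (s j)))\<^sup>2) \<le> (\<Sum>j\<in>?A. (s j)\<^sup>2)" for s
  proof -
    have eA: "e j \<in> L2 ?N" if "j \<in> ?A" for j using e that by simp
    define F where "F z = (\<Sum>j\<in>?A. complex_of_real (s j) * e j z)" for z
    have FL: "F \<in> L2 ?N" unfolding F_def by (rule L2_sum[OF eA])
    have F_right: "L2_inner ?N g F = (\<Sum>j\<in>?A. complex_of_real (s j) * L2_inner ?N g (e j))" if g: "g \<in> L2 ?N" for g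
    proof -
      have "L2_inner ?N g F = (\<Sum>j\<in>?A. cnj (complex_of_real (s j)) * L2_inner ?N g (e j))"
        unfolding F_def by (rule L2_inner_sum_right[OF eA g])
      then show ?thesis by simp
    qed
    have F_left: "L2_inner ?N F g = (\<Sum>j\<in>?A. complex_of_real (s j) * L2_inner ?N (e j) g)" if g: "g \<in> L2 ?N" for g
      unfolding F_def by (rule L2_inner_sum_left[OF eA g])
    let ?G = "\<lambda>z. indicator ?\<Gamma> z * F z"
    have GL: "?G \<in> L2 ?N" by (rule L2_indicator[OF FL cs])
    have eq: "cmod (\<Sum>j\<in>?A. c l j * complex_of_real (s j)) = cmod (L2_inner ?N ?G (h l))" if l: "l < n" for l
    proof -
      have "(\<Sum>j\<in>?A. c l j * complex_of_real (s j)) = L2_inner ?N (?f l) F"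
        unfolding F_right[OF fL[OF l]] c_def by (simp only: mult.commute)
      also have "\<dots> = L2_inner ?N (h l) ?G"
        unfolding L2_inner_def by (rule Bochner_Integration.integral_cong) (auto simp: indicator_def)
      also have "\<dots> = cnj (L2_inner ?N ?G (h l))" by (rule L2_inner_commute)
      finally show ?thesis by simp
    qed
    have "(\<Sum>l<n. (cmod (\<Sum>j\<in>?A. c l j * complex_of_real (s j)))\<^sup>2) = (\<Sum>l<n. (cmod (L2_inner ?N ?G (h l)))\<^sup>2)"
      using eq by (intro sum.cong) auto
    also have "\<dots> \<le> (\<integral>z. (cmod (?G z))\<^sup>2 \<partial>?N)"
      using hL hon by (intro bessel_inequality GL) auto
    also have "\<dots> \<le> (\<integral>z. (cmod (F z))\<^sup>2 \<partial>?N)"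
      using L2_norm_integrable[OF GL] L2_norm_integrable[OF FL] by (intro integral_mono) (auto simp: indicator_def)
    also have "\<dots> = (\<Sum>j\<in>?A. (s j)\<^sup>2)"
    proof -
      have "L2_inner ?N (e i) F = complex_of_real (s i)" if i: "i \<in> ?A" for i
      proof -
        have "L2_inner ?N (e i) F = (\<Sum>j\<in>?A. complex_of_real (s j) * L2_inner ?N (e i) (e j))"
          by (rule F_right[OF eA[OF i]])
        also have "\<dots> = (\<Sum>j\<in>?A. if j = i then complex_of_real (s j) else 0)"
          using on[of i] i by (intro sum.cong) auto
        also have "\<dots> = complex_of_real (s i)" using i J by simp
        finally show ?thesis .
      qed
      then have "L2_inner ?N F F = (\<Sum>i\<in>?A. complex_of_real (s i) * complex_of_real (s i))"
        unfolding F_left[OF FL] by (intro sum.cong refl) (simp only:)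
      also have "\<dots> = complex_of_real (\<Sum>j\<in>?A. (s j)\<^sup>2)" by (simp add: power2_eq_square)
      finally have "complex_of_real (\<integral>z. (cmod (F z))\<^sup>2 \<partial>?N) = complex_of_real (\<Sum>j\<in>?A. (s j)\<^sup>2)"
        by (simp only: L2_inner_self)
      then show ?thesis by (simp only: of_real_eq_iff)
    qed
    finally show ?thesis .
  qed
  let ?F = "\<lambda>z::'x. ennreal ((norm z)\<^sup>2)"
  have fin: "finite ?A" using J by simp
  have dom: "gauss_expect {..<n} (\<lambda>l. \<Sum>j\<in>?A. c' l j *\<^sub>R v j) ?F \<le> gauss_expect ?A v ?F"
    if c': "\<And>l s. l < n \<Longrightarrow> (\<Sum>j\<in>?A. c' l j * s j)\<^sup>2 \<le> (cmod (\<Sum>j\<in>?A. c l j * complex_of_real (s j)))\<^sup>2" for c'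
  proof (rule gauss_expect_contraction[OF fin _ cvx_cont_norm_square])
    fix s
    have "(\<Sum>l<n. (\<Sum>j\<in>?A. c' l j * s j)\<^sup>2) \<le> (\<Sum>l<n. (cmod (\<Sum>j\<in>?A. c l j * complex_of_real (s j)))\<^sup>2)"
      using c' by (intro sum_mono) auto
    also note bess
    finally show "(\<Sum>l<n. (\<Sum>j\<in>?A. c' l j * s j)\<^sup>2) \<le> (\<Sum>j\<in>?A. (s j)\<^sup>2)" .
  qed simp
  \<comment> \<open>For real arguments the real and imaginary parts of a complex contraction are
    again contractions.\<close>
  have ReIm: "(Re w)\<^sup>2 \<le> (cmod w)\<^sup>2" "(Im w)\<^sup>2 \<le> (cmod w)\<^sup>2" for w by (simp_all add: cmod_power2)
  have dr: "gauss_expect {..<n} Xr ?F \<le> gauss_expect ?A v ?F"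
    unfolding Xr_def
  proof (rule dom)
    fix l s
    show "(\<Sum>j\<in>?A. Re (c l j) * s j)\<^sup>2 \<le> (cmod (\<Sum>j\<in>?A. c l j * complex_of_real (s j)))\<^sup>2"
      using ReIm(1)[of "\<Sum>j\<in>?A. c l j * complex_of_real (s j)"] by simp
  qed
  have di: "gauss_expect {..<n} Xi ?F \<le> gauss_expect ?A v ?F"
    unfolding Xi_def
  proof (rule dom)
    fix l s
    show "(\<Sum>j\<in>?A. Im (c l j) * s j)\<^sup>2 \<le> (cmod (\<Sum>j\<in>?A. c l j * complex_of_real (s j)))\<^sup>2"
      using ReIm(2)[of "\<Sum>j\<in>?A. c l j * complex_of_real (s j)"] by simp
  qed
  let ?P = "\<Pi>\<^sub>M k\<in>{..<n}. gauss"
  have meas: "(\<lambda>g. ?F (\<Sum>l<n. g l *\<^sub>R X l)) \<in> borel_measurable ?P" for X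
    by (rule measurable_compose[OF gauss_sum_measurable cvx_cont_borel[OF cvx_cont_norm_square]]) simp
  have "gauss_expect {..<n} (\<lambda>l. U (?f l)) ?F \<le> (\<integral>\<^sup>+g. 2 * ?F (\<Sum>l<n. g l *\<^sub>R Xr l) + 2 * ?F (\<Sum>l<n. g l *\<^sub>R Xi l) \<partial>?P)"
    unfolding gauss_expect_def
  proof (rule nn_integral_mono)
    fix g :: "nat \<Rightarrow> real"
    let ?r = "\<Sum>l<n. g l *\<^sub>R Xr l" and ?i = "\<Sum>l<n. g l *\<^sub>R Xi l"
    have "(\<Sum>l<n. g l *\<^sub>R U (?f l)) = (\<Sum>l<n. g l *\<^sub>R Xr l + scaleC \<i> (g l *\<^sub>R Xi l))"
      using UX by (intro sum.cong) (auto simp: scaleR_add_right scaleC_scaleR)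
    also have "\<dots> = ?r + scaleC \<i> ?i" by (simp add: sum.distrib scaleC_sum_right)
    finally have "norm (\<Sum>l<n. g l *\<^sub>R U (?f l)) \<le> norm ?r + norm ?i"
      using norm_triangle_ineq[of ?r "scaleC \<i> ?i"] by (simp add: norm_scaleC)
    then have "(norm (\<Sum>l<n. g l *\<^sub>R U (?f l)))\<^sup>2 \<le> (norm ?r + norm ?i)\<^sup>2" by (intro power_mono) auto
    also have "\<dots> \<le> 2 * (norm ?r)\<^sup>2 + 2 * (norm ?i)\<^sup>2"
      using zero_le_power2[of "norm ?r - norm ?i"] by (simp add: power2_eq_square algebra_simps)
    finally have "?F (\<Sum>l<n. g l *\<^sub>R U (?f l)) \<le> ennreal (2 * (norm ?r)\<^sup>2 + 2 * (norm ?i)\<^sup>2)" by (rule ennreal_leI)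
    then show "?F (\<Sum>l<n. g l *\<^sub>R U (?f l)) \<le> 2 * ?F ?r + 2 * ?F ?i" by (simp add: ennreal_mult)
  qed
  also have "\<dots> = 2 * gauss_expect {..<n} Xr ?F + 2 * gauss_expect {..<n} Xi ?F"
    unfolding gauss_expect_def using meas by (simp add: nn_integral_add nn_integral_cmult)
  also have "\<dots> \<le> 2 * gauss_expect ?A v ?F + 2 * gauss_expect ?A v ?F"
    by (intro add_mono mult_left_mono dr di) auto
  also have "\<dots> = ennreal (2\<^sup>2) * gauss_expect ?A v ?F"
    by (simp add: distrib_right[symmetric])
  finally have "gauss_norm {..<n} (\<lambda>l. U (?f l)) \<le> 2 * gauss_norm ?A v"
    using fin by (subst gauss_norm_le_iff) auto
  then show "(case q of (n, h) \<Rightarrow> ennreal (sqrt (\<integral>g. (norm (\<Sum>k<n. g k *\<^sub>R U (\<lambda>z. indicator ?\<Gamma> z * h k z)))\<^sup>2 \<partial>gaussian_measure n)))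
    \<le> ennreal (2 * gauss_norm ?A v)"
    unfolding q by (simp add: sqrt_integral_gaussian_measure ennreal_leI del: ennreal_le_iff2)
qed

section \<open>The estimate with the doubling dimension\<close>

theorem proposition4:
  fixes \<mu> :: "'m::complete_space measure" and \<epsilon> :: real
  assumes "doubling_space \<mu>"
    and "cone_covering_property \<mu>"
    and "umd_space TYPE('x::complex_banach)"
    and "\<epsilon> > 0"
  shows "\<exists>C::real. \<forall>\<alpha>\<ge>1. \<forall>u \<in> (L2_compact_tensor \<mu> :: (('m \<times> real \<Rightarrow> complex) \<Rightarrow> 'x) set).
           (\<integral>\<^sup>+x. area_functional \<mu> \<alpha> u x \<partial>\<mu>)
             \<le> ennreal (C * \<alpha> powr (doubling_dimension \<mu> + \<epsilon>)) * (\<integral>\<^sup>+x. area_functional \<mu> 1 u x \<partial>\<mu>)"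
proof -
  let ?d = "doubling_dimension \<mu>"
  let ?S = "{n. doubling_exponent \<mu> n}"
  have \<mu>: "sets \<mu> = sets borel" and ne: "?S \<noteq> {}" using assms(1) by (auto simp: doubling_space_def)
  have d0: "0 \<le> ?d"
    unfolding doubling_dimension_def using ne by (intro cInf_greatest) (auto simp: doubling_exponent_def)
  \<comment> \<open>The infimum need not be attained; up to half of epsilon is spent on an
    admissible exponent \<open>n\<close>.\<close>
  have "Inf ?S < ?d + \<epsilon> / 2" using assms(4) by (simp add: doubling_dimension_def)
  then obtain n where n: "doubling_exponent \<mu> n" "n < ?d + \<epsilon> / 2"
    using cInf_lessD[OF ne] by auto
  then obtain C0 where n0: "0 < n"
    and C0: "\<And>x r a. 0 < r \<Longrightarrow> 1 \<le> a \<Longrightarrow> volume \<mu> x (a * r) \<le> C0 * a powr n * volume \<mu> x r"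
    by (auto simp: doubling_exponent_def)
  interpret doubling_complete \<mu> n "max 1 C0"
  proof
    fix x :: 'm and r a :: real
    show "0 < emeasure \<mu> (ball x r)" if "0 < r" using assms(1) that by (simp add: doubling_space_def)
    show "emeasure \<mu> (ball x r) < \<infinity>"
    proof (cases "0 < r")
      case True
      then show ?thesis using assms(1) by (simp add: doubling_space_def)
    next
      case False
      then have b: "ball x r = {}" by simp
      show ?thesis unfolding b by simp
    qed
    assume "0 < r" "1 \<le> a"
    then have "measure \<mu> (ball x (a * r)) \<le> C0 * a powr n * measure \<mu> (ball x r)"
      using C0 by (simp add: volume_def)
    also have "\<dots> \<le> max 1 C0 * a powr n * measure \<mu> (ball x r)" by (intro mult_right_mono) auto
    finally show "measure \<mu> (ball x (a * r)) \<le> max 1 C0 * a powr n * measure \<mu> (ball x r)" .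
  qed (use \<mu> n0 in auto)
  \<comment> \<open>The remainder of epsilon pays for \<open>p\<close>: the quotient exceeds 1
    because \<open>n\<close> is below \<open>?d + \<epsilon> / 2\<close>, and it is the largest
    exponent with \<open>n * p\<close> at most \<open>?d + \<epsilon>\<close>. The cap 2 is the
    range of the upper moment comparison.\<close>
  define p where "p = min 2 ((?d + \<epsilon>) / n)"
  have p: "1 < p" "p \<le> 2" using n n0 assms(4) by (auto simp: p_def field_simps)
  have np: "n * p \<le> ?d + \<epsilon>"
  proof -
    have "n * p \<le> n * ((?d + \<epsilon>) / n)" using n0 by (intro mult_left_mono) (auto simp: p_def)
    then show ?thesis using n0 by simp
  qed
  obtain K where K: "0 \<le> K" and est: "\<forall>\<alpha>\<ge>1. \<forall>J y k (v :: nat \<Rightarrow> 'x). finite J \<longrightarrow>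
     (\<integral>\<^sup>+x. ennreal (gauss_norm {j\<in>J. dist x (y j) < \<alpha> * 2 powi k j} v) \<partial>\<mu>)
    \<le> ennreal (K * \<alpha> powr (n * p)) * (\<integral>\<^sup>+x. ennreal (gauss_norm {j\<in>J. dist x (y j) < 2 powi k j} v) \<partial>\<mu>)"
    using L1_estimate[OF assms(3) p assms(2)] by (elim exE conjE) (rule that)
  show ?thesis
  proof (intro exI[of _ "2 * (K * 6 powr (n * p))"] allI impI ballI)
    fix \<alpha> :: real and u :: "('m \<times> real \<Rightarrow> complex) \<Rightarrow> 'x"
    assume a: "1 \<le> \<alpha>" and u: "u \<in> L2_compact_tensor \<mu>"
    obtain J :: "nat set" and e v y k where J: "finite J" "\<forall>j\<in>J. e j \<in> L2 (upper_measure \<mu>)"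
      "\<forall>i\<in>J. \<forall>j\<in>J. L2_inner (upper_measure \<mu>) (e i) (e j) = (if i = j then 1 else 0)"
      "\<forall>j\<in>J. \<forall>z. e j z \<noteq> 0 \<longrightarrow> z \<in> box (y j) (k j)"
      "\<forall>f\<in>L2 (upper_measure \<mu>). u f = (\<Sum>j\<in>J. scaleC (L2_inner (upper_measure \<mu>) f (e j)) (v j))"
      using discretise[OF \<mu> u] by (elim exE conjE) (rule that)
    \<comment> \<open>Only the comparison from above widens the aperture, so the discrete estimate
      is applied once, with aperture \<open>6 * \<alpha>\<close>, and the 6 ends up in the
      constant.\<close>
    have a6: "1 \<le> 6 * \<alpha>" using a by simp
    have "(\<integral>\<^sup>+x. area_functional \<mu> \<alpha> u x \<partial>\<mu>) \<le> (\<integral>\<^sup>+x. 2 * ennreal (gauss_norm {j\<in>J. dist x (y j) < 6 * \<alpha> * 2 powi k j} v) \<partial>\<mu>)"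
    proof (rule nn_integral_mono)
      fix x
      have "area_functional \<mu> \<alpha> u x \<le> ennreal (2 * gauss_norm {j\<in>J. dist x (y j) < 6 * \<alpha> * 2 powi k j} v)"
        by (rule area_functional_le[OF \<mu> a J(1), of e]) (use J in auto)
      then show "area_functional \<mu> \<alpha> u x \<le> 2 * ennreal (gauss_norm {j\<in>J. dist x (y j) < 6 * \<alpha> * 2 powi k j} v)"
        by (simp add: ennreal_mult)
    qed
    also have "\<dots> = 2 * (\<integral>\<^sup>+x. ennreal (gauss_norm {j\<in>J. dist x (y j) < 6 * \<alpha> * 2 powi k j} v) \<partial>\<mu>)"
      by (rule nn_integral_cmult[OF ball_pattern_measurable[OF J(1)]])
    also have "\<dots> \<le> 2 * (ennreal (K * (6 * \<alpha>) powr (n * p)) * (\<integral>\<^sup>+x. ennreal (gauss_norm {j\<in>J. dist x (y j) < 2 powi k j} v) \<partial>\<mu>))"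
      by (intro mult_left_mono est[THEN spec, THEN mp, OF a6, THEN spec, THEN spec, THEN spec, THEN spec, THEN mp, OF J(1)]) simp
    also have "\<dots> \<le> 2 * (ennreal (K * (6 * \<alpha>) powr (n * p)) * (\<integral>\<^sup>+x. area_functional \<mu> 1 u x \<partial>\<mu>))"
    proof (intro mult_left_mono nn_integral_mono)
      fix x
      show "ennreal (gauss_norm {j\<in>J. dist x (y j) < 2 powi k j} v) \<le> area_functional \<mu> 1 u x"
        by (rule area_functional_ge[OF J(1), of e]) (use J in auto)
    qed auto
    also have "\<dots> = ennreal (2 * (K * (6 * \<alpha>) powr (n * p))) * (\<integral>\<^sup>+x. area_functional \<mu> 1 u x \<partial>\<mu>)"
      using K by (simp add: ennreal_mult mult.assoc)
    also have "\<dots> \<le> ennreal (2 * (K * 6 powr (n * p)) * \<alpha> powr (?d + \<epsilon>)) * (\<integral>\<^sup>+x. area_functional \<mu> 1 u x \<partial>\<mu>)"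
    proof (intro mult_right_mono ennreal_leI)
      have "(6 * \<alpha>) powr (n * p) = 6 powr (n * p) * \<alpha> powr (n * p)" using a by (simp add: powr_mult)
      also have "\<dots> \<le> 6 powr (n * p) * \<alpha> powr (?d + \<epsilon>)" using a np by (intro mult_left_mono powr_mono) auto
      finally have "K * (6 * \<alpha>) powr (n * p) \<le> K * (6 powr (n * p) * \<alpha> powr (?d + \<epsilon>))" using K by (rule mult_left_mono)
      then show "2 * (K * (6 * \<alpha>) powr (n * p)) \<le> 2 * (K * 6 powr (n * p)) * \<alpha> powr (?d + \<epsilon>)" by (simp add: mult.assoc)
    qed simp
    finally show "(\<integral>\<^sup>+x. area_functional \<mu> \<alpha> u x \<partial>\<mu>)
      \<le> ennreal (2 * (K * 6 powr (n * p)) * \<alpha> powr (?d + \<epsilon>)) * (\<integral>\<^sup>+x. area_functional \<mu> 1 u x \<partial>\<mu>)" .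
  qed
qed

end
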